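(* Let $\{D(t): 0<t<t_0\}$ be a growing family of bounded domains in $\mathbb{C}$ with $C^2$ boundaries produced by an elliptic growth process of Schrödinger type with operator $\Delta-u$ and singularity at $w$. If $$\lim_{t\to 0}\ \sup_{\zeta\in\partial D(t)}|\zeta-w| = 0,$$ then $$\lim_{t\to 0}\frac{d}{dt}\,\mathrm{area}(D(t)) = 1.$$
   Context: Elliptic growth of Schrödinger type with operator $\Delta-u$ and singularity $w$: $u\ge 0$ is a smooth real function on an open set containing the closures of all the domains $D(t)$, $w\in\bigcap_t D(t)$, and the outward normal velocity $v_n$ of $\partial D(t)$ satisfies $v_n=\partial_n g_w$ on $\partial D(t)$ for each $t$. Here $g_w$ is the Green function of $\Delta-u$ on $D(t)$ with singularity $w$, with the sign convention $(\Delta-u)g_w=\delta_w$ in $D(t)$ and $g_w=0$ on $\partial D(t)$ (so $g_w\le 0$), and $\partial_n$ is the outward normal derivative. "Growing" means nested increasing in $t$. *)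

theory Defs
  imports "HOL-Analysis.Analysis"
begin

text \<open>Real functions of class $C^k$ on an open set: the gradient exists and, for $k+1$, its
  components are of class $C^k$.\<close>

fun C_k_on :: "nat \<Rightarrow> 'a::euclidean_space set \<Rightarrow> ('a \<Rightarrow> real) \<Rightarrow> bool" where
  "C_k_on 0 S f \<longleftrightarrow> continuous_on S f"
| "C_k_on (Suc k) S f \<longleftrightarrow>
     (\<exists>G. (\<forall>x\<in>S. GDERIV f x :> G x) \<and> (\<forall>b\<in>Basis. C_k_on k S (\<lambda>x. G x \<bullet> b)))"

definition smooth_real_on :: "'a::euclidean_space set \<Rightarrow> ('a \<Rightarrow> real) \<Rightarrow> bool" where
  "smooth_real_on S f \<longleftrightarrow> (\<forall>k. C_k_on k S f)"

definition partial_deriv :: "'a::euclidean_space \<Rightarrow> ('a \<Rightarrow> real) \<Rightarrow> 'a \<Rightarrow> real" where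
  "partial_deriv b f x = deriv (\<lambda>s. f (x + s *\<^sub>R b)) 0"

definition laplacian :: "('a::euclidean_space \<Rightarrow> real) \<Rightarrow> 'a \<Rightarrow> real" where
  "laplacian f x = (\<Sum>b\<in>Basis. partial_deriv b (partial_deriv b f) x)"

definition test_function :: "complex set \<Rightarrow> (complex \<Rightarrow> real) \<Rightarrow> bool" where
  "test_function D \<psi> \<longleftrightarrow> smooth_real_on UNIV \<psi> \<and>
     compact (closure {z. \<psi> z \<noteq> 0}) \<and> closure {z. \<psi> z \<noteq> 0} \<subseteq> D"

text \<open>The equation $(\Delta - u) g = \delta_w$ in $D$ is understood in the sense of
  distributions.  The value of \<open>g\<close> at the singularity \<open>w\<close> is irrelevant.\<close>

definition green_function ::
    "(complex \<Rightarrow> real) \<Rightarrow> complex set \<Rightarrow> complex \<Rightarrow> (complex \<Rightarrow> real) \<Rightarrow> bool" where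
  "green_function u D w g \<longleftrightarrow>
     continuous_on (closure D - {w}) g \<and>
     (\<forall>K. compact K \<and> K \<subseteq> D \<longrightarrow> g absolutely_integrable_on K) \<and>
     (\<forall>\<psi>. test_function D \<psi> \<longrightarrow>
        (LINT z:D|lebesgue. g z * (laplacian \<psi> z - u z * \<psi> z)) = \<psi> w) \<and>
     (\<forall>z\<in>frontier D. g z = 0)"

text \<open>\<open>S\<close> is the sublevel set $\{\varphi < 0\}$ near \<open>x\<close>, with \<open>\<phi>\<close> of class $C^k$.\<close>

definition local_defining_function ::
    "nat \<Rightarrow> 'a::euclidean_space set \<Rightarrow> 'a \<Rightarrow> ('a \<Rightarrow> real) \<Rightarrow> bool" where
  "local_defining_function k S x \<phi> \<longleftrightarrow>
     (\<exists>N. open N \<and> x \<in> N \<and> C_k_on k N \<phi> \<and> S \<inter> N = {y \<in> N. \<phi> y < 0})"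

definition C2_boundary :: "complex set \<Rightarrow> bool" where
  "C2_boundary D \<longleftrightarrow>
     (\<forall>z\<in>frontier D. \<exists>\<phi> G. local_defining_function 2 D z \<phi> \<and> GDERIV \<phi> z :> G \<and> G \<noteq> 0)"

definition outward_unit_normal :: "complex set \<Rightarrow> complex \<Rightarrow> complex \<Rightarrow> bool" where
  "outward_unit_normal D z n \<longleftrightarrow>
     (\<exists>\<phi> G. local_defining_function 1 D z \<phi> \<and> GDERIV \<phi> z :> G \<and> G \<noteq> 0 \<and> n = G /\<^sub>R norm G)"

definition spacetime :: "real \<Rightarrow> (real \<Rightarrow> complex set) \<Rightarrow> (real \<times> complex) set" where
  "spacetime t0 D = {(t, z). 0 < t \<and> t < t0 \<and> z \<in> D t}"

text \<open>If $D(s) = \{\varphi(s,\cdot) < 0\}$ locally, then differentiating $\varphi(s,x(s)) = 0$ along a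
  path $x(s) \in \partial D(s)$ gives $x' \cdot n = - \partial_t\varphi / |\nabla_z\varphi|$, where
  $n = \nabla_z\varphi / |\nabla_z\varphi|$ is the outward unit normal.\<close>

definition normal_velocity ::
    "real \<Rightarrow> (real \<Rightarrow> complex set) \<Rightarrow> real \<Rightarrow> complex \<Rightarrow> real \<Rightarrow> bool" where
  "normal_velocity t0 D t z v \<longleftrightarrow>
     (\<exists>\<phi> a G. local_defining_function 1 (spacetime t0 D) (t, z) \<phi> \<and>
        GDERIV \<phi> (t, z) :> (a, G) \<and> G \<noteq> 0 \<and> v = - a / norm G)"

text \<open>The boundary sweeps out a $C^1$ hypersurface of space-time that is nowhere tangent to a
  time slice.  Taking the frontier in space-time, instead of the union of the
  frontiers of the slices, excludes jumps such as a hole of \<open>D t\<close> being filled instantaneously.\<close>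

definition C1_moving_boundary :: "real \<Rightarrow> (real \<Rightarrow> complex set) \<Rightarrow> bool" where
  "C1_moving_boundary t0 D \<longleftrightarrow>
     (\<forall>t z. 0 < t \<and> t < t0 \<and> (t, z) \<in> frontier (spacetime t0 D) \<longrightarrow>
        (\<exists>v. normal_velocity t0 D t z v))"

text \<open>The normal derivative at a boundary point is one-sided, since \<open>g\<close> only matters on the
  closure of the domain.\<close>

definition outward_normal_derivative ::
    "complex set \<Rightarrow> (complex \<Rightarrow> real) \<Rightarrow> complex \<Rightarrow> real \<Rightarrow> bool" where
  "outward_normal_derivative D g z d \<longleftrightarrow>
     (\<exists>n. outward_unit_normal D z n \<and>
        ((\<lambda>h. g (z + h *\<^sub>R n)) has_real_derivative d) (at_left 0))"

definition elliptic_growth ::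
    "(complex \<Rightarrow> real) \<Rightarrow> complex \<Rightarrow> real \<Rightarrow> (real \<Rightarrow> complex set) \<Rightarrow> bool" where
  "elliptic_growth u w t0 D \<longleftrightarrow>
     (\<exists>U. open U \<and> (\<forall>t\<in>{0<..<t0}. closure (D t) \<subseteq> U) \<and>
        smooth_real_on U u \<and> (\<forall>z\<in>U. 0 \<le> u z)) \<and>
     (\<forall>t\<in>{0<..<t0}. w \<in> D t) \<and>
     C1_moving_boundary t0 D \<and>
     (\<forall>t\<in>{0<..<t0}. \<exists>g. green_function u (D t) w g \<and>
        (\<forall>z\<in>frontier (D t). \<exists>v. normal_velocity t0 D t z v \<and>
           outward_normal_derivative (D t) g z v))"

end

theory Submission
  imports Defs
begin

text \<open>The core is a Richardson type identity: for every function \<open>f\<close> of class \<open>C\<^sup>2\<close>,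
  \[ \frac{d}{dt} \int_{D(t)} f = f(w) - \int_{D(t)} g_t (\Delta f - u f), \]
  where $g_t$ is the Green function of $D(t)$.  Both sides are additive in \<open>f\<close>, so a partition of
  unity reduces it to \<open>f\<close> supported near a point.  Away from the boundary it is the distributional
  equation for $g_t$.  Near a boundary point let $\varphi$ be a \<open>C\<^sup>2\<close> defining function of $D(t)$.
  Testing the equation with $f \eta(-\varphi/\varepsilon)$, where $\eta$ is a cutoff, and letting
  $\varepsilon \to 0$ in tubular coordinates stretched by $1/\varepsilon$ turns the right-hand side into
  the boundary integral of $f \partial_n g_t$, because $|g_t|$ is bounded by a multiple of the distance
  to the boundary; the left-hand side is the boundary integral of $f v_n$ by the same stretching.
  No regularity of $g_t$ beyond continuity is needed.

  For $f = 1$ the identity gives $A' = 1 + \int u g_t \le 1$ for the area \<open>A\<close>, as $g_t \le 0$.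
  Let $D(t)$ lie in the disc of radius $\rho$ about \<open>w\<close>, and take $f = |z-w|^2/4$, so that
  $\Delta f = 1$ and $f(w) = 0$.  As the domains grow, $\int_{D(t)} f$ grows at most at the rate
  $\rho^2 A'/4 \le \rho^2/4$.  Hence $\int |g_t| (1 - u f) \le \rho^2/4$, so that
  $\int |g_t| = O(\rho^2)$ and $|A' - 1| = O(\rho^2)$.\<close>

section \<open>Functions of class $C^k$\<close>

text \<open>The Green function is known only through its distributional equation, its continuity off
  \<open>w\<close> and a pointwise one-sided normal derivative. Green's formula cannot be applied to
  it, and even its sign has to come from a maximum principle for distributional inequalities, proved
  by mollification. The linear bound on \<open>g\<close> comes from comparison with explicit
  barriers around exterior discs, whose radius is locally uniform because the boundary is of class
  C^2. Both boundary integrals are computed in the same tube and appear as integrals over its axis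
  with the same Jacobian weight. That weight is never evaluated, so no notion of arc length enters.
  The chart is built from a C^2 defining function of the single slice \<open>D t\<close>, since
  following the gradient of a C^1 space-time function need not give a differentiable map; the
  space-time function only decides membership at nearby times. All constants near the boundary may
  depend on the time. The only estimate that has to be uniform as t tends to 0 is the bound of
  \<open>u\<close> near \<open>w\<close>.\<close>

lemma GDERIV_cong_open:
  assumes "GDERIV f x :> G" "open S" "x \<in> S" "\<And>y. y \<in> S \<Longrightarrow> f y = g y"
  shows "GDERIV g x :> G"
  using assms unfolding gderiv_def
  by (metis has_derivative_transform_within_open)

lemma GDERIV_isCont: "GDERIV f x :> G \<Longrightarrow> isCont f x"
  unfolding gderiv_def by (rule has_derivative_continuous)

lemma GDERIV_unique:
  assumes "GDERIV f x :> G" "GDERIV f x :> H"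
  shows "G = H"
proof -
  have "(\<lambda>h. h \<bullet> G) = (\<lambda>h. h \<bullet> H)"
    using assms unfolding gderiv_def by (rule has_derivative_unique)
  then have "(G - H) \<bullet> G = (G - H) \<bullet> H" by metis
  then have "(G - H) \<bullet> (G - H) = 0" by (simp add: inner_diff_right)
  then show ?thesis by simp
qed

lemma GDERIV_DERIV_line:
  assumes "GDERIV f (x + s *\<^sub>R b) :> G"
  shows "((\<lambda>s. f (x + s *\<^sub>R b)) has_real_derivative (G \<bullet> b)) (at s)"
proof -
  have "((\<lambda>s. x + s *\<^sub>R b) has_derivative (\<lambda>s. s *\<^sub>R b)) (at s)"
    by (auto intro!: derivative_eq_intros)
  then have "((\<lambda>s. f (x + s *\<^sub>R b)) has_derivative (\<lambda>s. (s *\<^sub>R b) \<bullet> G)) (at s)"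
    using assms unfolding gderiv_def by (rule has_derivative_compose)
  moreover have "(\<lambda>s. (s *\<^sub>R b) \<bullet> G) = (*) (G \<bullet> b)" by (auto simp: inner_commute)
  ultimately show ?thesis by (simp add: has_field_derivative_def)
qed

lemma C_k_on_imp_continuous_on: "C_k_on k S f \<Longrightarrow> continuous_on S f"
  by (cases k) (auto intro!: continuous_at_imp_continuous_on dest: GDERIV_isCont)

lemma C_k_on_SucD: "C_k_on (Suc k) S f \<Longrightarrow> C_k_on k S f"
proof (induction k arbitrary: f)
  case 0 then show ?case using C_k_on_imp_continuous_on[of "Suc 0" S f] by simp
next
  case (Suc k)
  from Suc.prems obtain G where "\<forall>x\<in>S. GDERIV f x :> G x" "\<forall>b\<in>Basis. C_k_on (Suc k) S (\<lambda>x. G x \<bullet> b)"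
    unfolding C_k_on.simps(2)[of "Suc k"] by blast
  then show ?case using Suc.IH unfolding C_k_on.simps(2)[of k] by blast
qed

lemma C_k_on_const: "C_k_on k S (\<lambda>_. c)"
proof (induction k arbitrary: c)
  case 0 show ?case by simp
next
  case (Suc k) then show ?case using GDERIV_const by fastforce
qed

lemma C_k_on_add: "C_k_on k S f \<Longrightarrow> C_k_on k S g \<Longrightarrow> C_k_on k S (\<lambda>x. f x + g x)"
proof (induction k arbitrary: f g)
  case 0 then show ?case by (simp add: continuous_on_add)
next
  case (Suc k)
  obtain G H where "\<forall>x\<in>S. GDERIV f x :> G x" "\<forall>b\<in>Basis. C_k_on k S (\<lambda>x. G x \<bullet> b)"
    "\<forall>x\<in>S. GDERIV g x :> H x" "\<forall>b\<in>Basis. C_k_on k S (\<lambda>x. H x \<bullet> b)"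
    using Suc.prems by auto
  then show ?case
    by (auto intro!: exI[of _ "\<lambda>x. G x + H x"] GDERIV_add Suc.IH simp: inner_add_left)
qed

lemma C_k_on_mult: "C_k_on k S f \<Longrightarrow> C_k_on k S g \<Longrightarrow> C_k_on k S (\<lambda>x. f x * g x)"
proof (induction k arbitrary: f g)
  case 0 then show ?case by (simp add: continuous_on_mult)
next
  case (Suc k)
  obtain G H where *: "\<forall>x\<in>S. GDERIV f x :> G x" "\<forall>b\<in>Basis. C_k_on k S (\<lambda>x. G x \<bullet> b)"
    "\<forall>x\<in>S. GDERIV g x :> H x" "\<forall>b\<in>Basis. C_k_on k S (\<lambda>x. H x \<bullet> b)"
    using Suc.prems by auto
  have fg: "C_k_on k S f" "C_k_on k S g" using Suc.prems by (blast intro: C_k_on_SucD)+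
  show ?case unfolding C_k_on.simps
    by (rule exI[of _ "\<lambda>x. f x *\<^sub>R H x + g x *\<^sub>R G x"])
      (use * fg in \<open>auto intro!: GDERIV_mult Suc.IH C_k_on_add simp: inner_add_left\<close>)
qed

lemma C_k_on_inner: "C_k_on k S (\<lambda>x. x \<bullet> c)"
proof (cases k)
  case (Suc j)
  have "GDERIV (\<lambda>x. x \<bullet> c) x :> c" for x
    unfolding gderiv_def by (auto intro!: derivative_eq_intros)
  then have "C_k_on (Suc j) S (\<lambda>x. x \<bullet> c)"
    unfolding C_k_on.simps by (intro exI[of _ "\<lambda>_. c"]) (auto intro: C_k_on_const)
  then show ?thesis using Suc by simp
qed (auto intro!: continuous_intros)

lemma GDERIV_norm_sq: "GDERIV (\<lambda>x. (norm x)\<^sup>2) x :> 2 *\<^sub>R x"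
  unfolding gderiv_def power2_norm_eq_inner
  by (auto intro!: derivative_eq_intros simp: inner_commute)

lemma C_k_on_norm_sq: "C_k_on k S (\<lambda>x. (norm x)\<^sup>2)"
proof (cases k)
  case (Suc j)
  have "C_k_on j S (\<lambda>x. (2 *\<^sub>R x) \<bullet> b)" for b :: 'a
    using C_k_on_mult[OF C_k_on_const[of j S 2] C_k_on_inner[of j S b]] by simp
  then have "C_k_on (Suc j) S (\<lambda>x::'a. (norm x)\<^sup>2)"
    unfolding C_k_on.simps using GDERIV_norm_sq by (intro exI[of _ "\<lambda>x. 2 *\<^sub>R x"]) blast
  then show ?thesis using Suc by simp
qed (auto intro!: continuous_intros)

lemma GDERIV_reflect: "GDERIV f (a - x) :> G \<Longrightarrow> GDERIV (\<lambda>x. f (a - x)) x :> - G"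
proof -
  assume "GDERIV f (a - x) :> G"
  moreover have "((\<lambda>x. a - x) has_derivative (\<lambda>h. - h)) (at x)"
    by (auto intro!: derivative_eq_intros)
  ultimately show ?thesis
    unfolding gderiv_def using has_derivative_compose by fastforce
qed

lemma C_k_on_reflect: "C_k_on k UNIV f \<Longrightarrow> C_k_on k UNIV (\<lambda>x. f (a - x))"
proof (induction k arbitrary: f)
  case 0
  then show ?case by (auto intro!: continuous_on_compose2[of UNIV f] continuous_intros)
next
  case (Suc k)
  then obtain G where G: "\<forall>x. GDERIV f x :> G x" "\<forall>b\<in>Basis. C_k_on k UNIV (\<lambda>x. G x \<bullet> b)" by auto
  have "C_k_on k UNIV (\<lambda>x. (- G (a - x)) \<bullet> b)" if "b \<in> Basis" for b
    using C_k_on_mult[OF C_k_on_const[of k UNIV "-1"] Suc.IH[of "\<lambda>x. G x \<bullet> b"]] G that by simp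
  then show ?case unfolding C_k_on.simps
    using G by (intro exI[of _ "\<lambda>x. - G (a - x)"]) (auto intro: GDERIV_reflect)
qed

lemma smooth_reflect: "smooth_real_on UNIV f \<Longrightarrow> smooth_real_on UNIV (\<lambda>x. f (a - x))"
  unfolding smooth_real_on_def by (blast intro: C_k_on_reflect)

section \<open>A flat function and smooth bumps\<close>

definition flat_exp :: "nat \<Rightarrow> real \<Rightarrow> real" where
  "flat_exp n x = (if x \<le> 0 then 0 else exp (- (1 / x)) / x ^ n)"

lemma flat_exp_nonneg: "0 \<le> flat_exp n x" by (simp add: flat_exp_def)

text \<open>Keeping only the term of degree n + 2 in the series of \<open>exp (1/x)\<close> gives
  the bound. The surplus factor x^2 makes the difference quotient at 0 tend to 0.\<close>

lemma flat_exp_le_power: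
  assumes "0 < x" shows "flat_exp n x \<le> fact (n + 2) * x\<^sup>2"
proof -
  have "(1/x) ^ (n+2) / fact (n+2) \<le> exp (1/x)"
  proof -
    have s: "summable (\<lambda>k. (1/x) ^ k /\<^sub>R fact k)"
      by (rule summable_exp_generic)
    have "(\<Sum>k\<in>{n+2}. (1/x) ^ k /\<^sub>R fact k) \<le> (\<Sum>k. (1/x) ^ k /\<^sub>R fact k)"
      by (rule sum_le_suminf[OF s]) (use assms in auto)
    then show ?thesis by (simp add: exp_def divide_inverse mult.commute)
  qed
  then have "(1/x) ^ (n+2) \<le> exp (1/x) * fact (n+2)"
    by (subst (asm) pos_divide_le_eq) simp_all
  then have "exp (- (1/x)) * (1/x)^(n+2) \<le> exp (- (1/x)) * (exp (1/x) * fact (n+2))"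
    by (rule mult_left_mono) simp
  also have "\<dots> = fact (n+2)" by (simp add: exp_minus)
  finally have "exp (- (1/x)) * (1/x)^(n+2) \<le> fact (n+2)" .
  moreover have "exp (- (1/x)) / x ^ n = exp (- (1/x)) * (1/x)^(n+2) * x\<^sup>2"
    using assms by (simp add: power_divide power_add power2_eq_square)
  ultimately show ?thesis using assms
    by (simp add: flat_exp_def mult_right_mono del: power_Suc fact_Suc)
qed

text \<open>The derivative of one member of the family is a combination of two others, so smoothness
  follows by induction on the order for all \<open>n\<close> at once. The estimate above serves the
  point 0; elsewhere this is elementary calculus.\<close>

lemma DERIV_flat_exp:
  "(flat_exp n has_real_derivative flat_exp (n + 2) x - real n * flat_exp (n + 1) x) (at x)"
proof (cases "x = 0")
  case True
  have "((\<lambda>h. flat_exp n h / h) \<longlongrightarrow> 0) (at 0)"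
  proof (rule Lim_null_comparison)
    show "\<forall>\<^sub>F h in at 0. norm (flat_exp n h / h) \<le> fact (n + 2) * \<bar>h\<bar>"
    proof (rule always_eventually, rule allI)
      fix h :: real
      show "norm (flat_exp n h / h) \<le> fact (n + 2) * \<bar>h\<bar>"
      proof (cases "0 < h")
        case True
        then show ?thesis using flat_exp_le_power[OF True, of n] flat_exp_nonneg[of n h]
          by (simp add: pos_divide_le_eq power2_eq_square mult.assoc del: fact_Suc)
      qed (auto simp: flat_exp_def mult_nonneg_nonpos simp del: fact_Suc)
    qed
    show "((\<lambda>h. fact (n + 2) * \<bar>h\<bar>) \<longlongrightarrow> 0) (at (0::real))"
      by (rule tendsto_eq_intros | simp)+
  qed
  then show ?thesis using True by (simp add: DERIV_def flat_exp_def)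
next
  case False
  show ?thesis
  proof (cases "x < 0")
    case True
    have "((\<lambda>x. 0) has_real_derivative 0) (at x)" by simp
    then have "(flat_exp n has_real_derivative 0) (at x)"
      by (rule has_field_derivative_transform_within_open[of _ _ _ "{..<0}"])
        (use True in \<open>auto simp: flat_exp_def\<close>)
    then show ?thesis using True by (simp add: flat_exp_def)
  next
    case f: False
    then have x: "0 < x" using False by simp
    have "((\<lambda>x. exp (- (1 / x)) / x ^ n) has_real_derivative
        exp (- (1/x)) / x ^ (n+2) - real n * (exp (- (1/x)) / x ^ (n+1))) (at x)"
      using x apply (auto intro!: derivative_eq_intros)
      apply (cases n)
       apply (auto simp: field_simps power2_eq_square)
      done
    then have "(flat_exp n has_real_derivative
        exp (- (1/x)) / x ^ (n+2) - real n * (exp (- (1/x)) / x ^ (n+1))) (at x)"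
      by (rule has_field_derivative_transform_within_open[of _ _ _ "{0<..}"])
        (use x in \<open>auto simp: flat_exp_def\<close>)
    then show ?thesis using x by (simp add: flat_exp_def)
  qed
qed

lemma C_k_on_flat_exp:
  assumes "\<And>k. C_k_on k S f"
  shows "C_k_on k S (\<lambda>x. flat_exp n (f x))"
proof (induction k arbitrary: n)
  case 0
  have "continuous_on UNIV (flat_exp n)"
    using DERIV_flat_exp by (blast intro: DERIV_isCont continuous_at_imp_continuous_on)
  then show ?case
    using assms[of 0] by (auto intro: continuous_on_compose2)
next
  case (Suc k)
  obtain G where G: "\<forall>x\<in>S. GDERIV f x :> G x" "\<forall>b\<in>Basis. C_k_on k S (\<lambda>x. G x \<bullet> b)"
    using assms[of "Suc k"] by auto
  have "C_k_on k S (\<lambda>x. flat_exp (n+2) (f x) + (- real n) * flat_exp (n+1) (f x))"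
    by (intro C_k_on_add C_k_on_mult C_k_on_const Suc.IH)
  then have *: "C_k_on k S (\<lambda>x. flat_exp (n+2) (f x) - real n * flat_exp (n+1) (f x))"
    by simp
  show ?case unfolding C_k_on.simps
  proof (intro exI conjI ballI)
    show "GDERIV (\<lambda>x. flat_exp n (f x)) x :>
        (flat_exp (n+2) (f x) - real n * flat_exp (n+1) (f x)) *\<^sub>R G x" if "x \<in> S" for x
      using G that by (intro GDERIV_DERIV_compose DERIV_flat_exp) auto
    show "C_k_on k S (\<lambda>x. ((flat_exp (n+2) (f x) - real n * flat_exp (n+1) (f x)) *\<^sub>R G x) \<bullet> b)"
      if "b \<in> Basis" for b
      unfolding inner_scaleR_left using G that * by (intro C_k_on_mult) auto
  qed
qed

lemma smooth_bump_exists: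
  assumes "0 < (d::real)"
  obtains \<rho> :: "'a::euclidean_space \<Rightarrow> real" where
    "smooth_real_on UNIV \<rho>" "\<And>x. 0 \<le> \<rho> x" "\<And>x. d \<le> norm x \<Longrightarrow> \<rho> x = 0" "0 < \<rho> 0" "\<And>x. \<rho> (- x) = \<rho> x"
proof
  \<comment> \<open>The squared norm is smooth at the origin, and d^2 - |x|^2 is positive exactly in
    the open ball of radius d.\<close>
  let ?\<rho> = "\<lambda>x::'a. flat_exp 0 (d\<^sup>2 + (-1) * (norm x)\<^sup>2)"
  show "smooth_real_on UNIV ?\<rho>"
    unfolding smooth_real_on_def
    by (intro allI C_k_on_flat_exp C_k_on_add C_k_on_mult C_k_on_const C_k_on_norm_sq)
  show "0 \<le> ?\<rho> x" for x by (rule flat_exp_nonneg)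
  show "?\<rho> x = 0" if "d \<le> norm x" for x
    using power_mono[OF that, of 2] assms by (simp add: flat_exp_def)
  show "0 < ?\<rho> 0" using assms by (simp add: flat_exp_def)
  show "?\<rho> (- x) = ?\<rho> x" for x by simp
qed

section \<open>Second order calculus in the plane\<close>

text \<open>\<open>G\<close> is the gradient of \<open>f\<close>, and \<open>A\<close>, \<open>B\<close> are the
  gradients of the two components of \<open>G\<close>, so that the Laplacian of \<open>f\<close> is \<open>Re A + Im B\<close>.\<close>

definition c2 :: "complex set \<Rightarrow> (complex \<Rightarrow> real) \<Rightarrow> (complex \<Rightarrow> complex) \<Rightarrow>
    (complex \<Rightarrow> complex) \<Rightarrow> (complex \<Rightarrow> complex) \<Rightarrow> bool" where
  "c2 S f G A B \<longleftrightarrow> open S \<and> continuous_on S A \<and> continuous_on S B \<and>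
     (\<forall>x\<in>S. GDERIV f x :> G x \<and> GDERIV (\<lambda>x. Re (G x)) x :> A x \<and> GDERIV (\<lambda>x. Im (G x)) x :> B x)"

lemma continuous_on_complexI:
  fixes A :: "'a::t2_space \<Rightarrow> complex"
  assumes "\<forall>b\<in>Basis. continuous_on S (\<lambda>x. A x \<bullet> b)" shows "continuous_on S A"
  using assms continuous_on_componentwise[of S A] by auto

lemma C_2_on_iff:
  assumes "open S"
  shows "C_k_on 2 S f \<longleftrightarrow> (\<exists>G A B. c2 S f G A B)"
proof
  assume "C_k_on 2 S f"
  then obtain G where G: "\<forall>x\<in>S. GDERIV f x :> G x" "\<forall>b\<in>Basis. C_k_on 1 S (\<lambda>x. G x \<bullet> b)"
    by (auto simp: numeral_2_eq_2)
  have "C_k_on (Suc 0) S (\<lambda>x. Re (G x))" "C_k_on (Suc 0) S (\<lambda>x. Im (G x))"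
    using G(2) by (auto simp: Basis_complex_def simp del: C_k_on.simps)
  then obtain A B where
    "\<forall>x\<in>S. GDERIV (\<lambda>x. Re (G x)) x :> A x" "\<forall>b\<in>Basis. continuous_on S (\<lambda>x. A x \<bullet> b)"
    "\<forall>x\<in>S. GDERIV (\<lambda>x. Im (G x)) x :> B x" "\<forall>b\<in>Basis. continuous_on S (\<lambda>x. B x \<bullet> b)"
    unfolding C_k_on.simps by metis
  then have "c2 S f G A B" unfolding c2_def
    using G assms by (auto intro: continuous_on_complexI)
  then show "\<exists>G A B. c2 S f G A B" by blast
next
  assume "\<exists>G A B. c2 S f G A B"
  then obtain G A B where c: "c2 S f G A B" by blast
  have "\<forall>b\<in>Basis. C_k_on (Suc 0) S (\<lambda>x. G x \<bullet> b)"
    using c unfolding c2_def by (force simp: Basis_complex_def intro: continuous_intros)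
  then show "C_k_on 2 S f" using c unfolding c2_def
    unfolding numeral_2_eq_2 C_k_on.simps(2)[of "Suc 0"] by blast
qed

lemma c2_open: "c2 S f G A B \<Longrightarrow> open S" by (simp add: c2_def)

lemma c2_GDERIV: "c2 S f G A B \<Longrightarrow> x \<in> S \<Longrightarrow> GDERIV f x :> G x" by (simp add: c2_def)

lemma c2_continuous_on: 
  assumes "c2 S f G A B"
  shows "continuous_on S f" "continuous_on S G" "continuous_on S A" "continuous_on S B"
proof -
  show "continuous_on S f" "continuous_on S A" "continuous_on S B" using assms
    by (auto simp: c2_def intro!: continuous_at_imp_continuous_on GDERIV_isCont)
  have "continuous_on S (\<lambda>x. Re (G x))" "continuous_on S (\<lambda>x. Im (G x))" using assms
    by (auto simp: c2_def intro!: continuous_at_imp_continuous_on GDERIV_isCont)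
  then show "continuous_on S G" by (intro continuous_on_complexI) (auto simp: Basis_complex_def)
qed

lemma c2_subset: "c2 S f G A B \<Longrightarrow> open T \<Longrightarrow> T \<subseteq> S \<Longrightarrow> c2 T f G A B"
  by (auto simp: c2_def intro: continuous_on_subset)

lemma partial_deriv_GDERIV: "GDERIV f x :> G \<Longrightarrow> partial_deriv b f x = G \<bullet> b"
  unfolding partial_deriv_def using GDERIV_DERIV_line[of f x 0 b G]
  by (simp add: DERIV_imp_deriv)

text \<open>The inner partial derivative agrees with a component of \<open>G\<close> on the whole
  open set \<open>S\<close>, which is what permits differentiating it again.\<close>

lemma c2_laplacian:
  assumes c: "c2 S f G A B" and x: "x \<in> S"
  shows "laplacian f x = Re (A x) + Im (B x)"
proof -
  have p: "partial_deriv b f y = G y \<bullet> b" if "y \<in> S" for b y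
    using c that by (intro partial_deriv_GDERIV) (auto simp: c2_def)
  have "GDERIV (partial_deriv 1 f) x :> A x"
    by (rule GDERIV_cong_open[of "\<lambda>x. Re (G x)" _ _ S]) (use c x p in \<open>auto simp: c2_def\<close>)
  moreover have "GDERIV (partial_deriv \<i> f) x :> B x"
    by (rule GDERIV_cong_open[of "\<lambda>x. Im (G x)" _ _ S]) (use c x p in \<open>auto simp: c2_def\<close>)
  ultimately show ?thesis
    by (simp add: laplacian_def Basis_complex_def partial_deriv_GDERIV)
qed

lemma c2_const: "open S \<Longrightarrow> c2 S (\<lambda>_. c) (\<lambda>_. 0) (\<lambda>_. 0) (\<lambda>_. 0)"
  by (simp add: c2_def GDERIV_const)

lemma c2_add:
  assumes "c2 S f G A B" "c2 S g G' A' B'"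
  shows "c2 S (\<lambda>x. f x + g x) (\<lambda>x. G x + G' x) (\<lambda>x. A x + A' x) (\<lambda>x. B x + B' x)"
  using assms by (auto simp: c2_def intro!: continuous_intros GDERIV_add)

text \<open>The second-order data stay in the shape produced by the product rule, so that such rules
  chain; terms are collected only when a Laplacian is evaluated.\<close>

lemma c2_mult:
  assumes f: "c2 S f G A B" and g: "c2 S g G' A' B'"
  shows "c2 S (\<lambda>x. f x * g x) (\<lambda>x. f x *\<^sub>R G' x + g x *\<^sub>R G x)
    (\<lambda>x. (f x *\<^sub>R A' x + Re (G' x) *\<^sub>R G x) + (g x *\<^sub>R A x + Re (G x) *\<^sub>R G' x))
    (\<lambda>x. (f x *\<^sub>R B' x + Im (G' x) *\<^sub>R G x) + (g x *\<^sub>R B x + Im (G x) *\<^sub>R G' x))"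
  using f g c2_continuous_on[OF f] c2_continuous_on[OF g] unfolding c2_def
  by (auto intro!: continuous_intros GDERIV_add GDERIV_mult)

lemma c2_compose:
  assumes f: "c2 S f G A B"
    and h: "\<And>x. (h has_real_derivative h1 x) (at x)" "\<And>x. (h1 has_real_derivative h2 x) (at x)"
    and c: "continuous_on UNIV h2"
  shows "c2 S (\<lambda>x. h (f x)) (\<lambda>x. h1 (f x) *\<^sub>R G x)
    (\<lambda>x. h1 (f x) *\<^sub>R A x + Re (G x) *\<^sub>R (h2 (f x) *\<^sub>R G x))
    (\<lambda>x. h1 (f x) *\<^sub>R B x + Im (G x) *\<^sub>R (h2 (f x) *\<^sub>R G x))"
proof -
  have c1: "continuous_on UNIV h1" using h(2) by (blast intro: DERIV_isCont continuous_at_imp_continuous_on)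
  have "continuous_on S (\<lambda>x. h1 (f x))" "continuous_on S (\<lambda>x. h2 (f x))"
    using c1 c c2_continuous_on[OF f] by (auto intro: continuous_on_compose2)
  then have 1: "continuous_on S (\<lambda>x. h1 (f x) *\<^sub>R A x + Re (G x) *\<^sub>R (h2 (f x) *\<^sub>R G x))"
    "continuous_on S (\<lambda>x. h1 (f x) *\<^sub>R B x + Im (G x) *\<^sub>R (h2 (f x) *\<^sub>R G x))"
    using c2_continuous_on[OF f] by (auto intro!: continuous_intros)
  have "GDERIV (\<lambda>x. h (f x)) x :> h1 (f x) *\<^sub>R G x"
    "GDERIV (\<lambda>x. h1 (f x) * Re (G x)) x :> h1 (f x) *\<^sub>R A x + Re (G x) *\<^sub>R (h2 (f x) *\<^sub>R G x)"
    "GDERIV (\<lambda>x. h1 (f x) * Im (G x)) x :> h1 (f x) *\<^sub>R B x + Im (G x) *\<^sub>R (h2 (f x) *\<^sub>R G x)"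
    if "x \<in> S" for x
    using f that h unfolding c2_def
    by (intro GDERIV_mult GDERIV_DERIV_compose[of f]; blast)+
  with 1 f show ?thesis unfolding c2_def by simp
qed

lemma c2_zero_region:
  assumes c: "c2 S f G A B" and T: "open T" "T \<subseteq> S" "\<And>x. x \<in> T \<Longrightarrow> f x = 0" and x: "x \<in> T"
  shows "G x = 0" "A x = 0" "B x = 0"
proof -
  have G: "G y = 0" if "y \<in> T" for y
  proof (rule GDERIV_unique)
    show "GDERIV f y :> G y" using c T that by (auto simp: c2_def)
    show "GDERIV f y :> 0" by (rule GDERIV_cong_open[OF GDERIV_const[of 0] T(1) that]) (use T in auto)
  qed
  then show "G x = 0" using x by auto
  show "A x = 0"
  proof (rule GDERIV_unique)
    show "GDERIV (\<lambda>x. Re (G x)) x :> A x" using c T x by (auto simp: c2_def)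
    show "GDERIV (\<lambda>x. Re (G x)) x :> 0"
      by (rule GDERIV_cong_open[OF GDERIV_const[of 0] T(1) x]) (use G in auto)
  qed
  show "B x = 0"
  proof (rule GDERIV_unique)
    show "GDERIV (\<lambda>x. Im (G x)) x :> B x" using c T x by (auto simp: c2_def)
    show "GDERIV (\<lambda>x. Im (G x)) x :> 0"
      by (rule GDERIV_cong_open[OF GDERIV_const[of 0] T(1) x]) (use G in auto)
  qed
qed

section \<open>Extension by zero of compactly supported functions\<close>

lemma continuous_on_extend_zero:
  fixes A :: "'a::t2_space \<Rightarrow> 'b::real_normed_vector"
  assumes S: "open S" and K: "compact K" "K \<subseteq> S" and A: "continuous_on S A" 
    and z: "\<And>x. x \<in> S - K \<Longrightarrow> A x = 0"
  shows "continuous_on UNIV (\<lambda>x. if x \<in> S then A x else 0)"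
proof -
  have "continuous_on (S \<union> - K) (\<lambda>x. if x \<in> S then A x else 0)"
  proof (rule continuous_on_cases_local_open)
    show "openin (top_of_set (S \<union> - K)) S" "openin (top_of_set (S \<union> - K)) (- K)"
      using S compact_imp_closed[OF K(1)] by (auto intro: open_subset)
  qed (use A z in auto)
  moreover have "S \<union> - K = UNIV" using K by auto
  ultimately show ?thesis by simp
qed

lemma GDERIV_extend_zero:
  fixes f :: "'a::real_inner \<Rightarrow> real"
  assumes S: "open S" and K: "compact K" "K \<subseteq> S" and f: "\<And>x. x \<in> S \<Longrightarrow> GDERIV f x :> G x"
    and z: "\<And>x. x \<in> S - K \<Longrightarrow> f x = 0"
  shows "GDERIV (\<lambda>x. if x \<in> S then f x else 0) x :> (if x \<in> S then G x else 0)"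
proof (cases "x \<in> S")
  case True
  then show ?thesis by (auto intro!: GDERIV_cong_open[OF f S])
next
  case False
  have "GDERIV (\<lambda>x. if x \<in> S then f x else 0) x :> 0"
    by (rule GDERIV_cong_open[OF GDERIV_const[of 0], of "- K"])
      (use False K z in \<open>auto simp: compact_imp_closed\<close>)
  then show ?thesis using False by simp
qed

text \<open>A defining function lives only near a boundary point. Multiplied by a compactly
  supported factor it becomes a global test function through this extension.\<close>

lemma c2_extend_zero:
  assumes c: "c2 S f G A B" and K: "compact K" "K \<subseteq> S" and z: "\<And>x. x \<in> S - K \<Longrightarrow> f x = 0"
  shows "c2 UNIV (\<lambda>x. if x \<in> S then f x else 0) (\<lambda>x. if x \<in> S then G x else 0)
    (\<lambda>x. if x \<in> S then A x else 0) (\<lambda>x. if x \<in> S then B x else 0)"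
proof -
  have S: "open S" using c by (simp add: c2_def)
  then have T: "open (S - K)" using K by (simp add: compact_imp_closed open_Diff)
  have zz: "G x = 0" "A x = 0" "B x = 0" if "x \<in> S - K" for x
    using c2_zero_region[OF c T] z that by auto
  have "GDERIV (\<lambda>x. if x \<in> S then Re (G x) else 0) x :> (if x \<in> S then A x else 0)"
    "GDERIV (\<lambda>x. if x \<in> S then Im (G x) else 0) x :> (if x \<in> S then B x else 0)" for x
    by (rule GDERIV_extend_zero[OF S K]; use c zz in \<open>auto simp: c2_def\<close>)+
  moreover have "(\<lambda>x. if x \<in> S then Re (G x) else 0) = (\<lambda>x. Re (if x \<in> S then G x else 0))"
    "(\<lambda>x. if x \<in> S then Im (G x) else 0) = (\<lambda>x. Im (if x \<in> S then G x else 0))"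
    by auto
  ultimately have "GDERIV (\<lambda>x. Re (if x \<in> S then G x else 0)) x :> (if x \<in> S then A x else 0)"
    "GDERIV (\<lambda>x. Im (if x \<in> S then G x else 0)) x :> (if x \<in> S then B x else 0)" for x
    by metis+
  moreover have "GDERIV (\<lambda>x. if x \<in> S then f x else 0) x :> (if x \<in> S then G x else 0)" for x
    by (rule GDERIV_extend_zero[OF S K]) (use c z in \<open>auto simp: c2_def\<close>)
  ultimately show ?thesis unfolding c2_def 
    using continuous_on_extend_zero[OF S K, of A] continuous_on_extend_zero[OF S K, of B] zz c
    by (auto simp: c2_def)
qed

lemma c2_reflect:
  assumes "c2 UNIV f G A B"
  shows "c2 UNIV (\<lambda>x. f (a - x)) (\<lambda>x. - G (a - x)) (\<lambda>x. A (a - x)) (\<lambda>x. B (a - x))"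
proof -
  have "GDERIV (\<lambda>x. f (a - x)) x :> - G (a - x)" "GDERIV (\<lambda>x. - Re (G (a - x))) x :> - (- A (a - x))"
    "GDERIV (\<lambda>x. - Im (G (a - x))) x :> - (- B (a - x))" for x
    using assms unfolding c2_def
    by (intro GDERIV_minus GDERIV_reflect GDERIV_reflect[of "\<lambda>x. Re (G x)"] GDERIV_reflect[of "\<lambda>x. Im (G x)"]; simp)+
  then show ?thesis using assms unfolding c2_def
    by (auto intro: continuous_on_compose2[of UNIV A] continuous_on_compose2[of UNIV B] intro!: continuous_intros)
qed

text \<open>The integral of the quadratic cardinal B-spline is a \<open>C\<^sup>2\<close> transition from 0 to 1.\<close>

definition cutoff4 :: "nat \<Rightarrow> real \<Rightarrow> real" where
  "cutoff4 n x = ((max 0 (x-1))^n - 3 * (max 0 (x-2))^n + 3 * (max 0 (x-3))^n - (max 0 (x-4))^n) / fact n"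

lemma DERIV_max_power:
  "((\<lambda>x::real. (max 0 (x-a)) ^ (n+2)) has_real_derivative real (n+2) * (max 0 (x-a)) ^ (n+1)) (at x)"
proof -
  consider "x < a" | "a < x" | "x = a" by linarith
  then show ?thesis
  proof cases
    case 1
    have "((\<lambda>x. 0) has_real_derivative 0) (at x)" by simp
    then have "((\<lambda>x. (max 0 (x-a)) ^ (n+2)) has_real_derivative 0) (at x)"
      by (rule has_field_derivative_transform_within_open[of _ _ _ "{..<a}"]) (use 1 in auto)
    then show ?thesis using 1 by simp
  next
    case 2
    have "((\<lambda>x. x - a) has_real_derivative 1) (at x)" by (auto intro!: derivative_eq_intros)
    from DERIV_power[OF this, of "n+2"]
    have "((\<lambda>x. (x-a) ^ (n+2)) has_real_derivative real (n+2) * (x-a) ^ (n+1)) (at x)"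
      by simp
    then have "((\<lambda>x. (max 0 (x-a)) ^ (n+2)) has_real_derivative real (n+2) * (x-a) ^ (n+1)) (at x)"
      by (rule has_field_derivative_transform_within_open[of _ _ _ "{a<..}"]) (use 2 in auto)
    then show ?thesis using 2 by simp
  next
    case 3
    have "((\<lambda>h. (max 0 h) ^ (n+2) / h) \<longlongrightarrow> 0) (at (0::real))"
    proof (rule Lim_null_comparison)
      show "\<forall>\<^sub>F h::real in at 0. norm ((max 0 h) ^ (n+2) / h) \<le> \<bar>h\<bar> ^ (n+1)"
        by (intro always_eventually) (auto simp: max_def power_add abs_mult mult_nonpos_nonneg)
      show "((\<lambda>h. \<bar>h\<bar> ^ (n+1)) \<longlongrightarrow> 0) (at (0::real))"
        by (rule tendsto_eq_intros | simp)+
    qed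
    then show ?thesis using 3 by (simp add: DERIV_def)
  qed
qed

text \<open>Each \<open>cutoff4 n\<close> is a third difference of truncated powers divided by n!,
  so differentiation lowers \<open>n\<close>: orders 1 to 4 are the derivative of the spline, the
  spline, the transition and a convex antiderivative of it. The knots start at 1 and not at 0 so
  that a cutoff in the scaled defining function vanishes in a whole layer along the
  boundary.\<close>

lemma DERIV_cutoff4:
  "(cutoff4 (n+2) has_real_derivative cutoff4 (n+1) x) (at x)"
proof -
  have *: "((\<lambda>x. ((max 0 (x-1))^(n+2) - 3 * (max 0 (x-2))^(n+2) + 3 * (max 0 (x-3))^(n+2) - (max 0 (x-4))^(n+2)) / fact (n+2))
    has_real_derivative (real (n+2) * (max 0 (x-1))^(n+1) - 3 * (real (n+2) * (max 0 (x-2))^(n+1))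
      + 3 * (real (n+2) * (max 0 (x-3))^(n+1)) - real (n+2) * (max 0 (x-4))^(n+1)) / fact (n+2)) (at x)"
    by (intro DERIV_cdivide DERIV_diff DERIV_add DERIV_cmult DERIV_max_power[of 1] DERIV_max_power[of 2]
        DERIV_max_power[of 3] DERIV_max_power[of 4])
  have "(real (n+2) * a - 3 * (real (n+2) * b) + 3 * (real (n+2) * c) - real (n+2) * d) / fact (n+2)
     = (a - 3 * b + 3 * c - d) / fact (n+1)" for a b c d :: real
  proof -
    have "fact (n+2) = real (n+2) * fact (n+1)" by (simp add: algebra_simps)
    moreover have "real (n+2) * a - 3 * (real (n+2) * b) + 3 * (real (n+2) * c) - real (n+2) * d
      = real (n+2) * (a - 3 * b + 3 * c - d)" by (simp add: algebra_simps)
    ultimately show ?thesis by (simp del: fact_Suc of_nat_add of_nat_Suc)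
  qed
  with * show ?thesis unfolding cutoff4_def by simp
qed

lemma continuous_cutoff4: "continuous_on S (cutoff4 n)"
  unfolding cutoff4_def by (intro continuous_intros) auto

lemma cutoff4_eq_0: "x \<le> 1 \<Longrightarrow> 0 < n \<Longrightarrow> cutoff4 n x = 0"
  by (simp add: cutoff4_def)

lemma cutoff4_2_nonneg: "0 \<le> cutoff4 2 x"
proof -
  consider "x \<le> 1" | "1 \<le> x" "x \<le> 2" | "2 \<le> x" "x \<le> 3" | "3 \<le> x" "x \<le> 4" | "4 \<le> x" by linarith
  then show ?thesis
  proof cases
    case 3
    \<comment> \<open>On this piece the spline equals 1/2 + (x - 2)(3 - x).\<close>
    have "0 \<le> (x - 2) * (3 - x)" using 3 by simp
    then show ?thesis using 3 by (simp add: cutoff4_def max_def power2_eq_square algebra_simps)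
  next
    case 4
    have "(x-1)^2 - 3 * (x-2)^2 + 3 * (x-3)^2 = (4-x)^2" by (simp add: power2_eq_square algebra_simps)
    then show ?thesis using 4 by (simp add: cutoff4_def max_def)
  next
    case 5
    have "(x-1)^2 - 3 * (x-2)^2 + 3 * (x-3)^2 - (x-4)^2 = 0" by (simp add: power2_eq_square algebra_simps)
    then show ?thesis using 5 by (simp add: cutoff4_def max_def)
  qed (auto simp: cutoff4_def max_def)
qed

text \<open>A third difference with unit step turns x^3 into 3! and x^2 into 0. Past the last knot
  the transition is therefore 1 and the spline 0.\<close>

lemma cutoff4_3_eq_1: "4 \<le> x \<Longrightarrow> cutoff4 3 x = 1"
proof -
  have "(x-1)^3 - 3 * (x-2)^3 + 3 * (x-3)^3 - (x-4)^3 = 6" by (simp add: power3_eq_cube algebra_simps)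
  then show "4 \<le> x \<Longrightarrow> cutoff4 3 x = 1" by (simp add: cutoff4_def max_def fact_numeral)
qed

lemma cutoff4_2_eq_0: "4 \<le> x \<Longrightarrow> cutoff4 2 x = 0"
proof -
  have "(x-1)^2 - 3 * (x-2)^2 + 3 * (x-3)^2 - (x-4)^2 = 0" by (simp add: power2_eq_square algebra_simps)
  then show "4 \<le> x \<Longrightarrow> cutoff4 2 x = 0" by (simp add: cutoff4_def max_def)
qed

lemma cutoff4_1_eq_0: "4 \<le> x \<Longrightarrow> cutoff4 1 x = 0"
  by (simp add: cutoff4_def max_def)

lemma DERIV_cutoff4_3: "(cutoff4 3 has_real_derivative cutoff4 2 x) (at x)"
  using DERIV_cutoff4[of 1 x] by (simp add: numeral_3_eq_3 numeral_2_eq_2)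

lemma DERIV_cutoff4_2: "(cutoff4 2 has_real_derivative cutoff4 1 x) (at x)"
  using DERIV_cutoff4[of 0 x] by (simp add: numeral_2_eq_2)

lemma DERIV_cutoff4_4: "(cutoff4 4 has_real_derivative cutoff4 3 x) (at x)"
  using DERIV_cutoff4[of 2 x] by (simp add: numeral_3_eq_3 eval_nat_numeral)

lemma cutoff4_3_mono: "x \<le> y \<Longrightarrow> cutoff4 3 x \<le> cutoff4 3 y"
  using DERIV_cutoff4_3 cutoff4_2_nonneg by (metis DERIV_nonneg_imp_nondecreasing)

lemma cutoff4_3_range: "0 \<le> cutoff4 3 x" "cutoff4 3 x \<le> 1"
  using cutoff4_3_mono[of "min x 0" x] cutoff4_eq_0[of "min x 0" 3]
    cutoff4_3_mono[of x "max x 4"] cutoff4_3_eq_1[of "max x 4"] by auto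

lemma cutoff4_4_mono: "x \<le> y \<Longrightarrow> cutoff4 4 x \<le> cutoff4 4 y"
  using DERIV_cutoff4_4 cutoff4_3_range(1) by (metis DERIV_nonneg_imp_nondecreasing)

lemma cutoff4_4_nonneg: "0 \<le> cutoff4 4 x"
  using cutoff4_4_mono[of "min x 0" x] cutoff4_eq_0[of "min x 0" 4] by auto

section \<open>Change of variables in the plane\<close>

text \<open>The pair is swapped so that Fubini leaves the real part as the inner variable: in a tube
  it is the coordinate across the boundary, which is integrated out first.\<close>

lemma lborel_distr_Complex_swap:
  "distr (lborel :: (real \<times> real) measure) borel (\<lambda>(y, x). Complex x y) = lborel"
proof (rule lborel_eqI[symmetric])
  fix l u :: complex assume le: "\<And>b. b \<in> Basis \<Longrightarrow> l \<bullet> b \<le> u \<bullet> b"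
  have [measurable]: "(\<lambda>(y, x). Complex x y) \<in> borel_measurable borel"
    unfolding case_prod_beta by (intro borel_measurable_continuous_onI continuous_intros)
  have "(\<lambda>(y, x). Complex x y) -` box l u = box (Im l, Re l) (Im u, Re u)"
    by (auto simp: box_def Basis_prod_def ball_Un Basis_complex_def)
  then show "emeasure (distr (lborel :: (real \<times> real) measure) borel (\<lambda>(y, x). Complex x y)) (box l u)
      = (\<Prod>b\<in>Basis. (u - l) \<bullet> b)"
    using le[of 1] le[of \<i>]
    by (simp add: emeasure_distr emeasure_lborel_box_eq Basis_prod_def Basis_complex_def prod.union_disjoint
        mult.commute ball_Un)
qed simp

lemma integral_complex_iterated:
  fixes f :: "complex \<Rightarrow> real"
  assumes "integrable lborel f"
  shows "integral\<^sup>L lborel f = (LBINT y. LBINT x. f (Complex x y))"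
proof -
  have m: "(\<lambda>(y, x). Complex x y) \<in> (lborel :: (real \<times> real) measure) \<rightarrow>\<^sub>M borel"
    unfolding case_prod_beta measurable_lborel2
    by (intro borel_measurable_continuous_onI continuous_intros)
  have f: "f \<in> borel_measurable borel" using assms by auto
  have "integrable (lborel :: (real \<times> real) measure) (\<lambda>p. f (case p of (y, x) \<Rightarrow> Complex x y))"
    using assms integrable_distr_eq[OF m f] by (simp add: lborel_distr_Complex_swap)
  then have "integrable (lborel \<Otimes>\<^sub>M lborel) (\<lambda>p. f (case p of (y, x) \<Rightarrow> Complex x y))"
    by (simp add: lborel_prod)
  from lborel_pair.integral_fst'[OF this]
  show ?thesis using integral_distr[OF m f]
    by (simp add: lborel_distr_Complex_swap lborel_prod)
qed

definition jacobian :: "(complex \<Rightarrow> complex) \<Rightarrow> real" where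
  "jacobian L = \<bar>Re (L 1) * Im (L \<i>) - Re (L \<i>) * Im (L 1)\<bar>"

lemma lborel_distr_Complex_vec:
  "distr (lborel :: (real^2) measure) borel (\<lambda>v. Complex (v$1) (v$2)) = lborel"
proof (rule lborel_eqI[symmetric])
  fix l u :: complex assume le: "\<And>b. b \<in> Basis \<Longrightarrow> l \<bullet> b \<le> u \<bullet> b"
  have [measurable]: "(\<lambda>v. Complex (v$1) (v$2)) \<in> borel_measurable (borel :: (real^2) measure)"
    by (intro borel_measurable_continuous_onI continuous_intros)
  let ?e = "\<lambda>z. (\<chi> i. if i = 1 then Re z else Im z) :: real^2"
  have "(\<lambda>v. Complex (v$1) (v$2)) -` box l u = box (?e l) (?e u)"
    by (auto simp: in_box_complex_iff mem_box_cart forall_2)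
  moreover have "(\<Prod>b\<in>Basis. (?e u - ?e l) \<bullet> b) = (Re u - Re l) * (Im u - Im l)"
  proof -
    have *: "Basis = {axis 1 1, axis 2 1 :: real^2}" using Basis_vec_def[where ?'a=real and ?'b=2]
      by (auto simp: UNIV_2)
    have "axis 1 1 \<noteq> (axis 2 1 :: real^2)" by (simp add: axis_eq_axis)
    then show ?thesis unfolding * by (simp add: inner_axis)
  qed
  moreover have "?e l \<bullet> b \<le> ?e u \<bullet> b" if "b \<in> Basis" for b
    using that le[of 1] le[of \<i>] by (auto simp: Basis_vec_def inner_axis Basis_complex_def)
  ultimately show "emeasure (distr (lborel :: (real^2) measure) borel (\<lambda>v. Complex (v$1) (v$2))) (box l u)
      = (\<Prod>b\<in>Basis. (u - l) \<bullet> b)"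
    by (simp add: emeasure_distr emeasure_lborel_box_eq Basis_complex_def)
qed simp

text \<open>The general theorem concerns maps of \<open>real^2\<close> and Lebesgue measure. The
  linear identification \<open>c\<close> with inverse \<open>e\<close> carries it over, and the two
  Borel measurability assumptions bring the integrals back from the completion to
  \<open>lborel\<close>.\<close>

lemma change_of_variables_complex:
  fixes P :: "complex \<Rightarrow> complex" and f :: "complex \<Rightarrow> real"
  assumes S: "open S" and PS: "open (P ` S)"
    and der: "\<And>x. x \<in> S \<Longrightarrow> (P has_derivative P' x) (at x)"
    and inj: "inj_on P S"
    and f: "(\<lambda>z. indicator (P ` S) z * f z) \<in> borel_measurable borel"
    and m: "(\<lambda>x. indicator S x * (jacobian (P' x) * f (P x))) \<in> borel_measurable borel"
    and int: "integrable lborel (\<lambda>z. indicator (P ` S) z * f z)"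
  shows "integrable lborel (\<lambda>x. indicator S x * (jacobian (P' x) * f (P x)))" (is "integrable _ ?F")
    and "(LBINT x. indicator S x * (jacobian (P' x) * f (P x))) = (LBINT z. indicator (P ` S) z * f z)"
proof -
  define c where "c = (\<lambda>v::real^2. Complex (v$1) (v$2))"
  define e where "e = (\<lambda>z. (\<chi> i. if i = 1 then Re z else Im z) :: real^2)"
  have ce: "c (e z) = z" for z by (simp add: c_def e_def)
  have ec: "e (c v) = v" for v by (simp add: c_def e_def vec_eq_iff forall_2)
  have contc: "continuous_on UNIV c" unfolding c_def by (intro continuous_intros)
  have mc: "c \<in> lborel \<rightarrow>\<^sub>M borel" using contc by (simp add: borel_measurable_continuous_onI)
  have blc: "bounded_linear c"
    unfolding c_def by (intro linear_conv_bounded_linear[THEN iffD1] linearI)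
      (auto simp: complex_eq_iff)
  have ble: "bounded_linear e"
    unfolding e_def by (intro linear_conv_bounded_linear[THEN iffD1] linearI)
      (auto simp: vec_eq_iff)
  have distr: "distr lborel borel c = lborel"
    unfolding c_def by (rule lborel_distr_Complex_vec)
  define g where "g = (\<lambda>v. e (P (c v)))"
  define g' where "g' = (\<lambda>v h. e (P' (c v) (c h)))"
  define S' where "S' = c -` S"
  have S'_open: "open S'" unfolding S'_def using S contc by (simp add: open_vimage)
  have gS': "g ` S' = c -` (P ` S)"
  proof (intro equalityI subsetI)
    fix v assume "v \<in> c -` (P ` S)"
    then obtain x where x: "x \<in> S" "c v = P x" by auto
    then have "v = g (e x)" by (simp add: g_def ce x(2)[symmetric] ec)
    then show "v \<in> g ` S'" using x by (auto simp: S'_def ce)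
  qed (auto simp: g_def S'_def ce)
  have "open (g ` S')" unfolding gS' using PS contc by (simp add: open_vimage)
  have der': "(g has_derivative g' v) (at v within S')" if "v \<in> S'" for v
  proof -
    have "((\<lambda>v. P (c v)) has_derivative (\<lambda>h. P' (c v) (c h))) (at v)"
      by (rule has_derivative_compose[OF bounded_linear_imp_has_derivative[OF blc] der])
        (use that in \<open>simp add: S'_def\<close>)
    then have "(g has_derivative g' v) (at v)" unfolding g_def g'_def
      by (rule bounded_linear.has_derivative[OF ble])
    then show ?thesis by (rule has_derivative_at_withinI)
  qed
  have inj': "inj_on g S'"
  proof (rule inj_onI)
    fix x y assume "x \<in> S'" "y \<in> S'" "g x = g y"
    then have "P (c x) = P (c y)" unfolding g_def by (metis ce)
    then have cc: "c x = c y" using inj \<open>x \<in> S'\<close> \<open>y \<in> S'\<close> by (auto simp: S'_def dest: inj_onD)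
    show "x = y" using arg_cong[OF cc, of e] by (simp only: ec)
  qed
  have det: "\<bar>det (matrix (g' v))\<bar> = jacobian (P' (c v))" for v
  proof -
    have "c (axis 1 1) = 1" "c (axis 2 1) = \<i>"
      by (auto simp: c_def axis_def complex_eq_iff)
    then show ?thesis
      by (simp add: det_2 matrix_def g'_def e_def jacobian_def)
  qed
  let ?R = "\<lambda>z. indicator (P ` S) z * f z"
  have key: "(\<lambda>v. \<bar>det (matrix (g' v))\<bar> * f (c (g v))) absolutely_integrable_on S' \<and>
      integral S' (\<lambda>v. \<bar>det (matrix (g' v))\<bar> * f (c (g v))) = b \<longleftrightarrow>
      (\<lambda>v. f (c v)) absolutely_integrable_on (g ` S') \<and> integral (g ` S') (\<lambda>v. f (c v)) = b" for b
  proof -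
    \<comment> \<open>The scalar integrand is read as a vector in \<open>real^1\<close>, the shape
      of integrand in the general theorem.\<close>
    have "(\<lambda>x. \<bar>det (matrix (g' x))\<bar> *\<^sub>R (vec (f (c (g x))) :: real^1)) absolutely_integrable_on S' \<and>
           integral S' (\<lambda>x. \<bar>det (matrix (g' x))\<bar> *\<^sub>R vec (f (c (g x)))) = (vec b :: real ^ 1)
         \<longleftrightarrow> (\<lambda>x. vec (f (c x)) :: real ^ 1) absolutely_integrable_on (g ` S') \<and>
           integral (g ` S') (\<lambda>x. vec (f (c x))) = (vec b :: real ^ 1)"
      using S'_open
      by (intro has_absolute_integral_change_of_variables der' inj') auto
    then show ?thesis by (simp add: absolutely_integrable_on_1_iff integral_on_1_eq)
  qed
  have R: "integrable lborel (\<lambda>v. ?R (c v))" "integral\<^sup>L lborel ?R = (LBINT v. ?R (c v))"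
    using int integrable_distr_eq[OF mc f] integral_distr[OF mc f] by (simp_all add: distr)
  have [measurable]: "(\<lambda>v. ?R (c v)) \<in> borel_measurable borel"
    using measurable_comp[OF mc f] by (simp add: comp_def)
  have Ri: "indicator (g ` S') v *\<^sub>R f (c v) = ?R (c v)" for v
    by (simp add: gS' indicator_def)
  have aR: "(\<lambda>v. f (c v)) absolutely_integrable_on (g ` S')"
    unfolding set_integrable_def Ri using R(1) by (simp add: integrable_completion)
  have iR: "integral (g ` S') (\<lambda>v. f (c v)) = (LBINT v. ?R (c v))"
    using set_lebesgue_integral_eq_integral(2)[OF aR]
    unfolding set_lebesgue_integral_def Ri by (simp add: integral_completion)
  note L = key[of "LBINT v. ?R (c v)", THEN iffD2, OF conjI[OF aR iR]]
  have [measurable]: "(\<lambda>v. ?F (c v)) \<in> borel_measurable borel"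
    using measurable_comp[OF mc m] by (simp add: comp_def)
  have Li: "indicator S' v *\<^sub>R (\<bar>det (matrix (g' v))\<bar> * f (c (g v))) = ?F (c v)" for v
    by (simp add: S'_def det g_def ce indicator_def)
  have aL: "integrable lborel (\<lambda>v. ?F (c v))"
    using L[THEN conjunct1] unfolding set_integrable_def Li by (simp add: integrable_completion)
  have iL: "(LBINT v. ?F (c v)) = (LBINT v. ?R (c v))"
    using set_lebesgue_integral_eq_integral(2)[OF L[THEN conjunct1]] L[THEN conjunct2]
    unfolding set_lebesgue_integral_def Li by (simp add: integral_completion)
  show "integrable lborel ?F"
    using aL integrable_distr_eq[OF mc m] by (simp add: distr)
  show "integral\<^sup>L lborel ?F = integral\<^sup>L lborel ?R"
    using iL R(2) integral_distr[OF mc m] by (simp add: distr)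
qed

section \<open>Convolution and mollifiers\<close>

lemma lborel_reflect:
  fixes f :: "'a::euclidean_space \<Rightarrow> real"
  assumes "f \<in> borel_measurable borel"
  shows "(LBINT y. f (x - y)) = integral\<^sup>L lborel f"
    and "integrable lborel (\<lambda>y. f (x - y)) \<longleftrightarrow> integrable lborel f"
proof -
  have d: "distr lborel borel (\<lambda>y. x - y) = (lborel :: 'a measure)"
    using lborel_affine[of "-1" x] by (simp add: density_1)
  have m: "(\<lambda>y. x - y) \<in> (lborel :: 'a measure) \<rightarrow>\<^sub>M borel" by simp
  show "(LBINT y. f (x - y)) = integral\<^sup>L lborel f"
    using integral_distr[OF m assms] by (simp add: d)
  show "integrable lborel (\<lambda>y. f (x - y)) \<longleftrightarrow> integrable lborel f"
    using integrable_distr_eq[OF m assms] by (simp add: d)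
qed

text \<open>Dominated convergence along a filter reduces to sequences. The domination holds only
  eventually, so each sequence is shifted past its first terms.\<close>

lemma integral_tendsto_at:
  fixes f :: "'a::first_countable_topology \<Rightarrow> 'b \<Rightarrow> 'c::{banach, second_countable_topology}"
  assumes m: "\<forall>\<^sub>F s in at a within S. f s \<in> borel_measurable M" and m0: "g \<in> borel_measurable M"
    and w: "integrable M w" and b: "\<forall>\<^sub>F s in at a within S. \<forall>x. norm (f s x) \<le> w x"
    and l: "AE x in M. ((\<lambda>s. f s x) \<longlongrightarrow> g x) (at a within S)"
  shows "((\<lambda>s. \<integral>x. f s x \<partial>M) \<longlongrightarrow> (\<integral>x. g x \<partial>M)) (at a within S)"
  unfolding tendsto_at_iff_sequentially comp_def
proof (intro allI impI)
  fix X assume X: "\<forall>i. X i \<in> S - {a}" "X \<longlonglongrightarrow> a"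
  then have X': "filterlim X (at a within S) sequentially"
    by (auto simp: filterlim_at)
  from eventually_conj[OF m b]
  have "\<forall>\<^sub>F i in sequentially. f (X i) \<in> borel_measurable M \<and> (\<forall>x. norm (f (X i) x) \<le> w x)"
    using X' by (auto simp: filterlim_iff)
  then obtain N where N: "\<And>i. i \<ge> N \<Longrightarrow> f (X i) \<in> borel_measurable M \<and> (\<forall>x. norm (f (X i) x) \<le> w x)"
    by (auto simp: eventually_sequentially)
  have "(\<lambda>i. \<integral>x. f (X (i + N)) x \<partial>M) \<longlonglongrightarrow> (\<integral>x. g x \<partial>M)"
  proof (rule integral_dominated_convergence[OF m0 _ w])
    show "AE x in M. (\<lambda>i. f (X (i + N)) x) \<longlonglongrightarrow> g x"
      using l
    proof eventually_elim
      case (elim x)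
      have "(\<lambda>i. f (X i) x) \<longlonglongrightarrow> g x" using filterlim_compose[OF elim X'] .
      then show ?case by (rule LIMSEQ_ignore_initial_segment)
    qed
  qed (use N in auto)
  then show "(\<lambda>i. \<integral>x. f (X i) x \<partial>M) \<longlonglongrightarrow> (\<integral>x. g x \<partial>M)" by (rule LIMSEQ_offset)
qed

lemma bounded_of_compact_support:
  fixes f :: "'a::euclidean_space \<Rightarrow> 'b::real_normed_vector"
  assumes "continuous_on UNIV f" "\<And>x. R < norm x \<Longrightarrow> f x = 0"
  obtains M where "0 \<le> M" "\<And>x. norm (f x) \<le> M"
proof -
  have "compact (f ` cball 0 R)"
    by (rule compact_continuous_image) (use assms in \<open>auto intro: continuous_on_subset\<close>)
  then obtain M where M: "\<And>x. x \<in> cball 0 R \<Longrightarrow> norm (f x) \<le> M"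
    by (meson bounded_iff compact_imp_bounded imageI)
  have "norm (f x) \<le> max M 0" for x
    using M[of x] assms(2)[of x] by (cases "norm x \<le> R") auto
  then show ?thesis using that[of "max M 0"] by auto
qed

lemma integrable_of_compact_support:
  fixes f :: "'a::euclidean_space \<Rightarrow> 'b::{banach, second_countable_topology}"
  assumes "continuous_on UNIV f" "\<And>x. R < norm x \<Longrightarrow> f x = 0"
  shows "integrable lborel f"
proof -
  have "integrable lborel (\<lambda>x. indicator (cball 0 R) x *\<^sub>R f x)"
    by (rule borel_integrable_compact) (use assms in \<open>auto intro: continuous_on_subset\<close>)
  moreover have "(\<lambda>x. indicator (cball 0 R) x *\<^sub>R f x) = f"
    using assms(2) by (auto simp: indicator_def fun_eq_iff)
  ultimately show ?thesis by simp
qed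

text \<open>The kernel may be vector-valued, so that the gradient of a convolution is again a
  \<open>conv\<close>, with the gradient of the kernel in place of the kernel.\<close>

definition conv :: "('a::euclidean_space \<Rightarrow> real) \<Rightarrow> ('a \<Rightarrow> 'b::{banach, second_countable_topology}) \<Rightarrow> 'a \<Rightarrow> 'b"
  where "conv f k x = (LBINT y. f y *\<^sub>R k (x - y))"

lemma conv_commute:
  fixes f k :: "'a::euclidean_space \<Rightarrow> real"
  assumes "f \<in> borel_measurable borel" "k \<in> borel_measurable borel"
  shows "conv f k x = conv k f x"
proof -
  have "(\<lambda>y. f y * k (x - y)) \<in> borel_measurable borel" using assms by measurable
  from lborel_reflect(1)[OF this, of x] show ?thesis
    by (simp add: conv_def mult.commute)
qed

lemma conv_integrable:
  fixes k :: "'a::euclidean_space \<Rightarrow> 'b::{banach, second_countable_topology}"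
  assumes f: "integrable lborel f" and k: "k \<in> borel_measurable borel" "\<And>x. norm (k x) \<le> M"
  shows "integrable lborel (\<lambda>y. f y *\<^sub>R k (x - y))"
proof (rule Bochner_Integration.integrable_bound)
  show "integrable lborel (\<lambda>y. M * norm (f y))" using f by auto
  have [measurable]: "k \<in> borel_measurable borel" "f \<in> borel_measurable borel" using f k by auto
  show "(\<lambda>y. f y *\<^sub>R k (x - y)) \<in> borel_measurable lborel" by measurable
  have "0 \<le> M" using k(2)[of 0] norm_ge_zero[of "k 0"] by linarith
  then show "AE y in lborel. norm (f y *\<^sub>R k (x - y)) \<le> norm (M * norm (f y))"
    using k(2) by (auto simp: abs_mult mult.commute[of M] intro!: mult_left_mono)
qed

lemma conv_continuous:
  assumes f: "integrable lborel f" and k: "continuous_on UNIV k" "\<And>x. norm (k x) \<le> M"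
  shows "continuous_on UNIV (conv f k)"
  unfolding continuous_on_def conv_def
proof (intro ballI, rule integral_tendsto_at)
  fix x
  have [measurable]: "k \<in> borel_measurable borel" "f \<in> borel_measurable borel"
    using f k by (auto intro: borel_measurable_continuous_onI)
  show "\<forall>\<^sub>F z in at x. (\<lambda>y. f y *\<^sub>R k (z - y)) \<in> borel_measurable lborel"
    by (intro always_eventually allI) measurable
  show "(\<lambda>y. f y *\<^sub>R k (x - y)) \<in> borel_measurable lborel" by measurable
  show "integrable lborel (\<lambda>y. M * norm (f y))" using f by auto
  show "\<forall>\<^sub>F z in at x. \<forall>y. norm (f y *\<^sub>R k (z - y)) \<le> M * norm (f y)"
    using k(2) by (intro always_eventually) (auto simp: mult.commute[of M] intro!: mult_left_mono)
  have "isCont k z" for z using k(1) by (simp add: continuous_on_eq_continuous_at)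
  then have "((\<lambda>z. k (z - y)) \<longlongrightarrow> k (x - y)) (at x)" for y
    by (intro isCont_tendsto_compose[of _ k]) (auto intro!: tendsto_eq_intros)
  then show "AE y in lborel. ((\<lambda>z. f y *\<^sub>R k (z - y)) \<longlongrightarrow> f y *\<^sub>R k (x - y)) (at x)"
    by (intro AE_I2 tendsto_intros)
qed

lemma conv_GDERIV:
  fixes f k :: "'a::euclidean_space \<Rightarrow> real"
  assumes f: "integrable lborel f" and K: "\<And>x. GDERIV k x :> K x" "continuous_on UNIV K"
    and b: "\<And>x. \<bar>k x\<bar> \<le> M" "\<And>x. norm (K x) \<le> M"
  shows "GDERIV (conv f k) x :> conv f K x"
proof -
  have ck: "continuous_on UNIV k"
    using K(1) GDERIV_isCont by (blast intro: continuous_at_imp_continuous_on)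
  have [measurable]: "k \<in> borel_measurable borel" "f \<in> borel_measurable borel" "K \<in> borel_measurable borel"
    using f ck K by (auto intro: borel_measurable_continuous_onI)
  have i: "integrable lborel (\<lambda>y. f y * k (z - y))" for z
    using conv_integrable[of f k M z] f b by simp
  have iK: "integrable lborel (\<lambda>y. f y *\<^sub>R K (z - y))" for z
    using conv_integrable[of f K M z] f b by simp
  \<comment> \<open>The first-order remainder divided by |h|. As \<open>k\<close> is Lipschitz with
    constant M, it is dominated by 2 M |f|, which allows differentiation under the integral.\<close>
  define r where "r = (\<lambda>h y. f y * ((k (x + h - y) - k (x - y) - h \<bullet> K (x - y)) / norm h))"
  have lip: "\<bar>k (z + h) - k z\<bar> \<le> M * norm h" for z h
  proof -
    have "\<bar>k (z + h) - k z\<bar> \<le> M * norm (z + h - z)"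
      unfolding real_norm_def[symmetric]
    proof (rule differentiable_bound[of UNIV])
      show "(k has_derivative (\<lambda>h. h \<bullet> K x)) (at x within UNIV)" for x using K(1) by (simp add: gderiv_def)
      show "onorm (\<lambda>h. h \<bullet> K x) \<le> M" for x
        by (rule onorm_le) (metis Cauchy_Schwarz_ineq2 b(2) inner_commute mult_right_mono norm_ge_zero order_trans real_norm_def)
    qed auto
    then show ?thesis by simp
  qed
  have "((\<lambda>h. LBINT y. r h y) \<longlongrightarrow> (LBINT y::'a. (0::real))) (at 0)"
  proof (rule integral_tendsto_at)
    show "\<forall>\<^sub>F h in at 0. r h \<in> borel_measurable lborel"
      unfolding r_def by (intro always_eventually allI) measurable
    show "integrable lborel (\<lambda>y. (2 * M) * norm (f y))" using f by auto
    show "\<forall>\<^sub>F h in at 0. \<forall>y. norm (r h y) \<le> (2 * M) * norm (f y)"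
      unfolding eventually_at
    proof (intro exI[of _ 1] conjI ballI impI allI)
      fix h y :: 'a assume "h \<noteq> 0 \<and> dist h 0 < 1"
      then have h: "0 < norm h" by simp
      have "\<bar>h \<bullet> K (x - y)\<bar> \<le> norm h * M"
        using Cauchy_Schwarz_ineq2[of h "K (x - y)"] b(2)[of "x - y"] mult_left_mono[OF b(2)[of "x-y"] norm_ge_zero[of h]]
        by linarith
      moreover have "\<bar>k (x + h - y) - k (x - y)\<bar> \<le> M * norm h"
        using lip[of "x - y" h] by (simp add: algebra_simps)
      ultimately have "\<bar>(k (x + h - y) - k (x - y) - h \<bullet> K (x - y)) / norm h\<bar> \<le> 2 * M"
        using h by (simp add: pos_divide_le_eq mult.commute[of "norm h"])
      then show "norm (r h y) \<le> (2 * M) * norm (f y)"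
        unfolding r_def real_norm_def abs_mult by (metis abs_ge_zero mult.commute mult_left_mono)
    qed simp
    have "((\<lambda>h. (k (x + h - y) - k (x - y) - h \<bullet> K (x - y)) / norm h) \<longlongrightarrow> 0) (at 0)" for y
    proof -
      have "((\<lambda>h. norm (k (x - y + h) - k (x - y) - h \<bullet> K (x - y)) / norm h) \<longlongrightarrow> 0) (at 0)"
        using K(1)[of "x - y"] unfolding gderiv_def has_derivative_at by simp
      then have "((\<lambda>h. norm ((k (x + h - y) - k (x - y) - h \<bullet> K (x - y)) / norm h)) \<longlongrightarrow> 0) (at 0)"
        by (simp add: algebra_simps)
      then show ?thesis by (simp only: tendsto_norm_zero_iff)
    qed
    then show "AE y in lborel. ((\<lambda>h. r h y) \<longlongrightarrow> 0) (at 0)"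
      unfolding r_def by (intro AE_I2 tendsto_mult_right_zero)
  qed simp
  moreover have "(LBINT y. r h y) = (conv f k (x + h) - conv f k x - h \<bullet> conv f K x) / norm h" for h
  proof -
    have "h \<bullet> conv f K x = (LBINT y. f y * (h \<bullet> K (x - y)))"
      unfolding conv_def using integral_inner_right[of h lborel, OF iK] by simp
    moreover have "integrable lborel (\<lambda>y. f y * (h \<bullet> K (x - y)))"
      using integrable_inner_right[of h lborel, OF iK] by simp
    ultimately have "(LBINT y. f y * (k (x + h - y) - k (x - y) - h \<bullet> K (x - y)))
        = conv f k (x + h) - conv f k x - h \<bullet> conv f K x"
      using i by (simp add: conv_def right_diff_distrib)
    then show ?thesis unfolding r_def times_divide_eq_right by simp
  qed
  ultimately have "((\<lambda>h. (conv f k (x + h) - conv f k x - h \<bullet> conv f K x) / norm h) \<longlongrightarrow> 0) (at 0)"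
    by simp
  then have "((\<lambda>h. norm ((conv f k (x + h) - conv f k x - h \<bullet> conv f K x) / norm h)) \<longlongrightarrow> 0) (at 0)"
    by (rule tendsto_norm_zero)
  then show ?thesis
    unfolding gderiv_def has_derivative_at by (simp add: bounded_linear_inner_left)
qed

lemma GDERIV_zero_outside:
  fixes f :: "'a::real_inner \<Rightarrow> real"
  assumes "GDERIV f x :> G" "\<And>x. R < norm x \<Longrightarrow> f x = 0" "R < norm x"
  shows "G = 0"
proof (rule GDERIV_unique[OF assms(1)])
  have "open {x::'a. R < norm x}" by (intro open_Collect_less continuous_intros)
  from GDERIV_cong_open[OF GDERIV_const[of 0] this] show "GDERIV f x :> 0" using assms by auto
qed

lemma smooth_GDERIV:
  assumes "smooth_real_on UNIV f"
  obtains G where "\<And>x. GDERIV f x :> G x" "\<And>b. b \<in> Basis \<Longrightarrow> smooth_real_on UNIV (\<lambda>x. G x \<bullet> b)"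
proof -
  have "C_k_on (Suc 0) UNIV f" using assms unfolding smooth_real_on_def by blast
  then obtain G where G: "\<And>x. GDERIV f x :> G x" by auto
  have "C_k_on k UNIV (\<lambda>x. G x \<bullet> b)" if "b \<in> Basis" for b k
  proof -
    have "C_k_on (Suc k) UNIV f" using assms unfolding smooth_real_on_def by blast
    then obtain H where H: "\<And>x. GDERIV f x :> H x" "\<forall>b\<in>Basis. C_k_on k UNIV (\<lambda>x. H x \<bullet> b)"
      by auto
    have "H = G" using G H(1) GDERIV_unique by blast
    then show ?thesis using H(2) that by blast
  qed
  then show ?thesis using that G unfolding smooth_real_on_def by blast
qed

lemma smooth_continuous_on: "smooth_real_on S f \<Longrightarrow> continuous_on S f"
  unfolding smooth_real_on_def by (metis C_k_on.simps(1))

lemma conv_inner: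
  fixes K :: "'a::euclidean_space \<Rightarrow> 'a"
  assumes "integrable lborel (\<lambda>y. f y *\<^sub>R K (x - y))"
  shows "conv f K x \<bullet> b = conv f (\<lambda>x. K x \<bullet> b) x"
  using integral_inner_left[of b lborel "\<lambda>y. f y *\<^sub>R K (x - y)"] assms by (simp add: conv_def)

text \<open>Derivatives fall on the kernel alone, and the components of its gradient are again
  smooth with the same bound on the support. Hence the induction generalises over \<rho>.\<close>

lemma conv_smooth:
  fixes f \<rho> :: "'a::euclidean_space \<Rightarrow> real"
  assumes f: "integrable lborel f"
  shows "smooth_real_on UNIV \<rho> \<Longrightarrow> (\<And>x. R < norm x \<Longrightarrow> \<rho> x = 0) \<Longrightarrow> smooth_real_on UNIV (conv f \<rho>)"
  unfolding smooth_real_on_def[of _ "conv _ _"]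
proof (rule allI)
  fix k
  show "smooth_real_on UNIV \<rho> \<Longrightarrow> (\<And>x. R < norm x \<Longrightarrow> \<rho> x = 0) \<Longrightarrow> C_k_on k UNIV (conv f \<rho>)"
  proof (induction k arbitrary: \<rho>)
    case 0
    obtain M where "\<And>x. norm (\<rho> x) \<le> M"
      using bounded_of_compact_support[OF smooth_continuous_on[OF 0(1)] 0(2)] by blast
    then show ?case using conv_continuous[OF f smooth_continuous_on[OF 0(1)]] by auto
  next
    case (Suc k)
    obtain G where G: "\<And>x. GDERIV \<rho> x :> G x" "\<And>b. b \<in> Basis \<Longrightarrow> smooth_real_on UNIV (\<lambda>x. G x \<bullet> b)"
      using smooth_GDERIV[OF Suc.prems(1)] by blast
    have cG: "continuous_on UNIV G"
      using G(2) smooth_continuous_on by (subst continuous_on_componentwise) blast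
    have G0: "G x = 0" if "R < norm x" for x
      using GDERIV_zero_outside[OF G(1) Suc.prems(2) that] .
    obtain M1 where M1: "\<And>x. norm (\<rho> x) \<le> M1"
      using bounded_of_compact_support[OF smooth_continuous_on[OF Suc.prems(1)] Suc.prems(2)] by blast
    obtain M2 where M2: "\<And>x. norm (G x) \<le> M2" using bounded_of_compact_support[OF cG G0] by blast
    have "GDERIV (conv f \<rho>) x :> conv f G x" for x
    proof (rule conv_GDERIV[OF f G(1) cG])
      show "\<bar>\<rho> x\<bar> \<le> max M1 M2" for x using M1[of x] by simp
      show "norm (G x) \<le> max M1 M2" for x using M2[of x] by simp
    qed
    moreover have "C_k_on k UNIV (\<lambda>x. conv f G x \<bullet> b)" if "b \<in> Basis" for b
    proof -
      have [measurable]: "G \<in> borel_measurable borel" using cG by (rule borel_measurable_continuous_onI)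
      have "conv f G x \<bullet> b = conv f (\<lambda>x. G x \<bullet> b) x" for x
        by (rule conv_inner) (rule conv_integrable[OF f _ M2], measurable)
      then show ?thesis using Suc.IH[OF G(2)[OF that]] G0 by simp
    qed
    ultimately show ?case by auto
  qed
qed

lemma conv_c2:
  assumes f: "integrable lborel f" and k: "c2 UNIV k G A B" "\<And>x. R < norm x \<Longrightarrow> k x = 0"
  shows "c2 UNIV (conv f k) (conv f G) (conv f A) (conv f B)"
proof -
  have der: "GDERIV k x :> G x" "GDERIV (\<lambda>x. Re (G x)) x :> A x" "GDERIV (\<lambda>x. Im (G x)) x :> B x" for x
    using k(1) by (auto simp: c2_def)
  have G0: "G x = 0" if "R < norm x" for x using GDERIV_zero_outside[OF der(1) k(2) that] .
  have A0: "A x = 0" if "R < norm x" for x using GDERIV_zero_outside[OF der(2) _ that] G0 by auto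
  have B0: "B x = 0" if "R < norm x" for x using GDERIV_zero_outside[OF der(3) _ that] G0 by auto
  note c = c2_continuous_on[OF k(1)]
  obtain M1 M2 M3 M4 where M: "\<And>x. norm (k x) \<le> M1" "\<And>x. norm (G x) \<le> M2"
    "\<And>x. norm (A x) \<le> M3" "\<And>x. norm (B x) \<le> M4"
    using bounded_of_compact_support[OF c(1) k(2)] bounded_of_compact_support[OF c(2) G0]
      bounded_of_compact_support[OF c(3) A0] bounded_of_compact_support[OF c(4) B0] by metis
  define M where "M = max (max M1 M2) (max M3 M4)"
  have M': "\<bar>k x\<bar> \<le> M" "norm (G x) \<le> M" "norm (A x) \<le> M" "norm (B x) \<le> M" 
    "\<bar>Re (G x)\<bar> \<le> M" "\<bar>Im (G x)\<bar> \<le> M" for x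
    using M(1)[of x] M(2)[of x] M(3)[of x] M(4)[of x] abs_Re_le_cmod[of "G x"] abs_Im_le_cmod[of "G x"]
    by (auto simp: M_def)
  have [measurable]: "G \<in> borel_measurable borel" using c(2) by (rule borel_measurable_continuous_onI)
  have iG: "integrable lborel (\<lambda>y. f y *\<^sub>R G (x - y))" for x
    by (rule conv_integrable[OF f _ M'(2)]) measurable
  have ReG: "(\<lambda>x. Re (conv f G x)) = conv f (\<lambda>x. Re (G x))"
    "(\<lambda>x. Im (conv f G x)) = conv f (\<lambda>x. Im (G x))"
    using conv_inner[OF iG, of _ 1] conv_inner[OF iG, of _ \<i>] by (auto simp: fun_eq_iff)
  show ?thesis unfolding c2_def ReG
    using conv_continuous[OF f c(3) M'(3)] conv_continuous[OF f c(4) M'(4)]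
      conv_GDERIV[OF f der(1) c(2) M'(1,2)] conv_GDERIV[OF f der(2) c(3) M'(5,3)]
      conv_GDERIV[OF f der(3) c(4) M'(6,4)] by auto
qed

text \<open>The convolution of \<open>f\<close> with the indicator of a large ball is constant near
  0, because there the ball contains everything that \<open>f\<close> sees. Its gradient at 0
  vanishes, and this gradient is the integral of \<open>G\<close>.\<close>

lemma integral_GDERIV_zero:
  fixes f :: "'a::euclidean_space \<Rightarrow> real"
  assumes G: "\<And>x. GDERIV f x :> G x" "continuous_on UNIV G" and R: "\<And>x. R < norm x \<Longrightarrow> f x = 0"
  shows "(LBINT x. G x \<bullet> b) = 0"
proof -
  have cf: "continuous_on UNIV f"
    using G(1) GDERIV_isCont by (blast intro: continuous_at_imp_continuous_on)
  have G0: "G x = 0" if "R < norm x" for x using GDERIV_zero_outside[OF G(1) R that] .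
  obtain M1 where M1: "\<And>x. norm (f x) \<le> M1" using bounded_of_compact_support[OF cf R] by blast
  obtain M2 where M2: "\<And>x. norm (G x) \<le> M2" using bounded_of_compact_support[OF G(2) G0] by blast
  have b: "\<bar>f x\<bar> \<le> max M1 M2" "norm (G x) \<le> max M1 M2" for x using M1[of x] M2[of x] by auto
  let ?u = "indicator (cball (0::'a) (R + 1)) :: 'a \<Rightarrow> real"
  have [measurable]: "f \<in> borel_measurable borel" "G \<in> borel_measurable borel"
    using cf G(2) by (auto intro: borel_measurable_continuous_onI)
  have u: "integrable lborel ?u" using emeasure_lborel_cball_finite[of 0 "R + 1"] by (simp add: integrable_indicator_iff)
  have D: "GDERIV (conv ?u f) x :> conv ?u G x" for x by (rule conv_GDERIV[OF u G b])
  have near: "conv ?u f x = integral\<^sup>L lborel f" if "norm x < 1" for x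
  proof -
    have "f (x - y) = ?u y * f (x - y)" for y
    proof (cases "norm y \<le> R + 1")
      case False
      have "norm y \<le> norm (x - y) + norm x" by norm
      then have "R < norm (x - y)" using False that by linarith
      then show ?thesis using R by simp
    qed simp
    then have "conv ?u f x = (LBINT y. f (x - y))" unfolding conv_def by (metis real_scaleR_def)
    then show ?thesis by (simp add: lborel_reflect(1))
  qed
  have "GDERIV (conv ?u f) 0 :> 0"
    by (rule GDERIV_cong_open[OF GDERIV_const[of "integral\<^sup>L lborel f"], of "ball 0 1"]) (use near in auto)
  then have "conv ?u G 0 = 0" using D GDERIV_unique by blast
  moreover have "?u y *\<^sub>R G (0 - y) = G (0 - y)" for y using G0[of "- y"] by (auto simp: indicator_def)
  ultimately have *: "(LBINT y. G (0 - y)) = 0" by (simp add: conv_def)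
  have iG: "integrable lborel G" by (rule integrable_of_compact_support[OF G(2) G0])
  have "(LBINT x. G x \<bullet> b) = (LBINT x. G (0 - x) \<bullet> b)"
    by (rule lborel_reflect(1)[symmetric]) measurable
  also have "\<dots> = (LBINT x. G (0 - x)) \<bullet> b"
  proof (rule integral_inner_left)
    have "distr lborel borel (\<lambda>y. 0 - y) = (lborel :: 'a measure)"
      using lborel_affine[of "-1" "0::'a"] by (simp add: density_1)
    then show "integrable lborel (\<lambda>x. G (0 - x))"
      using iG integrable_distr_eq[of "\<lambda>y. 0 - y" lborel "borel :: 'a measure" G] by simp
  qed
  finally show ?thesis using * by simp
qed

text \<open>The divergence of H grad q - q grad H is integrated component by component; the products
  of first derivatives cancel. Compact support of \<open>H\<close> confines every term, as each
  carries \<open>H\<close> or a derivative of it.\<close>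

lemma Green_identity:
  assumes H: "c2 UNIV H G A B" "\<And>x. R < norm x \<Longrightarrow> H x = 0" and q: "c2 UNIV q G' A' B'"
  shows "(LBINT x. H x * (Re (A' x) + Im (B' x))) = (LBINT x. q x * (Re (A x) + Im (B x)))"
proof -
  have der: "GDERIV H x :> G x" "GDERIV (\<lambda>x. Re (G x)) x :> A x" "GDERIV (\<lambda>x. Im (G x)) x :> B x"
    "GDERIV q x :> G' x" "GDERIV (\<lambda>x. Re (G' x)) x :> A' x" "GDERIV (\<lambda>x. Im (G' x)) x :> B' x" for x
    using H(1) q by (auto simp: c2_def)
  have G0: "G x = 0" if "R < norm x" for x using GDERIV_zero_outside[OF der(1) H(2) that] .
  have A0: "A x = 0" if "R < norm x" for x using GDERIV_zero_outside[OF der(2) _ that] G0 by auto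
  have B0: "B x = 0" if "R < norm x" for x using GDERIV_zero_outside[OF der(3) _ that] G0 by auto
  note c = c2_continuous_on[OF H(1)] c2_continuous_on[OF q]
  let ?X = "\<lambda>x. (H x *\<^sub>R A' x + Re (G' x) *\<^sub>R G x) - (q x *\<^sub>R A x + Re (G x) *\<^sub>R G' x)"
  let ?Y = "\<lambda>x. (H x *\<^sub>R B' x + Im (G' x) *\<^sub>R G x) - (q x *\<^sub>R B x + Im (G x) *\<^sub>R G' x)"
  have X: "(LBINT x. ?X x \<bullet> 1) = 0"
  proof (rule integral_GDERIV_zero)
    show "GDERIV (\<lambda>x. H x * Re (G' x) - q x * Re (G x)) x :> ?X x" for x
      by (intro GDERIV_diff GDERIV_mult der)
    show "continuous_on UNIV ?X" by (intro continuous_intros c)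
    show "R < norm x \<Longrightarrow> H x * Re (G' x) - q x * Re (G x) = 0" for x by (simp add: G0 H(2))
  qed
  have Y: "(LBINT x. ?Y x \<bullet> \<i>) = 0"
  proof (rule integral_GDERIV_zero)
    show "GDERIV (\<lambda>x. H x * Im (G' x) - q x * Im (G x)) x :> ?Y x" for x
      by (intro GDERIV_diff GDERIV_mult der)
    show "continuous_on UNIV ?Y" by (intro continuous_intros c)
    show "R < norm x \<Longrightarrow> H x * Im (G' x) - q x * Im (G x) = 0" for x by (simp add: G0 H(2))
  qed
  have i: "integrable lborel (\<lambda>x. ?X x \<bullet> 1)" "integrable lborel (\<lambda>x. ?Y x \<bullet> \<i>)"
    "integrable lborel (\<lambda>x. H x * (Re (A' x) + Im (B' x)))" "integrable lborel (\<lambda>x. q x * (Re (A x) + Im (B x)))"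
    by (rule integrable_of_compact_support[of _ R];
        (intro continuous_intros c | simp add: G0 A0 B0 H(2)))+
  have "0 = (LBINT x. ?X x \<bullet> 1 + ?Y x \<bullet> \<i>)" using X Y i by simp
  also have "\<dots> = (LBINT x. H x * (Re (A' x) + Im (B' x)) - q x * (Re (A x) + Im (B x)))"
    by (intro Bochner_Integration.integral_cong) (auto simp: algebra_simps)
  finally show ?thesis using i(3,4) by simp
qed

text \<open>Evenness is recorded because it makes mollification self-adjoint, as used in
  \<open>conv_Fubini\<close>. The integral of the bump is nonzero since a nonempty open set is not
  negligible.\<close>

lemma mollifier_exists:
  assumes "0 < (d::real)"
  obtains \<rho> :: "'a::euclidean_space \<Rightarrow> real" where
    "smooth_real_on UNIV \<rho>" "\<And>x. 0 \<le> \<rho> x" "\<And>x. d \<le> norm x \<Longrightarrow> \<rho> x = 0" "integrable lborel \<rho>"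
    "integral\<^sup>L lborel \<rho> = 1" "\<And>x. \<rho> (- x) = \<rho> x"
proof -
  obtain \<rho> :: "'a \<Rightarrow> real" where \<rho>: "smooth_real_on UNIV \<rho>" "\<And>x. 0 \<le> \<rho> x" "\<And>x. d \<le> norm x \<Longrightarrow> \<rho> x = 0" "0 < \<rho> 0"
      "\<And>x. \<rho> (- x) = \<rho> x"
    using smooth_bump_exists[OF assms] by metis
  have c: "continuous_on UNIV \<rho>" by (rule smooth_continuous_on[OF \<rho>(1)])
  have i: "integrable lborel \<rho>" by (rule integrable_of_compact_support[OF c, of d]) (use \<rho>(3) in auto)
  have "integral\<^sup>L lborel \<rho> \<noteq> 0"
  proof
    assume "integral\<^sup>L lborel \<rho> = 0"
    then have "AE x in lborel. \<rho> x = 0" using integral_nonneg_eq_0_iff_AE[OF i] \<rho>(2) by auto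
    moreover have o: "open {x. \<rho> x \<noteq> 0}" using c by (intro open_Collect_neq) auto
    ultimately have "emeasure lborel {x. \<rho> x \<noteq> 0} = 0"
      by (subst (asm) AE_iff_measurable[of "{x. \<rho> x \<noteq> 0}"]) auto
    then have "negligible {x. \<rho> x \<noteq> 0}"
      using o by (simp add: negligible_iff_null_sets null_sets_def)
    then have "{x. \<rho> x \<noteq> 0} = {}" using open_not_negligible[OF o] by blast
    then show False using \<rho>(4) by auto
  qed
  then have I: "0 < integral\<^sup>L lborel \<rho>" using integral_nonneg_AE[of \<rho> lborel] \<rho>(2) by (simp add: less_le)
  let ?s = "\<lambda>x. \<rho> x * (1 / integral\<^sup>L lborel \<rho>)"
  show ?thesis
  proof (rule that[of ?s])
    show "smooth_real_on UNIV ?s" using \<rho>(1) unfolding smooth_real_on_def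
      by (intro allI C_k_on_mult C_k_on_const) auto
  qed (use \<rho> i I in auto)
qed

lemma conv_mollifier_bounds:
  fixes \<rho> \<psi> :: "'a::euclidean_space \<Rightarrow> real"
  assumes \<rho>: "\<And>x. 0 \<le> \<rho> x" "\<And>x. d \<le> norm x \<Longrightarrow> \<rho> x = 0" "integrable lborel \<rho>" "integral\<^sup>L lborel \<rho> = 1"
    and i: "integrable lborel (\<lambda>y. \<rho> y * \<psi> (x - y))"
    and b: "\<And>y. norm (x - y) < d \<Longrightarrow> \<psi> y \<in> {a..b}"
  shows "conv \<rho> \<psi> x \<in> {a..b}"
proof -
  have p: "\<rho> y * a \<le> \<rho> y * \<psi> (x - y) \<and> \<rho> y * \<psi> (x - y) \<le> \<rho> y * b" for y
  proof (cases "d \<le> norm y")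
    case False
    then have "\<psi> (x - y) \<in> {a..b}" using b[of "x - y"] by simp
    then show ?thesis using \<rho>(1)[of y] by (auto intro: mult_left_mono)
  qed (use \<rho>(2) in auto)
  have "(LBINT y. \<rho> y * a) \<le> conv \<rho> \<psi> x" unfolding conv_def
    using \<rho>(3) i p unfolding real_scaleR_def by (intro integral_mono) simp_all
  moreover have "conv \<rho> \<psi> x \<le> (LBINT y. \<rho> y * b)" unfolding conv_def
    using \<rho>(3) i p unfolding real_scaleR_def by (intro integral_mono) simp_all
  ultimately show ?thesis using \<rho>(4) by simp
qed

section \<open>The weak maximum principle\<close>

text \<open>This is the inequality \<Delta>f \<ge> h in the sense of distributions; ordinary
  subharmonicity is the case h = 0.\<close>

definition weakly_subharmonic :: "complex set \<Rightarrow> (complex \<Rightarrow> real) \<Rightarrow> (complex \<Rightarrow> real) \<Rightarrow> bool" where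
  "weakly_subharmonic \<Omega> f h \<longleftrightarrow> (\<forall>\<psi>. test_function \<Omega> \<psi> \<and> (\<forall>z. 0 \<le> \<psi> z) \<longrightarrow>
     (LBINT z. indicator \<Omega> z * (h z * \<psi> z)) \<le> (LBINT z. indicator \<Omega> z * (f z * laplacian \<psi> z)))"

lemma c2_zero_outside:
  assumes c: "c2 UNIV k G A B" and k: "\<And>x. R < norm x \<Longrightarrow> k x = 0" and x: "R < norm x"
  shows "G x = 0" "A x = 0" "B x = 0"
proof -
  have der: "GDERIV k x :> G x" "GDERIV (\<lambda>x. Re (G x)) x :> A x" "GDERIV (\<lambda>x. Im (G x)) x :> B x" for x
    using c by (auto simp: c2_def)
  have G0: "G x = 0" if "R < norm x" for x using GDERIV_zero_outside[OF der(1) k that] .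
  show "G x = 0" "A x = 0" "B x = 0" 
    using GDERIV_zero_outside[OF der(2) _ x] GDERIV_zero_outside[OF der(3) _ x] G0 x by auto
qed

lemma test_functionI:
  assumes "smooth_real_on UNIV \<psi>" "compact K" "K \<subseteq> D" "\<And>z. z \<notin> K \<Longrightarrow> \<psi> z = 0"
  shows "test_function D \<psi>"
proof -
  have "closure {z. \<psi> z \<noteq> 0} \<subseteq> K"
    using assms by (intro closure_minimal) (auto simp: compact_imp_closed)
  moreover from this have "compact (closure {z. \<psi> z \<noteq> 0})"
    using compact_Int_closed[OF assms(2) closed_closure] by (metis inf.absorb_iff2)
  ultimately show ?thesis using assms unfolding test_function_def by blast
qed

lemma smooth_c2: 
  assumes "smooth_real_on UNIV f" obtains G A B where "c2 UNIV f G A B"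
  using assms C_2_on_iff[of UNIV f] unfolding smooth_real_on_def by auto

text \<open>Testing with the reflected kernel turns the distributional inequality into a pointwise
  one for mollifications. The kernel lives in \<open>cball x d\<close>, so the integrals do not
  change when both functions are cut to \<open>K\<close>.\<close>

lemma conv_subharmonic:
  assumes weak: "weakly_subharmonic \<Omega> f h" and K: "K \<subseteq> \<Omega>"
    and \<rho>: "smooth_real_on UNIV \<rho>" "\<And>x. 0 \<le> \<rho> x" "\<And>x. d \<le> norm x \<Longrightarrow> \<rho> x = 0"
    and c: "c2 UNIV \<rho> G A B" and x: "cball x d \<subseteq> K"
  shows "conv (\<lambda>z. indicator K z * h z) \<rho> x \<le> conv (\<lambda>z. indicator K z * f z) (\<lambda>z. Re (A z) + Im (B z)) x"
proof -
  let ?\<psi> = "\<lambda>y. \<rho> (x - y)"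
  have in_ball: "y \<in> K \<and> y \<in> \<Omega>" if "norm (x - y) \<le> d" for y
    using that x K by (auto simp: dist_norm)
  have "test_function \<Omega> ?\<psi>"
    by (rule test_functionI[of _ "cball x d"]) (use \<rho> x K in \<open>auto intro: smooth_reflect simp: dist_norm\<close>)
  then have "(LBINT z. indicator \<Omega> z * (h z * ?\<psi> z)) \<le> (LBINT z. indicator \<Omega> z * (f z * laplacian ?\<psi> z))"
    using weak \<rho>(2) unfolding weakly_subharmonic_def by blast
  moreover have "laplacian ?\<psi> z = Re (A (x - z)) + Im (B (x - z))" for z
    using c2_laplacian[OF c2_reflect[OF c]] by simp
  moreover have "indicator \<Omega> z * (h z * ?\<psi> z) = (indicator K z * h z) * \<rho> (x - z)" for z
    using in_ball[of z] \<rho>(3)[of "x - z"] by (cases "norm (x - z) \<le> d") auto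
  moreover have "indicator \<Omega> z * (f z * (Re (A (x - z)) + Im (B (x - z))))
      = (indicator K z * f z) * (Re (A (x - z)) + Im (B (x - z)))" for z
    using in_ball[of z] c2_zero_outside[OF c, of d "x - z"] \<rho>(3) by (cases "norm (x - z) \<le> d") auto
  ultimately show ?thesis by (simp add: conv_def)
qed

text \<open>The interval form serves several ends: with a < b it gives uniform bounds and limits at
  points of continuity, with a = b it shows that a mollification vanishes or equals 1.\<close>

lemma conv_mollifier_bounds':
  fixes \<rho> \<psi> :: "'a::euclidean_space \<Rightarrow> real"
  assumes \<rho>: "continuous_on UNIV \<rho>" "\<And>x. 0 \<le> \<rho> x" "\<And>x. d \<le> norm x \<Longrightarrow> \<rho> x = 0" "integral\<^sup>L lborel \<rho> = 1"
    and i: "integrable lborel \<psi>"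
    and b: "\<And>y. norm (x - y) < d \<Longrightarrow> \<psi> y \<in> {a..b}"
  shows "conv \<psi> \<rho> x \<in> {a..b}" "conv \<rho> \<psi> x \<in> {a..b}"
proof -
  have z: "\<rho> x = 0" if "d < norm x" for x using that \<rho>(3) by simp
  obtain M where M: "\<And>x. norm (\<rho> x) \<le> M" using bounded_of_compact_support[OF \<rho>(1) z] by blast
  have [measurable]: "\<rho> \<in> borel_measurable borel" "\<psi> \<in> borel_measurable borel"
    using \<rho>(1) i by (auto intro: borel_measurable_continuous_onI)
  have "integrable lborel (\<lambda>y. \<psi> y *\<^sub>R \<rho> (x - y))" by (rule conv_integrable[OF i _ M]) measurable
  then have j: "integrable lborel (\<lambda>y. (\<lambda>z. \<psi> (x - z) * \<rho> z) (x - y))" by simp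
  have "(\<lambda>z. \<psi> (x - z) * \<rho> z) \<in> borel_measurable borel" by measurable
  from lborel_reflect(2)[OF this, of x] j have "integrable lborel (\<lambda>z. \<rho> z * \<psi> (x - z))"
    by (simp add: mult.commute)
  from conv_mollifier_bounds[OF \<rho>(2,3) integrable_of_compact_support[OF \<rho>(1) z] \<rho>(4) this b]
  show "conv \<rho> \<psi> x \<in> {a..b}" by blast
  then show "conv \<psi> \<rho> x \<in> {a..b}" by (subst conv_commute) auto
qed

text \<open>The bound is one-sided because the mollified function may be unbounded below, as a Green
  function is at its pole.\<close>

lemma conv_mollifier_le:
  fixes \<rho> \<psi> :: "'a::euclidean_space \<Rightarrow> real"
  assumes \<rho>: "continuous_on UNIV \<rho>" "\<And>x. 0 \<le> \<rho> x" "\<And>x. d \<le> norm x \<Longrightarrow> \<rho> x = 0" "integral\<^sup>L lborel \<rho> = 1"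
    and i: "integrable lborel \<psi>"
    and b: "\<And>y. norm (x - y) < d \<Longrightarrow> \<psi> y \<le> b"
  shows "conv \<psi> \<rho> x \<le> b"
proof -
  have [measurable]: "\<rho> \<in> borel_measurable borel" "\<psi> \<in> borel_measurable borel"
    using \<rho>(1) i by (auto intro: borel_measurable_continuous_onI)
  have z: "\<rho> x = 0" if "d < norm x" for x using that \<rho>(3) by simp
  obtain M where M: "\<And>x. norm (\<rho> x) \<le> M" using bounded_of_compact_support[OF \<rho>(1) z] by blast
  have "integrable lborel (\<lambda>y. \<psi> y *\<^sub>R \<rho> (x - y))" by (rule conv_integrable[OF i _ M]) measurable
  moreover have r: "integrable lborel \<rho>" by (rule integrable_of_compact_support[OF \<rho>(1) z])
  moreover have "integrable lborel (\<lambda>y. \<rho> (x - y))" using lborel_reflect(2)[of \<rho> x] r by auto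
  ultimately have "conv \<psi> \<rho> x \<le> (LBINT y. b * \<rho> (x - y))"
    unfolding conv_def
  proof (intro integral_mono)
    fix y
    show "\<psi> y *\<^sub>R \<rho> (x - y) \<le> b * \<rho> (x - y)"
      using b[of y] \<rho>(2)[of "x - y"] \<rho>(3)[of "x - y"] by (cases "norm (x - y) < d") (auto intro: mult_right_mono)
  qed auto
  also have "\<dots> = b" using lborel_reflect(1)[of \<rho> x] \<rho>(4) by simp
  finally show ?thesis .
qed

text \<open>This moves the mollifier from \<open>h\<close>, of which only integrability is known, to
  the continuous weight \<open>m\<close>.\<close>

lemma conv_Fubini:
  fixes h m \<rho> :: "complex \<Rightarrow> real"
  assumes h: "integrable lborel h" and m: "continuous_on UNIV m" "\<And>x. R < norm x \<Longrightarrow> m x = 0"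
    and \<rho>: "continuous_on UNIV \<rho>" "\<And>x. d < norm x \<Longrightarrow> \<rho> x = 0" "\<And>x. \<rho> (- x) = \<rho> x"
  shows "(LBINT x. m x * conv h \<rho> x) = (LBINT y. h y * conv m \<rho> y)"
proof -
  have [measurable]: "\<rho> \<in> borel_measurable borel" "h \<in> borel_measurable borel" "m \<in> borel_measurable borel"
    using \<rho>(1) m(1) h by (auto intro: borel_measurable_continuous_onI)
  obtain M where M: "\<And>x. norm (\<rho> x) \<le> M" using bounded_of_compact_support[OF \<rho>(1,2)] by blast
  have M0: "0 \<le> M" using M[of 0] norm_ge_zero[of "\<rho> 0"] by linarith
  have im: "integrable lborel m" by (rule integrable_of_compact_support[OF m])
  let ?F = "\<lambda>(x, y). m x * (h y * \<rho> (x - y))"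
  have "integrable (lborel \<Otimes>\<^sub>M lborel) (\<lambda>(x, y). m x * h y)"
  proof (rule lborel_pair.Fubini_integrable)
    show "integrable lborel (\<lambda>x. LBINT y. norm (case (x, y) of (x, y) \<Rightarrow> m x * h y))"
      using im h by (simp add: abs_mult)
    show "AE x in lborel. integrable lborel (\<lambda>y. case (x, y) of (x, y) \<Rightarrow> m x * h y)" using h by simp
  qed measurable
  then have "integrable (lborel \<Otimes>\<^sub>M lborel) (\<lambda>p. M * (case p of (x, y) \<Rightarrow> m x * h y))" by simp
  then have F: "integrable (lborel \<Otimes>\<^sub>M lborel) ?F"
  proof (rule Bochner_Integration.integrable_bound)
    show "?F \<in> borel_measurable (lborel \<Otimes>\<^sub>M lborel)" by measurable
    show "AE p in lborel \<Otimes>\<^sub>M lborel. norm (?F p) \<le> norm (M * (case p of (x, y) \<Rightarrow> m x * h y))"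
    proof (intro AE_I2, clarify)
      fix x y
      have "\<bar>m x * h y\<bar> * \<bar>\<rho> (x - y)\<bar> \<le> \<bar>m x * h y\<bar> * M" using M[of "x - y"] by (intro mult_left_mono) auto
      then show "norm (m x * (h y * \<rho> (x - y))) \<le> norm (M * (m x * h y))"
        using M0 by (simp add: abs_mult algebra_simps)
    qed
  qed
  have "(LBINT x. m x * conv h \<rho> x) = (LBINT x. LBINT y. m x * (h y * \<rho> (x - y)))"
    by (simp add: conv_def)
  also have "\<dots> = (LBINT y. LBINT x. m x * (h y * \<rho> (x - y)))"
    using lborel_pair.Fubini_integral[of "\<lambda>x y. m x * (h y * \<rho> (x - y))"] F by simp
  also have "\<dots> = (LBINT y. h y * conv m \<rho> y)"
  proof (intro Bochner_Integration.integral_cong refl)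
    fix y
    have "(\<lambda>x. m x * (h y * \<rho> (x - y))) = (\<lambda>x. h y * (m x * \<rho> (y - x)))"
      using \<rho>(3)[of "x - y" for x] by (simp add: fun_eq_iff)
    then show "(LBINT x. m x * (h y * \<rho> (x - y))) = h y * conv m \<rho> y" by (simp add: conv_def)
  qed
  finally show ?thesis .
qed

lemma c2_radial: "c2 UNIV (\<lambda>z. R - (norm z)\<^sup>2) (\<lambda>z. -2 * z) (\<lambda>_. -2) (\<lambda>_. -2 * \<i>)"
proof -
  have "GDERIV (\<lambda>z. R - (norm z)\<^sup>2) z :> 0 - 2 *\<^sub>R z" for z :: complex
    by (intro GDERIV_diff GDERIV_const GDERIV_norm_sq)
  moreover have "GDERIV (\<lambda>z. Re (-2 * z)) z :> -2" "GDERIV (\<lambda>z. Im (-2 * z)) z :> -2 * \<i>" for z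
    unfolding gderiv_def by (auto intro!: derivative_eq_intros simp: inner_complex_def)
  ultimately show ?thesis by (auto simp: c2_def scaleR_conv_of_real)
qed

text \<open>The margin 2d has room for one d between a point and \<open>K\<close> and another d for
  the radius of a kernel around that point.\<close>

lemma compact_thickening:
  fixes K :: "complex set"
  assumes "compact K" "open \<Omega>" "K \<subseteq> \<Omega>"
  obtains d K2 where "0 < d" "compact K2" "K2 \<subseteq> \<Omega>" "K \<subseteq> K2" "\<And>x. x \<in> K \<Longrightarrow> cball x (2 * d) \<subseteq> K2"
proof -
  obtain e where e: "0 < e" "(\<Union>x\<in>K. ball x e) \<subseteq> \<Omega>"
    using compact_subset_open_imp_ball_epsilon_subset[OF assms] by metis
  let ?K2 = "{x + y | x y. x \<in> K \<and> y \<in> cball 0 (e/2)}"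
  show ?thesis
  proof
    show "0 < e / 4" using e by simp
    show "compact ?K2" by (rule compact_sums) (use assms in auto)
    show "?K2 \<subseteq> \<Omega>" 
    proof clarify
      fix x y :: complex assume "x \<in> K" "y \<in> cball 0 (e/2)"
      then have "x + y \<in> ball x e" using e by (auto simp: dist_norm)
      then show "x + y \<in> \<Omega>" using e \<open>x \<in> K\<close> by blast
    qed
    show "K \<subseteq> ?K2" using e by (force intro: exI[of _ 0])
    show "cball x (2 * (e / 4)) \<subseteq> ?K2" if "x \<in> K" for x
    proof
      fix z assume "z \<in> cball x (2 * (e / 4))"
      then show "z \<in> ?K2" using that by (intro CollectI exI[of _ x] exI[of _ "z - x"]) (auto simp: dist_norm norm_minus_commute)
    qed
  qed
qed

lemma continuous_cutoff4_scaled: "continuous_on UNIV (\<lambda>t. cutoff4 n (t / e))"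
  by (rule continuous_on_compose2[OF continuous_cutoff4[of UNIV n]])
    (auto simp: divide_inverse intro!: continuous_intros)

text \<open>Away from \<open>w\<close> the closure of the superlevel set cannot reach the frontier,
  where f \<le> 0 < e. The point \<open>w\<close> is put in by hand, since \<open>f\<close> is not
  controlled there.\<close>

lemma superlevel_compact:
  fixes f :: "complex \<Rightarrow> real"
  assumes "open \<Omega>" "bounded \<Omega>" and f: "continuous_on (closure \<Omega> - {w}) f"
    and w: "w \<notin> frontier \<Omega>" and f0: "\<And>z. z \<in> frontier \<Omega> \<Longrightarrow> f z \<le> 0" and e: "0 < e"
  obtains K where "compact K" "K \<subseteq> \<Omega>" "\<And>z. z \<in> \<Omega> - {w} \<Longrightarrow> e \<le> f z \<Longrightarrow> z \<in> K" "w \<in> \<Omega> \<Longrightarrow> w \<in> K"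
    "\<And>z. z \<in> K - {w} \<Longrightarrow> e \<le> f z"
proof
  let ?L = "{z \<in> \<Omega> - {w}. e \<le> f z}"
  let ?K = "closure ?L \<union> ({w} \<inter> \<Omega>)"
  have sub: "closure ?L \<subseteq> closure \<Omega>" by (intro closure_mono) auto
  have fr: "closure \<Omega> = \<Omega> \<union> frontier \<Omega>" by (rule closure_Un_frontier)
  have ge: "e \<le> f z" if "z \<in> closure ?L" "z \<noteq> w" for z
  proof -
    have "\<exists>x. (\<forall>n. x n \<in> ?L) \<and> x \<longlonglongrightarrow> z" using that(1) by (simp only: closure_sequential)
    then obtain x where x: "\<And>n. x n \<in> ?L" "x \<longlonglongrightarrow> z" by blast
    have "(\<lambda>n. f (x n)) \<longlonglongrightarrow> f z"
    proof (rule continuous_on_tendsto_compose[OF f x(2)])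
      show "z \<in> closure \<Omega> - {w}" using that sub by auto
      show "\<forall>\<^sub>F n in sequentially. x n \<in> closure \<Omega> - {w}"
        using x(1) closure_subset[of \<Omega>] by (intro always_eventually) auto
    qed
    then show ?thesis using x(1) by (intro Lim_bounded2[of _ _ 0]) auto
  qed
  show "compact ?K"
    using assms(2) bounded_subset[of \<Omega> ?L] by (intro compact_Un) (auto simp: compact_eq_bounded_closed finite_imp_bounded finite_imp_closed)
  show "?K \<subseteq> \<Omega>"
  proof (intro Un_least subsetI)
    fix z assume z: "z \<in> closure ?L"
    show "z \<in> \<Omega>"
    proof (cases "z = w")
      case False
      then show ?thesis using ge[OF z False] f0[of z] e z sub fr by auto
    qed (use z sub fr w in auto)
  qed auto
  show "z \<in> ?K" if "z \<in> \<Omega> - {w}" "e \<le> f z" for z using that closure_subset[of ?L] by auto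
  show "e \<le> f z" if "z \<in> ?K - {w}" for z using ge[of z] that by (simp only: Diff_iff Un_iff Int_iff singleton_iff) blast
  show "w \<in> \<Omega> \<Longrightarrow> w \<in> ?K" by simp
qed

lemma mollifier_sequence:
  fixes d :: real assumes "0 < d"
  obtains s :: "nat \<Rightarrow> real" and \<rho> :: "nat \<Rightarrow> 'a::euclidean_space \<Rightarrow> real" where
    "\<And>n. 0 < s n" "\<And>n. s n \<le> d" "s \<longlonglongrightarrow> 0"
    "\<And>n. smooth_real_on UNIV (\<rho> n)" "\<And>n x. 0 \<le> \<rho> n x" "\<And>n x. s n \<le> norm x \<Longrightarrow> \<rho> n x = 0"
    "\<And>n. integral\<^sup>L lborel (\<rho> n) = 1" "\<And>n x. \<rho> n (- x) = \<rho> n x"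
proof -
  define s where "s = (\<lambda>n::nat. d / (real n + 1))"
  have s: "0 < s n" "s n \<le> d" for n using assms by (auto simp: s_def field_simps)
  have s0: "s \<longlonglongrightarrow> 0" unfolding s_def
    using tendsto_mult[OF tendsto_const[of d] LIMSEQ_inverse_real_of_nat] by (simp add: field_simps)
  have "\<forall>n. \<exists>\<rho>::'a\<Rightarrow>real. smooth_real_on UNIV \<rho> \<and> (\<forall>x. 0 \<le> \<rho> x) \<and> (\<forall>x. s n \<le> norm x \<longrightarrow> \<rho> x = 0)
     \<and> integral\<^sup>L lborel \<rho> = 1 \<and> (\<forall>x. \<rho> (- x) = \<rho> x)"
    using mollifier_exists[OF s(1)] by metis
  then obtain \<rho> :: "nat \<Rightarrow> 'a \<Rightarrow> real" where "\<And>n. smooth_real_on UNIV (\<rho> n)" "\<And>n x. 0 \<le> \<rho> n x"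
    "\<And>n x. s n \<le> norm x \<Longrightarrow> \<rho> n x = 0" "\<And>n. integral\<^sup>L lborel (\<rho> n) = 1" "\<And>n x. \<rho> n (- x) = \<rho> n x"
    by metis
  then show ?thesis using that s s0 by blast
qed

text \<open>As \<open>f\<close> is merely continuous off \<open>w\<close>, there is no second
  derivative to inspect at a maximum, and the inequality is used in integrated form. It is tested
  across \<open>w\<close>, where local integrability takes the place of continuity.\<close>

theorem weak_maximum_principle:
  fixes f h :: "complex \<Rightarrow> real"
  assumes \<Omega>: "open \<Omega>" "bounded \<Omega>" and f: "continuous_on (closure \<Omega> - {w}) f"
    and w: "w \<notin> frontier \<Omega>" and f0: "\<And>z. z \<in> frontier \<Omega> \<Longrightarrow> f z \<le> 0"
    and fi: "\<And>K. compact K \<Longrightarrow> K \<subseteq> \<Omega> \<Longrightarrow> integrable lborel (\<lambda>z. indicator K z * f z)"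
    and hi: "\<And>K. compact K \<Longrightarrow> K \<subseteq> \<Omega> \<Longrightarrow> integrable lborel (\<lambda>z. indicator K z * h z)"
    and hf: "\<And>z. z \<in> \<Omega> - {w} \<Longrightarrow> 0 < f z \<Longrightarrow> 0 \<le> h z"
    and weak: "weakly_subharmonic \<Omega> f h"
    and z0: "z0 \<in> \<Omega> - {w}"
  shows "f z0 \<le> 0"
proof (rule ccontr)
  assume "\<not> f z0 \<le> 0"
  \<comment> \<open>The factor 8 exceeds the last knot 4 of the cutoff: near \<open>z0\<close> the
    mollifications stay above 7e, where \<Phi> is positive, while \<Phi> vanishes up to e.\<close>
  define e where "e = f z0 / 8"
  have e: "0 < e" "f z0 = 8 * e" using \<open>\<not> f z0 \<le> 0\<close> by (auto simp: e_def)
  obtain K where K: "compact K" "K \<subseteq> \<Omega>" "\<And>z. z \<in> \<Omega> - {w} \<Longrightarrow> e \<le> f z \<Longrightarrow> z \<in> K"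
    "w \<in> \<Omega> \<Longrightarrow> w \<in> K" "\<And>z. z \<in> K - {w} \<Longrightarrow> e \<le> f z"
    using superlevel_compact[OF \<Omega> f w f0 e(1)] by metis
  obtain d K2 where d: "0 < d" and K2: "compact K2" "K2 \<subseteq> \<Omega>" "K \<subseteq> K2" "\<And>x. x \<in> K \<Longrightarrow> cball x (2 * d) \<subseteq> K2"
    using compact_thickening[OF K(1) \<Omega>(1) K(2)] by metis
  \<comment> \<open>Cutting to \<open>K2\<close> and not to \<open>K\<close> lets every
    mollification near \<open>K\<close> see \<open>f\<close> and \<open>h\<close> unchanged.\<close>
  define F where "F = (\<lambda>z. indicator K2 z * f z)"
  define H where "H = (\<lambda>z. indicator K2 z * h z)"
  have iF: "integrable lborel F" and iH: "integrable lborel H"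
    using fi[OF K2(1,2)] hi[OF K2(1,2)] by (auto simp: F_def H_def)
  have F_le: "F z \<le> e" if "z \<notin> K" for z
    using that K(3)[of z] K(4) K2(2) e by (force simp: F_def indicator_def)
  have F_cont: "isCont F z" if "z \<in> K" "z \<noteq> w" for z
  proof -
    have sub: "ball z d - {w} \<subseteq> \<Omega> - {w}" using K2(4)[OF that(1)] K2(2) d by (auto simp: subset_iff)
    have "continuous_on (ball z d - {w}) f"
      by (rule continuous_on_subset[OF f]) (use sub closure_subset[of \<Omega>] in auto)
    moreover have "F y = f y" if "y \<in> ball z d - {w}" for y
      using that K2(4)[OF \<open>z \<in> K\<close>] d by (auto simp: F_def indicator_def subset_iff)
    ultimately have "continuous_on (ball z d - {w}) F" by (simp cong: continuous_on_cong_simp)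
    then show ?thesis using that d by (simp add: continuous_on_eq_continuous_at open_delete)
  qed
  obtain R where R: "0 < R" "\<And>z. z \<in> K2 \<Longrightarrow> norm z \<le> R"
    using compact_imp_bounded[OF K2(1)] bounded_pos by metis
  text \<open>Let \<open>f\<^sub>n\<close> be the mollification of \<open>F\<close> and \<open>\<Phi>\<close> a convex function vanishing on \<open>{..e}\<close>.
    Testing \<open>\<Delta>(\<Phi> \<circ> f\<^sub>n) \<ge> \<Phi>'(f\<^sub>n) \<Delta>f\<^sub>n\<close> with \<open>q \<ge> 0\<close>, where \<open>\<Delta>q = -4\<close>, bounds \<open>\<integral>\<Phi>(f\<^sub>n)\<close>
    by a quantity whose limit is \<open>\<le> 0\<close>, although \<open>\<Phi>(f\<^sub>n)\<close> stays large near \<open>z0\<close>.\<close>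
  define q where "q = (\<lambda>z::complex. R\<^sup>2 - (norm z)\<^sup>2)"
  have q: "0 \<le> q z" if "z \<in> K2" for z using R(2)[OF that] by (simp add: q_def power_mono)
  have q_le: "q z \<le> R\<^sup>2" for z by (simp add: q_def)
  have qcont: "continuous_on UNIV q" unfolding q_def by (intro continuous_intros)
  obtain s :: "nat \<Rightarrow> real" and \<rho> :: "nat \<Rightarrow> complex \<Rightarrow> real" where
    s: "\<And>n. 0 < s n" "\<And>n. s n \<le> d" and s0: "s \<longlonglongrightarrow> 0"
    and \<rho>: "\<And>n. smooth_real_on UNIV (\<rho> n)" "\<And>n x. 0 \<le> \<rho> n x" "\<And>n x. s n \<le> norm x \<Longrightarrow> \<rho> n x = 0"
      "\<And>n. integral\<^sup>L lborel (\<rho> n) = 1" "\<And>n x. \<rho> n (- x) = \<rho> n x"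
    by (rule mollifier_sequence[OF d]) blast
  note \<rho>c = smooth_continuous_on[OF \<rho>(1)]
  define fn where "fn = (\<lambda>n. conv F (\<rho> n))"
  have cb: "conv \<psi> (\<rho> n) x \<in> {a..b}" if "integrable lborel \<psi>" "\<And>y. norm (x - y) < s n \<Longrightarrow> \<psi> y \<in> {a..b}" for \<psi> x a b n
    using conv_mollifier_bounds'(1)[of "\<rho> n" "s n" \<psi> x a b] \<rho>c \<rho>(2-4) that by blast
  have fn_le: "fn n x \<le> b" if "\<And>y. norm (x - y) < s n \<Longrightarrow> F y \<le> b" for n x b
    unfolding fn_def by (rule conv_mollifier_le[OF \<rho>c \<rho>(2) \<rho>(3) \<rho>(4) iF that])
  have fn_small: "fn n x \<le> e" if "\<And>y. y \<in> K \<Longrightarrow> s n < norm (x - y)" for n x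
  proof (rule fn_le)
    fix y assume "norm (x - y) < s n"
    then have "y \<notin> K" using that[of y] by auto
    then show "F y \<le> e" by (rule F_le)
  qed
  have fn_cont: "continuous_on UNIV (fn n)" for n
  proof -
    have z: "\<rho> n x = 0" if "s n < norm x" for x using that \<rho>(3) by simp
    obtain M where "\<And>x. norm (\<rho> n x) \<le> M" using bounded_of_compact_support[OF \<rho>c z] by blast
    then show ?thesis unfolding fn_def using conv_continuous[OF iF \<rho>c] by blast
  qed
  \<comment> \<open>\<eta> is the derivative of \<Phi> and nondecreasing, so \<Phi> is convex. Both
    vanish where \<open>fn\<close> is at most e, in particular wherever the kernel misses
    \<open>K\<close>.\<close>
  define \<eta> where "\<eta> = (\<lambda>t. cutoff4 3 (t / e))"
  define \<Phi> where "\<Phi> = (\<lambda>t. e * cutoff4 4 (t / e))"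
  have \<eta>: "0 \<le> \<eta> t" "\<eta> t \<le> 1" for t unfolding \<eta>_def by (rule cutoff4_3_range)+
  have \<eta>0: "\<eta> t = 0" if "t \<le> e" for t unfolding \<eta>_def using that e by (intro cutoff4_eq_0) auto
  have \<eta>_cont: "continuous_on UNIV \<eta>" unfolding \<eta>_def
    by (rule continuous_cutoff4_scaled)
  define m where "m = (\<lambda>n x. q x * \<eta> (fn n x))"
  have m_cont: "continuous_on UNIV (m n)" for n
    unfolding m_def using continuous_on_compose2[OF \<eta>_cont fn_cont] qcont by (auto intro!: continuous_intros)
  have near: "x \<in> K2 \<and> cball x (s n) \<subseteq> K2" if "y \<in> K" "norm (x - y) \<le> s n" for x y n
  proof -
    have "cball x (s n) \<subseteq> cball y (2 * d)"
    proof
      fix z assume "z \<in> cball x (s n)"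
      then have "dist y z \<le> 2 * d"
        using that(2) s(2)[of n] dist_triangle[of y z x] by (simp add: dist_norm norm_minus_commute)
      then show "z \<in> cball y (2 * d)" by simp
    qed
    then show ?thesis using K2(4)[OF that(1)] s(1)[of n] by (meson centre_in_cball less_imp_le subset_trans subsetD)
  qed
  have m0: "m n x = 0" if "x \<notin> K2" for n x
    unfolding m_def using fn_small[of n x] \<eta>0 near that by (metis linorder_not_le mult_zero_right)
  have m_range: "m n x \<in> {0..R\<^sup>2}" for n x
  proof (cases "x \<in> K2")
    case True
    then show ?thesis using q[OF True] q_le[of x] \<eta>[of "fn n x"] mult_mono[of "q x" "R\<^sup>2" "\<eta> (fn n x)" 1]
      by (auto simp: m_def)
  qed (simp add: m0)
  have mR: "m n x = 0" if "R < norm x" for n x using m0 R(2) that by fastforce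
  have mi: "integrable lborel (m n)" for n by (rule integrable_of_compact_support[OF m_cont mR])
  \<comment> \<open>The weight is mollified once more: by \<open>conv_Fubini\<close>, the
    mollification of \<open>H\<close> integrated against \<open>m\<close> is \<open>H\<close>
    integrated against \<open>P\<close>, so the limit concerns a continuous weight only.\<close>
  define P where "P = (\<lambda>n. conv (m n) (\<rho> n))"
  have step: "(LBINT x. \<Phi> (fn n x)) * 4 \<le> - (LBINT y. H y * P n y)" for n
  proof -
    obtain G A B where c: "c2 UNIV (\<rho> n) G A B" using smooth_c2[OF \<rho>(1)] by blast
    have z: "\<rho> n x = 0" if "s n < norm x" for x using that \<rho>(3) by simp
    have cfn: "c2 UNIV (fn n) (conv F G) (conv F A) (conv F B)"
      unfolding fn_def by (rule conv_c2[OF iF c z])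
    have D1: "(\<Phi> has_real_derivative \<eta> t) (at t)" for t
    proof -
      have "((\<lambda>t. t / e) has_real_derivative 1 / e) (at t)" using e(1) by (auto intro!: derivative_eq_intros)
      from DERIV_cmult[OF DERIV_chain2[OF DERIV_cutoff4_4 this], of e]
      show ?thesis using e by (simp add: \<Phi>_def \<eta>_def)
    qed
    define \<eta>' where "\<eta>' = (\<lambda>t. cutoff4 2 (t / e) * (1 / e))"
    have D2: "(\<eta> has_real_derivative \<eta>' t) (at t)" for t
    proof -
      have "((\<lambda>t. t / e) has_real_derivative 1 / e) (at t)" using e(1) by (auto intro!: derivative_eq_intros)
      from DERIV_chain2[OF DERIV_cutoff4_3 this]
      show ?thesis by (simp add: \<eta>_def \<eta>'_def)
    qed
    have \<eta>'_cont: "continuous_on UNIV \<eta>'" unfolding \<eta>'_def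
      by (intro continuous_intros continuous_cutoff4_scaled)
    have \<eta>'_nn: "0 \<le> \<eta>' t" for t unfolding \<eta>'_def using cutoff4_2_nonneg e by simp
    have \<eta>'0: "\<eta>' t = 0" if "t \<le> e" for t unfolding \<eta>'_def using that e cutoff4_eq_0[of "t/e" 2] by auto
    have \<Phi>0: "\<Phi> t = 0" if "t \<le> e" for t unfolding \<Phi>_def using that e cutoff4_eq_0[of "t/e" 4] by auto
    note cc = c2_compose[OF cfn D1 D2 \<eta>'_cont]
    have sup: "\<Phi> (fn n x) = 0" if "R < norm x" for x
      using fn_small[of n x] \<Phi>0 near that R(2) by (metis linorder_not_le)
    let ?L = "\<lambda>x. Re (\<eta> (fn n x) *\<^sub>R conv F A x + Re (conv F G x) *\<^sub>R (\<eta>' (fn n x) *\<^sub>R conv F G x))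
      + Im (\<eta> (fn n x) *\<^sub>R conv F B x + Im (conv F G x) *\<^sub>R (\<eta>' (fn n x) *\<^sub>R conv F G x))"
    from Green_identity[OF cc sup c2_radial[of "R\<^sup>2"]]
    have gr: "(LBINT x. \<Phi> (fn n x)) * -4 = (LBINT x. q x * ?L x)" by (simp add: q_def)
    have L0: "?L x = 0" if "fn n x \<le> e" for x using that \<eta>0 \<eta>'0 by simp
    \<comment> \<open>The second derivative of \<Phi> contributes a nonnegative multiple of the
      squared gradient of \<open>fn\<close>, which is dropped.\<close>
    have ineq: "m n x * conv H (\<rho> n) x \<le> q x * ?L x" for x
    proof (cases "\<exists>y\<in>K. norm (x - y) \<le> s n")
      case True
      then obtain y where y: "y \<in> K" "norm (x - y) \<le> s n" by blast
      have x: "x \<in> K2" "cball x (s n) \<subseteq> K2" using near[OF y] by auto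
      have "conv H (\<rho> n) x \<le> conv F (\<lambda>z. Re (A z) + Im (B z)) x"
        unfolding F_def H_def by (rule conv_subharmonic[OF weak K2(2) \<rho>(1-3) c x(2)])
      also have "\<dots> = Re (conv F A x) + Im (conv F B x)"
      proof -
        note c' = c2_continuous_on[OF c] and z' = c2_zero_outside[OF c, of "s n", OF z]
        obtain MA where MA: "\<And>x. norm (A x) \<le> MA"
          using bounded_of_compact_support[OF c'(3) z'(2)] by blast
        obtain MB where MB: "\<And>x. norm (B x) \<le> MB"
          using bounded_of_compact_support[OF c'(4) z'(3)] by blast
        have i: "integrable lborel (\<lambda>y. F y *\<^sub>R A (x - y))" "integrable lborel (\<lambda>y. F y *\<^sub>R B (x - y))"
          by (rule conv_integrable[OF iF borel_measurable_continuous_onI[OF c'(3)] MA]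
              conv_integrable[OF iF borel_measurable_continuous_onI[OF c'(4)] MB])+
        have "Re (conv F A x) = (LBINT y. F y * Re (A (x - y)))" "Im (conv F B x) = (LBINT y. F y * Im (B (x - y)))"
          using integral_Re[OF i(1)] integral_Im[OF i(2)] by (simp_all add: conv_def)
        moreover have "integrable lborel (\<lambda>y. F y * Re (A (x - y)))" "integrable lborel (\<lambda>y. F y * Im (B (x - y)))"
          using integrable_Re[OF i(1)] integrable_Im[OF i(2)] by simp_all
        ultimately show ?thesis by (simp add: conv_def distrib_left)
      qed
      finally have 1: "conv H (\<rho> n) x \<le> Re (conv F A x) + Im (conv F B x)" .
      have "\<eta> (fn n x) * conv H (\<rho> n) x \<le> \<eta> (fn n x) * (Re (conv F A x) + Im (conv F B x))"
        by (rule mult_left_mono[OF 1 \<eta>(1)])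
      also have "\<dots> \<le> ?L x"
        using mult_nonneg_nonneg[OF \<eta>'_nn, of "(Re (conv F G x))\<^sup>2" "fn n x"]
          mult_nonneg_nonneg[OF \<eta>'_nn, of "(Im (conv F G x))\<^sup>2" "fn n x"]
        by (simp add: power2_eq_square algebra_simps)
      finally show ?thesis unfolding m_def mult.assoc by (intro mult_left_mono q[OF x(1)])
    next
      case False
      then have "fn n x \<le> e" by (intro fn_small) (auto simp: not_le)
      then show ?thesis using L0 \<eta>0 by (simp add: m_def)
    qed
    have "(LBINT y. H y * P n y) = (LBINT x. m n x * conv H (\<rho> n) x)"
      unfolding P_def by (rule conv_Fubini[OF iH m_cont mR \<rho>c z \<rho>(5), symmetric])
    also have "\<dots> \<le> (LBINT x. q x * ?L x)"
    proof (rule integral_mono)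
      obtain M where M: "\<And>x. norm (\<rho> n x) \<le> M" using bounded_of_compact_support[OF \<rho>c z] by blast
      have "continuous_on UNIV (conv H (\<rho> n))" by (rule conv_continuous[OF iH \<rho>c M])
      then show "integrable lborel (\<lambda>x. m n x * conv H (\<rho> n) x)"
        by (intro integrable_of_compact_support[of _ R] continuous_intros m_cont) (simp_all add: mR)
      show "integrable lborel (\<lambda>x. q x * ?L x)"
      proof (rule integrable_of_compact_support[of _ R])
        show "continuous_on UNIV (\<lambda>x. q x * ?L x)"
          by (intro continuous_intros qcont c2_continuous_on[OF cc] c2_continuous_on[OF cfn]
              continuous_on_compose2[OF \<eta>_cont fn_cont] continuous_on_compose2[OF \<eta>'_cont fn_cont]) auto
        fix x :: complex assume "R < norm x"
        then have "fn n x \<le> e" using fn_small[of n x] near R(2) by (metis linorder_not_le)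
        then show "q x * ?L x = 0" using L0 by simp
      qed
    qed (rule ineq)
    finally show ?thesis using gr by linarith
  qed
  \<comment> \<open>The pointwise limit of \<open>P\<close> off \<open>w\<close>: at points of
    \<open>K\<close> by continuity of \<open>F\<close>, and outside \<open>K\<close> because
    \<open>P\<close> eventually vanishes there.\<close>
  define Q where "Q = (\<lambda>y. q y * \<eta> (F y))"
  have Plim: "(\<lambda>n. H y * P n y) \<longlonglongrightarrow> H y * Q y" if yw: "y \<noteq> w" for y
  proof (cases "y \<in> K2")
    case False
    then show ?thesis by (simp add: H_def)
  next
    case yK2: True
    have "(\<lambda>n. P n y) \<longlonglongrightarrow> Q y"
    proof (cases "y \<in> K")
      case False
      have "open (- K)" using K(1) by (simp add: compact_imp_closed open_Compl)
      then obtain r where r: "0 < r" "ball y r \<subseteq> - K" using False by (meson ComplI open_contains_ball)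
      have "P n y = 0" if n: "s n < r / 2" for n
      proof -
        have "m n x = 0" if "norm (y - x) < s n" for x
        proof -
          have "fn n x \<le> e"
          proof (rule fn_small)
            fix z assume "z \<in> K"
            then have "r \<le> dist y z" using r by (auto simp: subset_iff not_less)
            then show "s n < norm (x - z)"
              using dist_triangle[of y z x] that n by (simp add: dist_norm)
          qed
          then show ?thesis using \<eta>0 by (simp add: m_def)
        qed
        then have "conv (m n) (\<rho> n) y \<in> {0..0}" by (intro cb[OF mi]) auto
        then show ?thesis by (simp add: P_def)
      qed
      moreover have "\<forall>\<^sub>F n in sequentially. s n < r / 2"
        using s0 r(1) by (intro order_tendstoD(2)[of s 0]) auto
      ultimately have "\<forall>\<^sub>F n in sequentially. P n y = 0" by (auto elim: eventually_mono)
      moreover have "Q y = 0" using F_le[OF False] \<eta>0 by (simp add: Q_def)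
      ultimately show ?thesis by (simp add: tendsto_eventually)
    next
      case True
      have Fc: "isCont F y" by (rule F_cont[OF True yw])
      show ?thesis
      proof (rule LIMSEQ_I)
        fix \<epsilon> :: real assume \<epsilon>: "0 < \<epsilon>"
        have "continuous_on UNIV (\<lambda>p. q (fst p) * \<eta> (snd p))"
          by (intro continuous_intros continuous_on_compose2[OF qcont] continuous_on_compose2[OF \<eta>_cont]) auto
        then have "isCont (\<lambda>p. q (fst p) * \<eta> (snd p)) (y, F y)" by (simp add: continuous_on_eq_continuous_at)
        then obtain r where r: "0 < r" "\<And>p. dist p (y, F y) < r \<Longrightarrow> dist (q (fst p) * \<eta> (snd p)) (Q y) < \<epsilon> / 2"
          unfolding continuous_at_eps_delta Q_def using \<epsilon> by (metis fst_conv half_gt_zero snd_conv)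
        obtain t where t: "0 < t" "\<And>x. dist x y < t \<Longrightarrow> dist (F x) (F y) < r / 4"
          using Fc r(1) unfolding continuous_at_eps_delta by (metis divide_pos_pos zero_less_numeral)
        have "dist (P n y) (Q y) < \<epsilon>" if n: "s n < min (t / 2) (r / 2)" for n
        proof -
          have "m n x \<in> {Q y - \<epsilon>/2 .. Q y + \<epsilon>/2}" if x: "norm (y - x) < s n" for x
          proof -
            have "fn n x \<in> {F y - r/4 .. F y + r/4}" unfolding fn_def
            proof (rule cb[OF iF])
              fix z assume "norm (x - z) < s n"
              then have "dist z y < t" using x n dist_triangle[of z y x] by (simp add: dist_norm norm_minus_commute)
              then have "\<bar>F z - F y\<bar> < r/4" using t(2)[of z] by (simp add: dist_real_def)
              then show "F z \<in> {F y - r/4 .. F y + r/4}" unfolding atLeastAtMost_iff by linarith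
            qed
            then have "\<bar>fn n x - F y\<bar> \<le> r / 4" unfolding atLeastAtMost_iff by linarith
            moreover have "dist x y < r / 2" using x n by (simp add: dist_norm norm_minus_commute)
            ultimately have "dist (x, fn n x) (y, F y) < r"
              using dist_Pair_Pair[of x "fn n x" y "F y"] sqrt_sum_squares_le_sum_abs[of "dist x y" "dist (fn n x) (F y)"] r(1)
              by (simp add: dist_real_def)
            from r(2)[OF this] have "\<bar>m n x - Q y\<bar> < \<epsilon>/2" by (simp add: m_def dist_real_def)
            then show ?thesis unfolding atLeastAtMost_iff by linarith
          qed
          then have "P n y \<in> {Q y - \<epsilon>/2 .. Q y + \<epsilon>/2}" unfolding P_def by (intro cb[OF mi]) auto
          then show ?thesis using \<epsilon> unfolding dist_real_def atLeastAtMost_iff by linarith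
        qed
        moreover have "\<forall>\<^sub>F n in sequentially. s n < min (t / 2) (r / 2)"
          using s0 r(1) t(1) by (intro order_tendstoD(2)[of s 0]) auto
        ultimately show "\<exists>N. \<forall>n\<ge>N. norm (P n y - Q y) < \<epsilon>"
          by (auto simp: eventually_sequentially dist_norm)
      qed
    qed
    then show ?thesis by (rule tendsto_mult_left)
  qed
  have P_range: "P n y \<in> {0..R\<^sup>2}" for n y unfolding P_def by (rule cb[OF mi m_range])
  have [measurable]: "H \<in> borel_measurable borel" "F \<in> borel_measurable borel" "q \<in> borel_measurable borel"
    "\<eta> \<in> borel_measurable borel"
    using iH iF qcont \<eta>_cont by (auto intro: borel_measurable_continuous_onI)
  have [measurable]: "P n \<in> borel_measurable borel" for n
  proof -
    have z: "\<rho> n x = 0" if "s n < norm x" for x using that \<rho>(3) by simp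
    obtain M where "\<And>x. norm (\<rho> n x) \<le> M" using bounded_of_compact_support[OF \<rho>c z] by blast
    then have "continuous_on UNIV (P n)" unfolding P_def using conv_continuous[OF mi \<rho>c] by blast
    then show ?thesis by (rule borel_measurable_continuous_onI)
  qed
  have lim: "(\<lambda>n. LBINT y. H y * P n y) \<longlonglongrightarrow> (LBINT y. H y * Q y)"
  proof (rule integral_dominated_convergence)
    show "integrable lborel (\<lambda>y. R\<^sup>2 * norm (H y))" using iH by simp
    show "AE y in lborel. (\<lambda>n. H y * P n y) \<longlonglongrightarrow> H y * Q y"
      using AE_lborel_singleton[of w] by eventually_elim (rule Plim)
    show "AE y in lborel. norm (H y * P n y) \<le> R\<^sup>2 * norm (H y)" for n
      using P_range[of n] by (intro AE_I2) (auto simp: abs_mult mult.commute[of "R\<^sup>2"] intro!: mult_left_mono)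
  qed (simp_all add: Q_def)
  \<comment> \<open>\<open>Q\<close> is nonzero only where \<open>F\<close> exceeds e; there
    \<open>f\<close> is positive, so \<open>h\<close> is nonnegative by assumption.\<close>
  have nn: "0 \<le> (LBINT y. H y * Q y)"
  proof (rule integral_nonneg_AE)
    show "AE y in lborel. 0 \<le> H y * Q y"
      using AE_lborel_singleton[of w]
    proof eventually_elim
      case (elim y)
      show ?case
      proof (cases "y \<in> K2 \<and> e < F y")
        case True
        then have "0 < f y" "0 \<le> q y" using e q by (auto simp: F_def)
        moreover have "y \<in> \<Omega> - {w}" using True elim K2(2) by auto
        ultimately show ?thesis using hf \<eta>(1) by (simp add: H_def Q_def)
      next
        case False
        then show ?thesis using \<eta>0 by (auto simp: H_def Q_def)
      qed
    qed
  qed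
  have z0K: "z0 \<in> K" using K(3)[of z0] z0 e by auto
  have "isCont F z0" using F_cont[OF z0K] z0 by auto
  moreover have "F z0 = 8 * e" using z0K K2(3) e by (auto simp: F_def)
  ultimately obtain r where r: "0 < r" "\<And>x. dist x z0 < r \<Longrightarrow> dist (F x) (8 * e) < e"
    unfolding continuous_at_eps_delta using e(1) by metis
  have \<Phi>_mono: "\<Phi> a \<le> \<Phi> b" if "a \<le> b" for a b
    unfolding \<Phi>_def using that e by (intro mult_left_mono cutoff4_4_mono divide_right_mono) auto
  have \<Phi>7: "0 < \<Phi> (7 * e)" using e by (simp add: \<Phi>_def cutoff4_def fact_numeral)
  define c where "c = measure lborel (ball z0 (r/2)) * \<Phi> (7 * e)"
  have c: "0 < c" unfolding c_def using \<Phi>7 content_ball_pos[of "r/2" z0] r by simp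
  have low: "c \<le> (LBINT x. \<Phi> (fn n x))" if n: "s n < r/2" for n
  proof -
    have ge: "7 * e \<le> fn n x" if x: "x \<in> ball z0 (r/2)" for x
    proof -
      have "fn n x \<in> {7 * e .. 9 * e}" unfolding fn_def
      proof (rule cb[OF iF])
        fix z assume "norm (x - z) < s n"
        then have "dist z z0 < r" using x n dist_triangle[of z z0 x] by (simp add: dist_norm norm_minus_commute)
        then show "F z \<in> {7 * e .. 9 * e}" using r(2)[of z] unfolding dist_real_def atLeastAtMost_iff by linarith
      qed
      then show ?thesis by simp
    qed
    have \<Phi>_cont: "continuous_on UNIV (\<lambda>x. \<Phi> (fn n x))" unfolding \<Phi>_def
      by (intro continuous_intros continuous_on_compose2[OF continuous_cutoff4_scaled[of 4 e] fn_cont]) auto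
    have sup: "\<Phi> (fn n x) = 0" if "R < norm x" for x
    proof -
      have "fn n x \<le> e" using fn_small[of n x] near that R(2) by (metis linorder_not_le)
      then show ?thesis using e cutoff4_eq_0[of "fn n x / e" 4] by (simp add: \<Phi>_def)
    qed
    have "(LBINT x. indicator (ball z0 (r/2)) x * \<Phi> (7 * e)) \<le> (LBINT x. \<Phi> (fn n x))"
    proof (rule integral_mono)
      show "integrable lborel (\<lambda>x. indicator (ball z0 (r/2)) x * \<Phi> (7 * e))"
        using emeasure_lborel_ball_finite[of z0 "r/2"] by (simp add: integrable_indicator_iff)
      show "integrable lborel (\<lambda>x. \<Phi> (fn n x))" by (rule integrable_of_compact_support[OF \<Phi>_cont sup])
      have "0 \<le> \<Phi> t" for t unfolding \<Phi>_def using e cutoff4_4_nonneg by simp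
      then show "indicator (ball z0 (r/2)) x * \<Phi> (7 * e) \<le> \<Phi> (fn n x)" for x
        using ge[of x] \<Phi>_mono by (auto simp: indicator_def)
    qed
    then show ?thesis by (simp add: c_def)
  qed
  have "\<forall>\<^sub>F n in sequentially. s n < r / 2" using s0 r(1) by (intro order_tendstoD(2)[of s 0]) auto
  \<comment> \<open>With \<open>low\<close> and \<open>step\<close> this gives 4c \<le> 4 times the
    integral of \<Phi>(fn) \<le> minus the integral of H P < 4c, a contradiction.\<close>
  moreover have "\<forall>\<^sub>F n in sequentially. - (4 * c) < (LBINT y. H y * P n y)"
    using lim nn c by (intro order_tendstoD(1)[OF lim]) linarith
  ultimately have "\<forall>\<^sub>F n in sequentially. False"
  proof eventually_elim
    case (elim n)
    then show ?case using low[of n] step[of n] by linarith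
  qed
  then show False by simp
qed

lemma conv_mollifier_tendsto:
  fixes \<psi> :: "'a::euclidean_space \<Rightarrow> real"
  assumes s: "s \<longlonglongrightarrow> 0" and \<rho>: "\<And>n. continuous_on UNIV (\<rho> n)" "\<And>n x. 0 \<le> \<rho> n x"
    "\<And>n x. s n \<le> norm x \<Longrightarrow> \<rho> n x = 0" "\<And>n. integral\<^sup>L lborel (\<rho> n) = 1"
    and \<psi>: "integrable lborel \<psi>" "isCont \<psi> x"
  shows "(\<lambda>n. conv (\<rho> n) \<psi> x) \<longlonglongrightarrow> \<psi> x"
proof (rule LIMSEQ_I)
  fix e :: real assume e: "0 < e"
  then obtain t where t: "0 < t" "\<And>y. dist y x < t \<Longrightarrow> dist (\<psi> y) (\<psi> x) < e / 2"
    using \<psi>(2) unfolding continuous_at_eps_delta by (metis half_gt_zero)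
  have "norm (conv (\<rho> n) \<psi> x - \<psi> x) < e" if n: "s n < t" for n
  proof -
    have "conv (\<rho> n) \<psi> x \<in> {\<psi> x - e/2 .. \<psi> x + e/2}"
    proof (rule conv_mollifier_bounds'(2)[OF \<rho>(1,2) _ \<rho>(4) \<psi>(1)])
      show "\<rho> n y = 0" if "s n \<le> norm y" for y using \<rho>(3) that .
      fix y assume "norm (x - y) < s n"
      then have "dist (\<psi> y) (\<psi> x) < e / 2" using t(2)[of y] n by (simp add: dist_norm norm_minus_commute)
      then show "\<psi> y \<in> {\<psi> x - e/2 .. \<psi> x + e/2}" unfolding dist_real_def atLeastAtMost_iff by linarith
    qed
    then show ?thesis using e unfolding real_norm_def atLeastAtMost_iff by linarith
  qed
  moreover have "\<forall>\<^sub>F n in sequentially. s n < t" using s t(1) by (intro order_tendstoD(2)[of s 0]) auto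
  ultimately show "\<exists>N. \<forall>n\<ge>N. norm (conv (\<rho> n) \<psi> x - \<psi> x) < e" by (auto simp: eventually_sequentially)
qed

section \<open>Green functions and boundary barriers\<close>

lemma borel_measurable_indicator_punctured:
  fixes g :: "complex \<Rightarrow> real"
  assumes "S \<in> sets borel" "continuous_on (S - {w}) g"
  shows "(\<lambda>z. indicator S z * g z) \<in> borel_measurable borel"
proof -
  have "(\<lambda>z. indicator (S - {w}) z *\<^sub>R g z) \<in> borel_measurable borel"
    by (rule borel_measurable_continuous_on_indicator) (use assms in auto)
  then have "(\<lambda>z. indicator (S - {w}) z *\<^sub>R g z + indicator ({w} \<inter> S) z *\<^sub>R g w) \<in> borel_measurable borel"
    using assms(1) by (intro borel_measurable_add borel_measurable_scaleR[of "\<lambda>z. indicator ({w} \<inter> S) z"] borel_measurable_indicator borel_measurable_const) auto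
  moreover have "(\<lambda>z. indicator (S - {w}) z *\<^sub>R g z + indicator ({w} \<inter> S) z *\<^sub>R g w) = (\<lambda>z. indicator S z * g z)"
    by (auto simp: indicator_def fun_eq_iff)
  ultimately show ?thesis by simp
qed

lemma borel_measurable_indicator_continuous:
  fixes g :: "complex \<Rightarrow> real"
  assumes "S \<in> sets borel" "continuous_on S g"
  shows "(\<lambda>z. indicator S z * g z) \<in> borel_measurable borel"
  using borel_measurable_continuous_on_indicator[OF assms] by simp

locale green_domain =
  fixes D :: "complex set" and u :: "complex \<Rightarrow> real" and w :: complex and g :: "complex \<Rightarrow> real"
  assumes open_D: "open D" and bounded_D: "bounded D" and w_in_D: "w \<in> D"
    and u_cont: "continuous_on (closure D) u" and u_nonneg: "\<And>z. z \<in> D \<Longrightarrow> 0 \<le> u z"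
    and green: "green_function u D w g"
begin

lemma g_cont: "continuous_on (closure D - {w}) g"
  using green by (simp add: green_function_def)

lemma g_frontier: "z \<in> frontier D \<Longrightarrow> g z = 0"
  using green by (simp add: green_function_def)

lemma w_notin_frontier: "w \<notin> frontier D"
  using open_D w_in_D by (simp add: frontier_def interior_open)

lemma closure_D: "closure D = D \<union> frontier D"
  by (rule closure_Un_frontier)

lemma g_bounded_away:
  assumes "0 < r"
  obtains M where "0 < M" "\<And>z. z \<in> closure D \<Longrightarrow> z \<notin> ball w r \<Longrightarrow> \<bar>g z\<bar> \<le> M"
proof -
  have "compact (closure D - ball w r)" using bounded_D by (simp add: compact_diff compact_closure)
  then have "bounded (g ` (closure D - ball w r))"
    by (intro compact_imp_bounded compact_continuous_image continuous_on_subset[OF g_cont]) (use assms in auto)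
  then obtain M where "0 < M" "\<And>x. x \<in> g ` (closure D - ball w r) \<Longrightarrow> norm x \<le> M"
    by (metis bounded_pos)
  then show ?thesis using that[of M] by auto
qed

lemma g_measurable: "(\<lambda>z. indicator D z * g z) \<in> borel_measurable borel"
  by (rule borel_measurable_indicator_punctured[of _ w])
    (use open_D continuous_on_subset[OF g_cont] closure_subset in \<open>auto intro: continuous_on_subset[OF g_cont]\<close>)

lemma g_integrable_compact:
  assumes "compact K" "K \<subseteq> D"
  shows "integrable lborel (\<lambda>z. indicator K z * g z)"
proof -
  have "(\<lambda>z. indicator K z * g z) \<in> borel_measurable borel"
    by (rule borel_measurable_indicator_punctured[of _ w])
      (use assms closure_subset in \<open>auto intro: continuous_on_subset[OF g_cont] simp: compact_imp_closed borel_closed\<close>)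
  moreover have "g absolutely_integrable_on K" using green assms by (simp add: green_function_def)
  ultimately show ?thesis by (simp add: set_integrable_def integrable_completion)
qed

text \<open>Local integrability covers a disc about \<open>w\<close>; outside it \<open>g\<close> is
  bounded, being continuous on a compact set.\<close>

lemma g_integrable: "integrable lborel (\<lambda>z. indicator D z * g z)"
proof -
  obtain r where r: "0 < r" "cball w r \<subseteq> D" using open_D w_in_D open_contains_cball by blast
  obtain M where M: "0 < M" "\<And>z. z \<in> closure D \<Longrightarrow> z \<notin> ball w r \<Longrightarrow> \<bar>g z\<bar> \<le> M"
    using g_bounded_away[OF r(1)] by blast
  have D_fin: "emeasure lborel D < \<infinity>" using bounded_D by (rule emeasure_bounded_finite)
  have i: "integrable lborel (\<lambda>z. \<bar>indicator (cball w r) z * g z\<bar> + M * indicator D z)"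
    using g_integrable_compact[OF compact_cball r(2)] D_fin open_D by (auto simp: integrable_indicator_iff)
  show ?thesis
  proof (rule Bochner_Integration.integrable_bound[OF i])
    show "AE z in lborel. norm (indicator D z * g z) \<le> norm (\<bar>indicator (cball w r) z * g z\<bar> + M * indicator D z)"
      using M closure_subset[of D] by (intro AE_I2) (force simp: indicator_def)
  qed (use g_measurable in simp)
qed

lemma u_bounded: obtains M where "0 < M" "\<And>z. z \<in> closure D \<Longrightarrow> \<bar>u z\<bar> \<le> M"
proof -
  have "bounded (u ` closure D)"
    using bounded_D u_cont by (intro compact_imp_bounded compact_continuous_image) (auto simp: compact_closure)
  then obtain M where "0 < M" "\<And>x. x \<in> u ` closure D \<Longrightarrow> norm x \<le> M" by (metis bounded_pos)
  then show ?thesis using that[of M] by auto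
qed

lemma u_measurable: "(\<lambda>z. indicator D z * u z) \<in> borel_measurable borel"
  by (rule borel_measurable_indicator_continuous)
    (use open_D closure_subset in \<open>auto intro: continuous_on_subset[OF u_cont]\<close>)

lemma g_times_integrable:
  assumes "(\<lambda>z. indicator D z * k z) \<in> borel_measurable borel" "\<And>z. z \<in> D \<Longrightarrow> \<bar>k z\<bar> \<le> M"
  shows "integrable lborel (\<lambda>z. indicator D z * (g z * k z))"
proof (rule Bochner_Integration.integrable_bound)
  show "integrable lborel (\<lambda>z. M * (indicator D z * g z))" using g_integrable by simp
  have "(\<lambda>z. (indicator D z * g z) * (indicator D z * k z)) \<in> borel_measurable borel"
    using g_measurable assms(1) by (rule borel_measurable_times)
  moreover have "(\<lambda>z. (indicator D z * g z) * (indicator D z * k z)) = (\<lambda>z. indicator D z * (g z * k z))"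
    by (auto simp: indicator_def)
  ultimately show "(\<lambda>z. indicator D z * (g z * k z)) \<in> borel_measurable lborel" by simp
  show "AE z in lborel. norm (indicator D z * (g z * k z)) \<le> norm (M * (indicator D z * g z))"
  proof (rule AE_I2)
    fix z
    show "norm (indicator D z * (g z * k z)) \<le> norm (M * (indicator D z * g z))"
    proof (cases "z \<in> D")
      case True
      have "\<bar>g z\<bar> * \<bar>k z\<bar> \<le> \<bar>g z\<bar> * \<bar>M\<bar>" using assms(2)[OF True] by (intro mult_left_mono) auto
      then show ?thesis using True by (simp add: abs_mult mult.commute)
    qed simp
  qed
qed

lemma indicator_times_continuous:
  assumes "continuous_on UNIV k" shows "(\<lambda>z. indicator D z * (k z :: real)) \<in> borel_measurable borel"
  by (rule borel_measurable_indicator_continuous) (use assms open_D in \<open>auto intro: continuous_on_subset\<close>)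

lemma indicator_times_u:
  assumes "continuous_on UNIV k" shows "(\<lambda>z. indicator D z * (u z * k z :: real)) \<in> borel_measurable borel"
  by (rule borel_measurable_indicator_continuous)
    (use assms open_D closure_subset in \<open>auto intro!: continuous_intros intro: continuous_on_subset[OF u_cont] continuous_on_subset[OF assms]\<close>)

lemma green_test:
  assumes "test_function D \<psi>"
  shows "(LBINT z. indicator D z * (g z * (laplacian \<psi> z - u z * \<psi> z))) = \<psi> w"
proof -
  have sm: "smooth_real_on UNIV \<psi>" using assms by (simp add: test_function_def)
  obtain G A B where c: "c2 UNIV \<psi> G A B" using smooth_c2[OF sm] by blast
  have L: "laplacian \<psi> = (\<lambda>z. Re (A z) + Im (B z))" using c2_laplacian[OF c] by auto
  note cc = c2_continuous_on[OF c]
  have "(\<lambda>z. indicator D z * (laplacian \<psi> z - u z * \<psi> z)) \<in> borel_measurable borel"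
    unfolding L using indicator_times_continuous[of "\<lambda>z. Re (A z) + Im (B z)"] indicator_times_u[OF cc(1)] cc
    by (simp add: right_diff_distrib continuous_intros)
  from borel_measurable_times[OF g_measurable this]
  have "(\<lambda>z. indicator D z * (g z * (laplacian \<psi> z - u z * \<psi> z))) \<in> borel_measurable borel"
    by (rule measurable_cong[THEN iffD1, rotated]) (auto simp: indicator_def)
  then have "(LBINT z. indicator D z * (g z * (laplacian \<psi> z - u z * \<psi> z)))
      = (LINT z:D|lebesgue. g z * (laplacian \<psi> z - u z * \<psi> z))"
    by (simp add: set_lebesgue_integral_def integral_completion)
  then show ?thesis using green assms by (simp add: green_function_def)
qed

lemma continuous_bounded_on_D:
  assumes "continuous_on UNIV (k :: complex \<Rightarrow> real)" obtains M where "0 < M" "\<And>z. z \<in> closure D \<Longrightarrow> \<bar>k z\<bar> \<le> M"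
proof -
  have "bounded (k ` closure D)"
    using bounded_D continuous_on_subset[OF assms]
    by (intro compact_imp_bounded compact_continuous_image) (auto simp: compact_closure)
  then obtain M where "0 < M" "\<And>x. x \<in> k ` closure D \<Longrightarrow> norm x \<le> M" by (metis bounded_pos)
  then show ?thesis using that[of M] by auto
qed

lemma g_continuous_integrable:
  assumes k: "continuous_on UNIV k"
  shows "integrable lborel (\<lambda>z. indicator D z * (g z * k z))" "integrable lborel (\<lambda>z. indicator D z * (g z * (u z * k z)))"
proof -
  obtain M1 where M1: "\<And>z. z \<in> closure D \<Longrightarrow> \<bar>k z\<bar> \<le> M1" using continuous_bounded_on_D[OF k] by blast
  obtain M2 where M2: "0 < M2" "\<And>z. z \<in> closure D \<Longrightarrow> \<bar>u z\<bar> \<le> M2" using u_bounded by blast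
  show "integrable lborel (\<lambda>z. indicator D z * (g z * k z))"
    by (rule g_times_integrable[OF indicator_times_continuous[OF k]]) (use M1 closure_subset in blast)
  show "integrable lborel (\<lambda>z. indicator D z * (g z * (u z * k z)))"
  proof (rule g_times_integrable[OF indicator_times_u[OF k]])
    fix z assume "z \<in> D"
    then have "z \<in> closure D" using closure_subset by blast
    then show "\<bar>u z * k z\<bar> \<le> M2 * M1"
      using M1[of z] M2(2)[of z] M2(1) unfolding abs_mult by (intro mult_mono) auto
  qed
qed

text \<open>The equation is postulated for smooth test functions, while those built from a defining
  function of the boundary are only C^2. Mollification keeps the support in a compact part of
  \<open>D\<close>, and values and Laplacians converge pointwise with uniform bounds.\<close>

lemma green_c2:
  assumes c: "c2 UNIV \<psi> G A B" and K: "compact K" "K \<subseteq> D" "\<And>z. z \<notin> K \<Longrightarrow> \<psi> z = 0"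
  shows "(LBINT z. indicator D z * (g z * (Re (A z) + Im (B z) - u z * \<psi> z))) = \<psi> w"
proof -
  obtain d K2 where d: "0 < d" and K2: "compact K2" "K2 \<subseteq> D" "K \<subseteq> K2" "\<And>x. x \<in> K \<Longrightarrow> cball x (2 * d) \<subseteq> K2"
    using compact_thickening[OF K(1) open_D K(2)] by metis
  obtain s \<rho> where s: "\<And>n. 0 < s n" "\<And>n. s n \<le> d" "s \<longlonglongrightarrow> 0"
    and \<rho>: "\<And>n. smooth_real_on UNIV (\<rho> n)" "\<And>n x. 0 \<le> \<rho> n (x::complex)" "\<And>n x. s n \<le> norm x \<Longrightarrow> \<rho> n x = 0"
    "\<And>n. integral\<^sup>L lborel (\<rho> n) = 1" "\<And>n x. \<rho> n (- x) = \<rho> n x"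
    using mollifier_sequence[OF d] by metis
  note \<rho>c = smooth_continuous_on[OF \<rho>(1)]
  obtain R where R: "\<And>z. z \<in> K \<Longrightarrow> norm z \<le> R" using compact_imp_bounded[OF K(1)] by (meson bounded_iff)
  have z: "\<psi> z = 0" if "R < norm z" for z using that R K(3) by fastforce
  have \<rho>z: "\<rho> n x = 0" if "s n < norm x" for n x using that \<rho>(3) by simp
  have \<rho>i: "integrable lborel (\<rho> n)" for n by (rule integrable_of_compact_support[OF \<rho>c \<rho>z])
  note cc = c2_continuous_on[OF c]
  have zz: "G z = 0" "A z = 0" "B z = 0" if "R < norm z" for z
    using c2_zero_outside[of \<psi> G A B R z] c z that by auto
  define L where "L = (\<lambda>z. Re (A z) + Im (B z))"
  have Lc: "continuous_on UNIV L" unfolding L_def by (intro continuous_intros cc)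
  have L0: "L z = 0" if "R < norm z" for z using zz(2,3)[OF that] by (simp add: L_def)
  have \<psi>i: "integrable lborel \<psi>" "integrable lborel L"
    using integrable_of_compact_support[OF cc(1) z] integrable_of_compact_support[OF Lc L0] by auto
  define \<psi>n where "\<psi>n = (\<lambda>n. conv (\<rho> n) \<psi>)"
  have test: "test_function D (\<psi>n n)" for n
  proof (rule test_functionI[OF _ K2(1,2)])
    have "\<psi>n n = conv \<psi> (\<rho> n)" unfolding \<psi>n_def
      by (intro ext conv_commute borel_measurable_continuous_onI \<rho>c cc)
    then show "smooth_real_on UNIV (\<psi>n n)" using conv_smooth[OF \<psi>i(1) \<rho>(1) \<rho>z] by simp
    fix x assume x: "x \<notin> K2"
    have "\<psi>n n x \<in> {0..0}" unfolding \<psi>n_def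
    proof (rule conv_mollifier_bounds'(2)[OF \<rho>c \<rho>(2) _ \<rho>(4) \<psi>i(1)])
      show "\<rho> n y = 0" if "s n \<le> norm y" for y using \<rho>(3) that .
      fix y assume y: "norm (x - y) < s n"
      have "y \<notin> K"
      proof
        assume "y \<in> K"
        moreover have "x \<in> cball y (2 * d)" using y s(2)[of n] d by (simp add: dist_norm norm_minus_commute)
        ultimately show False using K2(4) x by blast
      qed
      then show "\<psi> y \<in> {0..0}" using K(3) by simp
    qed
    then show "\<psi>n n x = 0" by simp
  qed
  have lap: "laplacian (\<psi>n n) z = conv (\<rho> n) L z" for n z
  proof -
    have cn: "c2 UNIV (\<psi>n n) (conv (\<rho> n) G) (conv (\<rho> n) A) (conv (\<rho> n) B)"
      unfolding \<psi>n_def by (rule conv_c2[OF \<rho>i c z])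
    obtain MA where MA: "\<And>x. norm (A x) \<le> MA" using bounded_of_compact_support[OF cc(3) zz(2)] by blast
    obtain MB where MB: "\<And>x. norm (B x) \<le> MB" using bounded_of_compact_support[OF cc(4) zz(3)] by blast
    have i: "integrable lborel (\<lambda>y. \<rho> n y *\<^sub>R A (z - y))" "integrable lborel (\<lambda>y. \<rho> n y *\<^sub>R B (z - y))"
      by (rule conv_integrable[OF \<rho>i borel_measurable_continuous_onI[OF cc(3)] MA]
          conv_integrable[OF \<rho>i borel_measurable_continuous_onI[OF cc(4)] MB])+
    have "Re (conv (\<rho> n) A z) = (LBINT y. \<rho> n y * Re (A (z - y)))" "Im (conv (\<rho> n) B z) = (LBINT y. \<rho> n y * Im (B (z - y)))"
      using integral_Re[OF i(1)] integral_Im[OF i(2)] by (simp_all add: conv_def)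
    moreover have "integrable lborel (\<lambda>y. \<rho> n y * Re (A (z - y)))" "integrable lborel (\<lambda>y. \<rho> n y * Im (B (z - y)))"
      using integrable_Re[OF i(1)] integrable_Im[OF i(2)] by simp_all
    ultimately show ?thesis
      using c2_laplacian[OF cn, of z] by (simp add: conv_def distrib_left L_def)
  qed
  have tend: "(\<lambda>n. \<psi>n n z) \<longlonglongrightarrow> \<psi> z" "(\<lambda>n. conv (\<rho> n) L z) \<longlonglongrightarrow> L z" for z
    unfolding \<psi>n_def
    by (rule conv_mollifier_tendsto[OF s(3) \<rho>c \<rho>(2-4)];
        use \<psi>i cc(1) Lc in \<open>auto simp: continuous_on_eq_continuous_at\<close>)+
  obtain M1 where M1: "\<And>x. norm (\<psi> x) \<le> M1" using bounded_of_compact_support[OF cc(1) z] by blast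
  obtain M2 where M2: "\<And>x. norm (L x) \<le> M2" using bounded_of_compact_support[OF Lc L0] by blast
  have b: "\<bar>\<psi>n n z\<bar> \<le> M1" "\<bar>conv (\<rho> n) L z\<bar> \<le> M2" for n z
  proof -
    have "\<psi>n n z \<in> {-M1..M1}" unfolding \<psi>n_def
      by (rule conv_mollifier_bounds'(2)[OF \<rho>c \<rho>(2) \<rho>(3) \<rho>(4) \<psi>i(1)]) (use M1 in \<open>auto simp: abs_le_iff minus_le_iff\<close>)
    moreover have "conv (\<rho> n) L z \<in> {-M2..M2}"
      by (rule conv_mollifier_bounds'(2)[OF \<rho>c \<rho>(2) \<rho>(3) \<rho>(4) \<psi>i(2)]) (use M2 in \<open>auto simp: abs_le_iff minus_le_iff\<close>)
    ultimately show "\<bar>\<psi>n n z\<bar> \<le> M1" "\<bar>conv (\<rho> n) L z\<bar> \<le> M2" by auto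
  qed
  obtain Mu where Mu: "0 < Mu" "\<And>z. z \<in> closure D \<Longrightarrow> \<bar>u z\<bar> \<le> Mu" using u_bounded by blast
  have int_meas: "(\<lambda>z. indicator D z * (g z * (k1 z - u z * k2 z))) \<in> borel_measurable lborel"
    if "continuous_on UNIV k1" "continuous_on UNIV k2" for k1 k2
  proof -
    have "(\<lambda>z. indicator D z * (g z * k1 z) - indicator D z * (g z * (u z * k2 z))) \<in> borel_measurable lborel"
      using g_continuous_integrable(1)[OF that(1)] g_continuous_integrable(2)[OF that(2)] by auto
    then show ?thesis by (simp add: algebra_simps)
  qed
  have "(\<lambda>n. LBINT z. indicator D z * (g z * (conv (\<rho> n) L z - u z * \<psi>n n z)))
      \<longlonglongrightarrow> (LBINT z. indicator D z * (g z * (L z - u z * \<psi> z)))"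
  proof (rule integral_dominated_convergence)
    show "(\<lambda>z. indicator D z * (g z * (L z - u z * \<psi> z))) \<in> borel_measurable lborel"
      by (rule int_meas[OF Lc cc(1)])
    show "(\<lambda>z. indicator D z * (g z * (conv (\<rho> n) L z - u z * \<psi>n n z))) \<in> borel_measurable lborel" for n
      using int_meas conv_continuous[OF \<rho>i Lc M2] conv_continuous[OF \<rho>i cc(1) M1] unfolding \<psi>n_def by blast
    show "integrable lborel (\<lambda>z. (M2 + Mu * M1) * norm (indicator D z * g z))" using g_integrable by simp
    show "AE z in lborel. (\<lambda>n. indicator D z * (g z * (conv (\<rho> n) L z - u z * \<psi>n n z)))
        \<longlonglongrightarrow> indicator D z * (g z * (L z - u z * \<psi> z))"
      by (intro AE_I2 tendsto_intros tend)
    show "AE z in lborel. norm (indicator D z * (g z * (conv (\<rho> n) L z - u z * \<psi>n n z)))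
        \<le> (M2 + Mu * M1) * norm (indicator D z * g z)" for n
    proof (rule AE_I2)
      fix z
      show "norm (indicator D z * (g z * (conv (\<rho> n) L z - u z * \<psi>n n z))) \<le> (M2 + Mu * M1) * norm (indicator D z * g z)"
      proof (cases "z \<in> D")
        case True
        then have "\<bar>u z\<bar> \<le> Mu" using Mu(2) closure_subset by blast
        then have "\<bar>u z * \<psi>n n z\<bar> \<le> Mu * M1" unfolding abs_mult using b(1)[of n z] Mu(1) by (intro mult_mono) auto
        then have "\<bar>conv (\<rho> n) L z - u z * \<psi>n n z\<bar> \<le> M2 + Mu * M1" using b(2)[of n z] by linarith
        then have "\<bar>g z\<bar> * \<bar>conv (\<rho> n) L z - u z * \<psi>n n z\<bar> \<le> \<bar>g z\<bar> * (M2 + Mu * M1)" by (intro mult_left_mono) auto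
        then show ?thesis using True by (simp add: abs_mult mult.commute)
      qed simp
    qed
  qed
  moreover have "(LBINT z. indicator D z * (g z * (conv (\<rho> n) L z - u z * \<psi>n n z))) = \<psi>n n w" for n
    using green_test[OF test, of n] by (simp add: lap)
  ultimately have "(\<lambda>n. \<psi>n n w) \<longlonglongrightarrow> (LBINT z. indicator D z * (g z * (L z - u z * \<psi> z)))" by simp
  then show ?thesis using tend(1)[of w] LIMSEQ_unique unfolding L_def by blast
qed

end

section \<open>Sign of the Green function and its linear bound at the boundary\<close>

lemma disjoint_balls_dist:
  fixes x y :: "'a::real_normed_vector"
  assumes "ball x r \<inter> ball y s = {}" "0 < r" "0 < s"
  shows "r + s \<le> norm (x - y)"
proof (rule ccontr)
  assume "\<not> r + s \<le> norm (x - y)"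
  then have lt: "norm (x - y) < r + s" by simp
  \<comment> \<open>The point dividing the segment from \<open>x\<close> to \<open>y\<close> in the
    ratio r : s would lie in both balls.\<close>
  define p where "p = x + (r / (r + s)) *\<^sub>R (y - x)"
  have "norm (x - p) = (r / (r + s)) * norm (x - y)"
    using assms by (simp add: p_def norm_minus_commute)
  also have "\<dots> < (r / (r + s)) * (r + s)" using assms lt by (intro mult_strict_left_mono) auto
  finally have 1: "p \<in> ball x r" using assms by (simp add: dist_norm)
  have "1 - r / (r + s) = s / (r + s)" using assms by (simp add: field_simps)
  then have "y - p = (s / (r + s)) *\<^sub>R (y - x)" by (simp add: p_def algebra_simps flip: scaleR_left_diff_distrib)
      (metis (no_types, opaque_lifting) add.commute diff_add_cancel diff_diff_eq2 scaleR_diff_right scaleR_left_diff_distrib scaleR_one)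
  then have "norm (y - p) = (s / (r + s)) * norm (x - y)" using assms by (simp add: norm_minus_commute)
  also have "\<dots> < (s / (r + s)) * (r + s)" using assms lt by (intro mult_strict_left_mono) auto
  finally have "p \<in> ball y s" using assms by (simp add: dist_norm)
  with 1 assms(1) show False by blast
qed

context green_domain
begin

lemma ug_integrable_compact:
  assumes "compact K" "K \<subseteq> D"
  shows "integrable lborel (\<lambda>z. indicator K z * (u z * g z))"
proof -
  obtain M where M: "0 < M" "\<And>z. z \<in> closure D \<Longrightarrow> \<bar>u z\<bar> \<le> M" using u_bounded by blast
  show ?thesis
  proof (rule Bochner_Integration.integrable_bound)
    show "integrable lborel (\<lambda>z. M * (indicator K z * g z))"
      using g_integrable_compact[OF assms] by simp
    have "(\<lambda>z. (indicator K z * g z) * (indicator D z * u z)) \<in> borel_measurable borel"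
      by (rule borel_measurable_times[OF _ u_measurable]) (use g_integrable_compact[OF assms] in auto)
    moreover have "(\<lambda>z. (indicator K z * g z) * (indicator D z * u z)) = (\<lambda>z. indicator K z * (u z * g z))"
      using assms by (auto simp: indicator_def fun_eq_iff)
    ultimately show "(\<lambda>z. indicator K z * (u z * g z)) \<in> borel_measurable lborel" by simp
    show "AE z in lborel. norm (indicator K z * (u z * g z)) \<le> norm (M * (indicator K z * g z))"
    proof (rule AE_I2)
      fix z
      show "norm (indicator K z * (u z * g z)) \<le> norm (M * (indicator K z * g z))"
      proof (cases "z \<in> K")
        case True
        then have "\<bar>u z\<bar> \<le> M" using M(2) assms closure_subset by blast
        then have "\<bar>u z\<bar> * \<bar>g z\<bar> \<le> M * \<bar>g z\<bar>" by (intro mult_right_mono) auto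
        then show ?thesis using True M(1) by (simp add: abs_mult)
      qed simp
    qed
  qed
qed

lemma green_test_split:
  assumes "test_function D \<psi>"
  shows "(LBINT z. indicator D z * (g z * laplacian \<psi> z)) = \<psi> w + (LBINT z. indicator D z * (u z * g z * \<psi> z))"
proof -
  have sm: "smooth_real_on UNIV \<psi>" using assms by (simp add: test_function_def)
  obtain G A B where c: "c2 UNIV \<psi> G A B" using smooth_c2[OF sm] by blast
  note cc = c2_continuous_on[OF c]
  have L: "laplacian \<psi> = (\<lambda>z. Re (A z) + Im (B z))" using c2_laplacian[OF c] by auto
  have Lc: "continuous_on UNIV (laplacian \<psi>)" unfolding L by (intro continuous_intros cc)
  have "(LBINT z. indicator D z * (g z * laplacian \<psi> z)) - (LBINT z. indicator D z * (g z * (u z * \<psi> z)))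
    = (LBINT z. indicator D z * (g z * laplacian \<psi> z) - indicator D z * (g z * (u z * \<psi> z)))"
    using g_continuous_integrable(1)[OF Lc] g_continuous_integrable(2)[OF cc(1)] by simp
  also have "\<dots> = \<psi> w" using green_test[OF assms] by (simp add: algebra_simps)
  finally show ?thesis by (simp add: algebra_simps)
qed

text \<open>In the sense of distributions \<Delta>g is u g plus a unit point mass at
  \<open>w\<close>. The mass has the favourable sign, so \<Delta>g \<ge> u g, and u g \<ge> 0
  wherever g is positive.\<close>

lemma g_nonpos:
  assumes "z \<in> D - {w}" shows "g z \<le> 0"
proof (rule weak_maximum_principle[OF open_D bounded_D g_cont w_notin_frontier])
  show "weakly_subharmonic D g (\<lambda>z. u z * g z)"
    unfolding weakly_subharmonic_def using green_test_split by fastforce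
qed (use assms g_frontier g_integrable_compact ug_integrable_compact u_nonneg in auto)

text \<open>The barrier is a multiple of \<open>1 - exp ((R\<^sup>2 - |z - y|\<^sup>2) / R\<^sup>2)\<close>, which is superharmonic
  and nonnegative for \<open>|z - y| \<ge> R\<close>.\<close>

lemma barrier_bound:
  assumes R: "0 < R" and r: "0 < r" "cball w (2 * r) \<subseteq> D"
    and M: "0 < M" "\<And>z. z \<in> closure D \<Longrightarrow> z \<notin> ball w r \<Longrightarrow> \<bar>g z\<bar> \<le> M"
    and y: "ball y R \<inter> D = {}" and z: "z \<in> D - cball w r"
  shows "\<bar>g z\<bar> \<le> M / (1 - exp ((R\<^sup>2 - (R + r)\<^sup>2) / R\<^sup>2)) / R\<^sup>2 * ((norm (z - y))\<^sup>2 - R\<^sup>2)"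
proof -
  define bm where "bm = 1 - exp ((R\<^sup>2 - (R + r)\<^sup>2) / R\<^sup>2)"
  have "R\<^sup>2 < (R + r)\<^sup>2" using R r by (intro power_strict_mono) auto
  then have bm: "0 < bm" using R unfolding bm_def by (simp add: divide_neg_pos)
  \<comment> \<open>\<open>bm\<close> is the value of the barrier at distance R + r from
    \<open>y\<close>. With this factor the barrier dominates |g| on the circle about
    \<open>w\<close>, the inner part of the boundary of \<Omega>.\<close>
  define C where "C = M / bm"
  have C: "0 < C" using M bm by (simp add: C_def)
  define b where "b = (\<lambda>z. 1 - exp ((R\<^sup>2 - (norm (y - z))\<^sup>2) / R\<^sup>2))"
  have closure_far: "R \<le> norm (y - x)" if "x \<in> closure D" for x
  proof -
    have "ball y R \<inter> closure D = {}" using y by (subst open_Int_closure_eq_empty) auto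
    then show ?thesis using that by (force simp: dist_norm disjoint_iff)
  qed
  have b_nonneg: "0 \<le> b x" if "x \<in> closure D" for x
    using power_mono[OF closure_far[OF that], of 2] R by (simp add: b_def divide_nonpos_pos)
  define \<Omega> where "\<Omega> = D - cball w r"
  have \<Omega>: "open \<Omega>" "bounded \<Omega>" "\<Omega> \<subseteq> D" using open_D bounded_D bounded_subset by (auto simp: \<Omega>_def open_Diff)
  have cl: "closure \<Omega> \<subseteq> closure D - ball w r"
  proof -
    have "closure \<Omega> \<subseteq> closure D" using \<Omega>(3) by (rule closure_mono)
    moreover have "ball w r \<inter> closure \<Omega> = {}"
      by (subst open_Int_closure_eq_empty) (auto simp: \<Omega>_def)
    ultimately show ?thesis by auto
  qed
  have w\<Omega>: "w \<notin> closure \<Omega>" using cl r by auto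
  have bcont: "continuous_on UNIV b" unfolding b_def using R by (intro continuous_intros) auto
  define f where "f = (\<lambda>z. - g z - C * b z)"
  have fr: "f x \<le> 0" if x: "x \<in> frontier \<Omega>" for x
  proof (cases "x \<in> D")
    case False
    have "x \<in> closure D" "x \<notin> ball w r" using x cl by (auto simp: frontier_def)
    then have "g x = 0" using g_frontier closure_D False by auto
    then show ?thesis using b_nonneg[OF \<open>x \<in> closure D\<close>] C by (simp add: f_def)
  next
    case True
    have xc: "x \<in> closure D" "x \<notin> ball w r" using x cl by (auto simp: frontier_def)
    have "x \<notin> \<Omega>" using x \<Omega>(1) by (simp add: frontier_def interior_open)
    then have "x \<in> cball w r" using True by (simp add: \<Omega>_def)
    \<comment> \<open>A point within r of \<open>w\<close> has a disc of radius r inside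
      \<open>D\<close>, disjoint from the exterior disc, so its distance from \<open>y\<close> is at
      least R + r.\<close>
    have "ball x r \<subseteq> cball w (2 * r)"
    proof
      fix p assume "p \<in> ball x r"
      then show "p \<in> cball w (2 * r)" using \<open>x \<in> cball w r\<close> dist_triangle[of w p x] by simp
    qed
    then have "ball y R \<inter> ball x r = {}" using y r(2) by blast
    then have "R + r \<le> norm (y - x)" using disjoint_balls_dist R r(1) by blast
    then have "(R + r)\<^sup>2 \<le> (norm (y - x))\<^sup>2" using R r by (intro power_mono) auto
    then have "bm \<le> b x" using R by (simp add: bm_def b_def divide_right_mono)
    then have "M \<le> C * b x" using bm M(1) by (simp add: C_def pos_le_divide_eq mult.commute mult_left_mono)
    then show ?thesis using M(2)[OF xc] by (simp add: f_def)
  qed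
  have bi: "integrable lborel (\<lambda>z. indicator K z * b z)" if "compact K" for K
    using borel_integrable_compact[OF that continuous_on_subset[OF bcont]] by simp
  \<comment> \<open>On \<Omega>, which avoids the pole, \<Delta>(-g) = -u g, and -C b is
    subharmonic. So \<Delta>f \<ge> -u g, which is nonnegative.\<close>
  have weak: "weakly_subharmonic \<Omega> f (\<lambda>z. - (u z * g z))"
    unfolding weakly_subharmonic_def
  proof (intro allI impI)
    fix \<psi> assume "test_function \<Omega> \<psi> \<and> (\<forall>z. 0 \<le> \<psi> z)"
    then have t: "test_function \<Omega> \<psi>" and \<psi>0: "\<And>z. 0 \<le> \<psi> z" by auto
    have tD: "test_function D \<psi>" using t \<Omega>(3) by (auto simp: test_function_def)
    define S where "S = closure {z. \<psi> z \<noteq> 0}"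
    have S: "compact S" "S \<subseteq> \<Omega>" using t by (auto simp: test_function_def S_def)
    have \<psi>z: "\<psi> x = 0" if "x \<notin> S" for x using that closure_subset[of "{z. \<psi> z \<noteq> 0}"] by (auto simp: S_def)
    have sm: "smooth_real_on UNIV \<psi>" using t by (simp add: test_function_def)
    obtain G A B where c: "c2 UNIV \<psi> G A B" using smooth_c2[OF sm] by blast
    note cc = c2_continuous_on[OF c]
    have L: "laplacian \<psi> = (\<lambda>z. Re (A z) + Im (B z))" using c2_laplacian[OF c] by auto
    have Lc: "continuous_on UNIV (laplacian \<psi>)" unfolding L by (intro continuous_intros cc)
    have "open (- S)" using S by (simp add: compact_imp_closed open_Compl)
    then have L0: "laplacian \<psi> x = 0" if "x \<notin> S" for x
      using c2_zero_region[OF c, of "- S" x] \<psi>z that by (simp add: L)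
    obtain Rb where Rb: "\<And>x. x \<in> S \<Longrightarrow> norm x \<le> Rb" using compact_imp_bounded[OF S(1)] by (meson bounded_iff)
    have \<psi>R: "\<psi> x = 0" if "Rb < norm x" for x using \<psi>z Rb that by fastforce
    have LR: "laplacian \<psi> x = 0" if "Rb < norm x" for x using L0 Rb that by fastforce
    let ?e = "\<lambda>x. exp ((R\<^sup>2 - (norm (y - x))\<^sup>2) / R\<^sup>2)"
    have cr: "c2 UNIV (\<lambda>x. R\<^sup>2 - (norm (y - x))\<^sup>2) (\<lambda>x. - (- 2 * (y - x))) (\<lambda>_. -2) (\<lambda>_. -2 * \<i>)"
      by (rule c2_reflect[OF c2_radial])
    have d0: "((\<lambda>s. exp (s / R\<^sup>2)) has_real_derivative exp (s / R\<^sup>2) / R\<^sup>2) (at s)" for s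
    proof -
      have "((\<lambda>s. exp (s * (1 / R\<^sup>2))) has_real_derivative exp (s * (1 / R\<^sup>2)) * (1 * (1 / R\<^sup>2))) (at s)"
        by (intro DERIV_exp[THEN DERIV_chain2] DERIV_cmult_right DERIV_ident)
      then show ?thesis by simp
    qed
    have d1: "((\<lambda>s. 1 - exp (s / R\<^sup>2)) has_real_derivative - (exp (s / R\<^sup>2) / R\<^sup>2)) (at s)" for s
      using DERIV_diff[OF DERIV_const[of 1] d0] by simp
    have d2: "((\<lambda>s. - (exp (s / R\<^sup>2) / R\<^sup>2)) has_real_derivative - (exp (s / R\<^sup>2) / R\<^sup>2 / R\<^sup>2)) (at s)" for s
      by (intro DERIV_minus DERIV_cdivide d0)
    have d3: "continuous_on UNIV (\<lambda>s. - (exp (s / R\<^sup>2) / R\<^sup>2 / R\<^sup>2))" using R by (intro continuous_intros) auto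
    note cb = c2_compose[OF cr d1 d2 d3]
    \<comment> \<open>The Laplacian of the barrier. Its last factor is nonpositive on the closure of
      \<open>D\<close>, which keeps distance at least R from \<open>y\<close>.\<close>
    let ?lb = "\<lambda>x. 4 * ?e x / R\<^sup>2 * (1 - (norm (y - x))\<^sup>2 / R\<^sup>2)"
    have lb_eq: "Re (- (?e x / R\<^sup>2) *\<^sub>R -2 + Re (- (- 2 * (y - x))) *\<^sub>R (- (?e x / R\<^sup>2 / R\<^sup>2) *\<^sub>R (- (- 2 * (y - x))))) +
      Im (- (?e x / R\<^sup>2) *\<^sub>R (-2 * \<i>) + Im (- (- 2 * (y - x))) *\<^sub>R (- (?e x / R\<^sup>2 / R\<^sup>2) *\<^sub>R (- (- 2 * (y - x))))) = ?lb x" for x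
    proof -
      have "Re (- k *\<^sub>R -2 + Re (- (- 2 * z)) *\<^sub>R (- j *\<^sub>R (- (- 2 * z)))) +
        Im (- k *\<^sub>R (-2 * \<i>) + Im (- (- 2 * z)) *\<^sub>R (- j *\<^sub>R (- (- 2 * z)))) = 4 * k - 4 * j * (norm z)\<^sup>2" for k j z
        unfolding cmod_power2 by (simp add: power2_eq_square algebra_simps)
      then show ?thesis by (simp only:) (simp add: right_diff_distrib)
    qed
    have gi: "(LBINT x. \<psi> x * ?lb x) = (LBINT x. b x * laplacian \<psi> x)"
      using Green_identity[OF c \<psi>R cb] unfolding lb_eq L b_def by simp
    have "(LBINT x. \<psi> x * ?lb x) \<le> 0"
    proof -
      have "\<psi> x * ?lb x \<le> 0" for x
      proof (cases "x \<in> S")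
        case True
        then have "x \<in> closure D" using S \<Omega>(3) closure_subset by blast
        from power_mono[OF closure_far[OF this], of 2] R
        have "1 - (norm (y - x))\<^sup>2 / R\<^sup>2 \<le> 0" by (simp add: pos_le_divide_eq)
        then have "?lb x \<le> 0" using R by (intro mult_nonneg_nonpos) auto
        then show ?thesis by (rule mult_nonneg_nonpos[OF \<psi>0])
      qed (simp add: \<psi>z)
      then have "0 \<le> (LBINT x. - (\<psi> x * ?lb x))" by (intro Bochner_Integration.integral_nonneg) auto
      then show ?thesis by simp
    qed
    then have bL: "(LBINT x. b x * laplacian \<psi> x) \<le> 0" using gi by simp
    have 1: "integrable lborel (\<lambda>z. indicator D z * (g z * laplacian \<psi> z))"
      by (rule g_continuous_integrable(1)[OF Lc])
    have 2: "integrable lborel (\<lambda>x. b x * laplacian \<psi> x)"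
      by (rule integrable_of_compact_support[of _ Rb]) (auto intro!: continuous_intros bcont Lc simp: LR)
    have "indicator \<Omega> x * (f x * laplacian \<psi> x) = - (indicator D x * (g x * laplacian \<psi> x)) - C * (b x * laplacian \<psi> x)" for x
    proof (cases "x \<in> S")
      case True
      then show ?thesis using S \<Omega>(3) by (auto simp: f_def indicator_def algebra_simps)
    qed (simp add: L0)
    then have "(LBINT x. indicator \<Omega> x * (f x * laplacian \<psi> x))
      = - (LBINT x. indicator D x * (g x * laplacian \<psi> x)) - C * (LBINT x. b x * laplacian \<psi> x)"
      using 1 2 by simp
    moreover have "\<psi> w = 0"
    proof (rule \<psi>z)
      show "w \<notin> S" using S(2) r by (auto simp: \<Omega>_def)
    qed
    moreover
    have "indicator \<Omega> x * (- (u x * g x) * \<psi> x) = - (indicator D x * (u x * g x * \<psi> x))" for x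
    proof (cases "x \<in> S")
      case True
      then show ?thesis using S \<Omega>(3) by (auto simp: indicator_def)
    qed (simp add: \<psi>z)
    then have "(LBINT x. indicator \<Omega> x * (- (u x * g x) * \<psi> x)) = - (LBINT x. indicator D x * (u x * g x * \<psi> x))"
      by (simp only: integral_minus)
    moreover have "C * (LBINT x. b x * laplacian \<psi> x) \<le> 0" using bL C by (simp add: mult_nonneg_nonpos)
    ultimately show "(LBINT z. indicator \<Omega> z * (- (u z * g z) * \<psi> z)) \<le> (LBINT z. indicator \<Omega> z * (f z * laplacian \<psi> z))"
      using green_test_split[OF tD] by linarith
  qed
  have zz: "z \<in> \<Omega> - {w}" using z r by (auto simp: \<Omega>_def)
  have "f z \<le> 0"
  proof (rule weak_maximum_principle[OF \<Omega>(1,2) _ _ fr _ _ _ weak zz])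
    show "continuous_on (closure \<Omega> - {w}) f" unfolding f_def
      using cl r by (intro continuous_intros continuous_on_subset[OF g_cont] continuous_on_subset[OF bcont]) auto
    show "w \<notin> frontier \<Omega>" using w\<Omega> by (simp add: frontier_def)
    show "integrable lborel (\<lambda>z. indicator K z * f z)" if "compact K" "K \<subseteq> \<Omega>" for K
    proof -
      have "integrable lborel (\<lambda>z. - (indicator K z * g z) - C * (indicator K z * b z))"
        using g_integrable_compact[OF that(1)] bi[OF that(1)] that(2) \<Omega>(3) by auto
      then show ?thesis by (simp add: f_def algebra_simps)
    qed
    show "integrable lborel (\<lambda>z. indicator K z * - (u z * g z))" if "compact K" "K \<subseteq> \<Omega>" for K
      using ug_integrable_compact[OF that(1)] that(2) \<Omega>(3) by auto
    show "0 \<le> - (u x * g x)" if "x \<in> \<Omega> - {w}" "0 < f x" for x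
      using that g_nonpos[of x] u_nonneg[of x] \<Omega>(3) by (auto simp: mult_nonneg_nonpos)
  qed
  then have "- g z \<le> C * b z" by (simp add: f_def)
  \<comment> \<open>From 1 - exp (-s) \<le> s with s = (|z - y|^2 - R^2) / R^2: the barrier decays
    at least linearly towards the exterior disc.\<close>
  also have "\<dots> \<le> C * (((norm (z - y))\<^sup>2 - R\<^sup>2) / R\<^sup>2)"
  proof (rule mult_left_mono)
    have "1 + (R\<^sup>2 - (norm (y - z))\<^sup>2) / R\<^sup>2 \<le> exp ((R\<^sup>2 - (norm (y - z))\<^sup>2) / R\<^sup>2)" by (rule exp_ge_add_one_self)
    moreover have "((norm (z - y))\<^sup>2 - R\<^sup>2) / R\<^sup>2 = - ((R\<^sup>2 - (norm (y - z))\<^sup>2) / R\<^sup>2)"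
      by (simp add: norm_minus_commute[of y z] minus_divide_left)
    ultimately show "b z \<le> ((norm (z - y))\<^sup>2 - R\<^sup>2) / R\<^sup>2"
      unfolding b_def by linarith
  qed (use C in simp)
  finally have "- g z \<le> C / R\<^sup>2 * ((norm (z - y))\<^sup>2 - R\<^sup>2)" by simp
  then show ?thesis using g_nonpos[of z] zz \<Omega>(3) by (auto simp: C_def bm_def)
qed

text \<open>Of the exterior disc the constants involve only its radius, so one choice serves all
  boundary points that admit an exterior disc of radius \<open>R\<close>.\<close>

lemma boundary_bound:
  assumes "0 < R"
  obtains C r where "0 < C" "0 < r" "cball w r \<subseteq> D"
    "\<And>y z. ball y R \<inter> D = {} \<Longrightarrow> z \<in> D - cball w r \<Longrightarrow> \<bar>g z\<bar> \<le> C * ((norm (z - y))\<^sup>2 - R\<^sup>2)"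
proof -
  obtain r0 where r0: "0 < r0" "cball w r0 \<subseteq> D" using open_D w_in_D open_contains_cball by blast
  define r where "r = r0 / 2"
  have r: "0 < r" "cball w (2 * r) \<subseteq> D" using r0 by (auto simp: r_def)
  obtain M where M: "0 < M" "\<And>z. z \<in> closure D \<Longrightarrow> z \<notin> ball w r \<Longrightarrow> \<bar>g z\<bar> \<le> M"
    using g_bounded_away[OF r(1)] by blast
  have "R\<^sup>2 < (R + r)\<^sup>2" using assms r by (intro power_strict_mono) auto
  then have "0 < 1 - exp ((R\<^sup>2 - (R + r)\<^sup>2) / R\<^sup>2)" using assms by (simp add: divide_neg_pos)
  then show ?thesis
    using barrier_bound[OF assms r M] M(1) assms r subset_cball[of r "2 * r" w]
    by (intro that[of "M / (1 - exp ((R\<^sup>2 - (R + r)\<^sup>2) / R\<^sup>2)) / R\<^sup>2" r]) auto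
qed

end

section \<open>Tubular coordinates\<close>

text \<open>A nonzero value would keep its sign nearby and put \<open>p\<close> into the interior of
  \<open>S\<close> or of its complement.\<close>

lemma local_defining_zero:
  assumes N: "open N" "p \<in> N" and S: "S \<inter> N = {y \<in> N. \<phi> y < 0}" and c: "isCont \<phi> p"
    and p: "p \<in> frontier S"
  shows "\<phi> p = (0::real)"
proof (rule ccontr)
  assume "\<phi> p \<noteq> 0"
  have t: "(\<phi> \<longlongrightarrow> \<phi> p) (nhds p)" using c by (simp add: isCont_def tendsto_at_iff_tendsto_nhds)
  consider "\<phi> p < 0" | "0 < \<phi> p" using \<open>\<phi> p \<noteq> 0\<close> by linarith
  then show False
  proof cases
    case 1
    then have "\<forall>\<^sub>F x in nhds p. \<phi> x < 0" by (rule order_tendstoD(2)[OF t])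
    then have "\<forall>\<^sub>F x in nhds p. x \<in> S"
      using eventually_nhds_in_open[OF N]
    proof eventually_elim
      case (elim x)
      then have "x \<in> S \<inter> N" unfolding S by auto
      then show ?case by blast
    qed
    then have "p \<in> interior S" by (auto simp: eventually_nhds interior_def)
    then show False using p by (simp add: frontier_def)
  next
    case 2
    then have "\<forall>\<^sub>F x in nhds p. 0 < \<phi> x" by (rule order_tendstoD(1)[OF t])
    then have "\<forall>\<^sub>F x in nhds p. x \<notin> S"
      using eventually_nhds_in_open[OF N]
    proof eventually_elim
      case (elim x)
      then have "x \<notin> S \<inter> N" unfolding S by auto
      then show ?case using elim by blast
    qed
    then obtain T where "open T" "p \<in> T" "T \<inter> S = {}" by (auto simp: eventually_nhds)
    then have "p \<notin> closure S" using open_Int_closure_eq_empty by blast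
    then show False using p by (simp add: frontier_def)
  qed
qed

text \<open>If the unit gradients differ, their difference is a direction in which one function
  decreases and the other increases, although both have the same sublevel set. Normals and
  velocities defined through some defining function are thus independent of its choice.\<close>

lemma gradient_direction_unique:
  fixes p :: "'a::euclidean_space"
  assumes "open N" "p \<in> N" "\<And>x. x \<in> N \<Longrightarrow> \<phi> x < 0 \<longleftrightarrow> \<psi> x < 0"
    and G: "GDERIV \<phi> p :> G" "G \<noteq> 0" "\<phi> p = 0" and H: "GDERIV \<psi> p :> H" "H \<noteq> 0" "\<psi> p = 0"
  shows "G /\<^sub>R norm G = H /\<^sub>R norm H"
proof (rule ccontr)
  assume ne: "G /\<^sub>R norm G \<noteq> H /\<^sub>R norm H"
  define m n where "m = G /\<^sub>R norm G" and "n = H /\<^sub>R norm H"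
  have mn: "m \<bullet> m = 1" "n \<bullet> n = 1" using G H unfolding norm_eq_1[symmetric] by (auto simp: m_def n_def)
  have "0 < (norm (n - m))\<^sup>2" using ne by (simp add: m_def n_def)
  also have "(norm (n - m))\<^sup>2 = 2 - 2 * (m \<bullet> n)"
    unfolding power2_norm_eq_inner by (simp add: inner_diff_left inner_diff_right inner_commute[of n m] mn)
  finally have lt: "m \<bullet> n < 1" by simp
  define d where "d = n - m"
  have Gm: "G = norm G *\<^sub>R m" and Hn: "H = norm H *\<^sub>R n" using G H by (auto simp: m_def n_def)
  have "m \<bullet> d < 0" "0 < n \<bullet> d" using lt
    by (simp_all add: d_def inner_diff_right inner_commute[of n m] mn)
  then have "G \<bullet> d < 0" "0 < H \<bullet> d" using G(2) H(2)
    by (subst Gm Hn, simp add: mult_pos_neg)+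
  have "((\<lambda>s. \<phi> (p + s *\<^sub>R d)) has_real_derivative (G \<bullet> d)) (at 0)"
    "((\<lambda>s. \<psi> (p + s *\<^sub>R d)) has_real_derivative (H \<bullet> d)) (at 0)"
    using G H by (auto intro!: GDERIV_DERIV_line)
  from DERIV_neg_dec_right[OF this(1) \<open>G \<bullet> d < 0\<close>] DERIV_pos_inc_right[OF this(2) \<open>0 < H \<bullet> d\<close>]
  obtain e1 e2 where e: "0 < e1" "0 < e2" "\<And>h. 0 < h \<Longrightarrow> h < e1 \<Longrightarrow> \<phi> (p + h *\<^sub>R d) < 0"
    "\<And>h. 0 < h \<Longrightarrow> h < e2 \<Longrightarrow> 0 < \<psi> (p + h *\<^sub>R d)"
    using G(3) H(3) by auto
  have "((\<lambda>h. p + h *\<^sub>R d) \<longlongrightarrow> p + 0 *\<^sub>R d) (at_right 0)" by (intro tendsto_intros)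
  then have "\<forall>\<^sub>F h in at_right 0. p + h *\<^sub>R d \<in> N" using assms(1,2) topological_tendstoD by fastforce
  moreover have "\<forall>\<^sub>F h in at_right 0. 0 < h \<and> h < min e1 e2"
    using e by (auto simp: eventually_at_right_less intro!: eventually_conj eventually_at_rightI[of 0 "min e1 e2"])
  ultimately have "\<forall>\<^sub>F h in at_right (0::real). False"
  proof eventually_elim
    case (elim h)
    then show ?case using e(3)[of h] e(4)[of h] assms(3)[of "p + h *\<^sub>R d"] by auto
  qed
  then show False by simp
qed

text \<open>In finite dimension an injective derivative is invertible, and continuity of the
  derivative as an operator can be checked vector by vector.\<close>

lemma inverse_function_plane:
  fixes f :: "complex \<Rightarrow> complex"
  assumes U: "open U" "x0 \<in> U" and f': "\<And>x. x \<in> U \<Longrightarrow> (f has_derivative f' x) (at x)"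
    and cont: "\<And>h. continuous_on U (\<lambda>x. f' x h)" and inj: "\<And>h. f' x0 h = 0 \<Longrightarrow> h = 0"
  obtains U' V g g' where "open U'" "U' \<subseteq> U" "x0 \<in> U'" "open V" "f x0 \<in> V" "homeomorphism U' V f g"
    "\<And>y. y \<in> V \<Longrightarrow> (g has_derivative g' y) (at y)" "\<And>y. y \<in> V \<Longrightarrow> g' y = inv (f' (g y))"
    "\<And>y. y \<in> V \<Longrightarrow> bij (f' (g y))"
proof -
  have bl: "bounded_linear (f' x)" if "x \<in> U" for x using f'[OF that] by (rule has_derivative_bounded_linear)
  define F where "F = (\<lambda>x. Blinfun (f' x))"
  have F: "blinfun_apply (F x) = f' x" if "x \<in> U" for x
    using bl[OF that] by (simp add: F_def bounded_linear_Blinfun_apply)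
  have cF: "continuous_on U F"
  proof (rule continuous_on_blinfun_componentwise)
    show "continuous_on U (\<lambda>x. blinfun_apply (F x) i)" for i
      using cont[of i] by (rule continuous_on_eq) (simp add: F)
  qed
  have lin: "linear (f' x0)" using bl[OF U(2)] by (rule bounded_linear.linear)
  have "inj (f' x0)" using inj lin by (simp add: linear_injective_0)
  then obtain k where k: "linear k" "k \<circ> f' x0 = id" using linear_injective_left_inverse[OF lin] by blast
  have "Blinfun k o\<^sub>L F x0 = id_blinfun"
    using k U(2) by (intro blinfun_eqI) (simp add: F bounded_linear_Blinfun_apply linear_conv_bounded_linear[symmetric] pointfree_idE)
  from inverse_function_theorem[OF U(1) _ cF U(2) this, of f]
  obtain U' V g g' where *: "open U'" "U' \<subseteq> U" "x0 \<in> U'" "open V" "f x0 \<in> V" "homeomorphism U' V f g"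
    "\<And>y. y \<in> V \<Longrightarrow> (g has_derivative (g' y)) (at y)"
    "\<And>y. y \<in> V \<Longrightarrow> g' y = inv (blinfun_apply (F(g y)))" "\<And>y. y \<in> V \<Longrightarrow> bij (blinfun_apply (F(g y)))"
    using f' F by (metis (no_types, lifting))
  have "g y \<in> U" if "y \<in> V" for y using *(2,6) that by (auto simp: homeomorphism_def)
  then show ?thesis using that[OF *(1-7)] *(8,9) F by simp
qed

definition square :: "real \<Rightarrow> complex set" where
  "square a = {\<zeta>. \<bar>Re \<zeta>\<bar> < a \<and> \<bar>Im \<zeta>\<bar> < a}"

lemma open_square: "open (square a)"
  unfolding square_def by (intro open_Collect_conj open_Collect_less continuous_intros)

lemma square_subset_ball:
  assumes "open U" "0 \<in> U" obtains a where "0 < a" "\<And>\<zeta>. \<bar>Re \<zeta>\<bar> \<le> a \<Longrightarrow> \<bar>Im \<zeta>\<bar> \<le> a \<Longrightarrow> \<zeta> \<in> U"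
proof -
  obtain e where e: "0 < e" "ball 0 e \<subseteq> U" using assms open_contains_ball by blast
  show ?thesis
  proof (rule that[of "e/3"])
    fix \<zeta> assume "\<bar>Re \<zeta>\<bar> \<le> e/3" "\<bar>Im \<zeta>\<bar> \<le> e/3"
    then have "norm \<zeta> < e" using cmod_le[of \<zeta>] e by linarith
    then show "\<zeta> \<in> U" using e by auto
  qed (use e in simp)
qed

lemma inner_i_i: "(\<i> * x) \<bullet> (\<i> * y) = x \<bullet> (y::complex)"
  by (simp add: inner_complex_def)

text \<open>The map formed by \<phi> and the tangential coordinate at \<open>z0\<close> is a local
  diffeomorphism. Its inverse on the imaginary axis parametrises the level set.\<close>

lemma level_curve:
  assumes c: "c2 N \<phi> G A B" and z0: "z0 \<in> N" "\<phi> z0 = 0" "G z0 \<noteq> 0"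
  obtains d \<gamma> where "0 < d" "\<gamma> 0 = z0" "\<And>y. \<bar>y\<bar> < d \<Longrightarrow> \<gamma> y \<in> N \<and> \<phi> (\<gamma> y) = 0 \<and> 0 < G (\<gamma> y) \<bullet> G z0"
    "\<And>y. \<bar>y\<bar> < d \<Longrightarrow> (\<gamma> has_vector_derivative (\<i> * G (\<gamma> y)) /\<^sub>R (G (\<gamma> y) \<bullet> G z0)) (at y)"
proof -
  define \<tau> where "\<tau> = \<i> * G z0"
  define F where "F = (\<lambda>z. Complex (\<phi> z) ((z - z0) \<bullet> \<tau>))"
  define F' where "F' = (\<lambda>z h. Complex (h \<bullet> G z) (h \<bullet> \<tau>))"
  note cc = c2_continuous_on[OF c]
  define U where "U = {z \<in> N. 0 < G z \<bullet> G z0}"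
  have U: "open U"
  proof -
    have "continuous_on N (\<lambda>z. G z \<bullet> G z0)" by (intro continuous_intros cc)
    then have "open (N \<inter> (\<lambda>z. G z \<bullet> G z0) -` {0<..})"
      using c2_open[OF c] by (intro continuous_open_preimage) auto
    moreover have "U = N \<inter> (\<lambda>z. G z \<bullet> G z0) -` {0<..}" by (auto simp: U_def)
    ultimately show ?thesis by simp
  qed
  have zU: "z0 \<in> U" using z0 by (simp add: U_def)
  have FF': "(F has_derivative F' z) (at z)" if "z \<in> U" for z
  proof -
    have "(\<phi> has_derivative (\<lambda>h. h \<bullet> G z)) (at z)"
      using c2_GDERIV[OF c] that by (simp add: gderiv_def U_def)
    then have "((\<lambda>z. of_real (\<phi> z) + \<i> * of_real ((z - z0) \<bullet> \<tau>)) has_derivative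
      (\<lambda>h. of_real (h \<bullet> G z) + \<i> * of_real (h \<bullet> \<tau>))) (at z)"
      by (auto intro!: derivative_eq_intros)
    then show ?thesis by (simp add: F_def F'_def Complex_eq)
  qed
  have cF': "continuous_on U (\<lambda>z. F' z h)" for h
    unfolding F'_def by (intro continuous_intros continuous_on_subset[OF cc(2)]) (auto simp: U_def)
  have inj: "h = 0" if "F' z0 h = 0" for h
  proof -
    have h: "h \<bullet> G z0 = 0" "h \<bullet> (\<i> * G z0) = 0" using that by (auto simp: F'_def \<tau>_def complex_eq_iff)
    \<comment> \<open>\<open>G z0\<close> and its rotation by a right angle form an orthogonal basis
      of the plane.\<close>
    have "(norm h)\<^sup>2 * (norm (G z0))\<^sup>2 = (h \<bullet> G z0) * (h \<bullet> G z0) + (h \<bullet> (\<i> * G z0)) * (h \<bullet> (\<i> * G z0))"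
      unfolding cmod_power2 by (simp add: inner_complex_def algebra_simps power2_eq_square)
    then show ?thesis using h z0(3) by simp
  qed
  obtain U' V g g' where g: "open U'" "U' \<subseteq> U" "z0 \<in> U'" "open V" "F z0 \<in> V" "homeomorphism U' V F g"
    "\<And>y. y \<in> V \<Longrightarrow> (g has_derivative g' y) (at y)" "\<And>y. y \<in> V \<Longrightarrow> g' y = inv (F' (g y))"
    "\<And>y. y \<in> V \<Longrightarrow> bij (F' (g y))"
    by (rule inverse_function_plane[OF U zU FF' cF' inj]) (assumption | rule that)+
  have F0: "F z0 = 0" using z0 by (simp add: F_def complex_eq_iff)
  then obtain d where d: "0 < d" "\<And>\<zeta>. \<bar>Re \<zeta>\<bar> \<le> d \<Longrightarrow> \<bar>Im \<zeta>\<bar> \<le> d \<Longrightarrow> \<zeta> \<in> V"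
    using square_subset_ball[OF g(4)] g(5) by metis
  define \<gamma> where "\<gamma> = (\<lambda>y. g (Complex 0 y))"
  have V: "Complex 0 y \<in> V" if "\<bar>y\<bar> < d" for y using d that by simp
  have gU: "\<gamma> y \<in> U" "F (\<gamma> y) = Complex 0 y" if "\<bar>y\<bar> < d" for y
    using g(2,6) V[OF that] by (auto simp: \<gamma>_def homeomorphism_def)
  show ?thesis
  proof
    show "0 < d" by fact
    have "g (F z0) = z0" using g(3,6) by (auto simp: homeomorphism_def)
    then show "\<gamma> 0 = z0" by (simp add: \<gamma>_def F0 zero_complex.code)
    show "\<gamma> y \<in> N \<and> \<phi> (\<gamma> y) = 0 \<and> 0 < G (\<gamma> y) \<bullet> G z0" if "\<bar>y\<bar> < d" for y
      using gU[OF that] by (auto simp: U_def F_def)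
    show "(\<gamma> has_vector_derivative (\<i> * G (\<gamma> y)) /\<^sub>R (G (\<gamma> y) \<bullet> G z0)) (at y)" if y: "\<bar>y\<bar> < d" for y
    proof -
      \<comment> \<open>The tangent is the vector that \<open>F'\<close> sends to
        \<open>\<i>\<close>: a multiple of the rotated gradient, scaled to have tangential
        coordinate 1.\<close>
      let ?h = "(\<i> * G (\<gamma> y)) /\<^sub>R (G (\<gamma> y) \<bullet> G z0)"
      have pos: "0 < G (\<gamma> y) \<bullet> G z0" using gU[OF y] by (auto simp: U_def)
      have "F' (\<gamma> y) ?h = \<i>"
        using pos unfolding F'_def \<tau>_def inner_scaleR_left inner_i_i
        by (simp add: complex_eq_iff inner_complex_def)
      then have "inv (F' (\<gamma> y)) \<i> = ?h"
        using g(9)[OF V[OF y]] by (metis \<gamma>_def bij_inv_eq_iff)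
      then have h: "g' (Complex 0 y) \<i> = ?h" using g(8)[OF V[OF y]] by (simp add: \<gamma>_def)
      have "((\<lambda>y. Complex 0 y) has_derivative (\<lambda>s. s *\<^sub>R \<i>)) (at y)"
      proof -
        have "((\<lambda>y. of_real y * \<i>) has_derivative (\<lambda>s. of_real s * \<i>)) (at y)" by (auto intro!: derivative_eq_intros)
        moreover have "(\<lambda>y. of_real y * \<i>) = (\<lambda>y. Complex 0 y)" "(\<lambda>s. of_real s * \<i>) = (\<lambda>s. s *\<^sub>R \<i>)"
          by (auto simp: complex_eq_iff scaleR_conv_of_real)
        ultimately show ?thesis by simp
      qed
      from has_derivative_compose[OF this g(7)[OF V[OF y]]]
      have "(\<gamma> has_derivative (\<lambda>s. g' (Complex 0 y) (s *\<^sub>R \<i>))) (at y)" by (simp add: \<gamma>_def)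
      moreover have "g' (Complex 0 y) (s *\<^sub>R \<i>) = s *\<^sub>R ?h" for s
        using g(7)[OF V[OF y]] h by (metis has_derivative_bounded_linear linear_cmul bounded_linear.linear)
      ultimately show ?thesis by (simp add: has_vector_derivative_def)
    qed
  qed
qed

text \<open>The chart leaves the level curve along the unnormalised gradient. It is differentiable
  because \<gamma> and \<open>G\<close> are, and here the second derivatives of \<phi> enter. The
  derivative is controlled on the closed square so that the Jacobian is bounded on the open
  one.\<close>

lemma tubular_chart:
  assumes c: "c2 N \<phi> G A B" and z0: "z0 \<in> N" "\<phi> z0 = 0" "G z0 \<noteq> 0" and W: "open W" "z0 \<in> W"
  obtains a P P' \<gamma> where "0 < a" "\<gamma> 0 = z0" "P 0 = z0"
    "\<And>\<zeta>. \<bar>Re \<zeta>\<bar> \<le> a \<Longrightarrow> \<bar>Im \<zeta>\<bar> \<le> a \<Longrightarrow> (P has_derivative P' \<zeta>) (at \<zeta>)"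
    "continuous_on {\<zeta>. \<bar>Re \<zeta>\<bar> \<le> a \<and> \<bar>Im \<zeta>\<bar> \<le> a} (\<lambda>\<zeta>. jacobian (P' \<zeta>))"
    "inj_on P (square a)" "\<And>T. open T \<Longrightarrow> T \<subseteq> square a \<Longrightarrow> open (P ` T)"
    "\<And>\<zeta>. \<bar>Re \<zeta>\<bar> \<le> a \<Longrightarrow> \<bar>Im \<zeta>\<bar> \<le> a \<Longrightarrow> P \<zeta> \<in> W \<inter> N"
    "\<And>\<zeta>. P \<zeta> = \<gamma> (Im \<zeta>) + Re \<zeta> *\<^sub>R G (\<gamma> (Im \<zeta>))"
    "\<And>y. \<bar>y\<bar> \<le> a \<Longrightarrow> \<phi> (\<gamma> y) = 0"
proof -
  obtain d \<gamma> where d: "0 < d" "\<gamma> 0 = z0" "\<And>y. \<bar>y\<bar> < d \<Longrightarrow> \<gamma> y \<in> N \<and> \<phi> (\<gamma> y) = 0 \<and> 0 < G (\<gamma> y) \<bullet> G z0"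
    "\<And>y. \<bar>y\<bar> < d \<Longrightarrow> (\<gamma> has_vector_derivative (\<i> * G (\<gamma> y)) /\<^sub>R (G (\<gamma> y) \<bullet> G z0)) (at y)"
    using level_curve[OF c z0] by metis
  note cc = c2_continuous_on[OF c]
  define \<gamma>' where "\<gamma>' = (\<lambda>y. (\<i> * G (\<gamma> y)) /\<^sub>R (G (\<gamma> y) \<bullet> G z0))"
  define \<nu>' where "\<nu>' = (\<lambda>y. Complex (\<gamma>' y \<bullet> A (\<gamma> y)) (\<gamma>' y \<bullet> B (\<gamma> y)))"
  define P where "P = (\<lambda>\<zeta>. \<gamma> (Im \<zeta>) + Re \<zeta> *\<^sub>R G (\<gamma> (Im \<zeta>)))"
  define P' where "P' = (\<lambda>\<zeta> h. Im h *\<^sub>R \<gamma>' (Im \<zeta>) + (Re \<zeta> *\<^sub>R (Im h *\<^sub>R \<nu>' (Im \<zeta>)) + Re h *\<^sub>R G (\<gamma> (Im \<zeta>))))"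
  define U where "U = {\<zeta>. \<bar>Im \<zeta>\<bar> < d}"
  have U: "open U" "0 \<in> U" using d by (auto simp: U_def intro!: open_Collect_less continuous_intros)
  have der\<gamma>: "((\<lambda>\<zeta>. \<gamma> (Im \<zeta>)) has_derivative (\<lambda>h. Im h *\<^sub>R \<gamma>' (Im \<zeta>))) (at \<zeta>)" if "\<zeta> \<in> U" for \<zeta>
  proof (rule has_derivative_compose[of Im Im])
    show "(Im has_derivative Im) (at \<zeta>)" by (rule bounded_linear_imp_has_derivative) (rule bounded_linear_Im)
    show "(\<gamma> has_derivative (\<lambda>s. s *\<^sub>R \<gamma>' (Im \<zeta>))) (at (Im \<zeta>))"
      using d(4)[of "Im \<zeta>"] that by (simp add: U_def has_vector_derivative_def \<gamma>'_def)
  qed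
  have der: "(P has_derivative P' \<zeta>) (at \<zeta>)" if "\<zeta> \<in> U" for \<zeta>
  proof -
    have N: "\<gamma> (Im \<zeta>) \<in> N" using d(3) that by (simp add: U_def)
    have "((\<lambda>z. Re (G z)) has_derivative (\<lambda>h. h \<bullet> A (\<gamma> (Im \<zeta>)))) (at (\<gamma> (Im \<zeta>)))"
      "((\<lambda>z. Im (G z)) has_derivative (\<lambda>h. h \<bullet> B (\<gamma> (Im \<zeta>)))) (at (\<gamma> (Im \<zeta>)))"
      using c N by (auto simp: c2_def gderiv_def)
    from has_derivative_compose[OF der\<gamma>[OF that] this(1)] has_derivative_compose[OF der\<gamma>[OF that] this(2)]
    have r: "((\<lambda>\<zeta>. Re (G (\<gamma> (Im \<zeta>)))) has_derivative (\<lambda>h. (Im h *\<^sub>R \<gamma>' (Im \<zeta>)) \<bullet> A (\<gamma> (Im \<zeta>)))) (at \<zeta>)"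
      "((\<lambda>\<zeta>. Im (G (\<gamma> (Im \<zeta>)))) has_derivative (\<lambda>h. (Im h *\<^sub>R \<gamma>' (Im \<zeta>)) \<bullet> B (\<gamma> (Im \<zeta>)))) (at \<zeta>)"
      by auto
    have "((\<lambda>\<zeta>. of_real (Re (G (\<gamma> (Im \<zeta>)))) + \<i> * of_real (Im (G (\<gamma> (Im \<zeta>))))) has_derivative
      (\<lambda>h. of_real ((Im h *\<^sub>R \<gamma>' (Im \<zeta>)) \<bullet> A (\<gamma> (Im \<zeta>))) + \<i> * of_real ((Im h *\<^sub>R \<gamma>' (Im \<zeta>)) \<bullet> B (\<gamma> (Im \<zeta>))))) (at \<zeta>)"
      by (intro has_derivative_add has_derivative_mult_right has_derivative_of_real r)
    moreover have "of_real ((Im h *\<^sub>R \<gamma>' (Im \<zeta>)) \<bullet> A (\<gamma> (Im \<zeta>))) + \<i> * of_real ((Im h *\<^sub>R \<gamma>' (Im \<zeta>)) \<bullet> B (\<gamma> (Im \<zeta>)))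
      = Im h *\<^sub>R \<nu>' (Im \<zeta>)" for h
      by (simp add: \<nu>'_def complex_eq_iff)
    ultimately have G: "((\<lambda>\<zeta>. G (\<gamma> (Im \<zeta>))) has_derivative (\<lambda>h. Im h *\<^sub>R \<nu>' (Im \<zeta>))) (at \<zeta>)"
      by (simp add: complex_eq[symmetric])
    have R: "(Re has_derivative Re) (at \<zeta>)" by (rule bounded_linear_imp_has_derivative) (rule bounded_linear_Re)
    show ?thesis unfolding P_def P'_def
      by (rule has_derivative_add[OF der\<gamma>[OF that] has_derivative_scaleR[OF R G]])
  qed
  have contI: "continuous_on U (\<lambda>\<zeta>. \<gamma> (Im \<zeta>))"
    using der\<gamma> by (intro continuous_at_imp_continuous_on) (blast intro: has_derivative_continuous)
  have contN: "continuous_on U (\<lambda>\<zeta>. f (\<gamma> (Im \<zeta>)))" if "continuous_on N f" for f :: "complex \<Rightarrow> complex"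
    by (rule continuous_on_compose2[OF that contI]) (use d(3) in \<open>auto simp: U_def\<close>)
  have c\<gamma>': "continuous_on U (\<lambda>\<zeta>. \<gamma>' (Im \<zeta>))" unfolding \<gamma>'_def
    by (intro continuous_intros contN cc) (use d(3) in \<open>fastforce simp: U_def\<close>)
  have c\<nu>': "continuous_on U (\<lambda>\<zeta>. \<nu>' (Im \<zeta>))" unfolding \<nu>'_def
    by (intro continuous_intros c\<gamma>' contN cc)
  have cP': "continuous_on U (\<lambda>\<zeta>. P' \<zeta> h)" for h
    unfolding P'_def by (intro continuous_intros c\<gamma>' c\<nu>' contN cc)
  \<comment> \<open>At 0 the derivative sends 1 to \<open>G z0\<close> and \<open>\<i>\<close> to a
    nonzero vector orthogonal to it.\<close>
  have inj: "h = 0" if "P' 0 h = 0" for h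
  proof -
    have G2: "0 < G z0 \<bullet> G z0" using z0(3) by simp
    have e: "Im h *\<^sub>R ((\<i> * G z0) /\<^sub>R (G z0 \<bullet> G z0)) + Re h *\<^sub>R G z0 = 0"
      using that d(2) by (simp add: P'_def \<gamma>'_def)
    have "(Im h *\<^sub>R ((\<i> * G z0) /\<^sub>R (G z0 \<bullet> G z0)) + Re h *\<^sub>R G z0) \<bullet> G z0 = Re h * (G z0 \<bullet> G z0)"
      by (simp add: inner_add_left) (simp add: inner_complex_def)
    with e G2 have r: "Re h = 0" by simp
    with e have "Im h *\<^sub>R ((\<i> * G z0) /\<^sub>R (G z0 \<bullet> G z0)) = 0" by simp
    then have "Im h = 0" using G2 z0(3) by simp
    with r show ?thesis by (simp add: complex_eq_iff)
  qed
  obtain U' V Q Q' where Q: "open U'" "U' \<subseteq> U" "0 \<in> U'" "open V" "P 0 \<in> V" "homeomorphism U' V P Q"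
    by (rule inverse_function_plane[OF U der cP' inj]) (assumption | rule that)+
  have P0: "P 0 = z0" using d(2) by (simp add: P_def)
  have cP: "continuous_on U' P" using Q(6) by (simp add: homeomorphism_def)
  have "open (U' \<inter> P -` (W \<inter> N))"
    using W c2_open[OF c] by (intro continuous_open_preimage[OF cP Q(1)]) auto
  moreover have "0 \<in> U' \<inter> P -` (W \<inter> N)" using Q(3) P0 W z0 by auto
  ultimately obtain a where a: "0 < a" "\<And>\<zeta>. \<bar>Re \<zeta>\<bar> \<le> a \<Longrightarrow> \<bar>Im \<zeta>\<bar> \<le> a \<Longrightarrow> \<zeta> \<in> U' \<inter> P -` (W \<inter> N)"
    using square_subset_ball by metis
  have sq: "square a \<subseteq> U'" using a(2) by (auto simp: square_def)
  show ?thesis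
  proof
    show "0 < a" "\<gamma> 0 = z0" "P 0 = z0" by fact+
    show "(P has_derivative P' \<zeta>) (at \<zeta>)" if "\<bar>Re \<zeta>\<bar> \<le> a" "\<bar>Im \<zeta>\<bar> \<le> a" for \<zeta>
      using der a(2)[OF that] Q(2) by auto
    show "continuous_on {\<zeta>. \<bar>Re \<zeta>\<bar> \<le> a \<and> \<bar>Im \<zeta>\<bar> \<le> a} (\<lambda>\<zeta>. jacobian (P' \<zeta>))"
      unfolding jacobian_def using a(2) Q(2) by (intro continuous_intros continuous_on_subset[OF cP']) auto
    show "inj_on P (square a)"
      using Q(6) sq by (metis homeomorphism_def inj_on_subset inj_on_inverseI)
    show "open (P ` T)" if T: "open T" "T \<subseteq> square a" for T
    proof -
      have "P ` T = V \<inter> Q -` T"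
      proof
        show "P ` T \<subseteq> V \<inter> Q -` T" using Q(6) T(2) sq by (auto simp: homeomorphism_def)
        show "V \<inter> Q -` T \<subseteq> P ` T" using Q(6) by (force simp: homeomorphism_def)
      qed
      moreover have "continuous_on V Q" using Q(6) by (simp add: homeomorphism_def)
      ultimately show ?thesis using continuous_open_preimage[OF _ Q(4) T(1)] by simp
    qed
    show "P \<zeta> \<in> W \<inter> N" if "\<bar>Re \<zeta>\<bar> \<le> a" "\<bar>Im \<zeta>\<bar> \<le> a" for \<zeta> using a(2)[OF that] by auto
    show "P \<zeta> = \<gamma> (Im \<zeta>) + Re \<zeta> *\<^sub>R G (\<gamma> (Im \<zeta>))" for \<zeta> by (simp add: P_def)
    show "\<phi> (\<gamma> y) = 0" if "\<bar>y\<bar> \<le> a" for y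
      using a(2)[of "Complex 0 y"] a(1) that Q(2) d(3)[of y] by (auto simp: U_def)
  qed
qed

section \<open>Boundary layers\<close>

definition stretch :: "real \<Rightarrow> complex \<Rightarrow> complex" where
  "stretch e \<zeta> = Complex (e * Re \<zeta>) (Im \<zeta>)"

lemma stretch_simps [simp]: "Re (stretch e \<zeta>) = e * Re \<zeta>" "Im (stretch e \<zeta>) = Im \<zeta>"
  by (simp_all add: stretch_def)

lemma continuous_stretch: "continuous_on S (stretch e)"
  unfolding stretch_def by (intro continuous_intros)

lemma tendsto_stretch: "((\<lambda>e. stretch e \<zeta>) \<longlongrightarrow> Complex 0 (Im \<zeta>)) (at_right 0)"
proof -
  have "((\<lambda>e. stretch e \<zeta>) \<longlongrightarrow> Complex (0 * Re \<zeta>) (Im \<zeta>)) (at_right 0)"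
    unfolding stretch_def by (intro tendsto_intros)
  then show ?thesis by simp
qed

lemma bounded_linear_stretch: "bounded_linear (stretch e)"
  by (intro linear_conv_bounded_linear[THEN iffD1] linearI) (simp_all add: complex_eq_iff algebra_simps)

lemma eventually_small_right:
  "0 < (b::real) \<Longrightarrow> \<forall>\<^sub>F e in at_right 0. 0 < e \<and> e * c < b"
proof -
  assume b: "0 < b"
  have "((\<lambda>e. e * c) \<longlongrightarrow> 0 * c) (at_right 0)" by (intro tendsto_intros)
  then have "\<forall>\<^sub>F e in at_right 0. e * c < b" using b by (intro order_tendstoD(2)[of _ "0 * c"]) auto
  then show ?thesis using eventually_at_right_less[of 0] by eventually_elim auto
qed

text \<open>This is the signed width of the strip swept when the boundary moves from 0 to c.\<close>

lemma integral_step_diff: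
  "(LBINT s. (if s < c then 1 else 0) - (if s < 0 then 1 else (0::real))) = c"
proof (cases "0 \<le> c")
  case True
  have "(\<lambda>s. (if s < c then 1 else 0) - (if s < 0 then 1 else (0::real))) = indicator {0..<c}"
    using True by (auto simp: fun_eq_iff indicator_def)
  then show ?thesis using True by simp
next
  case False
  have "(\<lambda>s. (if s < c then 1 else 0) - (if s < 0 then 1 else (0::real))) = (\<lambda>s. - indicator {c..<0} s)"
    using False by (auto simp: fun_eq_iff indicator_def)
  then show ?thesis using False by simp
qed

lemma closed_square_integrable:
  "integrable lborel (\<lambda>\<zeta>. (K::real) * indicator (cbox (Complex (-b) (-a)) (Complex b a)) \<zeta>)"
  using emeasure_lborel_cbox_finite[of "Complex (-b) (-a)" "Complex b a"]
  by (simp add: integrable_indicator_iff)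

locale tube =
  fixes a :: real and P :: "complex \<Rightarrow> complex" and P' :: "complex \<Rightarrow> complex \<Rightarrow> complex"
    and \<gamma> :: "real \<Rightarrow> complex" and G :: "complex \<Rightarrow> complex"
  assumes a_pos: "0 < a"
    and P_der: "\<And>\<zeta>. \<bar>Re \<zeta>\<bar> \<le> a \<Longrightarrow> \<bar>Im \<zeta>\<bar> \<le> a \<Longrightarrow> (P has_derivative P' \<zeta>) (at \<zeta>)"
    and J_cont: "continuous_on {\<zeta>. \<bar>Re \<zeta>\<bar> \<le> a \<and> \<bar>Im \<zeta>\<bar> \<le> a} (\<lambda>\<zeta>. jacobian (P' \<zeta>))"
    and P_inj: "inj_on P (square a)"
    and P_open: "\<And>T. open T \<Longrightarrow> T \<subseteq> square a \<Longrightarrow> open (P ` T)"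
    and P_eq: "\<And>\<zeta>. P \<zeta> = \<gamma> (Im \<zeta>) + Re \<zeta> *\<^sub>R G (\<gamma> (Im \<zeta>))"
begin

definition J :: "complex \<Rightarrow> real" where "J \<zeta> = jacobian (P' \<zeta>)"

lemma P_axis: "P (Complex 0 y) = \<gamma> y" by (simp add: P_eq)

lemma square_eq_box: "{\<zeta>. \<bar>Re \<zeta>\<bar> \<le> a \<and> \<bar>Im \<zeta>\<bar> \<le> a} = cbox (Complex (-a) (-a)) (Complex a a)"
  by (auto simp: in_cbox_complex_iff)

lemma J_bounded: obtains M where "0 \<le> M" "\<And>\<zeta>. \<zeta> \<in> square a \<Longrightarrow> \<bar>J \<zeta>\<bar> \<le> M"
proof -
  have "compact ((\<lambda>\<zeta>. jacobian (P' \<zeta>)) ` {\<zeta>. \<bar>Re \<zeta>\<bar> \<le> a \<and> \<bar>Im \<zeta>\<bar> \<le> a})"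
    by (rule compact_continuous_image[OF J_cont]) (simp add: square_eq_box)
  then obtain M where M: "0 < M" "\<And>x. x \<in> (\<lambda>\<zeta>. jacobian (P' \<zeta>)) ` {\<zeta>. \<bar>Re \<zeta>\<bar> \<le> a \<and> \<bar>Im \<zeta>\<bar> \<le> a} \<Longrightarrow> norm x \<le> M"
    using compact_imp_bounded bounded_pos by metis
  show ?thesis by (rule that[of M]) (use M in \<open>auto simp: square_def J_def\<close>)
qed

lemma J_cont_square: "continuous_on (square a) J"
  unfolding J_def by (rule continuous_on_subset[OF J_cont]) (auto simp: square_def)

lemma P_cont: "continuous_on (square a) P"
proof (intro continuous_at_imp_continuous_on ballI)
  fix \<zeta> assume "\<zeta> \<in> square a"
  then have "(P has_derivative P' \<zeta>) (at \<zeta>)" by (intro P_der) (auto simp: square_def)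
  then show "isCont P \<zeta>" by (rule has_derivative_continuous)
qed

lemma open_strip: "open (stretch e -` square a)"
  by (rule open_vimage[OF open_square continuous_stretch])

lemma axis_in_square: "\<bar>y\<bar> < a \<Longrightarrow> Complex 0 y \<in> square a"
  using a_pos by (simp add: square_def)

lemma tendsto_axis:
  fixes f :: "complex \<Rightarrow> 'b::topological_space"
  assumes "continuous_on (square a) f" "\<bar>Im \<zeta>\<bar> < a"
  shows "((\<lambda>e. f (stretch e \<zeta>)) \<longlongrightarrow> f (Complex 0 (Im \<zeta>))) (at_right 0)"
proof -
  have "isCont f (Complex 0 (Im \<zeta>))"
    using assms axis_in_square open_square by (metis continuous_on_eq_continuous_at)
  then show ?thesis using tendsto_stretch by (rule isCont_tendsto_compose)
qed

lemma eventually_strip: "\<bar>Im \<zeta>\<bar> < a \<Longrightarrow> \<forall>\<^sub>F e in at_right 0. stretch e \<zeta> \<in> square a"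
  using eventually_small_right[OF a_pos, of "\<bar>Re \<zeta>\<bar>"]
  by eventually_elim (auto simp: square_def abs_mult)

lemma J_axis_cont: "continuous_on {-a<..<a} (\<lambda>y. J (Complex 0 y))"
  by (rule continuous_on_compose2[OF J_cont_square]) (use axis_in_square in \<open>auto intro!: continuous_intros\<close>)

lemma \<gamma>_cont: "continuous_on {-a<..<a} \<gamma>"
proof -
  have "continuous_on {-a<..<a} (\<lambda>y. P (Complex 0 y))"
    by (rule continuous_on_compose2[OF P_cont]) (use axis_in_square in \<open>auto intro!: continuous_intros\<close>)
  then show ?thesis by (simp add: P_axis)
qed

lemma P_stretch_measurable:
  "(\<lambda>\<zeta>. if stretch e \<zeta> \<in> square a then P (stretch e \<zeta>) else 0) \<in> borel_measurable borel"
proof -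
  have "continuous_on (stretch e -` square a) (\<lambda>\<zeta>. P (stretch e \<zeta>))"
    by (rule continuous_on_compose2[OF P_cont continuous_stretch]) auto
  then have "(\<lambda>\<zeta>. indicator (stretch e -` square a) \<zeta> *\<^sub>R P (stretch e \<zeta>)) \<in> borel_measurable borel"
    using open_strip by (intro borel_measurable_continuous_on_indicator) auto
  moreover have "(\<lambda>\<zeta>. indicator (stretch e -` square a) \<zeta> *\<^sub>R P (stretch e \<zeta>))
    = (\<lambda>\<zeta>. if stretch e \<zeta> \<in> square a then P (stretch e \<zeta>) else 0)"
    by (auto simp: indicator_def fun_eq_iff)
  ultimately show ?thesis by simp
qed

lemma J_stretch_measurable:
  "(\<lambda>\<zeta>. indicator (stretch e -` square a) \<zeta> * J (stretch e \<zeta>)) \<in> borel_measurable borel"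
proof (rule borel_measurable_indicator_continuous)
  show "continuous_on (stretch e -` square a) (\<lambda>\<zeta>. J (stretch e \<zeta>))"
    by (rule continuous_on_compose2[OF J_cont_square continuous_stretch]) auto
qed (use open_strip in auto)

lemma pullback_measurable:
  assumes "f \<in> borel_measurable borel"
  shows "(\<lambda>\<zeta>. indicator (stretch e -` square a) \<zeta> * (J (stretch e \<zeta>) * f (P (stretch e \<zeta>)))) \<in> borel_measurable borel"
proof -
  have "(\<lambda>\<zeta>. f (if stretch e \<zeta> \<in> square a then P (stretch e \<zeta>) else 0)) \<in> borel_measurable borel"
    using measurable_comp[OF P_stretch_measurable assms] by (simp add: comp_def)
  from borel_measurable_times[OF J_stretch_measurable this]
  show ?thesis by (rule measurable_cong[THEN iffD1, rotated]) (auto simp: indicator_def)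
qed

lemma integral_stretched:
  assumes e: "0 < e" and f: "integrable lborel f" "\<And>z. z \<notin> P ` square a \<Longrightarrow> f z = (0::real)"
  shows "integral\<^sup>L lborel f =
    (LBINT \<zeta>. indicator (stretch e -` square a) \<zeta> * (e * (J (stretch e \<zeta>) * f (P (stretch e \<zeta>)))))"
proof -
  let ?S = "stretch e -` square a"
  have fm: "f \<in> borel_measurable borel" using f by auto
  have img: "(\<lambda>\<zeta>. P (stretch e \<zeta>)) ` ?S = P ` square a"
  proof
    show "P ` square a \<subseteq> (\<lambda>\<zeta>. P (stretch e \<zeta>)) ` ?S"
    proof clarify
      fix \<zeta> assume "\<zeta> \<in> square a"
      moreover have "stretch e (Complex (Re \<zeta> / e) (Im \<zeta>)) = \<zeta>" using e by (simp add: complex_eq_iff)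
      ultimately show "P \<zeta> \<in> (\<lambda>\<zeta>. P (stretch e \<zeta>)) ` ?S"
        by (intro image_eqI[of _ _ "Complex (Re \<zeta> / e) (Im \<zeta>)"]) auto
    qed
  qed auto
  have der: "((\<lambda>\<zeta>. P (stretch e \<zeta>)) has_derivative (\<lambda>h. P' (stretch e \<zeta>) (stretch e h))) (at \<zeta>)" if "\<zeta> \<in> ?S" for \<zeta>
    by (rule has_derivative_compose[OF bounded_linear_imp_has_derivative[OF bounded_linear_stretch] P_der])
      (use that in \<open>auto simp: square_def\<close>)
  \<comment> \<open>Stretching multiplies the column across the boundary by e and leaves the
    tangential column unchanged.\<close>
  have jac: "jacobian (\<lambda>h. P' (stretch e \<zeta>) (stretch e h)) = e * J (stretch e \<zeta>)" if "\<zeta> \<in> ?S" for \<zeta>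
  proof -
    have "linear (P' (stretch e \<zeta>))" using P_der[of "stretch e \<zeta>"] that
      by (auto simp: square_def intro: bounded_linear.linear has_derivative_bounded_linear)
    moreover have "stretch e 1 = e *\<^sub>R 1" "stretch e \<i> = \<i>" by (auto simp: complex_eq_iff)
    ultimately have "P' (stretch e \<zeta>) (stretch e 1) = e *\<^sub>R P' (stretch e \<zeta>) 1" "P' (stretch e \<zeta>) (stretch e \<i>) = P' (stretch e \<zeta>) \<i>"
      by (simp_all only: linear_cmul)
    then have "jacobian (\<lambda>h. P' (stretch e \<zeta>) (stretch e h)) = \<bar>e * (Re (P' (stretch e \<zeta>) 1) * Im (P' (stretch e \<zeta>) \<i>)
      - Re (P' (stretch e \<zeta>) \<i>) * Im (P' (stretch e \<zeta>) 1))\<bar>"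
      by (simp add: jacobian_def algebra_simps)
    then show ?thesis using e by (simp add: J_def jacobian_def abs_mult)
  qed
  have inj: "inj_on (\<lambda>\<zeta>. P (stretch e \<zeta>)) ?S"
  proof (rule inj_onI)
    fix x y assume "x \<in> ?S" "y \<in> ?S" "P (stretch e x) = P (stretch e y)"
    then have "stretch e x = stretch e y" using P_inj by (auto dest: inj_onD)
    then show "x = y" using e by (simp add: stretch_def complex_eq_iff)
  qed
  have opn: "open (P ` square a)" by (rule P_open[OF open_square]) simp
  have f': "(\<lambda>z. indicator (P ` square a) z * f z) = f" using f(2) by (auto simp: indicator_def fun_eq_iff)
  have eq: "indicator ?S \<zeta> * (jacobian (\<lambda>h. P' (stretch e \<zeta>) (stretch e h)) * f (P (stretch e \<zeta>)))
    = indicator ?S \<zeta> * (e * (J (stretch e \<zeta>) * f (P (stretch e \<zeta>))))" for \<zeta>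
    using jac[of \<zeta>] by (cases "\<zeta> \<in> ?S") auto
  have m: "(\<lambda>\<zeta>. indicator ?S \<zeta> * (e * (J (stretch e \<zeta>) * f (P (stretch e \<zeta>))))) \<in> borel_measurable borel"
    using borel_measurable_times[OF borel_measurable_const[of e] pullback_measurable[OF fm, of e]]
    by (rule measurable_cong[THEN iffD1, rotated]) auto
  show ?thesis
    using change_of_variables_complex(2)[OF open_strip, of "\<lambda>\<zeta>. P (stretch e \<zeta>)" e "\<lambda>\<zeta> h. P' (stretch e \<zeta>) (stretch e h)" f]
    unfolding img f' eq using opn der inj fm m f(1) by simp
qed

text \<open>\<open>T e\<close> is the domain after a time step of length e, and \<open>c\<close> is
  the speed of its boundary in the coordinate Re. In stretched coordinates that boundary tends to
  the graph of \<open>c\<close>, while the boundary of \<open>T0\<close> is the axis. Since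
  \<open>far\<close> keeps the difference of the sets in a fixed strip, deciding membership
  pointwise off the graph suffices for dominated convergence.\<close>

lemma motion:
  fixes T :: "real \<Rightarrow> complex set" and \<psi> :: "complex \<Rightarrow> real"
  assumes T: "\<And>e. 0 < e \<Longrightarrow> e < e0 \<Longrightarrow> T e \<in> sets borel" "T0 \<in> sets borel" and e0: "0 < e0"
    and side: "\<And>\<zeta>. \<zeta> \<in> square a \<Longrightarrow> P \<zeta> \<in> T0 \<longleftrightarrow> Re \<zeta> < 0"
    and far: "\<And>e \<zeta>. 0 < e \<Longrightarrow> e < e0 \<Longrightarrow> \<zeta> \<in> square a \<Longrightarrow> C * e \<le> \<bar>Re \<zeta>\<bar> \<Longrightarrow> P \<zeta> \<in> T e \<longleftrightarrow> Re \<zeta> < 0"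
    and lim1: "\<And>y s. \<bar>y\<bar> < a \<Longrightarrow> s < c y \<Longrightarrow> \<forall>\<^sub>F e in at_right 0. P (Complex (e * s) y) \<in> T e"
    and lim2: "\<And>y s. \<bar>y\<bar> < a \<Longrightarrow> c y < s \<Longrightarrow> \<forall>\<^sub>F e in at_right 0. P (Complex (e * s) y) \<notin> T e"
    and c: "continuous_on {-a<..<a} c" "\<And>y. \<bar>y\<bar> < a \<Longrightarrow> \<bar>c y\<bar> \<le> C"
    and \<psi>: "continuous_on UNIV \<psi>" "compact K" "K \<subseteq> P ` square a" "\<And>z. z \<notin> K \<Longrightarrow> \<psi> z = 0"
  shows "((\<lambda>e. ((LBINT z. indicator (T e) z * \<psi> z) - (LBINT z. indicator T0 z * \<psi> z)) / e)
    \<longlongrightarrow> (LBINT y. indicator {-a<..<a} y * (J (Complex 0 y) * \<psi> (\<gamma> y) * c y))) (at_right 0)"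
proof -
  obtain R where R: "\<And>z. z \<in> K \<Longrightarrow> norm z \<le> R" using compact_imp_bounded[OF \<psi>(2)] by (meson bounded_iff)
  have \<psi>R: "\<psi> z = 0" if "R < norm z" for z using that R \<psi>(4) by fastforce
  have \<psi>i: "integrable lborel \<psi>" by (rule integrable_of_compact_support[OF \<psi>(1) \<psi>R])
  obtain M\<psi> where M\<psi>: "0 \<le> M\<psi>" "\<And>x. norm (\<psi> x) \<le> M\<psi>" using bounded_of_compact_support[OF \<psi>(1) \<psi>R] by blast
  obtain MJ where MJ: "0 \<le> MJ" "\<And>\<zeta>. \<zeta> \<in> square a \<Longrightarrow> \<bar>J \<zeta>\<bar> \<le> MJ" using J_bounded by blast
  have Ti: "integrable lborel (\<lambda>z. indicator S z * \<psi> z)" if "S \<in> sets borel" for S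
    using integrable_mult_indicator[OF _ \<psi>i, of S] that by simp
  define f where "f = (\<lambda>e z. (indicator (T e) z - indicator T0 z) * \<psi> z)"
  define step :: "real \<Rightarrow> real \<Rightarrow> real" where "step = (\<lambda>c s. (if s < c then 1 else 0) - (if s < 0 then 1 else (0::real)))"
  define F where "F = (\<lambda>e \<zeta>. indicator (stretch e -` square a) \<zeta> * (J (stretch e \<zeta>) * f e (P (stretch e \<zeta>))))"
  define L where "L = (\<lambda>\<zeta>. indicator {-a<..<a} (Im \<zeta>) * (J (Complex 0 (Im \<zeta>)) * \<psi> (\<gamma> (Im \<zeta>)) * step (c (Im \<zeta>)) (Re \<zeta>)))"
  have fm: "f e \<in> borel_measurable borel" "integrable lborel (f e)" if "0 < e" "e < e0" for e
  proof -
    have "integrable lborel (\<lambda>z. indicator (T e) z * \<psi> z - indicator T0 z * \<psi> z)" using Ti T that by auto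
    then show "integrable lborel (f e)" by (simp add: f_def left_diff_distrib)
    then show "f e \<in> borel_measurable borel" by auto
  qed
  have quot: "((LBINT z. indicator (T e) z * \<psi> z) - (LBINT z. indicator T0 z * \<psi> z)) / e = integral\<^sup>L lborel (F e)"
    if e: "0 < e" "e < e0" for e
  proof -
    have "(LBINT z. indicator (T e) z * \<psi> z) - (LBINT z. indicator T0 z * \<psi> z) = integral\<^sup>L lborel (f e)"
      using Ti T e by (simp add: f_def left_diff_distrib)
    also have "\<dots> = (LBINT \<zeta>. indicator (stretch e -` square a) \<zeta> * (e * (J (stretch e \<zeta>) * f e (P (stretch e \<zeta>)))))"
      by (rule integral_stretched[OF e(1) fm(2)[OF e]]) (use \<psi>(3,4) in \<open>auto simp: f_def\<close>)
    also have "\<dots> = (LBINT \<zeta>. e * F e \<zeta>)" by (simp add: F_def mult.left_commute)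
    finally show ?thesis using e by simp
  qed
  have cm: "(\<lambda>y. indicator {-a<..<a} y * c y) \<in> borel_measurable borel"
    using borel_measurable_continuous_on_indicator[OF _ c(1)] by simp
  have \<psi>\<gamma>: "continuous_on {-a<..<a} (\<lambda>y. \<psi> (\<gamma> y))"
    by (rule continuous_on_compose2[OF \<psi>(1) \<gamma>_cont]) auto
  have Jm: "(\<lambda>y. indicator {-a<..<a} y * (J (Complex 0 y) * \<psi> (\<gamma> y))) \<in> borel_measurable borel"
    using borel_measurable_continuous_on_indicator[of "{-a<..<a}" "\<lambda>y. J (Complex 0 y) * \<psi> (\<gamma> y)"]
      continuous_on_mult[OF J_axis_cont \<psi>\<gamma>] by simp
  have Lm: "L \<in> borel_measurable borel"
  proof -
    note [measurable] = cm Jm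
    have [measurable]: "Re \<in> borel_measurable borel" "Im \<in> borel_measurable borel"
      by (auto intro!: borel_measurable_continuous_onI continuous_intros)
    have "(\<lambda>\<zeta>. (\<lambda>y. indicator {-a<..<a} y * (J (Complex 0 y) * \<psi> (\<gamma> y))) (Im \<zeta>) *
      step ((\<lambda>y. indicator {-a<..<a} y * c y) (Im \<zeta>)) (Re \<zeta>)) \<in> borel_measurable borel"
      unfolding step_def by measurable
    then show ?thesis by (rule measurable_cong[THEN iffD1, rotated]) (auto simp: L_def indicator_def)
  qed
  \<comment> \<open>On the graph of \<open>c\<close> neither \<open>lim1\<close> nor
    \<open>lim2\<close> decides membership. Every horizontal line meets the graph in at most one
    point, so it is a null set.\<close>
  have null: "AE \<zeta> in lborel. \<not> (\<bar>Im \<zeta>\<bar> < a \<and> Re \<zeta> = c (Im \<zeta>))"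
  proof -
    let ?Z = "{\<zeta>. \<bar>Im \<zeta>\<bar> < a \<and> Re \<zeta> = c (Im \<zeta>)}"
    have Zm: "?Z \<in> sets borel"
    proof -
      have [measurable]: "Re \<in> borel_measurable borel" "Im \<in> borel_measurable borel"
        by (auto intro!: borel_measurable_continuous_onI continuous_intros)
      note [measurable] = cm
      have "{\<zeta> \<in> space borel. \<bar>Im \<zeta>\<bar> < a \<and> Re \<zeta> = (\<lambda>y. indicator {-a<..<a} y * c y) (Im \<zeta>)} \<in> sets borel"
        by measurable
      moreover have "{\<zeta> \<in> space borel. \<bar>Im \<zeta>\<bar> < a \<and> Re \<zeta> = (\<lambda>y. indicator {-a<..<a} y * c y) (Im \<zeta>)} = ?Z"
        by (auto simp: indicator_def)
      ultimately show ?thesis by (simp only:)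
    qed
    have "?Z \<subseteq> cbox (Complex (-C) (-a)) (Complex C a)"
      using c(2) by (fastforce simp: in_cbox_complex_iff)
    then have "emeasure lborel ?Z \<le> emeasure lborel (cbox (Complex (-C) (-a)) (Complex C a))"
      by (intro emeasure_mono) auto
    also have "\<dots> < \<infinity>" by (rule emeasure_lborel_cbox_finite)
    finally have fin: "emeasure lborel ?Z < \<infinity>" .
    then have int: "integrable lborel (indicator ?Z :: complex \<Rightarrow> real)" using Zm by (simp add: integrable_indicator_iff)
    have "(LBINT x. indicator ?Z (Complex x y)) = (0::real)" for y
    proof -
      have "(\<lambda>x. indicator ?Z (Complex x y)) = (\<lambda>x. (if \<bar>y\<bar> < a then 1 else 0) * indicator {c y} x :: real)"
        by (auto simp: fun_eq_iff indicator_def)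
      then show ?thesis by simp
    qed
    then have "measure lborel ?Z = 0" using integral_complex_iterated[OF int] by simp
    then have "emeasure lborel ?Z = 0" using fin by (simp add: emeasure_eq_ennreal_measure)
    then show ?thesis using Zm by (intro AE_I[of _ _ ?Z]) auto
  qed
  define wt where "wt = (\<lambda>\<zeta>. (MJ * M\<psi>) * indicator (cbox (Complex (-C) (-a)) (Complex C a)) \<zeta>)"
  have wi: "integrable lborel wt" unfolding wt_def by (rule closed_square_integrable)
  \<comment> \<open>By \<open>far\<close> and \<open>side\<close> the two sets agree once |Re
    \<zeta>| exceeds C in stretched coordinates, which gives a dominating function of bounded
    support.\<close>
  have F0: "F e \<zeta> = 0" if "0 < e" "e < e0" "\<zeta> \<notin> cbox (Complex (-C) (-a)) (Complex C a)" for e \<zeta>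
  proof (cases "stretch e \<zeta> \<in> square a")
    case True
    then have "\<bar>Im \<zeta>\<bar> < a" by (simp add: square_def)
    then have "C < \<bar>Re \<zeta>\<bar>" using that(3) by (auto simp: in_cbox_complex_iff)
    then have "C * e \<le> \<bar>Re (stretch e \<zeta>)\<bar>" using that(1) by (simp add: abs_mult mult.commute)
    from far[OF that(1,2) True this] side[OF True] show ?thesis by (simp add: F_def f_def indicator_def)
  qed (simp add: F_def)
  have "((\<lambda>e. integral\<^sup>L lborel (F e)) \<longlongrightarrow> integral\<^sup>L lborel L) (at_right 0)"
  proof (rule integral_tendsto_at[OF _ _ wi])
    have ev: "\<forall>\<^sub>F e in at_right 0. 0 < e \<and> e < e0" using eventually_small_right[OF e0, of 1] by simp
    show "\<forall>\<^sub>F e in at_right 0. F e \<in> borel_measurable lborel"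
      using ev
    proof eventually_elim
      case (elim e) then show ?case unfolding F_def using pullback_measurable[OF fm(1)] by simp
    qed
    show "\<forall>\<^sub>F e in at_right 0. \<forall>\<zeta>. norm (F e \<zeta>) \<le> wt \<zeta>"
      using ev
    proof eventually_elim
      case (elim e)
      show ?case
      proof
        fix \<zeta>
        show "norm (F e \<zeta>) \<le> wt \<zeta>"
        proof (cases "stretch e \<zeta> \<in> square a \<and> \<zeta> \<in> cbox (Complex (-C) (-a)) (Complex C a)")
          case True
          have "\<bar>J (stretch e \<zeta>)\<bar> * \<bar>f e (P (stretch e \<zeta>))\<bar> \<le> MJ * M\<psi>"
            using MJ(2)[of "stretch e \<zeta>"] True M\<psi> MJ(1)
            by (intro mult_mono) (auto simp: f_def abs_mult indicator_def)
          then show ?thesis using True by (simp add: F_def wt_def abs_mult)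
        next
          case False
          then have "F e \<zeta> = 0" using F0 elim by (auto simp: F_def)
          then show ?thesis using MJ M\<psi> by (simp add: wt_def)
        qed
      qed
    qed
    show "AE \<zeta> in lborel. ((\<lambda>e. F e \<zeta>) \<longlongrightarrow> L \<zeta>) (at_right 0)"
      using null
    proof eventually_elim
      case (elim \<zeta>)
      show ?case
      proof (cases "\<bar>Im \<zeta>\<bar> < a")
        case False
        then have "F e \<zeta> = 0" "L \<zeta> = 0" for e by (auto simp: F_def L_def square_def indicator_def)
        then show ?thesis by simp
      next
        case True
        have ev: "\<forall>\<^sub>F e in at_right 0. F e \<zeta> = J (stretch e \<zeta>) * \<psi> (P (stretch e \<zeta>)) * step (c (Im \<zeta>)) (Re \<zeta>)"
        proof -
          have in1: "\<forall>\<^sub>F e in at_right 0. P (stretch e \<zeta>) \<in> T e \<longleftrightarrow> Re \<zeta> < c (Im \<zeta>)"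
          proof (cases "Re \<zeta> < c (Im \<zeta>)")
            case t: True
            show ?thesis using lim1[OF True t] by eventually_elim (use t in \<open>simp add: stretch_def\<close>)
          next
            case f: False
            then have "c (Im \<zeta>) < Re \<zeta>" using elim True by auto
            from lim2[OF True this] show ?thesis by eventually_elim (use f in \<open>simp add: stretch_def\<close>)
          qed
          show ?thesis using in1 eventually_strip[OF True] eventually_at_right_less[of 0]
          proof eventually_elim
            case (elim e)
            then have "P (stretch e \<zeta>) \<in> T0 \<longleftrightarrow> Re \<zeta> < 0" using side[of "stretch e \<zeta>"] by (simp add: mult_less_0_iff)
            then show ?case using elim by (simp add: F_def f_def step_def indicator_def)
          qed
        qed
        have "((\<lambda>e. J (stretch e \<zeta>) * \<psi> (P (stretch e \<zeta>)) * step (c (Im \<zeta>)) (Re \<zeta>)) \<longlongrightarrow>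
          J (Complex 0 (Im \<zeta>)) * \<psi> (P (Complex 0 (Im \<zeta>))) * step (c (Im \<zeta>)) (Re \<zeta>)) (at_right 0)"
          by (intro tendsto_intros tendsto_axis[OF _ True] J_cont_square continuous_on_compose2[OF \<psi>(1) P_cont]) auto
        moreover have "L \<zeta> = J (Complex 0 (Im \<zeta>)) * \<psi> (P (Complex 0 (Im \<zeta>))) * step (c (Im \<zeta>)) (Re \<zeta>)"
          using True by (simp add: L_def P_axis indicator_def abs_less_iff)
        ultimately show ?thesis using tendsto_cong[OF ev] by simp
      qed
    qed
  qed (use Lm in simp)
  moreover have "integral\<^sup>L lborel L = (LBINT y. indicator {-a<..<a} y * (J (Complex 0 y) * \<psi> (\<gamma> y) * c y))"
  proof -
    have "integrable lborel L"
    proof (rule Bochner_Integration.integrable_bound[OF wi])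
      show "AE \<zeta> in lborel. norm (L \<zeta>) \<le> norm (wt \<zeta>)"
      proof (rule AE_I2)
        fix \<zeta>
        show "norm (L \<zeta>) \<le> norm (wt \<zeta>)"
        proof (cases "\<bar>Im \<zeta>\<bar> < a \<and> \<bar>Re \<zeta>\<bar> \<le> C")
          case True
          have "\<bar>J (Complex 0 (Im \<zeta>)) * \<psi> (\<gamma> (Im \<zeta>))\<bar> * \<bar>step (c (Im \<zeta>)) (Re \<zeta>)\<bar> \<le> (MJ * M\<psi>) * 1"
            unfolding abs_mult
            using MJ(2)[OF axis_in_square[of "Im \<zeta>"]] True M\<psi> MJ(1)
            by (intro mult_mono) (auto simp: step_def)
          then show ?thesis using True MJ(1) M\<psi>(1) by (auto simp: L_def wt_def abs_mult in_cbox_complex_iff indicator_def)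
        next
          case False
          then have "L \<zeta> = 0" using c(2)[of "Im \<zeta>"] by (auto simp: L_def step_def indicator_def abs_less_iff)
          then show ?thesis by simp
        qed
      qed
    qed (use Lm in simp)
    from integral_complex_iterated[OF this]
    have "integral\<^sup>L lborel L = (LBINT y. LBINT x. L (Complex x y))" .
    also have "\<dots> = (LBINT y. indicator {-a<..<a} y * (J (Complex 0 y) * \<psi> (\<gamma> y) * c y))"
    proof (intro Bochner_Integration.integral_cong refl)
      fix y
      have "(LBINT x. L (Complex x y)) = (LBINT x. (indicator {-a<..<a} y * (J (Complex 0 y) * \<psi> (\<gamma> y))) * step (c y) x)"
        by (simp add: L_def mult.assoc)
      also have "\<dots> = (indicator {-a<..<a} y * (J (Complex 0 y) * \<psi> (\<gamma> y))) * c y"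
        unfolding step_def integral_mult_right_zero integral_step_diff by simp
      finally show "(LBINT x. L (Complex x y)) = indicator {-a<..<a} y * (J (Complex 0 y) * \<psi> (\<gamma> y) * c y)"
        by (simp add: mult.assoc)
    qed
    finally show ?thesis .
  qed
  moreover have "\<forall>\<^sub>F e in at_right 0. ((LBINT z. indicator (T e) z * \<psi> z) - (LBINT z. indicator T0 z * \<psi> z)) / e = integral\<^sup>L lborel (F e)"
    using eventually_small_right[OF e0, of 1] by eventually_elim (use quot in auto)
  ultimately show ?thesis using tendsto_cong by fastforce
qed

end

section \<open>The Green function tested on a boundary layer\<close>

lemma integral_cutoff4_second:
  assumes b: "0 < b"
  shows "(LBINT s. (if s < 0 then s * cutoff4 1 (- (s * b)) else 0)) = 1 / b\<^sup>2"
proof -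
  let ?f = "\<lambda>s. (if s < 0 then s * cutoff4 1 (- (s * b)) else 0)"
  have "integral\<^sup>L lborel ?f = \<bar>- 1 / b\<bar> *\<^sub>R (LBINT x. ?f (0 + (- 1 / b) * x))"
    by (rule lborel_integral_real_affine) (use b in auto)
  also have "(\<lambda>x. ?f (0 + (- 1 / b) * x)) = (\<lambda>x. - (1 / b) * ((x * cutoff4 1 x) * indicator {0..4} x))"
    using b cutoff4_1_eq_0 cutoff4_eq_0[of _ 1]
    by (auto simp: fun_eq_iff indicator_def divide_less_0_iff zero_less_divide_iff)
  also have "(LBINT x. - (1 / b) * ((x * cutoff4 1 x) * indicator {0..4} x)) = - (1 / b) * (LBINT x. (x * cutoff4 1 x) * indicator {0..4} x)"
    by (rule integral_mult_right_zero)
  \<comment> \<open>After the substitution x = - s b the antiderivative is x \<eta>' - \<eta>, where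
    \<eta> is \<open>cutoff4 3\<close>; only the value \<eta>(4) = 1 survives at the ends.\<close>
  also have "(LBINT x. (x * cutoff4 1 x) * indicator {0..4} x) = (4 * cutoff4 2 4 - cutoff4 3 4) - (0 * cutoff4 2 0 - cutoff4 3 0)"
  proof (rule integral_FTC_Icc_real[of 0 4 "\<lambda>x. x * cutoff4 2 x - cutoff4 3 x"])
    show "((\<lambda>x. x * cutoff4 2 x - cutoff4 3 x) has_real_derivative x * cutoff4 1 x) (at x)" for x
      using DERIV_diff[OF DERIV_mult[OF DERIV_ident DERIV_cutoff4_2] DERIV_cutoff4_3, of x] by (simp add: mult.commute)
    have "continuous_on UNIV (\<lambda>x. x * cutoff4 1 x)" by (intro continuous_intros continuous_cutoff4)
    then show "isCont (\<lambda>x. x * cutoff4 1 x) x" for x by (simp add: continuous_on_eq_continuous_at)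
  qed simp
  also have "\<dots> = -1" using cutoff4_2_eq_0[of 4] cutoff4_3_eq_1[of 4] cutoff4_eq_0[of 0 3] by simp
  finally show ?thesis using b by (simp add: power2_eq_square)
qed

text \<open>\<omega> is the normal velocity in chart units: moving Re by s moves the point by s |G|,
  so v = \<omega> |G|, and the derivative of \<open>g\<close> along Re is v |G| = \<omega> |G|^2.
  The hypotheses \<open>side\<close>, \<open>b0\<close> and \<open>g_bound\<close> are what the
  layer estimate needs inside the tube.\<close>

locale boundary_patch = green_domain D u w g + tube a P P' \<gamma> G
  for D :: "complex set" and u :: "complex \<Rightarrow> real" and w :: complex and g :: "complex \<Rightarrow> real"
    and a P P' \<gamma> and G :: "complex \<Rightarrow> complex" +
  fixes N :: "complex set" and \<phi> :: "complex \<Rightarrow> real" and A B :: "complex \<Rightarrow> complex"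
    and b0 C :: real and \<omega> :: "real \<Rightarrow> real"
  assumes c: "c2 N \<phi> G A B"
    and P_in: "\<And>\<zeta>. \<bar>Re \<zeta>\<bar> \<le> a \<Longrightarrow> \<bar>Im \<zeta>\<bar> \<le> a \<Longrightarrow> P \<zeta> \<in> N"
    and D_side: "D \<inter> N = {z \<in> N. \<phi> z < 0}"
    and side: "\<And>\<zeta>. \<zeta> \<in> square a \<Longrightarrow> P \<zeta> \<in> D \<longleftrightarrow> Re \<zeta> < 0"
    and b0: "0 < b0" "\<And>\<zeta>. \<zeta> \<in> square a \<Longrightarrow> Re \<zeta> < 0 \<Longrightarrow> b0 * \<bar>Re \<zeta>\<bar> \<le> - \<phi> (P \<zeta>)"
    and level: "\<And>y. \<bar>y\<bar> < a \<Longrightarrow> \<phi> (\<gamma> y) = 0"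
    and G_nonzero: "\<And>y. \<bar>y\<bar> < a \<Longrightarrow> G (\<gamma> y) \<noteq> 0"
    and g_bound: "0 \<le> C" "\<And>\<zeta>. \<zeta> \<in> square a \<Longrightarrow> Re \<zeta> < 0 \<Longrightarrow> \<bar>g (P \<zeta>)\<bar> \<le> C * \<bar>Re \<zeta>\<bar>"
    and g_lim: "\<And>y. \<bar>y\<bar> < a \<Longrightarrow>
      ((\<lambda>s. g (P (Complex s y)) / s) \<longlongrightarrow> \<omega> y * (norm (G (\<gamma> y)))\<^sup>2) (at_left 0)"
    and \<omega>_cont: "continuous_on {-a<..<a} \<omega>"
    and w_far: "w \<notin> P ` square a"
begin

text \<open>In a layer of width e the Green function is O(e), while the Laplacian of the cutoff test
  function is O(1/e^2). The contribution of the layer is thus O(1), and its limit comes only from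
  the term that contains the second derivative of the cutoff.\<close>

lemma flux:
  assumes \<psi>: "c2 UNIV \<psi> G\<psi> A\<psi> B\<psi>" "compact K" "K \<subseteq> P ` square a" "\<And>z. z \<notin> K \<Longrightarrow> \<psi> z = 0"
  shows "- (LBINT z. indicator D z * (g z * (Re (A\<psi> z) + Im (B\<psi> z) - u z * \<psi> z))) =
    (LBINT y. indicator {-a<..<a} y * (J (Complex 0 y) * \<psi> (\<gamma> y) * \<omega> y))"
proof -
  note cc = c2_continuous_on[OF c] and c\<psi> = c2_continuous_on[OF \<psi>(1)]
  have imgN: "P ` square a \<subseteq> N" using P_in by (auto simp: square_def)
  have KN: "K \<subseteq> N" using \<psi>(3) imgN by blast
  have openK: "open (- K)" using \<psi>(2) by (simp add: compact_imp_closed open_Compl)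
  have \<psi>0: "\<psi> z = 0" "G\<psi> z = 0" "A\<psi> z = 0" "B\<psi> z = 0" if "z \<notin> K" for z
    using \<psi>(4) that c2_zero_region[OF \<psi>(1) openK _ _, of z] by auto
  define L0 where "L0 = (\<lambda>z. Re (A\<psi> z) + Im (B\<psi> z) - u z * \<psi> z)"
  define \<eta> where "\<eta> = (\<lambda>e z. if z \<in> N then cutoff4 3 (- \<phi> z / e) else 0)"
  \<comment> \<open>The factor 1/e^2 is taken out of the terms in which the cutoff is
    differentiated. What is left is bounded as e tends to 0, and the terms still carrying a factor e
    disappear in the limit.\<close>
  define m where "m = (\<lambda>e z. \<psi> z * (cutoff4 1 (- \<phi> z / e) * (norm (G z))\<^sup>2 - e * cutoff4 2 (- \<phi> z / e) * (Re (A z) + Im (B z)))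
      - 2 * e * cutoff4 2 (- \<phi> z / e) * (G\<psi> z \<bullet> G z))"
  define f where "f = (\<lambda>e z. indicator D z * (g z * (if z \<in> N then m e z / e\<^sup>2 else 0)))"
  define first where "first = (\<lambda>e z. indicator D z * (g z * (\<eta> e z * L0 z)))"
  obtain R where R: "\<And>z. z \<in> K \<Longrightarrow> norm z \<le> R" using compact_imp_bounded[OF \<psi>(2)] by (meson bounded_iff)
  have \<psi>R: "\<psi> z = 0" if "R < norm z" for z using that R \<psi>(4) by fastforce
  obtain M1 where M1: "0 \<le> M1" "\<And>x. norm (\<psi> x) \<le> M1" using bounded_of_compact_support[OF c\<psi>(1) \<psi>R] by blast
  have G\<psi>R: "G\<psi> z = 0" if "R < norm z" for z using that R \<psi>0(2) by fastforce
  obtain M2 where M2: "0 \<le> M2" "\<And>x. norm (G\<psi> x) \<le> M2" using bounded_of_compact_support[OF c\<psi>(2) G\<psi>R] by blast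
  have L0_cont: "continuous_on UNIV (\<lambda>z. Re (A\<psi> z) + Im (B\<psi> z))" by (intro continuous_intros c\<psi>)
  have L0_int: "integrable lborel (\<lambda>z. indicator D z * (g z * L0 z))"
  proof -
    have "integrable lborel (\<lambda>z. indicator D z * (g z * (Re (A\<psi> z) + Im (B\<psi> z))) - indicator D z * (g z * (u z * \<psi> z)))"
      using g_continuous_integrable(1)[OF L0_cont] g_continuous_integrable(2)[OF c\<psi>(1)] by auto
    then show ?thesis by (simp add: L0_def algebra_simps)
  qed
  text \<open>The test function \<open>\<psi> \<eta>\<close> vanishes near the boundary; its Laplacian is \<open>m / e\<^sup>2 + \<eta> \<Delta>\<psi>\<close>.\<close>
  have ident: "integrable lborel (f e)" "integrable lborel (first e)"
    "integral\<^sup>L lborel (first e) + integral\<^sup>L lborel (f e) = 0" if e: "0 < e" for e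
  proof -
    have d1: "((\<lambda>x. cutoff4 3 (- x / e)) has_real_derivative - (cutoff4 2 (- x / e) / e)) (at x)" for x
    proof -
      have "((\<lambda>x. - x / e) has_real_derivative - 1 / e) (at x)" using e by (auto intro!: derivative_eq_intros)
      from DERIV_chain2[OF DERIV_cutoff4_3 this] show ?thesis by simp
    qed
    have d2: "((\<lambda>x. - (cutoff4 2 (- x / e) / e)) has_real_derivative cutoff4 1 (- x / e) / e\<^sup>2) (at x)" for x
    proof -
      have "((\<lambda>x. - x / e) has_real_derivative - 1 / e) (at x)" using e by (auto intro!: derivative_eq_intros)
      from DERIV_minus[OF DERIV_cdivide[OF DERIV_chain2[OF DERIV_cutoff4_2 this], of e]]
      show ?thesis by (simp add: power2_eq_square)
    qed
    have d3: "continuous_on UNIV (\<lambda>x. cutoff4 1 (- x / e) / e\<^sup>2)"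
      using e by (intro continuous_intros continuous_on_compose2[OF continuous_cutoff4[of UNIV 1]]) auto
    note c\<eta> = c2_compose[OF c d1 d2 d3]
    have \<psi>N: "c2 N \<psi> G\<psi> A\<psi> B\<psi>" by (rule c2_subset[OF \<psi>(1) c2_open[OF c]]) simp
    note cprod = c2_mult[OF \<psi>N c\<eta>]
    \<comment> \<open>The cutoff vanishes unless -\<phi> exceeds e, so the product is supported in a
      compact part of \<open>D\<close> although \<open>K\<close> may meet the boundary.\<close>
    let ?K = "{z \<in> K. e \<le> - \<phi> z}"
    have Kc: "compact ?K"
    proof -
      have "continuous_on K (\<lambda>z. - \<phi> z)" by (intro continuous_intros continuous_on_subset[OF cc(1) KN])
      then have "closed (K \<inter> (\<lambda>z. - \<phi> z) -` {e..})"
        using \<psi>(2) by (intro continuous_closed_preimage) (auto simp: compact_imp_closed)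
      moreover have "?K = K \<inter> (K \<inter> (\<lambda>z. - \<phi> z) -` {e..})" by auto
      ultimately show ?thesis using compact_Int_closed[OF \<psi>(2)] by metis
    qed
    have KD: "?K \<subseteq> D"
    proof
      fix z assume "z \<in> ?K"
      then have "z \<in> D \<inter> N" unfolding D_side using KN e by auto
      then show "z \<in> D" by simp
    qed
    have vanish: "\<psi> z * cutoff4 3 (- \<phi> z / e) = 0" if "z \<in> N - ?K" for z
    proof (cases "z \<in> K")
      case True
      then have "- \<phi> z / e \<le> 1" using that e by (subst pos_divide_le_eq) auto
      then show ?thesis using cutoff4_eq_0[of "- \<phi> z / e" 3] by simp
    qed (simp add: \<psi>0)
    have KN': "?K \<subseteq> N" using KN by auto
    have ext: "c2 UNIV (\<lambda>z. if z \<in> N then \<psi> z * cutoff4 3 (- \<phi> z / e) else 0) G1 A1 B1 \<Longrightarrow>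
       (LBINT z. indicator D z * (g z * (Re (A1 z) + Im (B1 z) - u z * (if z \<in> N then \<psi> z * cutoff4 3 (- \<phi> z / e) else 0))))
       = (if w \<in> N then \<psi> w * cutoff4 3 (- \<phi> w / e) else 0)" for G1 A1 B1
      by (rule green_c2[OF _ Kc KD]) (use vanish in auto)
    have w0: "(if w \<in> N then \<psi> w * cutoff4 3 (- \<phi> w / e) else 0) = 0"
      using \<psi>0(1)[of w] w_far \<psi>(3) by auto
    note cext = c2_extend_zero[OF cprod Kc KN' vanish]
    have meas: "integrable lborel (f e)"
    proof -
      define k where "k = (\<lambda>z. if z \<in> N then m e z / e\<^sup>2 else 0)"
      have "continuous_on UNIV k" unfolding k_def
      proof (rule continuous_on_extend_zero[OF c2_open[OF c] \<psi>(2) KN])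
        show "continuous_on N (\<lambda>z. m e z / e\<^sup>2)" unfolding m_def
          using e by (intro continuous_intros cc continuous_on_compose2[OF continuous_cutoff4[of UNIV 1]]
            continuous_on_compose2[OF continuous_cutoff4[of UNIV 2]] continuous_on_subset[OF c\<psi>(1)] continuous_on_subset[OF c\<psi>(2)]) auto
      qed (simp add: m_def \<psi>0)
      moreover have "f e = (\<lambda>z. indicator D z * (g z * k z))" by (simp add: f_def k_def fun_eq_iff)
      ultimately show ?thesis using g_continuous_integrable(1) by simp
    qed
    then show "integrable lborel (f e)" .
    have \<eta>_range: "\<bar>\<eta> e z\<bar> \<le> 1" for z using cutoff4_3_range by (simp add: \<eta>_def)
    have "integrable lborel (first e)"
    proof (rule Bochner_Integration.integrable_bound[OF L0_int])
      have "\<eta> e \<in> borel_measurable borel"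
      proof -
        have "(\<lambda>z. indicator N z *\<^sub>R cutoff4 3 (- \<phi> z / e)) \<in> borel_measurable borel"
          using c2_open[OF c] e by (intro borel_measurable_continuous_on_indicator continuous_on_compose2[OF continuous_cutoff4[of UNIV 3]]
              continuous_intros cc) auto
        then show ?thesis by (rule measurable_cong[THEN iffD1, rotated]) (auto simp: \<eta>_def indicator_def)
      qed
      then have "(\<lambda>z. \<eta> e z * (indicator D z * (g z * L0 z))) \<in> borel_measurable lborel"
        using borel_measurable_times[of "\<eta> e" borel "\<lambda>z. indicator D z * (g z * L0 z)"] borel_measurable_integrable[OF L0_int] by simp
      then show "first e \<in> borel_measurable lborel"
        by (rule measurable_cong[THEN iffD1, rotated]) (simp add: first_def algebra_simps)
      show "AE z in lborel. norm (first e z) \<le> norm (indicator D z * (g z * L0 z))"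
      proof (rule AE_I2)
        fix z
        have "\<bar>\<eta> e z\<bar> * norm (indicator D z * (g z * L0 z)) \<le> 1 * norm (indicator D z * (g z * L0 z))"
          by (rule mult_right_mono[OF \<eta>_range]) simp
        then show "norm (first e z) \<le> norm (indicator D z * (g z * L0 z))"
          by (simp add: first_def abs_mult algebra_simps)
      qed
    qed
    then show "integrable lborel (first e)" .
    \<comment> \<open>The right-hand side is the Laplacian exactly as the product, composition and
      extension rules deliver it; \<open>alg\<close> is the polynomial identity behind the
      splitting.\<close>
    have "first e z + f e z = indicator D z * (g z * (Re (if z \<in> N then (\<psi> z *\<^sub>R (- (cutoff4 2 (- \<phi> z / e) / e) *\<^sub>R A z + Re (G z) *\<^sub>R ((cutoff4 1 (- \<phi> z / e) / e\<^sup>2) *\<^sub>R G z))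
        + Re (- (cutoff4 2 (- \<phi> z / e) / e) *\<^sub>R G z) *\<^sub>R G\<psi> z) + (cutoff4 3 (- \<phi> z / e) *\<^sub>R A\<psi> z + Re (G\<psi> z) *\<^sub>R (- (cutoff4 2 (- \<phi> z / e) / e) *\<^sub>R G z)) else 0)
      + Im (if z \<in> N then (\<psi> z *\<^sub>R (- (cutoff4 2 (- \<phi> z / e) / e) *\<^sub>R B z + Im (G z) *\<^sub>R ((cutoff4 1 (- \<phi> z / e) / e\<^sup>2) *\<^sub>R G z))
        + Im (- (cutoff4 2 (- \<phi> z / e) / e) *\<^sub>R G z) *\<^sub>R G\<psi> z) + (cutoff4 3 (- \<phi> z / e) *\<^sub>R B\<psi> z + Im (G\<psi> z) *\<^sub>R (- (cutoff4 2 (- \<phi> z / e) / e) *\<^sub>R G z)) else 0)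
      - u z * (if z \<in> N then \<psi> z * cutoff4 3 (- \<phi> z / e) else 0)))" for z
    proof (cases "z \<in> N")
      case True
      define k1 k2 k3 where k: "k1 = cutoff4 1 (- \<phi> z / e) / e\<^sup>2" "k2 = cutoff4 2 (- \<phi> z / e) / e" "k3 = cutoff4 3 (- \<phi> z / e)"
      have m: "m e z / e\<^sup>2 = \<psi> z * (k1 * (norm (G z))\<^sup>2 - k2 * (Re (A z) + Im (B z))) - 2 * k2 * (G\<psi> z \<bullet> G z)"
      proof -
        have "cutoff4 1 (- \<phi> z / e) = k1 * e\<^sup>2" "e * cutoff4 2 (- \<phi> z / e) = k2 * e\<^sup>2" using e by (simp_all add: k power2_eq_square)
        then have "m e z = (\<psi> z * (k1 * (norm (G z))\<^sup>2 - k2 * (Re (A z) + Im (B z))) - 2 * k2 * (G\<psi> z \<bullet> G z)) * e\<^sup>2"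
          unfolding m_def mult.assoc[of 2 e] by (simp add: algebra_simps)
        then show ?thesis using e by simp
      qed
      have alg: "k3 * (Re a1 + Im b1 - up) + (p * (k1 * (norm G0)\<^sup>2 - k2 * (Re a0 + Im b0')) - 2 * k2 * (g1 \<bullet> G0)) =
        Re ((p *\<^sub>R (- k2 *\<^sub>R a0 + Re G0 *\<^sub>R (k1 *\<^sub>R G0)) + Re (- k2 *\<^sub>R G0) *\<^sub>R g1) + (k3 *\<^sub>R a1 + Re g1 *\<^sub>R (- k2 *\<^sub>R G0))) +
        Im ((p *\<^sub>R (- k2 *\<^sub>R b0' + Im G0 *\<^sub>R (k1 *\<^sub>R G0)) + Im (- k2 *\<^sub>R G0) *\<^sub>R g1) + (k3 *\<^sub>R b1 + Im g1 *\<^sub>R (- k2 *\<^sub>R G0))) - up * k3"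
        for a1 b1 a0 b0' g1 G0 :: complex and up p
        unfolding cmod_power2 by (simp add: inner_complex_def power2_eq_square algebra_simps)
      have "first e z + f e z = indicator D z * (g z * (k3 * (Re (A\<psi> z) + Im (B\<psi> z) - u z * \<psi> z) + m e z / e\<^sup>2))"
        using True by (simp add: first_def f_def \<eta>_def L0_def k(3) distrib_left)
      then show ?thesis unfolding m alg using True by (simp only: k(1,2,3)[symmetric] if_True mult.assoc)
    qed (simp add: first_def f_def \<eta>_def)
    then have "(LBINT z. first e z + f e z) = 0" using ext[OF cext] w0 by simp
    then show "integral\<^sup>L lborel (first e) + integral\<^sup>L lborel (f e) = 0"
      using meas \<open>integrable lborel (first e)\<close> by simp
  qed
  have ev0: "\<forall>\<^sub>F e in at_right 0. (0::real) < e" by (rule eventually_at_right_less)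
  \<comment> \<open>At a point of \<open>D\<close> in \<open>K\<close> the cutoff is 1 as soon as 4e
    \<le> -\<phi>, so the integrand is eventually constant in e.\<close>
  have lim_first: "((\<lambda>e. integral\<^sup>L lborel (first e)) \<longlongrightarrow> (LBINT z. indicator D z * (g z * L0 z))) (at_right 0)"
  proof (rule integral_tendsto_at)
    show "\<forall>\<^sub>F e in at_right 0. first e \<in> borel_measurable lborel"
      using ev0 by eventually_elim (use ident(2) in blast)
    show "(\<lambda>z. indicator D z * (g z * L0 z)) \<in> borel_measurable lborel" using L0_int by auto
    show "integrable lborel (\<lambda>z. norm (indicator D z * (g z * L0 z)))" using L0_int by auto
    show "\<forall>\<^sub>F e in at_right 0. \<forall>z. norm (first e z) \<le> norm (indicator D z * (g z * L0 z))"
    proof (intro always_eventually allI)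
      fix e z
      have "\<bar>\<eta> e z\<bar> \<le> 1" using cutoff4_3_range by (simp add: \<eta>_def)
      then have "\<bar>\<eta> e z\<bar> * norm (indicator D z * (g z * L0 z)) \<le> 1 * norm (indicator D z * (g z * L0 z))"
        by (rule mult_right_mono) simp
      then show "norm (first e z) \<le> norm (indicator D z * (g z * L0 z))"
        by (simp add: first_def abs_mult algebra_simps)
    qed
    show "AE z in lborel. ((\<lambda>e. first e z) \<longlongrightarrow> indicator D z * (g z * L0 z)) (at_right 0)"
    proof (rule AE_I2)
      fix z
      show "((\<lambda>e. first e z) \<longlongrightarrow> indicator D z * (g z * L0 z)) (at_right 0)"
      proof (cases "z \<in> D \<and> z \<in> K")
        case True
        then have "z \<in> D \<inter> N" using KN by blast
        then have z: "z \<in> N" "\<phi> z < 0" unfolding D_side by auto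
        have "\<forall>\<^sub>F e in at_right 0. 0 < e \<and> e * 4 < - \<phi> z" using z by (intro eventually_small_right) simp
        then have "\<forall>\<^sub>F e in at_right 0. first e z = indicator D z * (g z * L0 z)"
        proof eventually_elim
          case (elim e)
          then have "4 \<le> - \<phi> z / e" by (subst pos_le_divide_eq) auto
          then show ?case using z cutoff4_3_eq_1 by (simp add: first_def \<eta>_def)
        qed
        then show ?thesis by (rule tendsto_eventually)
      next
        case False
        then have "L0 z = 0 \<or> z \<notin> D" using \<psi>0[of z] by (auto simp: L0_def)
        then show ?thesis by (auto simp: first_def)
      qed
    qed
  qed
  define F where "F = (\<lambda>e \<zeta>. indicator (stretch e -` square a) \<zeta> * (e * (J (stretch e \<zeta>) * f e (P (stretch e \<zeta>)))))"
  define L where "L = (\<lambda>\<zeta>. indicator {-a<..<a} (Im \<zeta>) * (J (Complex 0 (Im \<zeta>)) * \<psi> (\<gamma> (Im \<zeta>)) * \<omega> (Im \<zeta>) * (norm (G (\<gamma> (Im \<zeta>))))^4) *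
    (if Re \<zeta> < 0 then Re \<zeta> * cutoff4 1 (- (Re \<zeta> * (norm (G (\<gamma> (Im \<zeta>))))\<^sup>2)) else 0))"
  have fF: "integral\<^sup>L lborel (f e) = integral\<^sup>L lborel (F e)" if "0 < e" for e
    unfolding F_def
  proof (rule integral_stretched[OF that ident(1)[OF that]])
    fix z assume "z \<notin> P ` square a"
    then have "z \<notin> K" using \<psi>(3) by blast
    then show "f e z = 0" using \<psi>0 by (simp add: f_def m_def)
  qed
  \<comment> \<open>The factor e from the stretching leaves g m / e. It is grouped so that both g /
    e and m stay bounded in the layer.\<close>
  have fe: "e * (J (stretch e \<zeta>) * f e (P (stretch e \<zeta>))) = (if Re \<zeta> < 0 then J (stretch e \<zeta>) * ((g (P (stretch e \<zeta>)) / e) * m e (P (stretch e \<zeta>))) else 0)"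
    if "0 < e" "stretch e \<zeta> \<in> square a" for e \<zeta>
  proof -
    have "P (stretch e \<zeta>) \<in> N" using imgN that(2) by blast
    moreover have "P (stretch e \<zeta>) \<in> D \<longleftrightarrow> Re \<zeta> < 0" using side[OF that(2)] that(1) by (simp add: mult_less_0_iff)
    ultimately show ?thesis using that(1) by (auto simp: f_def power2_eq_square)
  qed
  define Cs where "Cs = {\<zeta>. \<bar>Re \<zeta>\<bar> \<le> a \<and> \<bar>Im \<zeta>\<bar> \<le> a}"
  have compN: "compact (P ` Cs)"
  proof (rule compact_continuous_image)
    show "continuous_on Cs P" unfolding Cs_def
    proof (intro continuous_at_imp_continuous_on ballI)
      fix \<zeta> assume "\<zeta> \<in> {\<zeta>. \<bar>Re \<zeta>\<bar> \<le> a \<and> \<bar>Im \<zeta>\<bar> \<le> a}"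
      then have "(P has_derivative P' \<zeta>) (at \<zeta>)" by (intro P_der) auto
      then show "isCont P \<zeta>" by (rule has_derivative_continuous)
    qed
    show "compact Cs" unfolding Cs_def square_eq_box by simp
  qed
  have PCsN: "P ` Cs \<subseteq> N" using P_in by (auto simp: Cs_def)
  have bddN: "\<exists>M\<ge>0. \<forall>z\<in>P ` square a. norm (h z) \<le> M" if "continuous_on N h" for h :: "complex \<Rightarrow> complex"
  proof -
    have "bounded (h ` (P ` Cs))"
      by (intro compact_imp_bounded compact_continuous_image[OF continuous_on_subset[OF that PCsN] compN])
    then obtain M where "0 < M" "\<And>x. x \<in> h ` (P ` Cs) \<Longrightarrow> norm x \<le> M" using bounded_pos by metis
    moreover have "square a \<subseteq> Cs" by (auto simp: square_def Cs_def)
    ultimately show ?thesis by (intro exI[of _ M]) auto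
  qed
  obtain MG where MG: "0 \<le> MG" "\<And>z. z \<in> P ` square a \<Longrightarrow> norm (G z) \<le> MG" using bddN[OF cc(2)] by blast
  have "continuous_on N (\<lambda>z. complex_of_real (Re (A z) + Im (B z)))" by (intro continuous_intros cc)
  from bddN[OF this] obtain Mlap where Mlap: "0 \<le> Mlap" "\<And>z. z \<in> P ` square a \<Longrightarrow> \<bar>Re (A z) + Im (B z)\<bar> \<le> Mlap"
    by (auto simp flip: of_real_add)
  obtain MJ where MJ: "0 \<le> MJ" "\<And>\<zeta>. \<zeta> \<in> square a \<Longrightarrow> \<bar>J \<zeta>\<bar> \<le> MJ" using J_bounded by blast
  have cut_bdd: "\<exists>M\<ge>0. \<forall>x. \<bar>cutoff4 n x\<bar> \<le> M" if "n \<in> {1,2}" for n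
  proof -
    have "bounded (cutoff4 n ` {1..4})"
      by (intro compact_imp_bounded compact_continuous_image continuous_cutoff4) simp
    then obtain M where M: "0 < M" "\<And>x. x \<in> cutoff4 n ` {1..4} \<Longrightarrow> norm x \<le> M" using bounded_pos by metis
    have "\<bar>cutoff4 n x\<bar> \<le> M" for x
    proof -
      consider "x \<le> 1" | "4 \<le> x" | "x \<in> {1..4}" by fastforce
      then show ?thesis
        using M that cutoff4_eq_0[of x n] cutoff4_1_eq_0[of x] cutoff4_2_eq_0[of x] by cases auto
    qed
    then show ?thesis using M by (intro exI[of _ M]) auto
  qed
  obtain Mc1 where Mc1: "0 \<le> Mc1" "\<And>x. \<bar>cutoff4 1 x\<bar> \<le> Mc1" using cut_bdd[of 1] by auto
  obtain Mc2 where Mc2: "0 \<le> Mc2" "\<And>x. \<bar>cutoff4 2 x\<bar> \<le> Mc2" using cut_bdd[of 2] by auto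
  define Mm where "Mm = M1 * (Mc1 * MG\<^sup>2 + Mc2 * Mlap) + 2 * Mc2 * (M2 * MG)"
  have Mm0: "0 \<le> Mm" using M1 Mc1 Mc2 MG Mlap M2 by (simp add: Mm_def)
  have m_bound: "\<bar>m e z\<bar> \<le> Mm" if "0 < e" "e < 1" "z \<in> P ` square a" for e z
  proof -
    have 1: "\<bar>cutoff4 1 (- \<phi> z / e) * (norm (G z))\<^sup>2\<bar> \<le> Mc1 * MG\<^sup>2"
      unfolding abs_mult using Mc1 MG(2)[OF that(3)] by (intro mult_mono) (auto intro: power_mono)
    have e2: "\<bar>e * cutoff4 2 (- \<phi> z / e)\<bar> \<le> Mc2"
      using mult_mono[of "\<bar>e\<bar>" 1 "\<bar>cutoff4 2 (- \<phi> z / e)\<bar>" Mc2] Mc2 that by (simp add: abs_mult)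
    have 2: "\<bar>e * cutoff4 2 (- \<phi> z / e) * (Re (A z) + Im (B z))\<bar> \<le> Mc2 * Mlap"
      unfolding abs_mult[of "e * cutoff4 2 (- \<phi> z / e)"] using e2 Mlap(2)[OF that(3)] Mc2(1) by (intro mult_mono) auto
    have "\<bar>G\<psi> z \<bullet> G z\<bar> \<le> M2 * MG"
      using Cauchy_Schwarz_ineq2[of "G\<psi> z" "G z"] mult_mono[OF M2(2)[of z] MG(2)[OF that(3)] M2(1) norm_ge_zero] by linarith
    then have "\<bar>(e * cutoff4 2 (- \<phi> z / e)) * (G\<psi> z \<bullet> G z)\<bar> \<le> Mc2 * (M2 * MG)"
      unfolding abs_mult[of "e * cutoff4 2 (- \<phi> z / e)"] using e2 Mc2(1) by (intro mult_mono) auto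
    then have 3: "\<bar>2 * e * cutoff4 2 (- \<phi> z / e) * (G\<psi> z \<bullet> G z)\<bar> \<le> 2 * Mc2 * (M2 * MG)"
      by (simp add: abs_mult)
    have "\<bar>\<psi> z * (cutoff4 1 (- \<phi> z / e) * (norm (G z))\<^sup>2 - e * cutoff4 2 (- \<phi> z / e) * (Re (A z) + Im (B z)))\<bar> \<le> M1 * (Mc1 * MG\<^sup>2 + Mc2 * Mlap)"
      unfolding abs_mult[of "\<psi> z"] using M1 1 2 by (intro mult_mono) auto
    then show ?thesis using 3 unfolding m_def Mm_def by linarith
  qed
  \<comment> \<open>The derivatives of the cutoff vanish from 4 on, and -\<phi> is at least b0 e |Re
    \<zeta>|. This fixes the width 4 / b0 of the stretched layer.\<close>
  have m_zero: "m e (P (stretch e \<zeta>)) = 0" if "0 < e" "stretch e \<zeta> \<in> square a" "Re \<zeta> < 0" "4 / b0 < \<bar>Re \<zeta>\<bar>" for e \<zeta>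
  proof -
    have "b0 * \<bar>Re (stretch e \<zeta>)\<bar> \<le> - \<phi> (P (stretch e \<zeta>))" using that by (intro b0(2)) (auto simp: mult_less_0_iff)
    then have "e * (b0 * \<bar>Re \<zeta>\<bar>) \<le> - \<phi> (P (stretch e \<zeta>))" using that(1) by (simp add: abs_mult mult.left_commute)
    moreover have "4 \<le> b0 * \<bar>Re \<zeta>\<bar>" using that(4) b0(1) by (simp add: pos_divide_less_eq mult.commute)
    ultimately have "e * 4 \<le> - \<phi> (P (stretch e \<zeta>))" using that(1) by (meson mult_left_mono less_imp_le order_trans)
    then have "4 \<le> - \<phi> (P (stretch e \<zeta>)) / e" using that(1) by (subst pos_le_divide_eq) (auto simp: mult.commute)
    from cutoff4_1_eq_0[OF this] cutoff4_2_eq_0[OF this] show ?thesis by (simp add: m_def)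
  qed
  define b where "b = 4 / b0"
  have b: "0 < b" using b0(1) by (simp add: b_def)
  define wt where "wt = (\<lambda>\<zeta>. (MJ * ((C * b) * Mm)) * indicator (cbox (Complex (-b) (-a)) (Complex b a)) \<zeta>)"
  have wi: "integrable lborel wt" unfolding wt_def by (rule closed_square_integrable)
  have wt0: "0 \<le> wt \<zeta>" for \<zeta> using MJ g_bound(1) b Mm0 by (simp add: wt_def)
  have F_bound: "norm (F e \<zeta>) \<le> wt \<zeta>" if e: "0 < e" "e < 1" for e \<zeta>
  proof (cases "stretch e \<zeta> \<in> square a \<and> Re \<zeta> < 0 \<and> \<bar>Re \<zeta>\<bar> \<le> b")
    case True
    have "\<bar>g (P (stretch e \<zeta>))\<bar> \<le> C * \<bar>Re (stretch e \<zeta>)\<bar>" using True e by (intro g_bound(2)) (auto simp: mult_less_0_iff)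
    also have "\<dots> \<le> C * (e * b)"
    proof (rule mult_left_mono[OF _ g_bound(1)])
      show "\<bar>Re (stretch e \<zeta>)\<bar> \<le> e * b" using mult_left_mono[of "\<bar>Re \<zeta>\<bar>" b e] conjunct2[OF conjunct2[OF True]] e
        unfolding stretch_simps abs_mult by simp
    qed
    finally have "\<bar>g (P (stretch e \<zeta>)) / e\<bar> \<le> C * b" using e by (simp add: abs_mult pos_divide_le_eq mult_ac)
    moreover have "\<bar>m e (P (stretch e \<zeta>))\<bar> \<le> Mm" using m_bound[OF e] True by blast
    ultimately have "\<bar>(g (P (stretch e \<zeta>)) / e) * m e (P (stretch e \<zeta>))\<bar> \<le> (C * b) * Mm"
      unfolding abs_mult[of "g _ / e"] using g_bound(1) b by (intro mult_mono) auto
    then have "\<bar>J (stretch e \<zeta>)\<bar> * \<bar>(g (P (stretch e \<zeta>)) / e) * m e (P (stretch e \<zeta>))\<bar> \<le> MJ * ((C * b) * Mm)"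
      using MJ True by (intro mult_mono) auto
    moreover have "\<zeta> \<in> cbox (Complex (-b) (-a)) (Complex b a)" using True by (auto simp: in_cbox_complex_iff square_def)
    ultimately show ?thesis using True fe[OF e(1)] by (simp add: F_def wt_def abs_mult)
  next
    case False
    have "F e \<zeta> = 0"
    proof (cases "stretch e \<zeta> \<in> square a \<and> Re \<zeta> < 0")
      case True
      then have "m e (P (stretch e \<zeta>)) = 0" using m_zero[OF e(1)] False by (auto simp: b_def)
      then show ?thesis using fe[OF e(1)] True by (simp add: F_def)
    next
      case False
      then show ?thesis using fe[OF e(1), of \<zeta>] unfolding F_def
        by (cases "stretch e \<zeta> \<in> square a") (simp_all only: if_False mult_zero_right indicator_simps vimage_eq simp_thms)
    qed
    then show ?thesis using wt0 by simp
  qed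
  have G\<gamma>: "continuous_on {-a<..<a} (\<lambda>y. G (\<gamma> y))"
    by (rule continuous_on_compose2[OF cc(2) \<gamma>_cont]) (use P_in[of "Complex 0 y" for y] P_axis a_pos in \<open>auto simp: abs_le_iff\<close>)
  have \<psi>\<gamma>: "continuous_on {-a<..<a} (\<lambda>y. \<psi> (\<gamma> y))"
    by (rule continuous_on_compose2[OF c\<psi>(1) \<gamma>_cont]) auto
  have Lm: "L \<in> borel_measurable borel"
  proof -
    have o: "open {\<zeta>. Im \<zeta> \<in> {-a<..<a}}"
      unfolding greaterThanLessThan_iff by (intro open_Collect_conj open_Collect_less continuous_intros)
    have cI: "continuous_on {\<zeta>. Im \<zeta> \<in> {-a<..<a}} (\<lambda>\<zeta>. h (Im \<zeta>))" if "continuous_on {-a<..<a} h" for h :: "real \<Rightarrow> complex"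
      by (rule continuous_on_compose2[OF that]) (auto intro!: continuous_intros)
    have cR: "continuous_on {\<zeta>. Im \<zeta> \<in> {-a<..<a}} (\<lambda>\<zeta>. h (Im \<zeta>))" if "continuous_on {-a<..<a} h" for h :: "real \<Rightarrow> real"
      by (rule continuous_on_compose2[OF that]) (auto intro!: continuous_intros)
    note i1 = cR[OF J_axis_cont] and i2 = cR[OF \<psi>\<gamma>] and i3 = cR[OF \<omega>_cont] and i4 = cI[OF G\<gamma>]
    have i5: "continuous_on {\<zeta>. Im \<zeta> \<in> {-a<..<a}} (\<lambda>\<zeta>. cutoff4 1 (- (Re \<zeta> * (norm (G (\<gamma> (Im \<zeta>))))\<^sup>2)))"
      by (rule continuous_on_compose2[OF continuous_cutoff4[of UNIV 1]])
        (intro continuous_on_minus continuous_on_mult continuous_on_power continuous_on_norm continuous_on_Re continuous_on_id i4, simp)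
    \<comment> \<open>With min (Re \<zeta>) 0 in place of the case distinction the integrand is
      visibly continuous.\<close>
    let ?k = "\<lambda>\<zeta>. (J (Complex 0 (Im \<zeta>)) * \<psi> (\<gamma> (Im \<zeta>)) * \<omega> (Im \<zeta>) * (norm (G (\<gamma> (Im \<zeta>))))^4) *
      (min (Re \<zeta>) 0 * cutoff4 1 (- (Re \<zeta> * (norm (G (\<gamma> (Im \<zeta>))))\<^sup>2)))"
    have k: "continuous_on {\<zeta>. Im \<zeta> \<in> {-a<..<a}} ?k"
      by (intro continuous_on_mult continuous_on_min continuous_on_power continuous_on_norm continuous_on_Re
          continuous_on_id continuous_on_const i1 i2 i3 i4 i5)
    have "(\<lambda>\<zeta>. indicator {\<zeta>. Im \<zeta> \<in> {-a<..<a}} \<zeta> *\<^sub>R ?k \<zeta>) \<in> borel_measurable borel"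
      by (rule borel_measurable_continuous_on_indicator[OF borel_open[OF o] k])
    moreover have "(\<lambda>\<zeta>. indicator {\<zeta>. Im \<zeta> \<in> {-a<..<a}} \<zeta> *\<^sub>R ?k \<zeta>) = L"
    proof
      fix \<zeta>
      show "indicator {\<zeta>. Im \<zeta> \<in> {-a<..<a}} \<zeta> *\<^sub>R ?k \<zeta> = L \<zeta>"
        by (cases "Im \<zeta> \<in> {-a<..<a}"; cases "Re \<zeta> < 0") (simp_all add: L_def)
    qed
    ultimately show ?thesis by (simp only:)
  qed
  have pointwise: "((\<lambda>e. F e \<zeta>) \<longlongrightarrow> L \<zeta>) (at_right 0)" for \<zeta>
  proof (cases "\<bar>Im \<zeta>\<bar> < a \<and> Re \<zeta> < 0")
    case False
    have "\<forall>\<^sub>F e in at_right 0. F e \<zeta> = L \<zeta>"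
      using ev0
    proof eventually_elim
      case (elim e)
      then show ?case using False fe[OF elim, of \<zeta>]
        by (cases "stretch e \<zeta> \<in> square a") (auto simp: F_def L_def square_def indicator_def)
    qed
    then show ?thesis by (rule tendsto_eventually)
  next
    case True
    define y where "y = Im \<zeta>"
    define s where "s = Re \<zeta>"
    have y: "\<bar>y\<bar> < a" and s: "s < 0" using True by (auto simp: y_def s_def)
    let ?b = "(norm (G (\<gamma> y)))\<^sup>2"
    have ev: "\<forall>\<^sub>F e in at_right 0. F e \<zeta> = J (stretch e \<zeta>) * ((g (P (stretch e \<zeta>)) / e) * m e (P (stretch e \<zeta>)))"
      using ev0 eventually_strip[OF conjunct1[OF True]]
    proof eventually_elim
      case (elim e)
      show ?case using fe[OF elim] True elim(2) by (simp add: F_def)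
    qed
    have left: "filterlim (\<lambda>e. e * s) (at_left 0) (at_right 0)"
    proof -
      have "((\<lambda>e. e * s) \<longlongrightarrow> 0 * s) (at_right 0)" by (intro tendsto_intros)
      moreover have "\<forall>\<^sub>F e in at_right 0. e * s \<in> {..<0} \<and> e * s \<noteq> 0"
        using ev0 by eventually_elim (use s in \<open>auto simp: mult_pos_neg\<close>)
      ultimately show ?thesis by (simp add: filterlim_at)
    qed
    have st: "stretch e \<zeta> = Complex (e * s) y" for e by (simp add: stretch_def s_def y_def)
    have t1: "((\<lambda>e. g (P (stretch e \<zeta>)) / e) \<longlongrightarrow> \<omega> y * ?b * s) (at_right 0)"
    proof -
      have "((\<lambda>e. g (P (Complex (e * s) y)) / (e * s) * s) \<longlongrightarrow> \<omega> y * ?b * s) (at_right 0)"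
        by (intro tendsto_intros filterlim_compose[OF g_lim[OF y] left])
      then show ?thesis using s by (simp add: st)
    qed
    have tJ: "((\<lambda>e. J (stretch e \<zeta>)) \<longlongrightarrow> J (Complex 0 y)) (at_right 0)"
      using tendsto_axis[OF J_cont_square, of \<zeta>] y by (simp add: y_def)
    have tN: "((\<lambda>e. h (P (stretch e \<zeta>))) \<longlongrightarrow> h (\<gamma> y)) (at_right 0)" if "continuous_on N h" for h :: "complex \<Rightarrow> 'z::topological_space"
    proof -
      have "continuous_on (square a) (\<lambda>\<zeta>. h (P \<zeta>))" by (rule continuous_on_compose2[OF that P_cont]) (use imgN in auto)
      from tendsto_axis[OF this, of \<zeta>] y show ?thesis by (simp add: y_def P_axis)
    qed
    \<comment> \<open>Along the ray through \<open>\<gamma> y\<close> the function \<phi> starts at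
      0 with slope |G|^2, so the scaled argument of the cutoff converges.\<close>
    have t\<phi>: "((\<lambda>e. - \<phi> (P (stretch e \<zeta>)) / e) \<longlongrightarrow> - (s * ?b)) (at_right 0)"
    proof -
      have "P (Complex 0 y) \<in> N" using P_in[of "Complex 0 y"] y a_pos by simp
      then have "GDERIV \<phi> (\<gamma> y + 0 *\<^sub>R G (\<gamma> y)) :> G (\<gamma> y)" using c2_GDERIV[OF c] by (simp add: P_axis)
      from GDERIV_DERIV_line[OF this]
      have "((\<lambda>h. \<phi> (\<gamma> y + h *\<^sub>R G (\<gamma> y))) has_real_derivative ?b) (at 0)" by (simp add: power2_norm_eq_inner)
      then have "((\<lambda>h. \<phi> (\<gamma> y + h *\<^sub>R G (\<gamma> y)) / h) \<longlongrightarrow> ?b) (at_left 0)"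
        using level[OF y] by (auto simp: DERIV_def intro: tendsto_within_subset)
      from filterlim_compose[OF this left]
      have "((\<lambda>e. - (\<phi> (\<gamma> y + (e * s) *\<^sub>R G (\<gamma> y)) / (e * s) * s)) \<longlongrightarrow> - (?b * s)) (at_right 0)"
        by (intro tendsto_intros)
      then show ?thesis using s by (simp add: st P_eq mult.commute)
    qed
    have tc: "((\<lambda>e. cutoff4 n (- \<phi> (P (stretch e \<zeta>)) / e)) \<longlongrightarrow> cutoff4 n (- (s * ?b))) (at_right 0)" for n
      using continuous_cutoff4[of UNIV n] t\<phi> by (auto simp: continuous_on_eq_continuous_at intro: isCont_tendsto_compose)
    have te: "((\<lambda>e. e) \<longlongrightarrow> (0::real)) (at_right 0)" by (rule tendsto_ident_at)
    have tm: "((\<lambda>e. m e (P (stretch e \<zeta>))) \<longlongrightarrow> \<psi> (\<gamma> y) * (cutoff4 1 (- (s * ?b)) * ?b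
        - 0 * cutoff4 2 (- (s * ?b)) * (Re (A (\<gamma> y)) + Im (B (\<gamma> y)))) - 2 * 0 * cutoff4 2 (- (s * ?b)) * (G\<psi> (\<gamma> y) \<bullet> G (\<gamma> y))) (at_right 0)"
      unfolding m_def
      by (intro tendsto_intros tc te tN cc continuous_on_subset[OF c\<psi>(1)] continuous_on_subset[OF c\<psi>(2)]) auto
    have "((\<lambda>e. J (stretch e \<zeta>) * ((g (P (stretch e \<zeta>)) / e) * m e (P (stretch e \<zeta>)))) \<longlongrightarrow>
      J (Complex 0 y) * ((\<omega> y * ?b * s) * (\<psi> (\<gamma> y) * (cutoff4 1 (- (s * ?b)) * ?b
        - 0 * cutoff4 2 (- (s * ?b)) * (Re (A (\<gamma> y)) + Im (B (\<gamma> y)))) - 2 * 0 * cutoff4 2 (- (s * ?b)) * (G\<psi> (\<gamma> y) \<bullet> G (\<gamma> y))))) (at_right 0)"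
      by (intro tendsto_mult tJ t1 tm)
    moreover have "norm (G (\<gamma> y)) ^ 4 = ?b * ?b" by (simp add: power2_eq_square power4_eq_xxxx)
    then have "L \<zeta> = J (Complex 0 y) * ((\<omega> y * ?b * s) * (\<psi> (\<gamma> y) * (cutoff4 1 (- (s * ?b)) * ?b
        - 0 * cutoff4 2 (- (s * ?b)) * (Re (A (\<gamma> y)) + Im (B (\<gamma> y)))) - 2 * 0 * cutoff4 2 (- (s * ?b)) * (G\<psi> (\<gamma> y) \<bullet> G (\<gamma> y))))"
      using y s by (simp add: L_def y_def[symmetric] s_def[symmetric] indicator_def abs_less_iff)
    ultimately show ?thesis using tendsto_cong[OF ev] by simp
  qed
  have limF: "((\<lambda>e. integral\<^sup>L lborel (F e)) \<longlongrightarrow> integral\<^sup>L lborel L) (at_right 0)"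
  proof (rule integral_tendsto_at[OF _ _ wi])
    have ev1: "\<forall>\<^sub>F e in at_right (0::real). 0 < e \<and> e < 1" using eventually_small_right[of 1 1] by simp
    show "\<forall>\<^sub>F e in at_right 0. F e \<in> borel_measurable lborel"
      using ev0
    proof eventually_elim
      case (elim e)
      have "f e \<in> borel_measurable borel" using ident(1)[OF elim] by auto
      from borel_measurable_times[OF borel_measurable_const[of e] pullback_measurable[OF this, of e]]
      show ?case unfolding F_def by (simp add: mult.left_commute)
    qed
    show "\<forall>\<^sub>F e in at_right 0. \<forall>\<zeta>. norm (F e \<zeta>) \<le> wt \<zeta>"
      using ev1 by eventually_elim (use F_bound in blast)
  qed (use Lm pointwise in auto)
  \<comment> \<open>The domination of \<open>F\<close> passes to its pointwise limit.\<close>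
  have "integrable lborel L"
  proof (rule Bochner_Integration.integrable_bound[OF wi])
    show "AE \<zeta> in lborel. norm (L \<zeta>) \<le> norm (wt \<zeta>)"
    proof (rule AE_I2)
      fix \<zeta>
      have "norm (L \<zeta>) \<le> wt \<zeta>"
      proof (rule tendsto_upperbound)
        show "((\<lambda>e. norm (F e \<zeta>)) \<longlongrightarrow> norm (L \<zeta>)) (at_right 0)" by (intro tendsto_norm pointwise)
        show "\<forall>\<^sub>F e in at_right 0. norm (F e \<zeta>) \<le> wt \<zeta>"
          using eventually_small_right[of 1 1] F_bound by (auto elim!: eventually_mono simp del: real_norm_def)
      qed simp
      then show "norm (L \<zeta>) \<le> norm (wt \<zeta>)" by simp
    qed
  qed (use Lm in simp)
  from integral_complex_iterated[OF this]
  have "integral\<^sup>L lborel L = (LBINT y. LBINT x. L (Complex x y))" .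
  also have "\<dots> = (LBINT y. indicator {-a<..<a} y * (J (Complex 0 y) * \<psi> (\<gamma> y) * \<omega> y))"
  proof (intro Bochner_Integration.integral_cong refl)
    fix y
    let ?b = "(norm (G (\<gamma> y)))\<^sup>2"
    have "(LBINT x. L (Complex x y)) = (LBINT x. (indicator {-a<..<a} y * (J (Complex 0 y) * \<psi> (\<gamma> y) * \<omega> y * (norm (G (\<gamma> y)))^4)) *
      (if x < 0 then x * cutoff4 1 (- (x * ?b)) else 0))"
      by (simp only: L_def complex.sel)
    also have "\<dots> = (indicator {-a<..<a} y * (J (Complex 0 y) * \<psi> (\<gamma> y) * \<omega> y * (norm (G (\<gamma> y)))^4)) *
      (LBINT x. (if x < 0 then x * cutoff4 1 (- (x * ?b)) else 0))"
      by (rule integral_mult_right_zero)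
    \<comment> \<open>One |G|^2 comes from the slope of \<open>g\<close> and one from the squared
      gradient of \<phi>. Together they cancel the 1/b^2 of \<open>integral_cutoff4_second\<close>,
      where b = |G|^2.\<close>
    also have "\<dots> = indicator {-a<..<a} y * (J (Complex 0 y) * \<psi> (\<gamma> y) * \<omega> y)"
    proof (cases "\<bar>y\<bar> < a")
      case True
      then have "0 < ?b" using G_nonzero by simp
      have "norm (G (\<gamma> y)) ^ 4 = ?b\<^sup>2" by simp
      then show ?thesis using integral_cutoff4_second[OF \<open>0 < ?b\<close>] \<open>0 < ?b\<close> by simp
    qed (auto simp: indicator_def)
    finally show "(LBINT x. L (Complex x y)) = indicator {-a<..<a} y * (J (Complex 0 y) * \<psi> (\<gamma> y) * \<omega> y)" .
  qed
  finally have IL: "integral\<^sup>L lborel L = (LBINT y. indicator {-a<..<a} y * (J (Complex 0 y) * \<psi> (\<gamma> y) * \<omega> y))" .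
  have "((\<lambda>e. integral\<^sup>L lborel (first e) + integral\<^sup>L lborel (F e)) \<longlongrightarrow>
    (LBINT z. indicator D z * (g z * L0 z)) + integral\<^sup>L lborel L) (at_right 0)"
    by (intro tendsto_add lim_first limF)
  moreover have "\<forall>\<^sub>F e in at_right 0. integral\<^sup>L lborel (first e) + integral\<^sup>L lborel (F e) = 0"
    using ev0 by eventually_elim (use ident(3) fF in simp)
  then have "((\<lambda>e. integral\<^sup>L lborel (first e) + integral\<^sup>L lborel (F e)) \<longlongrightarrow> 0) (at_right 0)"
    by (rule tendsto_eventually)
  ultimately have "(LBINT z. indicator D z * (g z * L0 z)) + integral\<^sup>L lborel L = 0"
    by (rule tendsto_unique[rotated]) simp
  then show ?thesis unfolding L0_def IL[symmetric] by simp
qed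

end

section \<open>Boundary motion and Green functions near a boundary point\<close>

lemma C_1_onD:
  assumes "C_k_on 1 S f"
  obtains \<Gamma> where "\<And>x. x \<in> S \<Longrightarrow> GDERIV f x :> \<Gamma> x" "continuous_on S \<Gamma>"
proof -
  obtain \<Gamma> where \<Gamma>: "\<forall>x\<in>S. GDERIV f x :> \<Gamma> x" "\<forall>b\<in>Basis. continuous_on S (\<lambda>x. \<Gamma> x \<bullet> b)"
    using assms by auto
  then have "continuous_on S \<Gamma>" by (subst continuous_on_componentwise)
  with \<Gamma>(1) show ?thesis using that by blast
qed

lemma mean_value_line:
  assumes "\<And>s. s \<in> closed_segment 0 r \<Longrightarrow> GDERIV f (p + s *\<^sub>R v) :> G s"
  obtains s where "s \<in> closed_segment 0 (r::real)" "f (p + r *\<^sub>R v) - f p = r * (G s \<bullet> v)"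
proof -
  have der: "((\<lambda>s. f (p + s *\<^sub>R v)) has_real_derivative (G s \<bullet> v)) (at s)" if "s \<in> closed_segment 0 r" for s
    using GDERIV_DERIV_line[OF assms[OF that]] .
  consider "r = 0" | "0 < r" | "r < 0" by linarith
  then show ?thesis
  proof cases
    case 1
    then show ?thesis using that[of 0] by simp
  next
    case 2
    have "\<exists>s. 0 < s \<and> s < r \<and> f (p + r *\<^sub>R v) - f (p + 0 *\<^sub>R v) = (r - 0) * (G s \<bullet> v)"
      by (rule MVT2[OF 2]) (use der 2 in \<open>auto simp: closed_segment_eq_real_ivl\<close>)
    then obtain s where "0 < s" "s < r" "f (p + r *\<^sub>R v) - f p = r * (G s \<bullet> v)" by auto
    then show ?thesis using that[of s] 2 by (simp add: closed_segment_eq_real_ivl)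
  next
    case 3
    have "\<exists>s. r < s \<and> s < 0 \<and> f (p + 0 *\<^sub>R v) - f (p + r *\<^sub>R v) = (0 - r) * (G s \<bullet> v)"
      by (rule MVT2[OF 3]) (use der 3 in \<open>auto simp: closed_segment_eq_real_ivl\<close>)
    then obtain s where "r < s" "s < 0" "f p - f (p + r *\<^sub>R v) = - r * (G s \<bullet> v)" by auto
    then show ?thesis using that[of s] 3 by (simp add: closed_segment_eq_real_ivl)
  qed
qed

text \<open>A boundary of class \<open>C\<^sup>2\<close> has exterior balls of uniform radius, which lets the barrier bound
  \<open>|g|\<close> linearly by the distance to the boundary.\<close>

lemma exterior_ball:
  assumes c: "c2 N \<phi> G A B" and z0: "z0 \<in> N" "G z0 \<noteq> 0" and D: "D \<inter> N = {z \<in> N. \<phi> z < 0}"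
  obtains r R where "0 < r" "0 < R" "ball z0 r \<subseteq> N" "\<And>p. p \<in> ball z0 r \<Longrightarrow> G p \<noteq> 0"
    "\<And>p. p \<in> ball z0 r \<Longrightarrow> \<phi> p = 0 \<Longrightarrow> ball (p + R *\<^sub>R sgn (G p)) R \<inter> D = {}"
proof -
  note cc = c2_continuous_on[OF c]
  define m where "m = norm (G z0) / 2"
  have m: "0 < m" using z0 by (simp add: m_def)
  have "open (N \<inter> (\<lambda>z. norm (G z)) -` {m<..})"
    by (rule continuous_open_preimage[OF continuous_on_norm[OF cc(2)] c2_open[OF c]]) simp
  moreover have "z0 \<in> N \<inter> (\<lambda>z. norm (G z)) -` {m<..}" using z0 m by (simp add: m_def)
  ultimately obtain r1 where r1: "0 < r1" "cball z0 r1 \<subseteq> N \<inter> (\<lambda>z. norm (G z)) -` {m<..}"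
    by (meson open_contains_cball)
  have sub: "cball z0 r1 \<subseteq> N" using r1 by auto
  have "bounded (A ` cball z0 r1)" "bounded (B ` cball z0 r1)"
    using sub by (auto intro!: compact_imp_bounded compact_continuous_image continuous_on_subset[OF cc(3)] continuous_on_subset[OF cc(4)])
  then obtain KA KB where K: "\<And>x. x \<in> cball z0 r1 \<Longrightarrow> norm (A x) \<le> KA" "\<And>x. x \<in> cball z0 r1 \<Longrightarrow> norm (B x) \<le> KB"
    unfolding bounded_iff by blast
  have KAB0: "0 \<le> KA" "0 \<le> KB"
    using order_trans[OF norm_ge_zero K(1)[of z0]] order_trans[OF norm_ge_zero K(2)[of z0]] r1(1) by simp_all
  define K where "K = KA + KB + 1"
  have K0: "0 < K" using KAB0 by (simp add: K_def)
  have lip1: "\<bar>f x - f y\<bar> \<le> k * norm (x - y)"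
    if "x \<in> cball z0 r1" "y \<in> cball z0 r1" "\<And>x. x \<in> cball z0 r1 \<Longrightarrow> GDERIV f x :> H x" "\<And>x. x \<in> cball z0 r1 \<Longrightarrow> norm (H x) \<le> k"
    for f :: "complex \<Rightarrow> real" and H k x y
    unfolding real_norm_def[symmetric]
  proof (rule differentiable_bound[OF convex_cball[of z0 r1] _ _ that(1,2)])
    show "(f has_derivative (\<lambda>h. h \<bullet> H x)) (at x within cball z0 r1)" if "x \<in> cball z0 r1" for x
      using \<open>\<And>x. x \<in> cball z0 r1 \<Longrightarrow> GDERIV f x :> H x\<close>[OF that] by (simp add: gderiv_def has_derivative_at_withinI)
    show "onorm (\<lambda>h. h \<bullet> H x) \<le> k" if "x \<in> cball z0 r1" for x
    proof (rule onorm_le)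
      fix h
      have "norm (h \<bullet> H x) \<le> norm h * norm (H x)" using Cauchy_Schwarz_ineq2[of h "H x"] by simp
      also have "\<dots> \<le> norm h * k" using \<open>\<And>x. x \<in> cball z0 r1 \<Longrightarrow> norm (H x) \<le> k\<close>[OF that] by (intro mult_left_mono) auto
      finally show "norm (h \<bullet> H x) \<le> k * norm h" by (simp add: mult.commute)
    qed
  qed
  have lip: "norm (G x - G y) \<le> K * norm (x - y)" if "x \<in> cball z0 r1" "y \<in> cball z0 r1" for x y
  proof -
    have "\<bar>Re (G x) - Re (G y)\<bar> \<le> KA * norm (x - y)"
      by (rule lip1[OF that _ K(1)]) (use c sub in \<open>auto simp: c2_def\<close>)
    moreover have "\<bar>Im (G x) - Im (G y)\<bar> \<le> KB * norm (x - y)"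
      by (rule lip1[OF that _ K(2)]) (use c sub in \<open>auto simp: c2_def\<close>)
    moreover have "norm (G x - G y) \<le> \<bar>Re (G x) - Re (G y)\<bar> + \<bar>Im (G x) - Im (G y)\<bar>"
      using cmod_le[of "G x - G y"] by simp
    ultimately show ?thesis by (simp add: K_def distrib_right) (use norm_ge_zero[of "x - y"] in linarith)
  qed
  define r where "r = r1 / 2"
  \<comment> \<open>The bound m / (2 K) lets the linear term at \<open>p\<close> absorb the
    quadratic error K |z - p|^2 throughout the tangent disc; r1 / 4 keeps that disc where the
    estimates hold.\<close>
  define R where "R = min (r1 / 4) (m / (2 * K))"
  have R: "0 < R" "2 * R \<le> r1 / 2" "2 * K * R \<le> m"
  proof -
    show "0 < R" "2 * R \<le> r1 / 2" using r1 m K0 by (auto simp: R_def min_def)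
    have "R \<le> m / (2 * K)" by (simp add: R_def)
    then show "2 * K * R \<le> m" using K0 by (simp add: pos_le_divide_eq mult.commute)
  qed
  show ?thesis
  proof
    show "0 < r" "0 < R" using r1 R by (auto simp: r_def)
    show "ball z0 r \<subseteq> N" using sub r1 by (auto simp: r_def subset_iff)
    show G0: "G p \<noteq> 0" if "p \<in> ball z0 r" for p
    proof -
      have "p \<in> cball z0 r1" using that r1 by (auto simp: r_def)
      then have "m < norm (G p)" using r1 by auto
      then show ?thesis using m by auto
    qed
    show "ball (p + R *\<^sub>R sgn (G p)) R \<inter> D = {}" if p: "p \<in> ball z0 r" "\<phi> p = 0" for p
    proof (rule ccontr)
      assume "ball (p + R *\<^sub>R sgn (G p)) R \<inter> D \<noteq> {}"
      then obtain z where z: "z \<in> ball (p + R *\<^sub>R sgn (G p)) R" "z \<in> D" by blast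
      define n where "n = sgn (G p)"
      have nn: "norm n = 1" using G0[OF p(1)] by (simp add: n_def norm_sgn)
      have zc: "norm (z - p - R *\<^sub>R n) < R" using z by (simp add: dist_norm n_def norm_minus_commute algebra_simps)
      then have "(norm (z - p - R *\<^sub>R n))\<^sup>2 < R\<^sup>2" by (intro power_strict_mono) auto
      moreover have "(norm (z - p - R *\<^sub>R n))\<^sup>2 = (norm (z - p))\<^sup>2 - 2 * R * (n \<bullet> (z - p)) + R\<^sup>2"
        using nn unfolding power2_norm_eq_inner norm_eq_1
        by (simp add: inner_diff_left inner_diff_right inner_commute power2_eq_square algebra_simps)
      \<comment> \<open>Membership in the disc of radius R tangent at \<open>p\<close>, with centre
        in the direction n, expressed through the inner product.\<close>
      ultimately have q: "(norm (z - p))\<^sup>2 < 2 * R * (n \<bullet> (z - p))" by linarith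
      have "norm (z - p) \<le> norm (z - p - R *\<^sub>R n) + norm (R *\<^sub>R n)" by (metis diff_add_cancel norm_triangle_ineq)
      then have zp: "norm (z - p) < 2 * R" using zc nn R(1) by simp
      have seg: "p + s *\<^sub>R (z - p) \<in> cball z0 r1" if "s \<in> closed_segment 0 1" for s
      proof -
        have s: "0 \<le> s" "s \<le> 1" using that by (auto simp: closed_segment_eq_real_ivl)
        have "norm (s *\<^sub>R (z - p)) \<le> 1 * norm (z - p)" unfolding norm_scaleR using s by (intro mult_right_mono) auto
        then have "norm (s *\<^sub>R (z - p)) \<le> r1 / 2" using zp R(2) by linarith
        moreover have "dist z0 p < r1 / 2" using p by (simp add: r_def)
        moreover have "dist z0 (p + s *\<^sub>R (z - p)) \<le> dist z0 p + norm (s *\<^sub>R (z - p))"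
          using dist_triangle[of z0 "p + s *\<^sub>R (z - p)" p] by (simp add: dist_norm)
        ultimately show ?thesis by simp
      qed
      obtain s where s: "s \<in> closed_segment 0 1" "\<phi> (p + 1 *\<^sub>R (z - p)) - \<phi> p = 1 * (G (p + s *\<^sub>R (z - p)) \<bullet> (z - p))"
        using mean_value_line[of 1 \<phi> p "z - p" "\<lambda>s. G (p + s *\<^sub>R (z - p))"] c2_GDERIV[OF c] seg sub by blast
      have pc: "p \<in> cball z0 r1" using seg[of 0] by simp
      have "norm (G (p + s *\<^sub>R (z - p)) - G p) \<le> K * norm (s *\<^sub>R (z - p))"
        using lip[OF seg[OF s(1)] pc] by simp
      also have "\<dots> \<le> K * norm (z - p)"
      proof (rule mult_left_mono)
        have "norm (s *\<^sub>R (z - p)) \<le> 1 * norm (z - p)"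
          unfolding norm_scaleR using s(1) by (intro mult_right_mono) (auto simp: closed_segment_eq_real_ivl)
        then show "norm (s *\<^sub>R (z - p)) \<le> norm (z - p)" by simp
      qed (use K0 in simp)
      finally have "\<bar>(G (p + s *\<^sub>R (z - p)) - G p) \<bullet> (z - p)\<bar> \<le> K * norm (z - p) * norm (z - p)"
        using Cauchy_Schwarz_ineq2[of "G (p + s *\<^sub>R (z - p)) - G p" "z - p"]
        by (meson mult_right_mono norm_ge_zero order_trans)
      then have "G p \<bullet> (z - p) - K * (norm (z - p))\<^sup>2 \<le> G (p + s *\<^sub>R (z - p)) \<bullet> (z - p)"
        by (simp add: inner_diff_left power2_eq_square)
      then have low: "G p \<bullet> (z - p) - K * (norm (z - p))\<^sup>2 \<le> \<phi> z" using s(2) p(2) by simp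
      have Gp: "G p = norm (G p) *\<^sub>R n" using G0[OF p(1)] by (simp add: n_def sgn_div_norm)
      have np: "0 < n \<bullet> (z - p)" using le_less_trans[OF zero_le_power2 q] R(1) by (simp add: zero_less_mult_iff)
      have "K * (norm (z - p))\<^sup>2 \<le> K * (2 * R * (n \<bullet> (z - p)))" using q K0 by (intro mult_left_mono) auto
      also have "\<dots> = (2 * K * R) * (n \<bullet> (z - p))" by simp
      also have "\<dots> \<le> m * (n \<bullet> (z - p))" using R(3) np by (intro mult_right_mono) auto
      also have "\<dots> \<le> norm (G p) * (n \<bullet> (z - p))" using pc r1(2) np by (intro mult_right_mono) auto
      also have "\<dots> = G p \<bullet> (z - p)" by (subst (2) Gp) simp
      finally have "0 \<le> \<phi> z" using low by linarith
      moreover have "z \<in> N" using seg[of 1] sub by auto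
      moreover from this have "z \<in> {z \<in> N. \<phi> z < 0}" using z(2) unfolding D[symmetric] by simp
      ultimately show False by simp
    qed
  qed
qed

text \<open>The quotient is unchanged when the space-time gradient is scaled by a positive factor,
  and the direction of that gradient is fixed by the domain. Hence one \<Theta> computes the
  velocity at all boundary points near its base point.\<close>

lemma normal_velocity_unique:
  assumes nv: "normal_velocity t0 D t z v"
    and \<Theta>: "open M" "(t, z) \<in> M" "spacetime t0 D \<inter> M = {p \<in> M. \<Theta> p < 0}" "GDERIV \<Theta> (t, z) :> H" "snd H \<noteq> 0"
    and fr: "(t, z) \<in> frontier (spacetime t0 D)"
  shows "v = - fst H / norm (snd H)"
proof -
  obtain \<phi> a G N where \<phi>: "open N" "(t, z) \<in> N" "spacetime t0 D \<inter> N = {y \<in> N. \<phi> y < 0}"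
    "GDERIV \<phi> (t, z) :> (a, G)" "G \<noteq> 0" "v = - a / norm G"
    using nv unfolding normal_velocity_def local_defining_function_def by blast
  have z: "\<phi> (t, z) = 0" "\<Theta> (t, z) = 0"
    using local_defining_zero[OF \<phi>(1,2,3) GDERIV_isCont[OF \<phi>(4)] fr]
      local_defining_zero[OF \<Theta>(1,2,3) GDERIV_isCont[OF \<Theta>(4)] fr] by auto
  have ne: "(a, G) \<noteq> 0" "H \<noteq> 0" using \<phi>(5) \<Theta>(5) by (auto simp: zero_prod_def)
  have "(a, G) /\<^sub>R norm (a, G) = H /\<^sub>R norm H"
  proof (rule gradient_direction_unique[OF _ _ _ \<phi>(4) ne(1) z(1) \<Theta>(4) ne(2) z(2)])
    show "open (N \<inter> M)" "(t, z) \<in> N \<inter> M" using \<phi> \<Theta> by auto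
    fix x assume "x \<in> N \<inter> M"
    then have "\<phi> x < 0 \<longleftrightarrow> x \<in> spacetime t0 D \<inter> N" "\<Theta> x < 0 \<longleftrightarrow> x \<in> spacetime t0 D \<inter> M"
      unfolding \<phi>(3) \<Theta>(3) by auto
    then show "\<phi> x < 0 \<longleftrightarrow> \<Theta> x < 0" using \<open>x \<in> N \<inter> M\<close> by blast
  qed
  then have e: "(a, G) = (norm (a, G) / norm H) *\<^sub>R H"
  proof -
    assume h: "(a, G) /\<^sub>R norm (a, G) = H /\<^sub>R norm H"
    have "(a, G) = norm (a, G) *\<^sub>R ((a, G) /\<^sub>R norm (a, G))" using ne by simp
    also have "\<dots> = (norm (a, G) / norm H) *\<^sub>R H" unfolding h by (simp add: divide_inverse)
    finally show ?thesis .
  qed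
  define k where "k = norm (a, G) / norm H"
  have k: "0 < k" using ne by (simp add: k_def)
  have "a = k * fst H" "G = k *\<^sub>R snd H" using arg_cong[OF e, of fst] arg_cong[OF e, of snd] by (simp_all add: k_def)
  then show ?thesis using \<phi>(6) k \<Theta>(5) by simp
qed

lemma outward_normal_unique:
  assumes n: "outward_unit_normal D z n"
    and \<phi>: "open N" "z \<in> N" "D \<inter> N = {y \<in> N. \<phi> y < 0}" "GDERIV \<phi> z :> G" "G \<noteq> 0"
    and fr: "z \<in> frontier D"
  shows "n = sgn G"
proof -
  obtain \<psi> H M where \<psi>: "open M" "z \<in> M" "D \<inter> M = {y \<in> M. \<psi> y < 0}" "GDERIV \<psi> z :> H" "H \<noteq> 0" "n = H /\<^sub>R norm H"
    using n unfolding outward_unit_normal_def local_defining_function_def by blast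
  have z: "\<phi> z = 0" "\<psi> z = 0"
    using local_defining_zero[OF \<phi>(1,2,3) GDERIV_isCont[OF \<phi>(4)] fr]
      local_defining_zero[OF \<psi>(1,2,3) GDERIV_isCont[OF \<psi>(4)] fr] by auto
  have "H /\<^sub>R norm H = G /\<^sub>R norm G"
  proof (rule gradient_direction_unique[OF _ _ _ \<psi>(4,5) z(2) \<phi>(4,5) z(1)])
    show "open (M \<inter> N)" "z \<in> M \<inter> N" using \<phi> \<psi> by auto
    fix x assume "x \<in> M \<inter> N"
    then have "\<psi> x < 0 \<longleftrightarrow> x \<in> D \<inter> M" "\<phi> x < 0 \<longleftrightarrow> x \<in> D \<inter> N" unfolding \<phi>(3) \<psi>(3) by auto
    then show "\<psi> x < 0 \<longleftrightarrow> \<phi> x < 0" using \<open>x \<in> M \<inter> N\<close> by blast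
  qed
  then show ?thesis using \<psi>(6) by (simp add: sgn_div_norm)
qed

lemma frontier_spacetime:
  assumes t: "0 < t" "t < t0" and D: "open (D t)" and z: "z \<in> frontier (D t)"
  shows "(t, z) \<in> frontier (spacetime t0 D)"
proof -
  have "z \<notin> D t" using z D by (simp add: frontier_def interior_open)
  then have "(t, z) \<notin> interior (spacetime t0 D)" using interior_subset by (auto simp: spacetime_def)
  moreover have "(t, z) \<in> closure (spacetime t0 D)"
  proof -
    obtain x where x: "\<And>n. x n \<in> D t" "x \<longlonglongrightarrow> z"
      using z unfolding frontier_def by (auto simp: closure_sequential)
    have "(\<lambda>n. (t, x n)) \<longlonglongrightarrow> (t, z)" by (intro tendsto_intros x)
    moreover have "\<forall>n. (t, x n) \<in> spacetime t0 D" using x t by (simp add: spacetime_def)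
    ultimately show ?thesis unfolding closure_sequential by (intro exI[of _ "\<lambda>n. (t, x n)"]) auto
  qed
  ultimately show ?thesis by (simp add: frontier_def)
qed

lemma gradient_slice:
  fixes \<Theta> :: "real \<times> complex \<Rightarrow> real"
  assumes "GDERIV \<Theta> (t, z) :> H" shows "GDERIV (\<lambda>z. \<Theta> (t, z)) z :> snd H"
proof -
  have "((\<lambda>z. (t, z)) has_derivative (\<lambda>h. (0, h))) (at z)" by (auto intro!: derivative_eq_intros)
  moreover have "(\<Theta> has_derivative (\<lambda>h. h \<bullet> H)) (at (t, z))" using assms by (simp add: gderiv_def)
  ultimately have "((\<lambda>z. \<Theta> (t, z)) has_derivative (\<lambda>h. (0, h) \<bullet> H)) (at z)" by (rule has_derivative_compose)
  moreover have "(\<lambda>h. (0, h) \<bullet> H) = (\<lambda>h. h \<bullet> snd H)" by (cases H) (simp add: fun_eq_iff)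
  ultimately show ?thesis unfolding gderiv_def by simp
qed

lemma dist_pair_le: "dist (a, b) (c, d) \<le> dist a c + dist b d"
  using sqrt_sum_squares_le_sum_abs[of "dist a c" "dist b d"] by (simp add: dist_Pair_Pair)

text \<open>The neighbourhood is the image of a tube so small that mean value estimates hold for
  both defining functions. In it \<open>motion\<close>, applied forward and backward in time, and
  \<open>flux\<close> produce the same integral over the axis.\<close>

lemma local_identity:
  fixes D :: "real \<Rightarrow> complex set"
  assumes t: "0 < t" "t < t0" and opens: "\<And>s. 0 < s \<Longrightarrow> s < t0 \<Longrightarrow> open (D s)"
    and gd: "green_domain (D t) u w g"
    and C2: "C2_boundary (D t)"
    and gr: "\<And>z. z \<in> frontier (D t) \<Longrightarrow> \<exists>v. normal_velocity t0 D t z v \<and> outward_normal_derivative (D t) g z v"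
    and z0: "z0 \<in> frontier (D t)"
  obtains W where "open W" "z0 \<in> W" "w \<notin> W"
    "\<And>\<psi> G\<psi> A\<psi> B\<psi> K. c2 UNIV \<psi> G\<psi> A\<psi> B\<psi> \<Longrightarrow> compact K \<Longrightarrow> K \<subseteq> W \<Longrightarrow> (\<And>z. z \<notin> K \<Longrightarrow> \<psi> z = 0) \<Longrightarrow>
      ((\<lambda>s. LBINT z. indicator (D s) z * \<psi> z) has_real_derivative
        - (LBINT z. indicator (D t) z * (g z * (Re (A\<psi> z) + Im (B\<psi> z) - u z * \<psi> z)))) (at t)"
proof -
  interpret gd: green_domain "D t" u w g by fact
  obtain \<phi> G0 where \<phi>: "local_defining_function 2 (D t) z0 \<phi>" "GDERIV \<phi> z0 :> G0" "G0 \<noteq> 0"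
    using C2 z0 unfolding C2_boundary_def by blast
  then obtain N where N: "open N" "z0 \<in> N" "C_k_on 2 N \<phi>" "D t \<inter> N = {y \<in> N. \<phi> y < 0}"
    unfolding local_defining_function_def by blast
  obtain G A B where c: "c2 N \<phi> G A B" using N(3) C_2_on_iff[OF N(1)] by blast
  note cc = c2_continuous_on[OF c]
  have Gz0: "G z0 \<noteq> 0" using GDERIV_unique[OF c2_GDERIV[OF c N(2)] \<phi>(2)] \<phi>(3) by simp
  have \<phi>z0: "\<phi> z0 = 0" by (rule local_defining_zero[OF N(1,2,4) GDERIV_isCont[OF \<phi>(2)] z0])
  obtain r R where rR: "0 < r" "0 < R" "ball z0 r \<subseteq> N" "\<And>p. p \<in> ball z0 r \<Longrightarrow> G p \<noteq> 0"
    "\<And>p. p \<in> ball z0 r \<Longrightarrow> \<phi> p = 0 \<Longrightarrow> ball (p + R *\<^sub>R sgn (G p)) R \<inter> D t = {}"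
    using exterior_ball[OF c N(2) Gz0 N(4)] by blast
  obtain C r2 where Cr: "0 < C" "0 < r2" "cball w r2 \<subseteq> D t"
    "\<And>y z. ball y R \<inter> D t = {} \<Longrightarrow> z \<in> D t - cball w r2 \<Longrightarrow> \<bar>g z\<bar> \<le> C * ((norm (z - y))\<^sup>2 - R\<^sup>2)"
    using gd.boundary_bound[OF rR(2)] by blast
  have z0w: "z0 \<notin> cball w r2"
    using z0 Cr(3) gd.open_D by (auto simp: frontier_def interior_open)
  have frS: "(t, z) \<in> frontier (spacetime t0 D)" if "z \<in> frontier (D t)" for z
    by (rule frontier_spacetime[where D = D]) (use t gd.open_D that in auto)
  obtain v0 where "normal_velocity t0 D t z0 v0" using gr[OF z0] by blast
  then obtain \<Theta> a0 H0 where \<Theta>: "local_defining_function 1 (spacetime t0 D) (t, z0) \<Theta>"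
    "GDERIV \<Theta> (t, z0) :> (a0, H0)" "H0 \<noteq> 0"
    unfolding normal_velocity_def by blast
  then obtain M where M: "open M" "(t, z0) \<in> M" "C_k_on 1 M \<Theta>" "spacetime t0 D \<inter> M = {p \<in> M. \<Theta> p < 0}"
    unfolding local_defining_function_def by blast
  obtain \<Gamma> where \<Gamma>: "\<And>p. p \<in> M \<Longrightarrow> GDERIV \<Theta> p :> \<Gamma> p" "continuous_on M \<Gamma>" using C_1_onD[OF M(3)] by blast
  have \<Theta>0: "\<Theta> (t, z) = 0" if "z \<in> frontier (D t)" "(t, z) \<in> M" for z
    by (rule local_defining_zero[OF M(1) that(2) M(4) GDERIV_isCont[OF \<Gamma>(1)[OF that(2)]] frS[OF that(1)]])
  have inD: "\<phi> z < 0 \<longleftrightarrow> z \<in> D t" if "z \<in> N" for z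
    using that N(4) by blast
  have in\<Theta>: "\<Theta> (s, z) < 0 \<longleftrightarrow> z \<in> D s" if "(s, z) \<in> M" "0 < s" "s < t0" for s z
  proof -
    have "\<Theta> (s, z) < 0 \<longleftrightarrow> (s, z) \<in> spacetime t0 D \<inter> M" unfolding M(4) using that(1) by simp
    then show ?thesis using that by (simp add: spacetime_def)
  qed
  \<comment> \<open>At time t both functions have the same sublevel set near \<open>z\<close>, so
    their spatial gradients are positively proportional.\<close>
  have parallel: "snd (\<Gamma> (t, z)) /\<^sub>R norm (snd (\<Gamma> (t, z))) = G z /\<^sub>R norm (G z)"
    if "z \<in> frontier (D t)" "z \<in> N" "(t, z) \<in> M" "snd (\<Gamma> (t, z)) \<noteq> 0" "G z \<noteq> 0" for z
  proof (rule gradient_direction_unique[OF _ _ _ gradient_slice[OF \<Gamma>(1)[OF that(3)]] that(4) \<Theta>0[OF that(1,3)]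
        c2_GDERIV[OF c that(2)] that(5)])
    have "open ((\<lambda>z. (t, z)) -` M)" by (intro open_vimage M continuous_intros)
    then show "open (N \<inter> (\<lambda>z. (t, z)) -` M)" using N(1) by auto
    show "z \<in> N \<inter> (\<lambda>z. (t, z)) -` M" using that by auto
    show "\<phi> z = 0" by (rule local_defining_zero[OF N(1) that(2) N(4) GDERIV_isCont[OF c2_GDERIV[OF c that(2)]] that(1)])
    show "\<Theta> (t, x) < 0 \<longleftrightarrow> \<phi> x < 0" if "x \<in> N \<inter> (\<lambda>z. (t, z)) -` M" for x
      using that inD in\<Theta> t by auto
  qed
  have \<Gamma>0: "snd (\<Gamma> (t, z0)) \<noteq> 0" using GDERIV_unique[OF \<Gamma>(1)[OF M(2)] \<Theta>(2)] \<Theta>(3) by simp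
  \<comment> \<open>Half of a positive number, so that the bound persists nearby, with the two
    gradients at different points and times: the mean value theorem evaluates one of them at an
    unknown place.\<close>
  define c0 where "c0 = (snd (\<Gamma> (t, z0)) \<bullet> G z0) / 2"
  have c0: "0 < c0" "c0 < snd (\<Gamma> (t, z0)) \<bullet> G z0"
  proof -
    have "snd (\<Gamma> (t, z0)) = norm (snd (\<Gamma> (t, z0))) *\<^sub>R (G z0 /\<^sub>R norm (G z0))"
      using parallel[OF z0 N(2) M(2) \<Gamma>0 Gz0] \<Gamma>0 by (simp flip: parallel[OF z0 N(2) M(2) \<Gamma>0 Gz0])
    then have "snd (\<Gamma> (t, z0)) \<bullet> G z0 = norm (snd (\<Gamma> (t, z0))) * (inverse (norm (G z0)) * (G z0 \<bullet> G z0))"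
      by (metis inner_scaleR_left)
    then have "0 < snd (\<Gamma> (t, z0)) \<bullet> G z0" using \<Gamma>0 Gz0 by simp
    then show "0 < c0" "c0 < snd (\<Gamma> (t, z0)) \<bullet> G z0" by (simp_all add: c0_def)
  qed
  define b0 where "b0 = (G z0 \<bullet> G z0) / 2"
  have b0: "0 < b0" "b0 < G z0 \<bullet> G z0" using Gz0 by (simp_all add: b0_def)
  define M1 where "M1 = \<bar>fst (\<Gamma> (t, z0))\<bar> + 1"
  define MG where "MG = norm (G z0) + 1"
  have "\<exists>e>0. \<forall>h z z'. \<bar>h\<bar> < e \<and> dist z z0 < e \<and> dist z' z0 < e \<longrightarrow>
      (t + h, z) \<in> M \<and> z' \<in> N \<and> c0 < snd (\<Gamma> (t + h, z)) \<bullet> G z'"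
  proof -
    have cont: "continuous_on (M \<times> N) (\<lambda>q. snd (\<Gamma> (fst q)) \<bullet> G (snd q))"
      by (intro continuous_on_inner continuous_on_snd continuous_on_compose2[OF \<Gamma>(2)] continuous_on_compose2[OF cc(2)] continuous_intros) auto
    have "open ((M \<times> N) \<inter> (\<lambda>q. snd (\<Gamma> (fst q)) \<bullet> G (snd q)) -` {c0<..})"
      by (rule continuous_open_preimage[OF cont]) (auto intro: open_Times M N)
    moreover have "((t, z0), z0) \<in> (M \<times> N) \<inter> (\<lambda>q. snd (\<Gamma> (fst q)) \<bullet> G (snd q)) -` {c0<..}" using M N c0 by simp
    ultimately obtain e where e: "0 < e" "ball ((t, z0), z0) e \<subseteq> (M \<times> N) \<inter> (\<lambda>q. snd (\<Gamma> (fst q)) \<bullet> G (snd q)) -` {c0<..}"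
      by (meson open_contains_ball)
    show ?thesis
    proof (intro exI[of _ "e/3"] conjI allI impI)
      fix h z z' assume "\<bar>h\<bar> < e/3 \<and> dist z z0 < e/3 \<and> dist z' z0 < e/3"
      then have "dist ((t + h, z), z') ((t, z0), z0) < e"
        using dist_pair_le[of "(t + h, z)" z' "(t, z0)" z0] dist_pair_le[of "t + h" z t z0] by (simp add: dist_real_def)
      then have "((t + h, z), z') \<in> (M \<times> N) \<inter> (\<lambda>q. snd (\<Gamma> (fst q)) \<bullet> G (snd q)) -` {c0<..}"
        using e(2) by (auto simp: dist_commute subset_iff)
      then show "(t + h, z) \<in> M" "z' \<in> N" "c0 < snd (\<Gamma> (t + h, z)) \<bullet> G z'" by auto
    qed (use e in simp)
  qed
  then obtain e1 where e1: "0 < e1" "\<And>h z z'. \<bar>h\<bar> < e1 \<Longrightarrow> dist z z0 < e1 \<Longrightarrow> dist z' z0 < e1 \<Longrightarrow>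
      (t + h, z) \<in> M \<and> z' \<in> N \<and> c0 < snd (\<Gamma> (t + h, z)) \<bullet> G z'" by blast
  have "\<exists>e>0. \<forall>h z. \<bar>h\<bar> < e \<and> dist z z0 < e \<longrightarrow> \<bar>fst (\<Gamma> (t + h, z))\<bar> < M1"
  proof -
    have cont: "continuous_on M (\<lambda>p. \<bar>fst (\<Gamma> p)\<bar>)" by (intro continuous_intros \<Gamma>(2))
    have "open (M \<inter> (\<lambda>p. \<bar>fst (\<Gamma> p)\<bar>) -` {..<M1})" by (rule continuous_open_preimage[OF cont M(1)]) simp
    moreover have "(t, z0) \<in> M \<inter> (\<lambda>p. \<bar>fst (\<Gamma> p)\<bar>) -` {..<M1}" using M(2) by (simp add: M1_def)
    ultimately obtain e where e: "0 < e" "ball (t, z0) e \<subseteq> M \<inter> (\<lambda>p. \<bar>fst (\<Gamma> p)\<bar>) -` {..<M1}"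
      by (meson open_contains_ball)
    show ?thesis
    proof (intro exI[of _ "e/2"] conjI allI impI)
      fix h z assume "\<bar>h\<bar> < e/2 \<and> dist z z0 < e/2"
      then have "dist (t + h, z) (t, z0) < e" using dist_pair_le[of "t + h" z t z0] by (simp add: dist_real_def)
      then show "\<bar>fst (\<Gamma> (t + h, z))\<bar> < M1" using e(2) by (auto simp: dist_commute subset_iff)
    qed (use e in simp)
  qed
  then obtain e2 where e2: "0 < e2" "\<And>h z. \<bar>h\<bar> < e2 \<Longrightarrow> dist z z0 < e2 \<Longrightarrow> \<bar>fst (\<Gamma> (t + h, z))\<bar> < M1" by blast
  have "\<exists>e>0. \<forall>z z'. dist z z0 < e \<and> dist z' z0 < e \<longrightarrow> b0 < G z \<bullet> G z' \<and> norm (G z) < MG"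
  proof -
    have cont: "continuous_on (N \<times> N) (\<lambda>q. G (fst q) \<bullet> G (snd q))"
      by (intro continuous_on_inner continuous_on_compose2[OF cc(2)] continuous_intros) auto
    have "open ((N \<times> N) \<inter> (\<lambda>q. G (fst q) \<bullet> G (snd q)) -` {b0<..})"
      by (rule continuous_open_preimage[OF cont]) (auto intro: open_Times N)
    moreover have "(z0, z0) \<in> (N \<times> N) \<inter> (\<lambda>q. G (fst q) \<bullet> G (snd q)) -` {b0<..}" using N b0 by simp
    ultimately obtain e where e: "0 < e" "ball (z0, z0) e \<subseteq> (N \<times> N) \<inter> (\<lambda>q. G (fst q) \<bullet> G (snd q)) -` {b0<..}"
      by (meson open_contains_ball)
    have "open (N \<inter> (\<lambda>z. norm (G z)) -` {..<MG})" by (rule continuous_open_preimage[OF continuous_on_norm[OF cc(2)] N(1)]) simp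
    moreover have "z0 \<in> N \<inter> (\<lambda>z. norm (G z)) -` {..<MG}" using N(2) by (simp add: MG_def)
    ultimately obtain e' where e': "0 < e'" "ball z0 e' \<subseteq> N \<inter> (\<lambda>z. norm (G z)) -` {..<MG}"
      by (meson open_contains_ball)
    show ?thesis
    proof (intro exI[of _ "min (e/2) e'"] conjI allI impI)
      fix z z' assume *: "dist z z0 < min (e/2) e' \<and> dist z' z0 < min (e/2) e'"
      then have "dist (z, z') (z0, z0) < e" using dist_pair_le[of z z' z0 z0] by simp
      then show "b0 < G z \<bullet> G z'" using e(2) by (auto simp: dist_commute subset_iff)
      show "norm (G z) < MG" using e'(2) * by (auto simp: dist_commute subset_iff)
    qed (use e e' in simp)
  qed
  then obtain e3 where e3: "0 < e3" "\<And>z z'. dist z z0 < e3 \<Longrightarrow> dist z' z0 < e3 \<Longrightarrow> b0 < G z \<bullet> G z' \<and> norm (G z) < MG" by blast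
  have "open (- cball w r2)" by (simp add: open_Compl)
  then obtain e4 where e4: "0 < e4" "ball z0 e4 \<subseteq> - cball w r2" using z0w by (meson ComplI open_contains_ball)
  \<comment> \<open>The bounds by t and t0 - t keep the times t - h and t + h, for h below e, inside
    the interval of definition.\<close>
  define e where "e = min (min (min e1 e2) (min e3 e4)) (min r (min t (t0 - t)))"
  have e: "0 < e" "e \<le> e1" "e \<le> e2" "e \<le> e3" "e \<le> e4" "e \<le> r" "e \<le> t" "e \<le> t0 - t"
    using e1(1) e2(1) e3(1) e4(1) rR(1) t by (auto simp: e_def)
  obtain a P P' \<gamma> where ch: "0 < a" "\<gamma> 0 = z0" "P 0 = z0"
    "\<And>\<zeta>. \<bar>Re \<zeta>\<bar> \<le> a \<Longrightarrow> \<bar>Im \<zeta>\<bar> \<le> a \<Longrightarrow> (P has_derivative P' \<zeta>) (at \<zeta>)"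
    "continuous_on {\<zeta>. \<bar>Re \<zeta>\<bar> \<le> a \<and> \<bar>Im \<zeta>\<bar> \<le> a} (\<lambda>\<zeta>. jacobian (P' \<zeta>))"
    "inj_on P (square a)" "\<And>T. open T \<Longrightarrow> T \<subseteq> square a \<Longrightarrow> open (P ` T)"
    "\<And>\<zeta>. \<bar>Re \<zeta>\<bar> \<le> a \<Longrightarrow> \<bar>Im \<zeta>\<bar> \<le> a \<Longrightarrow> P \<zeta> \<in> ball z0 e \<inter> N"
    "\<And>\<zeta>. P \<zeta> = \<gamma> (Im \<zeta>) + Re \<zeta> *\<^sub>R G (\<gamma> (Im \<zeta>))"
    "\<And>y. \<bar>y\<bar> \<le> a \<Longrightarrow> \<phi> (\<gamma> y) = 0"
  proof (rule tubular_chart[OF c N(2) \<phi>z0 Gz0 open_ball])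
    show "z0 \<in> ball z0 e" using e(1) by simp
  qed (rule that; assumption)
  have tb: "tube a P P' \<gamma> G" by (rule tube.intro) (use ch in blast)+
  interpret tb: tube a P P' \<gamma> G by (rule tb)
  have Pin: "dist (P \<zeta>) z0 < e" "P \<zeta> \<in> N" if "\<bar>Re \<zeta>\<bar> \<le> a" "\<bar>Im \<zeta>\<bar> \<le> a" for \<zeta>
    using ch(8)[OF that] by (auto simp: dist_commute)
  have \<gamma>in: "dist (\<gamma> y) z0 < e" "\<gamma> y \<in> N" if "\<bar>y\<bar> \<le> a" for y
    using Pin[of "Complex 0 y"] that ch(1) by (simp_all add: tb.P_axis)
  have Gne: "G (\<gamma> y) \<noteq> 0" if "\<bar>y\<bar> \<le> a" for y
    using rR(4)[of "\<gamma> y"] \<gamma>in(1)[OF that] e(6) by (simp add: dist_commute)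
  have seg: "\<bar>s\<bar> \<le> a" if "s \<in> closed_segment 0 (Re \<zeta>)" "\<bar>Re \<zeta>\<bar> \<le> a" for s \<zeta>
    using that by (auto simp: closed_segment_eq_real_ivl split: if_splits)
  \<comment> \<open>The factor d > b0 yields two facts: \<phi> has the sign of Re \<zeta>, and its
    absolute value is at least b0 |Re \<zeta>|.\<close>
  have phi_mvt: "\<exists>d>b0. \<phi> (P \<zeta>) = Re \<zeta> * d" if \<zeta>: "\<bar>Re \<zeta>\<bar> \<le> a" "\<bar>Im \<zeta>\<bar> \<le> a" for \<zeta>
  proof -
    let ?y = "Im \<zeta>"
    have pt: "\<gamma> ?y + s *\<^sub>R G (\<gamma> ?y) = P (Complex s ?y)" for s by (simp add: ch(9))
    have der: "GDERIV \<phi> (\<gamma> ?y + s *\<^sub>R G (\<gamma> ?y)) :> G (P (Complex s ?y))" if "s \<in> closed_segment 0 (Re \<zeta>)" for s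
      unfolding pt using seg[OF that \<zeta>(1)] \<zeta>(2) by (intro c2_GDERIV[OF c] Pin) auto
    obtain s where s: "s \<in> closed_segment 0 (Re \<zeta>)"
      "\<phi> (\<gamma> ?y + Re \<zeta> *\<^sub>R G (\<gamma> ?y)) - \<phi> (\<gamma> ?y) = Re \<zeta> * (G (P (Complex s ?y)) \<bullet> G (\<gamma> ?y))"
      using mean_value_line[of "Re \<zeta>" \<phi> "\<gamma> ?y" "G (\<gamma> ?y)" "\<lambda>s. G (P (Complex s ?y))", OF der] by blast
    have "b0 < G (P (Complex s ?y)) \<bullet> G (\<gamma> ?y)"
      using e3(2)[of "P (Complex s ?y)" "\<gamma> ?y"] Pin(1)[of "Complex s ?y"] \<gamma>in(1)[of ?y] seg[OF s(1) \<zeta>(1)] \<zeta>(2) e(4) by simp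
    then show ?thesis using s(2) ch(10)[OF \<zeta>(2)] by (auto simp: ch(9)[of \<zeta>])
  qed
  have sq: "\<bar>Re \<zeta>\<bar> \<le> a" "\<bar>Im \<zeta>\<bar> \<le> a" if "\<zeta> \<in> square a" for \<zeta> using that by (auto simp: square_def)
  have side: "P \<zeta> \<in> D t \<longleftrightarrow> Re \<zeta> < 0" if \<zeta>: "\<zeta> \<in> square a" for \<zeta>
  proof -
    obtain d where "b0 < d" "\<phi> (P \<zeta>) = Re \<zeta> * d" using phi_mvt[OF sq[OF \<zeta>]] by blast
    then have "\<phi> (P \<zeta>) < 0 \<longleftrightarrow> Re \<zeta> < 0" using b0(1) by (simp add: mult_less_0_iff)
    then show ?thesis using inD[OF Pin(2)[OF sq[OF \<zeta>]]] by simp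
  qed
  have \<gamma>_frontier: "\<gamma> y \<in> frontier (D t)" if y: "\<bar>y\<bar> < a" for y
  proof -
    have "\<gamma> y \<notin> D t" using side[of "Complex 0 y"] y ch(1) by (simp add: square_def tb.P_axis)
    moreover have "\<gamma> y \<in> closure (D t)"
    proof -
      have lim: "((\<lambda>e. P (stretch e (Complex (-1) y))) \<longlongrightarrow> P (Complex 0 y)) (at_right 0)"
        using tb.tendsto_axis[OF tb.P_cont, of "Complex (-1) y"] y by simp
      have "\<forall>\<^sub>F e in at_right 0. stretch e (Complex (-1) y) \<in> square a" using tb.eventually_strip[of "Complex (-1) y"] y by simp
      then have "\<forall>\<^sub>F e in at_right 0. P (stretch e (Complex (-1) y)) \<in> closure (D t)"
        using eventually_at_right_less[of 0]
      proof eventually_elim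
        case (elim e)
        then have "P (stretch e (Complex (-1) y)) \<in> D t" using side by simp
        then show ?case using closure_subset by blast
      qed
      from Lim_in_closed_set[OF closed_closure this _ lim] show ?thesis by (simp add: tb.P_axis)
    qed
    ultimately show ?thesis using gd.open_D by (simp add: frontier_def interior_open)
  qed
  have tM: "(t, \<gamma> y) \<in> M" "c0 < snd (\<Gamma> (t, \<gamma> y)) \<bullet> G (\<gamma> y)" "\<bar>fst (\<Gamma> (t, \<gamma> y))\<bar> < M1" if "\<bar>y\<bar> \<le> a" for y
    using e1(2)[of 0 "\<gamma> y" "\<gamma> y"] e2(2)[of 0 "\<gamma> y"] \<gamma>in(1)[OF that] e e1(1) e2(1) by auto
  \<comment> \<open>To first order in h, the value of \<Theta> at time t + h and at the point with
    coordinate Re = h s is h times the sum of the time derivative and s times the inner product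
    below. \<omega> is the s for which this vanishes.\<close>
  define \<omega> where "\<omega> = (\<lambda>y. - fst (\<Gamma> (t, \<gamma> y)) / (snd (\<Gamma> (t, \<gamma> y)) \<bullet> G (\<gamma> y)))"
  have \<omega>_cont: "continuous_on {-a<..<a} \<omega>"
  proof -
    have 1: "continuous_on {-a<..<a} (\<lambda>y. \<Gamma> (t, \<gamma> y))"
      by (rule continuous_on_compose2[OF \<Gamma>(2)]) (use tM(1) in \<open>auto intro!: continuous_intros tb.\<gamma>_cont\<close>)
    have 2: "continuous_on {-a<..<a} (\<lambda>y. G (\<gamma> y))"
      by (rule continuous_on_compose2[OF cc(2) tb.\<gamma>_cont]) (use \<gamma>in(2) in auto)
    show ?thesis unfolding \<omega>_def
    proof (intro continuous_intros 1 2 ballI)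
      fix y assume "y \<in> {-a<..<a}"
      then have "\<bar>y\<bar> \<le> a" by auto
      from tM(2)[OF this] show "snd (\<Gamma> (t, \<gamma> y)) \<bullet> G (\<gamma> y) \<noteq> 0" using c0(1) by linarith
    qed
  qed
  \<comment> \<open>For s = |Re \<zeta>| the squared distance to the centre of the exterior disc
    exceeds R^2 by s (2 R |G| + s |G|^2); the bounds s \<le> a and |G| \<le> MG give the
    constant.\<close>
  define Cg where "Cg = C * (2 * R * MG + a * MG\<^sup>2)"
  have MG0: "0 < MG" by (simp add: MG_def add_nonneg_pos)
  have bp: "boundary_patch (D t) u w g a P P' \<gamma> G N \<phi> A B b0 Cg \<omega>"
  proof (rule boundary_patch.intro[OF gd tb boundary_patch_axioms.intro])
    show "c2 N \<phi> G A B" "D t \<inter> N = {z \<in> N. \<phi> z < 0}" "0 < b0" "continuous_on {-a<..<a} \<omega>" by fact+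
    show "P \<zeta> \<in> N" if "\<bar>Re \<zeta>\<bar> \<le> a" "\<bar>Im \<zeta>\<bar> \<le> a" for \<zeta> using Pin(2)[OF that] .
    show "P \<zeta> \<in> D t \<longleftrightarrow> Re \<zeta> < 0" if "\<zeta> \<in> square a" for \<zeta> using side[OF that] .
    show "b0 * \<bar>Re \<zeta>\<bar> \<le> - \<phi> (P \<zeta>)" if \<zeta>: "\<zeta> \<in> square a" "Re \<zeta> < 0" for \<zeta>
    proof -
      obtain d where "b0 < d" "\<phi> (P \<zeta>) = Re \<zeta> * d" using phi_mvt[OF sq[OF \<zeta>(1)]] by blast
      moreover from this have "b0 * \<bar>Re \<zeta>\<bar> \<le> d * \<bar>Re \<zeta>\<bar>" by (intro mult_right_mono) auto
      ultimately show ?thesis using \<zeta>(2) by (simp add: mult.commute)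
    qed
    show "\<phi> (\<gamma> y) = 0" "G (\<gamma> y) \<noteq> 0" if "\<bar>y\<bar> < a" for y using ch(10) Gne that by auto
    show "0 \<le> Cg" using Cr(1) rR(2) MG0 ch(1) by (simp add: Cg_def)
    show "\<bar>g (P \<zeta>)\<bar> \<le> Cg * \<bar>Re \<zeta>\<bar>" if \<zeta>: "\<zeta> \<in> square a" "Re \<zeta> < 0" for \<zeta>
    proof -
      define p where "p = \<gamma> (Im \<zeta>)"
      define s where "s = \<bar>Re \<zeta>\<bar>"
      have s: "0 < s" "s \<le> a" "Re \<zeta> = - s" using \<zeta> sq[OF \<zeta>(1)] by (auto simp: s_def)
      have p: "p \<in> ball z0 r" "\<phi> p = 0" "G p \<noteq> 0" "norm (G p) \<le> MG"
        using \<gamma>in(1)[OF sq(2)[OF \<zeta>(1)]] e ch(10)[OF sq(2)[OF \<zeta>(1)]] Gne[OF sq(2)[OF \<zeta>(1)]] e3(2)[of p p]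
        by (auto simp: p_def dist_commute)
      have "P \<zeta> \<in> ball z0 e4" using Pin(1)[OF sq[OF \<zeta>(1)]] e(5) by (simp add: dist_commute)
      then have "P \<zeta> \<notin> cball w r2" using e4(2) by blast
      then have PD: "P \<zeta> \<in> D t - cball w r2" using side[OF \<zeta>(1)] \<zeta>(2) by simp
      have "P \<zeta> - (p + R *\<^sub>R sgn (G p)) = - ((s + R / norm (G p)) *\<^sub>R G p)"
        by (simp add: ch(9)[of \<zeta>] p_def[symmetric] s(3) sgn_div_norm algebra_simps divide_inverse)
      then have "norm (P \<zeta> - (p + R *\<^sub>R sgn (G p))) = \<bar>s + R / norm (G p)\<bar> * norm (G p)" by simp
      also have "\<dots> = s * norm (G p) + R" using s(1) rR(2) p(3) by (simp add: distrib_right)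
      finally have n: "(norm (P \<zeta> - (p + R *\<^sub>R sgn (G p))))\<^sup>2 - R\<^sup>2 = s * (2 * R * norm (G p) + s * (norm (G p))\<^sup>2)"
        by (simp add: power2_eq_square algebra_simps)
      have "\<bar>g (P \<zeta>)\<bar> \<le> C * (s * (2 * R * norm (G p) + s * (norm (G p))\<^sup>2))"
        using Cr(4)[OF rR(5)[OF p(1,2)] PD] unfolding n .
      also have "\<dots> \<le> C * (s * (2 * R * MG + a * MG\<^sup>2))"
        using Cr(1) s rR(2) p(4) by (intro mult_left_mono add_mono mult_mono power_mono) auto
      finally show ?thesis by (simp add: Cg_def s_def[symmetric] mult_ac)
    qed
    show "((\<lambda>s. g (P (Complex s y)) / s) \<longlongrightarrow> \<omega> y * (norm (G (\<gamma> y)))\<^sup>2) (at_left 0)" if y: "\<bar>y\<bar> < a" for y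
    proof -
      define z where "z = \<gamma> y"
      have z: "z \<in> frontier (D t)" "z \<in> N" "G z \<noteq> 0" "(t, z) \<in> M" "c0 < snd (\<Gamma> (t, z)) \<bullet> G z"
        using \<gamma>_frontier[OF y] \<gamma>in(2)[of y] Gne[of y] tM[of y] y by (auto simp: z_def)
      have sne: "snd (\<Gamma> (t, z)) \<noteq> 0" using z(5) c0(1) by auto
      obtain v where v: "normal_velocity t0 D t z v" "outward_normal_derivative (D t) g z v" using gr[OF z(1)] by blast
      obtain n where n: "outward_unit_normal (D t) z n" "((\<lambda>h. g (z + h *\<^sub>R n)) has_real_derivative v) (at_left 0)"
        using v(2) unfolding outward_normal_derivative_def by blast
      have n_eq: "n = sgn (G z)" by (rule outward_normal_unique[OF n(1) N(1) z(2) N(4) c2_GDERIV[OF c z(2)] z(3,1)])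
      have v_eq: "v = - fst (\<Gamma> (t, z)) / norm (snd (\<Gamma> (t, z)))"
        by (rule normal_velocity_unique[OF v(1) M(1) z(4) M(4) \<Gamma>(1)[OF z(4)] sne frS[OF z(1)]])
      have "snd (\<Gamma> (t, z)) = norm (snd (\<Gamma> (t, z))) *\<^sub>R (snd (\<Gamma> (t, z)) /\<^sub>R norm (snd (\<Gamma> (t, z))))" using sne by simp
      also have "\<dots> = norm (snd (\<Gamma> (t, z))) *\<^sub>R (G z /\<^sub>R norm (G z))" by (simp only: parallel[OF z(1,2,4) sne z(3)])
      finally have "snd (\<Gamma> (t, z)) \<bullet> G z = (norm (snd (\<Gamma> (t, z))) *\<^sub>R (G z /\<^sub>R norm (G z))) \<bullet> G z" by (rule arg_cong)
      also have "\<dots> = norm (snd (\<Gamma> (t, z))) * norm (G z)"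
        using z(3) by (simp add: power2_norm_eq_inner[symmetric] power2_eq_square)
      finally have inner: "snd (\<Gamma> (t, z)) \<bullet> G z = norm (snd (\<Gamma> (t, z))) * norm (G z)" .
      \<comment> \<open>The gradients being parallel, the inner product in \<omega> is the product
        of the norms, whence v = \<omega> |G|.\<close>
      have val: "\<omega> y * (norm (G z))\<^sup>2 = v * norm (G z)"
        using z(3) sne by (simp add: \<omega>_def z_def[symmetric] v_eq inner power2_eq_square)
      have gz: "g z = 0" using gd.g_frontier[OF z(1)] .
      have q: "((\<lambda>h. g (z + h *\<^sub>R n) / h) \<longlongrightarrow> v) (at_left 0)"
        using n(2) gz by (simp add: has_field_derivative_iff)
      have "filterlim (\<lambda>s. s * norm (G z)) (at_left 0) (at_left 0)"
      proof -
        have "((\<lambda>s. s * norm (G z)) \<longlongrightarrow> 0 * norm (G z)) (at_left 0)" by (intro tendsto_intros)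
        moreover have "\<forall>\<^sub>F s in at_left 0. s * norm (G z) \<in> {..<0} \<and> s * norm (G z) \<noteq> 0"
          using z(3) by (auto simp: mult_less_0_iff eventually_at_filter intro!: always_eventually)
        ultimately show ?thesis by (simp add: filterlim_at)
      qed
      from filterlim_compose[OF q this]
      have "((\<lambda>s. g (z + (s * norm (G z)) *\<^sub>R n) / (s * norm (G z)) * norm (G z)) \<longlongrightarrow> v * norm (G z)) (at_left 0)"
        by (intro tendsto_intros)
      moreover have "g (z + (s * norm (G z)) *\<^sub>R n) / (s * norm (G z)) * norm (G z) = g (P (Complex s y)) / s" for s
      proof -
        have "(s * norm (G z)) *\<^sub>R n = s *\<^sub>R G z" using z(3) by (simp add: n_eq sgn_div_norm mult.assoc)
        then show ?thesis using z(3) by (simp add: ch(9) z_def)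
      qed
      ultimately show ?thesis unfolding z_def[symmetric] val by simp
    qed
    show "w \<notin> P ` square a"
    proof
      assume "w \<in> P ` square a"
      then obtain \<zeta> where "\<zeta> \<in> square a" "w = P \<zeta>" by blast
      then have "w \<in> ball z0 e4" using Pin(1)[OF sq] e(5) by (force simp: dist_commute)
      then show False using e4(2) Cr(2) by auto
    qed
  qed
  interpret bp: boundary_patch "D t" u w g a P P' \<gamma> G N \<phi> A B b0 Cg \<omega> by (rule bp)
  \<comment> \<open>During time h the function \<Theta> changes by at most M1 h at the axis, while
    moving by Re changes it by at least c0 |Re|. Beyond |Re| = (M1 / c0) h the latter decides the
    sign.\<close>
  define Cm where "Cm = M1 / c0"
  have M1: "1 \<le> M1" by (simp add: M1_def)
  have Cm: "0 < Cm" using M1 c0(1) by (simp add: Cm_def)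
  \<comment> \<open>The sign k selects the direction of time. Running time backward is again a
    motion, with speed -\<omega>, and gives the left-hand derivative.\<close>
  have one_sided: "((\<lambda>h. ((LBINT z. indicator (D (t + k * h)) z * \<psi> z) - (LBINT z. indicator (D t) z * \<psi> z)) / h)
      \<longlongrightarrow> (LBINT y. indicator {-a<..<a} y * (tb.J (Complex 0 y) * \<psi> (\<gamma> y) * (k * \<omega> y)))) (at_right 0)"
    if k: "\<bar>k\<bar> = 1" and \<psi>: "continuous_on UNIV \<psi>" "compact K" "K \<subseteq> P ` square a" "\<And>z. z \<notin> K \<Longrightarrow> \<psi> z = 0" for k \<psi> K
  proof (rule tb.motion[where C = Cm and ?e0.0 = e and c = "\<lambda>y. k * \<omega> y"])
    have tk: "0 < t + k * h" "t + k * h < t0" "\<bar>k * h\<bar> < e" if "0 < h" "h < e" for h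
      using that e(7,8) k by (auto simp: abs_mult abs_if split: if_splits)
    show "D (t + k * h) \<in> sets borel" if "0 < h" "h < e" for h using opens[OF tk(1,2)[OF that]] by simp
    show "D t \<in> sets borel" using gd.open_D by simp
    show "0 < e" by fact
    show "P \<zeta> \<in> D t \<longleftrightarrow> Re \<zeta> < 0" if "\<zeta> \<in> square a" for \<zeta> using side[OF that] .
    show "P \<zeta> \<in> D (t + k * h) \<longleftrightarrow> Re \<zeta> < 0" if h: "0 < h" "h < e" and \<zeta>: "\<zeta> \<in> square a" "Cm * h \<le> \<bar>Re \<zeta>\<bar>" for h \<zeta>
    proof -
      let ?y = "Im \<zeta>"
      have y: "\<bar>?y\<bar> \<le> a" "\<bar>?y\<bar> < a" using \<zeta> by (auto simp: square_def)
      have inM: "(t + x, P \<xi>) \<in> M" if "\<bar>x\<bar> < e" "\<bar>Re \<xi>\<bar> \<le> a" "\<bar>Im \<xi>\<bar> \<le> a" for x \<xi>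
        using e1(2)[of x "P \<xi>" z0] Pin(1)[OF that(2,3)] that(1) e(2) e1(1) by auto
      have time: "\<bar>\<Theta> (t + k * h, \<gamma> ?y)\<bar> \<le> M1 * h"
      proof -
        have der: "GDERIV \<Theta> ((t, \<gamma> ?y) + s *\<^sub>R (k, 0)) :> \<Gamma> (t + s * k, \<gamma> ?y)" if "s \<in> closed_segment 0 h" for s
        proof -
          have "\<bar>s * k\<bar> < e" using that h k by (auto simp: closed_segment_eq_real_ivl abs_mult)
          then have "(t + s * k, \<gamma> ?y) \<in> M" using inM[of "s * k" "Complex 0 ?y"] y(1) ch(1) by (simp add: tb.P_axis)
          then show ?thesis using \<Gamma>(1) by simp
        qed
        obtain s where s: "s \<in> closed_segment 0 h"
          "\<Theta> ((t, \<gamma> ?y) + h *\<^sub>R (k, 0)) - \<Theta> (t, \<gamma> ?y) = h * (\<Gamma> (t + s * k, \<gamma> ?y) \<bullet> (k, 0))"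
          using mean_value_line[of h \<Theta> "(t, \<gamma> ?y)" "(k, 0)" "\<lambda>s. \<Gamma> (t + s * k, \<gamma> ?y)", OF der] by blast
        have "\<bar>s * k\<bar> < e" using s(1) h k by (auto simp: closed_segment_eq_real_ivl abs_mult)
        then have "\<bar>fst (\<Gamma> (t + s * k, \<gamma> ?y))\<bar> < M1" using e2(2)[of "s * k" "\<gamma> ?y"] \<gamma>in(1)[OF y(1)] e(3) by simp
        moreover have "\<Gamma> (t + s * k, \<gamma> ?y) \<bullet> (k, 0) = fst (\<Gamma> (t + s * k, \<gamma> ?y)) * k"
          by (cases "\<Gamma> (t + s * k, \<gamma> ?y)") simp
        moreover have "\<Theta> (t, \<gamma> ?y) = 0" by (rule \<Theta>0[OF \<gamma>_frontier[OF y(2)] tM(1)[OF y(1)]])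
        ultimately show ?thesis using s(2) h k by (simp add: abs_mult mult.commute)
      qed
      have "\<exists>d>c0. \<Theta> (t + k * h, P \<zeta>) - \<Theta> (t + k * h, \<gamma> ?y) = Re \<zeta> * d"
      proof -
        have der: "GDERIV \<Theta> ((t + k * h, \<gamma> ?y) + s *\<^sub>R (0, G (\<gamma> ?y))) :> \<Gamma> (t + k * h, P (Complex s ?y))"
          if "s \<in> closed_segment 0 (Re \<zeta>)" for s
        proof -
          have "(t + k * h, P (Complex s ?y)) \<in> M"
            using inM[OF tk(3)[OF h], of "Complex s ?y"] seg[OF that sq(1)[OF \<zeta>(1)]] y(1) by simp
          then show ?thesis using \<Gamma>(1) by (simp add: ch(9))
        qed
        obtain s where s: "s \<in> closed_segment 0 (Re \<zeta>)"
          "\<Theta> ((t + k * h, \<gamma> ?y) + Re \<zeta> *\<^sub>R (0, G (\<gamma> ?y))) - \<Theta> (t + k * h, \<gamma> ?y) =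
            Re \<zeta> * (\<Gamma> (t + k * h, P (Complex s ?y)) \<bullet> (0, G (\<gamma> ?y)))"
          using mean_value_line[of "Re \<zeta>" \<Theta> "(t + k * h, \<gamma> ?y)" "(0, G (\<gamma> ?y))" "\<lambda>s. \<Gamma> (t + k * h, P (Complex s ?y))", OF der] by blast
        have "c0 < snd (\<Gamma> (t + k * h, P (Complex s ?y))) \<bullet> G (\<gamma> ?y)"
          using e1(2)[of "k * h" "P (Complex s ?y)" "\<gamma> ?y"] tk(3)[OF h] Pin(1)[of "Complex s ?y"] \<gamma>in(1)[OF y(1)]
            seg[OF s(1) sq(1)[OF \<zeta>(1)]] y(1) e(2) by simp
        moreover have "\<Gamma> (t + k * h, P (Complex s ?y)) \<bullet> (0, G (\<gamma> ?y)) = snd (\<Gamma> (t + k * h, P (Complex s ?y))) \<bullet> G (\<gamma> ?y)"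
          by (cases "\<Gamma> (t + k * h, P (Complex s ?y))") simp
        ultimately show ?thesis using s(2) by (auto simp: ch(9)[of \<zeta>])
      qed
      then obtain d where d: "c0 < d" "\<Theta> (t + k * h, P \<zeta>) - \<Theta> (t + k * h, \<gamma> ?y) = Re \<zeta> * d" by blast
      have big: "M1 * h \<le> c0 * \<bar>Re \<zeta>\<bar>" using \<zeta>(2) c0(1) by (simp add: Cm_def pos_divide_le_eq mult.commute)
      have Re0: "Re \<zeta> \<noteq> 0" using \<zeta>(2) mult_pos_pos[OF Cm h(1)] by (metis abs_zero not_le)
      have strict: "c0 * \<bar>Re \<zeta>\<bar> < d * \<bar>Re \<zeta>\<bar>" using d(1) Re0 by simp
      have iff: "P \<zeta> \<in> D (t + k * h) \<longleftrightarrow> \<Theta> (t + k * h, P \<zeta>) < 0"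
        using in\<Theta>[OF inM[OF tk(3)[OF h] sq[OF \<zeta>(1)]] tk(1,2)[OF h]] by simp
      show ?thesis
      proof (cases "Re \<zeta> < 0")
        case True
        then have "d * \<bar>Re \<zeta>\<bar> = - (Re \<zeta> * d)" by simp
        then have "\<Theta> (t + k * h, P \<zeta>) < 0" using d(2) time big strict by linarith
        then show ?thesis using iff True by simp
      next
        case False
        then have "d * \<bar>Re \<zeta>\<bar> = Re \<zeta> * d" by simp
        then have "0 < \<Theta> (t + k * h, P \<zeta>)" using d(2) time big strict by linarith
        then show ?thesis using iff False by simp
      qed
    qed
    \<comment> \<open>Along the path that leaves \<open>\<gamma> y\<close> with speed s the
      derivative of \<Theta> has the sign of s - k \<omega> y. This decides membership for small h
      except at the critical speed.\<close>
    have slope: "((\<lambda>h. \<Theta> (t + k * h, P (Complex (h * s) y))) has_real_derivative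
        (s - k * \<omega> y) * (snd (\<Gamma> (t, \<gamma> y)) \<bullet> G (\<gamma> y))) (at 0)" "\<Theta> (t + k * 0, P (Complex (0 * s) y)) = 0"
      if y: "\<bar>y\<bar> < a" for y s
    proof -
      have "GDERIV \<Theta> ((t, \<gamma> y) + 0 *\<^sub>R (k, s *\<^sub>R G (\<gamma> y))) :> \<Gamma> (t, \<gamma> y)" using \<Gamma>(1) tM(1)[of y] y by simp
      from GDERIV_DERIV_line[OF this]
      have "((\<lambda>h. \<Theta> (t + h * k, \<gamma> y + (h * s) *\<^sub>R G (\<gamma> y))) has_real_derivative \<Gamma> (t, \<gamma> y) \<bullet> (k, s *\<^sub>R G (\<gamma> y))) (at 0)"
        by simp
      moreover have "\<Gamma> (t, \<gamma> y) \<bullet> (k, s *\<^sub>R G (\<gamma> y)) = (s - k * \<omega> y) * (snd (\<Gamma> (t, \<gamma> y)) \<bullet> G (\<gamma> y))"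
        using tM(2)[of y] y c0(1) by (cases "\<Gamma> (t, \<gamma> y)") (simp add: \<omega>_def field_simps)
      ultimately show "((\<lambda>h. \<Theta> (t + k * h, P (Complex (h * s) y))) has_real_derivative
        (s - k * \<omega> y) * (snd (\<Gamma> (t, \<gamma> y)) \<bullet> G (\<gamma> y))) (at 0)" by (simp add: ch(9) mult.commute)
      show "\<Theta> (t + k * 0, P (Complex (0 * s) y)) = 0"
        using \<Theta>0[OF \<gamma>_frontier[OF y] tM(1)[of y]] y by (simp add: tb.P_axis)
    qed
    have evM: "\<forall>\<^sub>F h in at_right 0. (P (Complex (h * s) y) \<in> D (t + k * h) \<longleftrightarrow> \<Theta> (t + k * h, P (Complex (h * s) y)) < 0)"
      if y: "\<bar>y\<bar> < a" for y s
    proof -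
      have "\<forall>\<^sub>F h in at_right 0. stretch h (Complex s y) \<in> square a" using tb.eventually_strip[of "Complex s y"] y by simp
      with eventually_small_right[OF e(1), of 1] show ?thesis
    proof eventually_elim
      case (elim h)
      have "(t + k * h, P (Complex (h * s) y)) \<in> M"
        using e1(2)[of "k * h" "P (Complex (h * s) y)" z0] tk(3)[of h] Pin(1)[of "Complex (h * s) y"] elim e(2) e1(1)
        by (auto simp: stretch_def square_def)
      then show ?case using in\<Theta> tk[of h] elim by simp
    qed
    qed
    show "\<forall>\<^sub>F h in at_right 0. P (Complex (h * s) y) \<in> D (t + k * h)" if y: "\<bar>y\<bar> < a" "s < k * \<omega> y" for y s
    proof -
      have "(s - k * \<omega> y) * (snd (\<Gamma> (t, \<gamma> y)) \<bullet> G (\<gamma> y)) < 0" using y tM(2)[of y] c0(1) by (simp add: mult_less_0_iff)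
      from DERIV_neg_dec_right[OF slope(1)[OF y(1)] this] slope(2)[OF y(1), of s]
      obtain d where "0 < d" "\<And>h. 0 < h \<Longrightarrow> h < d \<Longrightarrow> \<Theta> (t + k * h, P (Complex (h * s) y)) < 0" by auto
      then have "\<forall>\<^sub>F h in at_right 0. \<Theta> (t + k * h, P (Complex (h * s) y)) < 0" by (intro eventually_at_rightI[of 0 d]) auto
      with evM[OF y(1), of s] show ?thesis by eventually_elim auto
    qed
    show "\<forall>\<^sub>F h in at_right 0. P (Complex (h * s) y) \<notin> D (t + k * h)" if y: "\<bar>y\<bar> < a" "k * \<omega> y < s" for y s
    proof -
      have "0 < (s - k * \<omega> y) * (snd (\<Gamma> (t, \<gamma> y)) \<bullet> G (\<gamma> y))" using y tM(2)[of y] c0(1) by simp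
      from DERIV_pos_inc_right[OF slope(1)[OF y(1)] this] slope(2)[OF y(1), of s]
      obtain d where "0 < d" "\<And>h. 0 < h \<Longrightarrow> h < d \<Longrightarrow> 0 < \<Theta> (t + k * h, P (Complex (h * s) y))" by auto
      then have "\<forall>\<^sub>F h in at_right 0. 0 < \<Theta> (t + k * h, P (Complex (h * s) y))" by (intro eventually_at_rightI[of 0 d]) auto
      with evM[OF y(1), of s] show ?thesis by eventually_elim auto
    qed
    show "continuous_on {-a<..<a} (\<lambda>y. k * \<omega> y)" by (intro continuous_intros \<omega>_cont)
    show "\<bar>k * \<omega> y\<bar> \<le> Cm" if "\<bar>y\<bar> < a" for y
    proof -
      have "\<bar>\<omega> y\<bar> = \<bar>fst (\<Gamma> (t, \<gamma> y))\<bar> / (snd (\<Gamma> (t, \<gamma> y)) \<bullet> G (\<gamma> y))"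
        using tM(2)[of y] that c0(1) by (simp add: \<omega>_def abs_divide)
      also have "\<dots> \<le> M1 / c0" using tM[of y] that c0(1) M1 by (intro frac_le) auto
      finally show ?thesis using k by (simp add: Cm_def abs_mult)
    qed
  qed (use \<psi> in auto)
  show ?thesis
  proof (rule that[of "P ` square a"])
    show "open (P ` square a)" by (rule ch(7)[OF open_square]) simp
    show "z0 \<in> P ` square a" using ch(1,3) by (intro image_eqI[of _ _ 0]) (auto simp: square_def)
    show "w \<notin> P ` square a" by (rule bp.w_far)
    fix \<psi> G\<psi> A\<psi> B\<psi> K
    assume \<psi>: "c2 UNIV \<psi> G\<psi> A\<psi> B\<psi>" "compact K" "K \<subseteq> P ` square a" "\<And>z. z \<notin> K \<Longrightarrow> \<psi> z = 0"
    let ?E = "\<lambda>s. LBINT z. indicator (D s) z * \<psi> z"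
    define I where "I = (LBINT y. indicator {-a<..<a} y * (tb.J (Complex 0 y) * \<psi> (\<gamma> y) * \<omega> y))"
    note os = one_sided[OF _ c2_continuous_on(1)[OF \<psi>(1)] \<psi>(2-4)]
    have r: "((\<lambda>h. (?E (t + h) - ?E t) / h) \<longlongrightarrow> I) (at_right 0)" using os[of 1] by (simp add: I_def)
    have "((\<lambda>h. (?E (t + - 1 * h) - ?E t) / h) \<longlongrightarrow>
      (LBINT y. indicator {-a<..<a} y * (tb.J (Complex 0 y) * \<psi> (\<gamma> y) * (- 1 * \<omega> y)))) (at_right 0)" by (rule os) simp
    moreover have "(LBINT y. indicator {-a<..<a} y * (tb.J (Complex 0 y) * \<psi> (\<gamma> y) * (- 1 * \<omega> y))) = - I"
      unfolding I_def integral_minus[symmetric] by (intro Bochner_Integration.integral_cong) auto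
    ultimately have "((\<lambda>h. - ((?E (t + - 1 * h) - ?E t) / h)) \<longlongrightarrow> - (- I)) (at_right 0)"
      by (intro tendsto_minus) simp
    then have "((\<lambda>h. (?E (t + - h) - ?E t) / (- h)) \<longlongrightarrow> I) (at_right 0)" by simp
    then have l: "((\<lambda>h. (?E (t + h) - ?E t) / h) \<longlongrightarrow> I) (at_left 0)"
      using filterlim_at_left_to_right[of "\<lambda>h. (?E (t + h) - ?E t) / h" "nhds I" 0] by simp
    have "((\<lambda>h. (?E (t + h) - ?E t) / h) \<longlongrightarrow> I) (at 0)" using filterlim_split_at[OF l r] .
    then have "(?E has_real_derivative I) (at t)" by (simp add: DERIV_def)
    then show "(?E has_real_derivative - (LBINT z. indicator (D t) z * (g z * (Re (A\<psi> z) + Im (B\<psi> z) - u z * \<psi> z)))) (at t)"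
      unfolding I_def using bp.flux[OF \<psi>] by simp
  qed
qed

section \<open>Derivatives of moments\<close>

text \<open>The function is a mollified indicator of a thickening of \<open>K\<close>. The first
  thickening leaves room for the value 1 near \<open>K\<close>, the second for a support inside
  \<Omega>, and the radius of the mollifier respects both.\<close>

lemma smooth_cutoff:
  fixes K :: "complex set"
  assumes "compact K" "open \<Omega>" "K \<subseteq> \<Omega>"
  obtains \<theta> K' V where "smooth_real_on UNIV \<theta>" "compact K'" "K' \<subseteq> \<Omega>" "\<And>x. x \<notin> K' \<Longrightarrow> \<theta> x = 0"
    "open V" "K \<subseteq> V" "\<And>x. x \<in> V \<Longrightarrow> \<theta> x = 1"
proof -
  obtain d1 K1 where d1: "0 < d1" "compact K1" "K1 \<subseteq> \<Omega>" "K \<subseteq> K1" "\<And>x. x \<in> K \<Longrightarrow> cball x (2 * d1) \<subseteq> K1"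
    using compact_thickening[OF assms] by metis
  obtain d2 K2 where d2: "0 < d2" "compact K2" "K2 \<subseteq> \<Omega>" "K1 \<subseteq> K2" "\<And>x. x \<in> K1 \<Longrightarrow> cball x (2 * d2) \<subseteq> K2"
    using compact_thickening[OF d1(2) assms(2) d1(3)] by metis
  define d where "d = min d1 d2"
  have d: "0 < d" "d \<le> d1" "d \<le> d2" using d1 d2 by (auto simp: d_def)
  obtain \<rho> :: "complex \<Rightarrow> real" where \<rho>: "smooth_real_on UNIV \<rho>" "\<And>x. 0 \<le> \<rho> x" "\<And>x. d \<le> norm x \<Longrightarrow> \<rho> x = 0" "integrable lborel \<rho>"
    "integral\<^sup>L lborel \<rho> = 1" "\<And>x. \<rho> (- x) = \<rho> x" using mollifier_exists[OF d(1)] by blast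
  define f :: "complex \<Rightarrow> real" where "f = indicator K1"
  have fi: "integrable lborel f" using d1(2) unfolding f_def
    using emeasure_bounded_finite[OF compact_imp_bounded[OF d1(2)]]
    by (simp add: integrable_indicator_iff compact_imp_closed borel_closed)
  note b = conv_mollifier_bounds'(1)[OF smooth_continuous_on[OF \<rho>(1)] \<rho>(2,3,5) fi]
  show ?thesis
  proof (rule that[of "conv f \<rho>" K2 "\<Union>x\<in>K. ball x d1"])
    show "smooth_real_on UNIV (conv f \<rho>)" by (rule conv_smooth[OF fi \<rho>(1), of d]) (use \<rho>(3) in auto)
    show "compact K2" "K2 \<subseteq> \<Omega>" by fact+
    show "conv f \<rho> x = 0" if "x \<notin> K2" for x
    proof -
      have "conv f \<rho> x \<in> {0..0}"
      proof (rule b)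
        fix y assume y: "norm (x - y) < d"
        have "y \<notin> K1"
        proof
          assume "y \<in> K1"
          moreover have "x \<in> cball y (2 * d2)" using y d d2(1) by (simp add: dist_norm norm_minus_commute)
          ultimately show False using d2(5) that by blast
        qed
        then show "f y \<in> {0..0}" by (simp add: f_def)
      qed
      then show ?thesis by simp
    qed
    show "open (\<Union>x\<in>K. ball x d1)" "K \<subseteq> (\<Union>x\<in>K. ball x d1)" using d1(1) by auto
    show "conv f \<rho> x = 1" if x: "x \<in> (\<Union>x\<in>K. ball x d1)" for x
    proof -
      obtain k where k: "k \<in> K" "dist k x < d1" using x by auto
      have "conv f \<rho> x \<in> {1..1}"
      proof (rule b)
        fix y assume "norm (x - y) < d"
        then have "y \<in> cball k (2 * d1)" using k(2) d(2) dist_triangle[of k y x] by (simp add: dist_norm)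
        then show "f y \<in> {1..1}" using d1(5)[OF k(1)] by (auto simp: f_def)
      qed
      then show ?thesis by simp
    qed
  qed
qed

text \<open>This plays the part of a partition of unity: a single cutoff splits a function over a
  union of two open sets, and finite unions follow by induction.\<close>

lemma C2_localize:
  fixes T :: "(complex \<Rightarrow> real) \<Rightarrow> bool"
  assumes add: "\<And>f g K. C_k_on 2 UNIV f \<Longrightarrow> C_k_on 2 UNIV g \<Longrightarrow> compact K \<Longrightarrow> (\<And>z. z \<notin> K \<Longrightarrow> f z = 0) \<Longrightarrow>
      (\<And>z. z \<notin> K \<Longrightarrow> g z = 0) \<Longrightarrow> T f \<Longrightarrow> T g \<Longrightarrow> T (\<lambda>z. f z + g z)"
    and cover: "\<And>z. \<exists>W. open W \<and> z \<in> W \<and> (\<forall>f K. C_k_on 2 UNIV f \<longrightarrow> compact K \<longrightarrow> K \<subseteq> W \<longrightarrow> (\<forall>z. z \<notin> K \<longrightarrow> f z = 0) \<longrightarrow> T f)"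
    and f: "C_k_on 2 UNIV f" "compact K" "\<And>z. z \<notin> K \<Longrightarrow> f z = 0"
  shows "T f"
proof -
  define loc where "loc = (\<lambda>W. open W \<and> (\<forall>f K. C_k_on 2 UNIV f \<longrightarrow> compact K \<longrightarrow> K \<subseteq> W \<longrightarrow> (\<forall>z. z \<notin> K \<longrightarrow> f z = 0) \<longrightarrow> T f))"
  have locD: "T f" if "loc W" "C_k_on 2 UNIV f" "compact K" "K \<subseteq> W" "\<And>z. z \<notin> K \<Longrightarrow> f z = 0" for W f K
    using that unfolding loc_def by blast
  have loc_Un: "loc (V \<union> W)" if "loc V" "loc W" for V W
    unfolding loc_def
  proof (intro conjI allI impI)
    show "open (V \<union> W)" using that by (auto simp: loc_def)
    fix f K assume f: "C_k_on 2 UNIV f" "compact K" "K \<subseteq> V \<union> W" "\<forall>z. z \<notin> K \<longrightarrow> f z = 0"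
    have "compact (K - W)" "open V" "K - W \<subseteq> V" using f that by (auto simp: loc_def compact_diff)
    then obtain \<theta> K' X where \<theta>: "smooth_real_on UNIV \<theta>" "compact K'" "K' \<subseteq> V" "\<And>x. x \<notin> K' \<Longrightarrow> \<theta> x = 0"
      "open X" "K - W \<subseteq> X" "\<And>x. x \<in> X \<Longrightarrow> \<theta> x = 1"
      using smooth_cutoff by metis
    have C\<theta>: "C_k_on 2 UNIV \<theta>" using \<theta>(1) unfolding smooth_real_on_def by blast
    have C1: "C_k_on 2 UNIV (\<lambda>z. \<theta> z * f z)" by (rule C_k_on_mult[OF C\<theta> f(1)])
    have C2: "C_k_on 2 UNIV (\<lambda>z. (1 + (-1) * \<theta> z) * f z)"
      by (intro C_k_on_mult C_k_on_add C_k_on_const C\<theta> f(1))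
    have "T (\<lambda>z. \<theta> z * f z)"
      by (rule locD[OF that(1) C1, of "K \<inter> K'"]) (use \<theta> f in \<open>auto simp: compact_Int\<close>)
    \<comment> \<open>The factor 1 - \<theta> vanishes on \<open>X\<close>, and \<open>K - W\<close>
      lies in \<open>X\<close>, so the support of this summand is in \<open>W\<close>.\<close>
    moreover have "T (\<lambda>z. (1 + (-1) * \<theta> z) * f z)"
      by (rule locD[OF that(2) C2, of "K - X"]) (use \<theta> f in \<open>auto simp: compact_diff\<close>)
    ultimately have "T (\<lambda>z. \<theta> z * f z + (1 + (-1) * \<theta> z) * f z)"
      using f by (intro add[OF C1 C2 f(2)]) auto
    moreover have "(\<lambda>z. \<theta> z * f z + (1 + (-1) * \<theta> z) * f z) = f" by (auto simp: algebra_simps)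
    ultimately show "T f" by simp
  qed
  have "\<forall>z. \<exists>W. loc W \<and> z \<in> W" using cover unfolding loc_def by blast
  then obtain W where W: "\<And>z. loc (W z)" "\<And>z. z \<in> W z" by metis
  have "K \<subseteq> (\<Union>z\<in>K. W z)" using W(2) by blast
  moreover have "\<And>z. open (W z)" using W(1) by (simp add: loc_def)
  ultimately obtain F where F: "F \<subseteq> K" "finite F" "K \<subseteq> (\<Union>z\<in>F. W z)"
    using compactE_image[OF f(2), of K W] by metis
  \<comment> \<open>Inserting 0 gives the induction a base case: the empty union is replaced by the
    single set \<open>W 0\<close>.\<close>
  have "loc (\<Union>z\<in>insert 0 F. W z)"
    using F(2)
  proof (induction F rule: finite_induct)
    case empty
    then show ?case using W(1) by simp
  next
    case (insert x F)
    have "(\<Union>z\<in>insert 0 (insert x F). W z) = W x \<union> (\<Union>z\<in>insert 0 F. W z)" by auto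
    then show ?case using loc_Un[OF W(1) insert.IH] by simp
  qed
  moreover have "K \<subseteq> (\<Union>z\<in>insert 0 F. W z)" using F(3) by auto
  ultimately show ?thesis using f unfolding loc_def by blast
qed

lemma laplacian_cong_open:
  assumes "open V" "\<And>z. z \<in> V \<Longrightarrow> f z = h z" "x \<in> V"
  shows "laplacian f x = laplacian h x"
proof -
  have pc: "partial_deriv b f1 y = partial_deriv b f2 y" if "\<And>z. z \<in> V \<Longrightarrow> f1 z = f2 z" "y \<in> V" for b y f1 f2
    unfolding partial_deriv_def
  proof (rule deriv_cong_ev)
    have "((\<lambda>s. y + s *\<^sub>R b) \<longlongrightarrow> y + 0 *\<^sub>R b) (nhds 0)" by (intro tendsto_intros filterlim_ident)
    then have "\<forall>\<^sub>F s in nhds 0. y + s *\<^sub>R b \<in> V" using topological_tendstoD assms(1) that(2) by fastforce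
    then show "\<forall>\<^sub>F s in nhds 0. f1 (y + s *\<^sub>R b) = f2 (y + s *\<^sub>R b)" by eventually_elim (rule that(1))
  qed simp
  have "partial_deriv b f z = partial_deriv b h z" if "z \<in> V" for b z
    using pc[of f h z b] assms(2) that by blast
  then have "partial_deriv b (partial_deriv b f) x = partial_deriv b (partial_deriv b h) x" for b
    using pc[of "partial_deriv b f" "partial_deriv b h" x b] assms(3) by blast
  then show ?thesis unfolding laplacian_def by simp
qed

lemma laplacian_continuous:
  assumes "C_k_on 2 UNIV f" shows "continuous_on UNIV (laplacian (f :: complex \<Rightarrow> real))"
proof -
  obtain G A B where c: "c2 UNIV f G A B" using assms C_2_on_iff[of UNIV f] by auto
  have "laplacian f = (\<lambda>z. Re (A z) + Im (B z))" using c2_laplacian[OF c] by auto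
  then show ?thesis using c2_continuous_on[OF c] by (simp add: continuous_on_add continuous_on_Re continuous_on_Im)
qed

lemma laplacian_add:
  assumes "C_k_on 2 UNIV f" "C_k_on 2 UNIV h"
  shows "laplacian (\<lambda>z. f z + h z) x = laplacian f x + laplacian (h :: complex \<Rightarrow> real) x"
proof -
  obtain G A B where c: "c2 UNIV f G A B" using assms C_2_on_iff[of UNIV f] by auto
  obtain G' A' B' where c': "c2 UNIV h G' A' B'" using assms C_2_on_iff[of UNIV h] by auto
  show ?thesis using c2_laplacian[OF c2_add[OF c c'], of x] c2_laplacian[OF c, of x] c2_laplacian[OF c', of x] by simp
qed

text \<open>On the frontier of space-time a defining function vanishes, while membership requires a
  negative value. Points of a slice are therefore interior in space-time, and compact subsets of
  \<open>D t\<close> remain covered at nearby times.\<close>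

lemma spacetime_interior:
  assumes mb: "C1_moving_boundary t0 D" and t: "0 < t" "t < t0" and z: "z \<in> D t"
  shows "(t, z) \<in> interior (spacetime t0 D)"
proof (rule ccontr)
  have S: "(t, z) \<in> spacetime t0 D" using t z by (simp add: spacetime_def)
  assume "(t, z) \<notin> interior (spacetime t0 D)"
  then have fr: "(t, z) \<in> frontier (spacetime t0 D)" using S closure_subset by (auto simp: frontier_def)
  then obtain v where "normal_velocity t0 D t z v" using mb t unfolding C1_moving_boundary_def by blast
  then obtain \<phi> a G N where \<phi>: "open N" "(t, z) \<in> N" "spacetime t0 D \<inter> N = {y \<in> N. \<phi> y < 0}" "GDERIV \<phi> (t, z) :> (a, G)"
    unfolding normal_velocity_def local_defining_function_def by blast
  have "\<phi> (t, z) = 0" by (rule local_defining_zero[OF \<phi>(1-3) GDERIV_isCont[OF \<phi>(4)] fr])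
  moreover have "(t, z) \<in> {y \<in> N. \<phi> y < 0}" unfolding \<phi>(3)[symmetric] using S \<phi>(2) by simp
  ultimately show False by simp
qed

text \<open>At a frontier point the spatial gradient is nonzero, so small steps against it stay in
  the same slice and enter \<open>D t\<close>. Hence over time t the frontier of space-time lies in
  the closure of the slice.\<close>

lemma spacetime_exterior:
  assumes mb: "C1_moving_boundary t0 D" and t: "0 < t" "t < t0" and z: "z \<notin> closure (D t)"
  shows "(t, z) \<notin> closure (spacetime t0 D)"
proof
  assume cl: "(t, z) \<in> closure (spacetime t0 D)"
  have "z \<notin> D t" using z closure_subset by blast
  then have "(t, z) \<notin> interior (spacetime t0 D)" using interior_subset by (auto simp: spacetime_def)
  with cl have fr: "(t, z) \<in> frontier (spacetime t0 D)" by (simp add: frontier_def)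
  then obtain v where "normal_velocity t0 D t z v" using mb t unfolding C1_moving_boundary_def by blast
  then obtain \<phi> a G N where \<phi>: "open N" "(t, z) \<in> N" "spacetime t0 D \<inter> N = {y \<in> N. \<phi> y < 0}" "GDERIV \<phi> (t, z) :> (a, G)" "G \<noteq> 0"
    unfolding normal_velocity_def local_defining_function_def by blast
  have \<phi>0: "\<phi> (t, z) = 0" by (rule local_defining_zero[OF \<phi>(1-3) GDERIV_isCont[OF \<phi>(4)] fr])
  have "((\<lambda>s. \<phi> ((t, z) + s *\<^sub>R (0, - G))) has_real_derivative ((a, G) \<bullet> (0, - G))) (at 0)"
    by (rule GDERIV_DERIV_line) (use \<phi>(4) in \<open>simp add: zero_prod_def[symmetric]\<close>)
  then have "((\<lambda>s. \<phi> (t, z - s *\<^sub>R G)) has_real_derivative - (G \<bullet> G)) (at 0)" by simp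
  from DERIV_neg_dec_right[OF this] \<phi>(5) \<phi>0
  obtain d where d: "0 < d" "\<And>h. 0 < h \<Longrightarrow> h < d \<Longrightarrow> \<phi> (t, z - h *\<^sub>R G) < 0" by auto
  have "((\<lambda>h. (t, z - h *\<^sub>R G)) \<longlongrightarrow> (t, z - 0 *\<^sub>R G)) (at_right 0)" by (intro tendsto_intros)
  then have "\<forall>\<^sub>F h in at_right 0. (t, z - h *\<^sub>R G) \<in> N" using topological_tendstoD \<phi>(1,2) by fastforce
  moreover have "\<forall>\<^sub>F h in at_right 0. \<phi> (t, z - h *\<^sub>R G) < 0" using d by (intro eventually_at_rightI[of 0 d]) auto
  ultimately have "\<forall>\<^sub>F h in at_right 0. z - h *\<^sub>R G \<in> closure (D t)"
  proof eventually_elim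
    case (elim h)
    then have "(t, z - h *\<^sub>R G) \<in> spacetime t0 D \<inter> N" unfolding \<phi>(3) by simp
    then have "z - h *\<^sub>R G \<in> D t" by (simp add: spacetime_def)
    then show ?case using closure_subset by blast
  qed
  moreover have "((\<lambda>h. z - h *\<^sub>R G) \<longlongrightarrow> z - 0 *\<^sub>R G) (at_right 0)" by (intro tendsto_intros)
  ultimately have "z - 0 *\<^sub>R G \<in> closure (D t)" by (intro Lim_in_closed_set[OF closed_closure]) auto
  then show False using z by simp
qed

lemma compact_slice_nearby:
  fixes K :: "complex set"
  assumes "compact K" "open S" "\<And>z. z \<in> K \<Longrightarrow> (t::real, z) \<in> S"
  obtains e where "0 < e" "\<And>s z. \<bar>s - t\<bar> < e \<Longrightarrow> z \<in> K \<Longrightarrow> (s, z) \<in> S"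
proof -
  have "compact ({t} \<times> K)" "{t} \<times> K \<subseteq> S" using assms by (auto intro: compact_Times)
  then obtain e where e: "0 < e" "(\<Union>x\<in>{t} \<times> K. ball x e) \<subseteq> S"
    using compact_subset_open_imp_ball_epsilon_subset[OF _ assms(2)] by metis
  show ?thesis
  proof (rule that[OF e(1)])
    fix s z assume "\<bar>s - t\<bar> < e" "z \<in> K"
    then have "(s, z) \<in> ball (t, z) e" by (simp add: dist_Pair_Pair dist_real_def abs_minus_commute)
    then show "(s, z) \<in> S" using e(2) \<open>z \<in> K\<close> by blast
  qed
qed

lemma moment_derivative:
  fixes D :: "real \<Rightarrow> complex set"
  assumes t: "0 < t" "t < t0" and opens: "\<And>s. 0 < s \<Longrightarrow> s < t0 \<Longrightarrow> open (D s)"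
    and gd: "green_domain (D t) u w g" and mb: "C1_moving_boundary t0 D"
    and C2: "C2_boundary (D t)"
    and gr: "\<And>z. z \<in> frontier (D t) \<Longrightarrow> \<exists>v. normal_velocity t0 D t z v \<and> outward_normal_derivative (D t) g z v"
    and \<psi>: "C_k_on 2 UNIV \<psi>" "compact K" "\<And>z. z \<notin> K \<Longrightarrow> \<psi> z = 0"
  shows "((\<lambda>s. LBINT z. indicator (D s) z * \<psi> z) has_real_derivative
    \<psi> w - (LBINT z. indicator (D t) z * (g z * (laplacian \<psi> z - u z * \<psi> z)))) (at t)"
proof -
  interpret gd: green_domain "D t" u w g by fact
  define T where "T = (\<lambda>\<psi>. ((\<lambda>s. LBINT z. indicator (D s) z * \<psi> z) has_real_derivative
    \<psi> w - (LBINT z. indicator (D t) z * (g z * (laplacian \<psi> z - u z * \<psi> z)))) (at t))"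
  have int: "integrable lborel (\<lambda>z. indicator S z * f z)"
    if f: "C_k_on 2 UNIV f" "compact K" "\<And>z. z \<notin> K \<Longrightarrow> f z = 0" "open S" for f :: "complex \<Rightarrow> real" and K S
  proof -
    obtain R where R: "\<And>z. z \<in> K \<Longrightarrow> norm z \<le> R" using compact_imp_bounded[OF f(2)] by (meson bounded_iff)
    have "integrable lborel f"
      by (rule integrable_of_compact_support[OF C_k_on_imp_continuous_on[OF f(1)], of R]) (use R f(3) in fastforce)
    then show ?thesis using integrable_mult_indicator[of S lborel f] f(4) by simp
  qed
  have int2: "integrable lborel (\<lambda>z. indicator (D t) z * (g z * (laplacian f z - u z * f z)))" if "C_k_on 2 UNIV f" for f
  proof -
    have "integrable lborel (\<lambda>z. indicator (D t) z * (g z * laplacian f z) - indicator (D t) z * (g z * (u z * f z)))"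
      using gd.g_continuous_integrable(1)[OF laplacian_continuous[OF that]]
        gd.g_continuous_integrable(2)[OF C_k_on_imp_continuous_on[OF that]] by auto
    then show ?thesis by (simp add: algebra_simps)
  qed
  have "T \<psi>"
  proof (rule C2_localize[OF _ _ \<psi>])
    fix f h K
    assume f: "C_k_on 2 UNIV f" "C_k_on 2 UNIV h" "compact K" "\<And>z. z \<notin> K \<Longrightarrow> f z = 0" "\<And>z. z \<notin> K \<Longrightarrow> h z = 0" "T f" "T h"
    have "(LBINT z. indicator (D s) z * (f z + h z)) = (LBINT z. indicator (D s) z * f z) + (LBINT z. indicator (D s) z * h z)"
      if "s \<in> {0<..<t0}" for s
    proof -
      have "open (D s)" using opens that by simp
      then show ?thesis using int[OF f(1,3,4)] int[OF f(2,3,5)] by (simp add: distrib_left)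
    qed
    moreover have "(LBINT z. indicator (D t) z * (g z * (laplacian (\<lambda>z. f z + h z) z - u z * (f z + h z)))) =
      (LBINT z. indicator (D t) z * (g z * (laplacian f z - u z * f z))) + (LBINT z. indicator (D t) z * (g z * (laplacian h z - u z * h z)))"
    proof -
      have "(\<lambda>z. indicator (D t) z * (g z * (laplacian (\<lambda>z. f z + h z) z - u z * (f z + h z)))) =
        (\<lambda>z. indicator (D t) z * (g z * (laplacian f z - u z * f z)) + indicator (D t) z * (g z * (laplacian h z - u z * h z)))"
        unfolding laplacian_add[OF f(1,2)] by (simp add: algebra_simps)
      then show ?thesis using int2[OF f(1)] int2[OF f(2)] by simp
    qed
    moreover have "((\<lambda>s. (LBINT z. indicator (D s) z * f z) + (LBINT z. indicator (D s) z * h z)) has_real_derivative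
      (f w - (LBINT z. indicator (D t) z * (g z * (laplacian f z - u z * f z)))) + (h w - (LBINT z. indicator (D t) z * (g z * (laplacian h z - u z * h z))))) (at t)"
      using f(6,7) unfolding T_def by (rule DERIV_add)
    then have "((\<lambda>s. LBINT z. indicator (D s) z * (f z + h z)) has_real_derivative
      (f w - (LBINT z. indicator (D t) z * (g z * (laplacian f z - u z * f z)))) + (h w - (LBINT z. indicator (D t) z * (g z * (laplacian h z - u z * h z))))) (at t)"
      by (rule has_field_derivative_transform_within_open[of _ _ _ "{0<..<t0}"]) (use t calculation(1) in auto)
    ultimately show "T (\<lambda>z. f z + h z)" unfolding T_def by (simp add: algebra_simps)
  next
    fix z
    consider "z \<in> D t" | "z \<notin> closure (D t)" | "z \<in> frontier (D t)" using gd.closure_D by blast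
    then show "\<exists>W. open W \<and> z \<in> W \<and> (\<forall>f K. C_k_on 2 UNIV f \<longrightarrow> compact K \<longrightarrow> K \<subseteq> W \<longrightarrow> (\<forall>z. z \<notin> K \<longrightarrow> f z = 0) \<longrightarrow> T f)"
    proof cases
      case 1
      show ?thesis
      proof (intro exI[of _ "D t"] conjI allI impI)
        show "open (D t)" "z \<in> D t" using 1 gd.open_D by auto
        fix f K assume f: "C_k_on 2 UNIV f" "compact K" "K \<subseteq> D t" "\<forall>z. z \<notin> K \<longrightarrow> f z = 0"
        obtain G A B where c: "c2 UNIV f G A B" using f(1) C_2_on_iff[of UNIV f] by auto
        have inn: "(t, z) \<in> interior (spacetime t0 D)" if "z \<in> K" for z
          using spacetime_interior[OF mb t, of z] f(3) that by blast
        obtain e where e: "0 < e" "\<And>s z. \<bar>s - t\<bar> < e \<Longrightarrow> z \<in> K \<Longrightarrow> (s, z) \<in> interior (spacetime t0 D)"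
          using compact_slice_nearby[OF f(2) open_interior inn] by blast
        have "K \<subseteq> D s" if "\<bar>s - t\<bar> < e" for s
          using e(2)[OF that] interior_subset[of "spacetime t0 D"] by (fastforce simp: spacetime_def)
        then have eq: "(LBINT z. f z) = (LBINT z. indicator (D s) z * f z)" if "s \<in> ball t e" for s
          using that f(4) by (intro Bochner_Integration.integral_cong) (auto simp: indicator_def dist_real_def abs_minus_commute)
        have "((\<lambda>s. LBINT z. indicator (D s) z * f z) has_real_derivative 0) (at t)"
          by (rule has_field_derivative_transform_within_open[OF DERIV_const open_ball _ eq]) (use e(1) in auto)
        moreover have "(LBINT z. indicator (D t) z * (g z * (laplacian f z - u z * f z))) = f w"
          using gd.green_c2[OF c f(2,3)] f(4) c2_laplacian[OF c] by simp
        ultimately show "T f" unfolding T_def by simp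
      qed
    next
      case 2
      show ?thesis
      proof (intro exI[of _ "- closure (D t)"] conjI allI impI)
        show "open (- closure (D t))" "z \<in> - closure (D t)" using 2 by auto
        fix f K assume f: "C_k_on 2 UNIV f" "compact K" "K \<subseteq> - closure (D t)" "\<forall>z. z \<notin> K \<longrightarrow> f z = 0"
        have o: "open (- closure (spacetime t0 D))" by auto
        have out: "(t, z) \<in> - closure (spacetime t0 D)" if "z \<in> K" for z
          using spacetime_exterior[OF mb t, of z] f(3) that by blast
        obtain e where e: "0 < e" "\<And>s z. \<bar>s - t\<bar> < e \<Longrightarrow> z \<in> K \<Longrightarrow> (s, z) \<in> - closure (spacetime t0 D)"
          by (rule compact_slice_nearby[OF f(2) o out]) (assumption | rule that)+
        have zero: "indicator (D s) z * f z = 0" if "\<bar>s - t\<bar> < min e (min t (t0 - t))" for s z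
        proof (cases "z \<in> K")
          case True
          then have "(s, z) \<notin> spacetime t0 D" using e(2)[of s z] that closure_subset by auto
          then have "z \<notin> D s" using that t by (auto simp: spacetime_def)
          then show ?thesis by simp
        qed (use f(4) in auto)
        have eq: "(0::real) = (LBINT z. indicator (D s) z * f z)" if "s \<in> ball t (min e (min t (t0 - t)))" for s
        proof -
          have "(\<lambda>z. indicator (D s) z * f z) = (\<lambda>z. 0)"
            using that by (intro ext zero) (simp add: dist_real_def abs_minus_commute)
          then show ?thesis by simp
        qed
        have "((\<lambda>s. LBINT z. indicator (D s) z * f z) has_real_derivative 0) (at t)"
          by (rule has_field_derivative_transform_within_open[of "\<lambda>_. 0" _ _ "ball t (min e (min t (t0 - t)))"])
            (use e(1) t eq in simp_all)
        moreover have fD: "f z = 0" if "z \<in> D t" for z using f(3,4) that closure_subset by blast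
        moreover have "laplacian f z = 0" if "z \<in> D t" for z
        proof -
          have "laplacian f z = laplacian (\<lambda>_. 0) z" by (rule laplacian_cong_open[OF gd.open_D fD that])
          then show ?thesis using c2_laplacian[OF c2_const[OF open_UNIV], of z 0] by simp
        qed
        then have "(\<lambda>z. indicator (D t) z * (g z * (laplacian f z - u z * f z))) = (\<lambda>z. 0)"
          using fD by (auto simp: indicator_def)
        ultimately show "T f" unfolding T_def using gd.w_in_D by simp
      qed
    next
      case 3
      have "\<exists>W. open W \<and> z \<in> W \<and> w \<notin> W \<and> (\<forall>\<psi> G\<psi> A\<psi> B\<psi> K. c2 UNIV \<psi> G\<psi> A\<psi> B\<psi> \<longrightarrow> compact K \<longrightarrow> K \<subseteq> W \<longrightarrow>
          (\<forall>z. z \<notin> K \<longrightarrow> \<psi> z = 0) \<longrightarrow> ((\<lambda>s. LBINT z. indicator (D s) z * \<psi> z) has_real_derivative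
            - (LBINT z. indicator (D t) z * (g z * (Re (A\<psi> z) + Im (B\<psi> z) - u z * \<psi> z)))) (at t))"
      proof (rule local_identity[OF t opens gd C2 gr 3])
        fix W assume W: "open W" "z \<in> W" "w \<notin> W"
          "\<And>\<psi> G\<psi> A\<psi> B\<psi> K. c2 UNIV \<psi> G\<psi> A\<psi> B\<psi> \<Longrightarrow> compact K \<Longrightarrow> K \<subseteq> W \<Longrightarrow> (\<And>z. z \<notin> K \<Longrightarrow> \<psi> z = 0) \<Longrightarrow>
            ((\<lambda>s. LBINT z. indicator (D s) z * \<psi> z) has_real_derivative
              - (LBINT z. indicator (D t) z * (g z * (Re (A\<psi> z) + Im (B\<psi> z) - u z * \<psi> z)))) (at t)"
        show ?thesis by (intro exI[of _ W] conjI allI impI W) auto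
      qed
      then obtain W where W: "open W" "z \<in> W" "w \<notin> W"
        "\<forall>\<psi> G\<psi> A\<psi> B\<psi> K. c2 UNIV \<psi> G\<psi> A\<psi> B\<psi> \<longrightarrow> compact K \<longrightarrow> K \<subseteq> W \<longrightarrow>
          (\<forall>z. z \<notin> K \<longrightarrow> \<psi> z = 0) \<longrightarrow> ((\<lambda>s. LBINT z. indicator (D s) z * \<psi> z) has_real_derivative
            - (LBINT z. indicator (D t) z * (g z * (Re (A\<psi> z) + Im (B\<psi> z) - u z * \<psi> z)))) (at t)" by blast
      show ?thesis
      proof (intro exI[of _ W] conjI allI impI)
        show "open W" "z \<in> W" by fact+
        fix f K assume f: "C_k_on 2 UNIV f" "compact K" "K \<subseteq> W" "\<forall>z. z \<notin> K \<longrightarrow> f z = 0"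
        obtain G A B where c: "c2 UNIV f G A B" using f(1) C_2_on_iff[of UNIV f] by auto
        have "f w = 0" using f(3,4) W(3) by blast
        then show "T f" unfolding T_def using W(4)[rule_format, OF c f(2,3)] f(4) c2_laplacian[OF c] by simp
      qed
    qed
  qed
  then show ?thesis by (simp add: T_def)
qed

text \<open>A cutoff equal to 1 near the closure of \<open>D t1\<close>, for a time t1 between t and
  t0, removes the assumption of compact support. As the domains grow, it is 1 on every
  \<open>D s\<close> with s \<le> t1, so neither side notices it.\<close>

lemma moment_derivative_global:
  fixes D :: "real \<Rightarrow> complex set"
  assumes t: "0 < t" "t < t0" and opens: "\<And>s. 0 < s \<Longrightarrow> s < t0 \<Longrightarrow> open (D s)"
    and bounded: "\<And>s. 0 < s \<Longrightarrow> s < t0 \<Longrightarrow> bounded (D s)"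
    and mono: "\<And>r s. 0 < r \<Longrightarrow> r \<le> s \<Longrightarrow> s < t0 \<Longrightarrow> D r \<subseteq> D s"
    and gd: "green_domain (D t) u w g" and mb: "C1_moving_boundary t0 D"
    and C2: "C2_boundary (D t)"
    and gr: "\<And>z. z \<in> frontier (D t) \<Longrightarrow> \<exists>v. normal_velocity t0 D t z v \<and> outward_normal_derivative (D t) g z v"
    and f: "C_k_on 2 UNIV f"
  shows "((\<lambda>s. LBINT z. indicator (D s) z * f z) has_real_derivative
    f w - (LBINT z. indicator (D t) z * (g z * (laplacian f z - u z * f z)))) (at t)"
proof -
  interpret gd: green_domain "D t" u w g by fact
  define t1 where "t1 = (t + t0) / 2"
  have t1: "t < t1" "t1 < t0" "0 < t1" using t by (auto simp: t1_def)
  have "compact (closure (D t1))" using bounded t1 by (simp add: compact_closure)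
  then obtain \<theta> K V where \<theta>: "smooth_real_on UNIV \<theta>" "compact K" "\<And>x. x \<notin> K \<Longrightarrow> \<theta> x = 0"
    "open V" "closure (D t1) \<subseteq> V" "\<And>x. x \<in> V \<Longrightarrow> \<theta> x = 1"
    using smooth_cutoff[OF _ open_UNIV] by (metis subset_UNIV)
  have C\<theta>: "C_k_on 2 UNIV (\<lambda>z. \<theta> z * f z)"
    using \<theta>(1) f unfolding smooth_real_on_def by (blast intro: C_k_on_mult)
  have sub: "D s \<subseteq> V" if "0 < s" "s \<le> t1" for s
    using mono[OF that t1(2)] \<theta>(5) closure_subset[of "D t1"] by blast
  have eq: "(LBINT z. indicator (D s) z * (\<theta> z * f z)) = (LBINT z. indicator (D s) z * f z)" if "s \<in> {0<..<t1}" for s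
    using sub[of s] that \<theta>(6) by (intro Bochner_Integration.integral_cong) (auto simp: indicator_def)
  have "((\<lambda>s. LBINT z. indicator (D s) z * (\<theta> z * f z)) has_real_derivative
    \<theta> w * f w - (LBINT z. indicator (D t) z * (g z * (laplacian (\<lambda>z. \<theta> z * f z) z - u z * (\<theta> z * f z))))) (at t)"
    by (rule moment_derivative[OF t opens gd mb C2 gr C\<theta> \<theta>(2)]) (simp_all add: \<theta>(3))
  moreover have tV: "D t \<subseteq> V" using sub t t1 by simp
  moreover have "(LBINT z. indicator (D t) z * (g z * (laplacian (\<lambda>z. \<theta> z * f z) z - u z * (\<theta> z * f z))))
    = (LBINT z. indicator (D t) z * (g z * (laplacian f z - u z * f z)))"
  proof (intro Bochner_Integration.integral_cong refl)
    fix z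
    show "indicator (D t) z * (g z * (laplacian (\<lambda>z. \<theta> z * f z) z - u z * (\<theta> z * f z))) = indicator (D t) z * (g z * (laplacian f z - u z * f z))"
    proof (cases "z \<in> D t")
      case True
      then have "z \<in> V" using tV by blast
      moreover from this have "laplacian (\<lambda>z. \<theta> z * f z) z = laplacian f z"
        by (intro laplacian_cong_open[OF \<theta>(4)]) (simp_all add: \<theta>(6))
      ultimately show ?thesis by (simp add: \<theta>(6))
    qed simp
  qed
  ultimately have "((\<lambda>s. LBINT z. indicator (D s) z * (\<theta> z * f z)) has_real_derivative
    f w - (LBINT z. indicator (D t) z * (g z * (laplacian f z - u z * f z)))) (at t)"
    using \<theta>(6) gd.w_in_D by auto
  then show ?thesis
    by (rule has_field_derivative_transform_within_open[of _ _ _ "{0<..<t1}"]) (use t t1 eq in auto)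
qed

section \<open>Area and second moment\<close>

lemma c2_quarter_square:
  "c2 UNIV (\<lambda>z. (norm (z - w))\<^sup>2 / 4) (\<lambda>z. (z - w) / 2) (\<lambda>_. 1 / 2) (\<lambda>_. \<i> / 2)"
proof -
  have "GDERIV (\<lambda>z. (norm (z - w))\<^sup>2 / 4) z :> (z - w) / 2" for z
    unfolding gderiv_def power2_norm_eq_inner
    by (auto intro!: derivative_eq_intros simp: fun_eq_iff inner_complex_def field_simps)
  moreover have "GDERIV (\<lambda>z. Re ((z - w) / 2)) z :> 1 / 2" "GDERIV (\<lambda>z. Im ((z - w) / 2)) z :> \<i> / 2" for z
    unfolding gderiv_def by (auto intro!: derivative_eq_intros simp: inner_complex_def)
  ultimately show ?thesis by (simp add: c2_def)
qed

text \<open>\<open>rate\<close> is the derivative of the area, and \<open>moment\<close> compares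
  the growth of the second moment with it. The condition M \<rho>^2 \<le> 2 makes u q \<le> 1/2, so
  the weight 1 - u q is at least 1/2 and the integral of |g| is at most \<rho>^2 / 2.\<close>

lemma (in green_domain) rate_bound:
  fixes q :: "complex \<Rightarrow> real"
  defines "q \<equiv> (\<lambda>z. (norm (z - w))\<^sup>2 / 4)"
  defines "rate \<equiv> 1 + (LBINT z. indicator D z * (g z * u z))"
  assumes D: "D \<subseteq> cball w \<rho>" and M: "\<And>z. z \<in> D \<Longrightarrow> u z \<le> M" "M * \<rho>\<^sup>2 \<le> 2" "0 \<le> M"
    and moment: "- (LBINT z. indicator D z * (g z * (1 - u z * q z))) \<le> \<rho>\<^sup>2 / 4 * rate"
  shows "\<bar>rate - 1\<bar> \<le> M * \<rho>\<^sup>2 / 2"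
proof -
  have qc: "continuous_on UNIV q" unfolding q_def by (intro continuous_intros) auto
  have i1: "integrable lborel (\<lambda>z. indicator D z * (g z * u z))"
    using g_continuous_integrable(2)[OF continuous_on_const[of UNIV 1]] by simp
  have i2: "integrable lborel (\<lambda>z. indicator D z * (g z * (1 - u z * q z)))"
  proof -
    have "integrable lborel (\<lambda>z. indicator D z * g z - indicator D z * (g z * (u z * q z)))"
      using g_integrable g_continuous_integrable(2)[OF qc] by auto
    then show ?thesis by (simp add: algebra_simps)
  qed
  define I where "I = (LBINT z. indicator D z * - g z)"
  have i3: "integrable lborel (\<lambda>z. indicator D z * - g z)" using g_integrable by simp
  have aew: "AE z in lborel. z \<noteq> w" by (rule AE_lborel_singleton)
  have ug: "(LBINT z. indicator D z * (g z * u z)) \<le> 0"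
  proof -
    have "0 \<le> (LBINT z. - (indicator D z * (g z * u z)))"
    proof (rule integral_nonneg_AE)
      show "AE z in lborel. 0 \<le> - (indicator D z * (g z * u z))"
        using aew
      proof eventually_elim
        case (elim z)
        then show ?case using g_nonpos[of z] u_nonneg[of z] by (auto simp: indicator_def mult_nonpos_nonneg)
      qed
    qed
    then show ?thesis by simp
  qed
  have "1 / 2 * I \<le> - (LBINT z. indicator D z * (g z * (1 - u z * q z)))"
  proof -
    have "(LBINT z. 1 / 2 * (indicator D z * - g z)) \<le> (LBINT z. - (indicator D z * (g z * (1 - u z * q z))))"
    proof (rule integral_mono_AE)
      show "AE z in lborel. 1 / 2 * (indicator D z * - g z) \<le> - (indicator D z * (g z * (1 - u z * q z)))"
        using aew
      proof eventually_elim
        case (elim z)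
        show ?case
        proof (cases "z \<in> D")
          case True
          then have "norm (z - w) \<le> \<rho>" using D by (auto simp: dist_norm norm_minus_commute)
          then have "q z \<le> \<rho>\<^sup>2 / 4" "0 \<le> q z" by (auto simp: q_def intro: power_mono)
          then have "u z * q z \<le> M * (\<rho>\<^sup>2 / 4)" using M(1)[OF True] M(3) by (intro mult_mono) auto
          then have "1 / 2 \<le> 1 - u z * q z" using M(2) by simp
          then have "1 / 2 * - g z \<le> (1 - u z * q z) * - g z"
            using g_nonpos[of z] True elim by (intro mult_right_mono) auto
          then show ?thesis using True by (simp add: mult.commute)
        qed simp
      qed
    qed (use i2 i3 in \<open>auto simp del: mult_minus_right\<close>)
    then show ?thesis by (simp add: I_def)
  qed
  also have "\<dots> \<le> \<rho>\<^sup>2 / 4 * rate" by (rule moment)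
  also have "\<dots> \<le> \<rho>\<^sup>2 / 4 * 1" using ug by (intro mult_left_mono) (simp_all add: rate_def)
  finally have I: "I \<le> \<rho>\<^sup>2 / 2" by simp
  have "(LBINT z. - (indicator D z * (g z * u z))) \<le> (LBINT z. M * (indicator D z * - g z))"
  proof (rule integral_mono_AE)
    show "AE z in lborel. - (indicator D z * (g z * u z)) \<le> M * (indicator D z * - g z)"
      using aew
    proof eventually_elim
      case (elim z)
      show ?case
      proof (cases "z \<in> D")
        case True
        then have "u z * - g z \<le> M * - g z" using M(1)[OF True] g_nonpos[of z] elim by (intro mult_right_mono) auto
        then show ?thesis using True by (simp add: mult.commute)
      qed simp
    qed
  qed (use i1 i3 in \<open>auto simp del: mult_minus_right\<close>)
  also have "\<dots> = M * I" unfolding I_def by (rule integral_mult_right_zero)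
  also have "\<dots> \<le> M * (\<rho>\<^sup>2 / 2)" using I M(3) by (rule mult_left_mono)
  finally show ?thesis using ug by (simp add: rate_def)
qed

text \<open>A point of the closure farthest from \<open>w\<close> cannot lie in the open set
  \<open>D\<close>, since it could be pushed outward; so it is on the frontier.\<close>

lemma domain_in_ball:
  assumes D: "open D" "bounded D" "w \<in> (D :: complex set)"
  shows "D \<subseteq> cball w (SUP \<zeta>\<in>frontier D. norm (\<zeta> - w))"
proof
  let ?\<rho> = "SUP \<zeta>\<in>frontier D. norm (\<zeta> - w)"
  fix z assume z: "z \<in> D"
  have "compact (frontier D)" using D(2) by (rule compact_frontier_bounded)
  then have "compact ((\<lambda>\<zeta>. norm (\<zeta> - w)) ` frontier D)" by (intro compact_continuous_image continuous_intros)
  then have bdd: "bdd_above ((\<lambda>\<zeta>. norm (\<zeta> - w)) ` frontier D)" by (intro bounded_imp_bdd_above compact_imp_bounded)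
  have le: "norm (\<zeta> - w) \<le> ?\<rho>" if "\<zeta> \<in> frontier D" for \<zeta> using that bdd by (rule cSUP_upper)
  have "frontier D \<noteq> {}" using D not_bounded_UNIV by (auto simp: frontier_eq_empty)
  then have \<rho>0: "0 \<le> ?\<rho>" using le norm_ge_zero order_trans by blast
  have c: "compact (closure D)" "closure D \<noteq> {}" using D(2) z closure_subset by (auto simp: compact_closure)
  have "continuous_on (closure D) (\<lambda>x. norm (x - w))" by (intro continuous_intros)
  from continuous_attains_sup[OF c this]
  obtain m where m: "m \<in> closure D" "\<And>x. x \<in> closure D \<Longrightarrow> norm (x - w) \<le> norm (m - w)"
    by auto
  have "norm (m - w) \<le> ?\<rho>"
  proof (cases "m \<in> frontier D")
    case False
    then have "m \<in> D" using m(1) closure_Un_frontier[of D] by blast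
    then obtain e where e: "0 < e" "cball m e \<subseteq> D" using D(1) open_contains_cball by blast
    show ?thesis
    proof (rule ccontr)
      assume "\<not> norm (m - w) \<le> ?\<rho>"
      then have "m \<noteq> w" using \<rho>0 by auto
      define x where "x = m + e *\<^sub>R sgn (m - w)"
      have "x \<in> D" using e \<open>m \<noteq> w\<close> by (auto simp: x_def dist_norm norm_sgn intro!: subsetD[OF e(2)])
      then have "norm (x - w) \<le> norm (m - w)" using m(2) closure_subset by blast
      moreover have "x - w = (1 + e / norm (m - w)) *\<^sub>R (m - w)"
        by (simp add: x_def sgn_div_norm algebra_simps divide_inverse)
      then have "norm (x - w) = \<bar>1 + e / norm (m - w)\<bar> * norm (m - w)" by (simp only: norm_scaleR)
      then have "norm (x - w) = norm (m - w) + e" using e(1) \<open>m \<noteq> w\<close> by (simp add: distrib_right)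
      ultimately show False using e(1) by simp
    qed
  qed (rule le)
  then have "norm (z - w) \<le> ?\<rho>" using m(2)[of z] z closure_subset by force
  then show "z \<in> cball w ?\<rho>" by (simp add: dist_norm norm_minus_commute)
qed

lemma integrable_open_bounded:
  fixes f :: "complex \<Rightarrow> real"
  assumes "open S" "bounded S" "continuous_on UNIV f"
  shows "integrable lborel (\<lambda>z. indicator S z * f z)"
proof -
  have "integrable lborel (\<lambda>z. indicator (closure S) z *\<^sub>R f z)"
    by (rule borel_integrable_compact) (use assms in \<open>auto simp: compact_closure intro: continuous_on_subset\<close>)
  then have "integrable lborel (\<lambda>z. indicator S z *\<^sub>R (indicator (closure S) z *\<^sub>R f z))"
    by (rule integrable_mult_indicator[rotated]) (use assms(1) in auto)
  also have "(\<lambda>z. indicator S z *\<^sub>R (indicator (closure S) z *\<^sub>R f z)) = (\<lambda>z. indicator S z * f z)"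
    using closure_subset[of S] by (auto simp: fun_eq_iff indicator_def)
  finally show ?thesis .
qed

lemma laplacian_quarter_square: "laplacian (\<lambda>z::complex. (norm (z - w))\<^sup>2 / 4) z = 1"
  using c2_laplacian[OF c2_quarter_square, of z w] by simp

theorem theorem3p5:
  fixes u :: "complex \<Rightarrow> real" and w :: complex and t0 :: real and D :: "real \<Rightarrow> complex set"
  assumes "0 < t0"
    and "\<And>t. t \<in> {0<..<t0} \<Longrightarrow> open (D t) \<and> connected (D t) \<and> bounded (D t) \<and> C2_boundary (D t)"
    and "\<And>s t. \<lbrakk>s \<in> {0<..<t0}; t \<in> {0<..<t0}; s \<le> t\<rbrakk> \<Longrightarrow> D s \<subseteq> D t"
    and "elliptic_growth u w t0 D"
    and "((\<lambda>t. SUP \<zeta>\<in>frontier (D t). norm (\<zeta> - w)) \<longlongrightarrow> 0) (at_right 0)"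
  shows "(\<forall>t\<in>{0<..<t0}. (\<lambda>s. measure lebesgue (D s)) differentiable (at t)) \<and>
         ((\<lambda>t. deriv (\<lambda>s. measure lebesgue (D s)) t) \<longlongrightarrow> 1) (at_right 0)"
proof -
  define \<rho> where "\<rho> = (\<lambda>t. SUP \<zeta>\<in>frontier (D t). norm (\<zeta> - w))"
  define area where "area = (\<lambda>s. measure lebesgue (D s))"
  have eg: "C1_moving_boundary t0 D" "\<And>t. t \<in> {0<..<t0} \<Longrightarrow> w \<in> D t"
    using assms(4) unfolding elliptic_growth_def by blast+
  note growth = assms(4)[unfolded elliptic_growth_def]
  from conjunct1[OF growth]
  obtain U where U: "open U" "\<And>t. t \<in> {0<..<t0} \<Longrightarrow> closure (D t) \<subseteq> U" "smooth_real_on U u" "\<And>z. z \<in> U \<Longrightarrow> 0 \<le> u z"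
    by (elim exE conjE) (simp only: Ball_def)
  note conjunct2[OF conjunct2[OF conjunct2[OF growth]]]
  then obtain g where g: "\<And>t. t \<in> {0<..<t0} \<Longrightarrow> green_function u (D t) w (g t)"
    "\<And>t z. t \<in> {0<..<t0} \<Longrightarrow> z \<in> frontier (D t) \<Longrightarrow>
      \<exists>v. normal_velocity t0 D t z v \<and> outward_normal_derivative (D t) (g t) z v"
    by metis
  have gd: "green_domain (D t) u w (g t)" if t: "t \<in> {0<..<t0}" for t
  proof
    show "continuous_on (closure (D t)) u"
      using smooth_continuous_on[OF U(3)] U(2)[OF t] by (rule continuous_on_subset)
    show "0 \<le> u z" if "z \<in> D t" for z using U(2)[OF t] U(4) that closure_subset by blast
  qed (use assms(2)[OF t] eg(2)[OF t] g(1)[OF t] in auto)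
  have moment: "((\<lambda>s. LBINT z. indicator (D s) z * f z) has_real_derivative
      f w - (LBINT z. indicator (D t) z * (g t z * (laplacian f z - u z * f z)))) (at t)"
    if "t \<in> {0<..<t0}" "C_k_on 2 UNIV f" for t f
    by (rule moment_derivative_global[OF _ _ _ _ _ gd[OF that(1)] eg(1)])
      (use that assms(2,3) g(2) in auto)
  define rate where "rate = (\<lambda>t. 1 + (LBINT z. indicator (D t) z * (g t z * u z)))"
  have area_eq: "(LBINT z. indicator (D s) z * 1) = area s" if "s \<in> {0<..<t0}" for s
    using assms(2)[OF that] by (simp add: area_def measure_completion)
  have area_deriv: "(area has_real_derivative rate t) (at t)" if t: "t \<in> {0<..<t0}" for t
  proof -
    have "laplacian (\<lambda>_. 1) z = 0" for z :: complex using c2_laplacian[OF c2_const[OF open_UNIV], of z 1] by simp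
    then have "((\<lambda>s. LBINT z. indicator (D s) z * 1) has_real_derivative rate t) (at t)"
      using moment[OF t C_k_on_const[of 2 UNIV 1]] by (simp add: rate_def)
    then show ?thesis
      by (rule has_field_derivative_transform_within_open[of _ _ _ "{0<..<t0}"]) (use t area_eq in auto)
  qed
  define q where "q = (\<lambda>z. (norm (z - w))\<^sup>2 / 4)"
  define m where "m = (\<lambda>s. LBINT z. indicator (D s) z * q z)"
  have m_deriv: "(m has_real_derivative - (LBINT z. indicator (D t) z * (g t z * (1 - u z * q z)))) (at t)"
    if t: "t \<in> {0<..<t0}" for t
  proof -
    have "C_k_on 2 UNIV q" unfolding q_def using c2_quarter_square by (subst C_2_on_iff) auto
    from moment[OF t this] show ?thesis
      by (simp add: m_def q_def laplacian_quarter_square)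
  qed
  have in_ball: "D t \<subseteq> cball w (\<rho> t)" if "t \<in> {0<..<t0}" for t
    unfolding \<rho>_def using assms(2)[OF that] eg(2)[OF that] by (intro domain_in_ball) auto
  have m_rate: "- (LBINT z. indicator (D t) z * (g t z * (1 - u z * q z))) \<le> (\<rho> t)\<^sup>2 / 4 * rate t"
    if t: "t \<in> {0<..<t0}" for t
  proof (rule ccontr)
    \<comment> \<open>For every s \<le> t the slice \<open>D s\<close> lies in the disc of radius
      \<rho> t, where q - \<rho>(t)^2 / 4 is nonpositive. Up to time t the integral of this
      difference over the growing slices cannot increase, which excludes a positive derivative at
      t.\<close>
    define h where "h = (\<lambda>s. m s - (\<rho> t)\<^sup>2 / 4 * area s)"
    have int: "integrable lborel (\<lambda>z. indicator (D s) z * q z)" "integrable lborel (\<lambda>z. indicator (D s) z * 1 :: real)"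
      if "s \<in> {0<..<t0}" for s
      using assms(2)[OF that] unfolding q_def
      by (intro integrable_open_bounded continuous_intros; simp)+
    have h_eq: "h s = (LBINT z. indicator (D s) z * (q z - (\<rho> t)\<^sup>2 / 4))" if "s \<in> {0<..<t0}" for s
    proof -
      have "h s = (LBINT z. indicator (D s) z * q z) - (LBINT z. (\<rho> t)\<^sup>2 / 4 * (indicator (D s) z * 1))"
        by (simp only: h_def m_def area_eq[OF that, symmetric] integral_mult_right_zero)
      also have "\<dots> = (LBINT z. indicator (D s) z * q z - (\<rho> t)\<^sup>2 / 4 * (indicator (D s) z * 1))"
        using int[OF that] by (intro Bochner_Integration.integral_diff[symmetric] integrable_mult_right) auto
      finally show ?thesis by (simp add: algebra_simps)
    qed
    have h_int: "integrable lborel (\<lambda>z. indicator (D s) z * (q z - (\<rho> t)\<^sup>2 / 4))" if "s \<in> {0<..<t0}" for s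
      using assms(2)[OF that] unfolding q_def by (intro integrable_open_bounded continuous_intros; simp)
    have h_mono: "h t \<le> h s" if s: "0 < s" "s < t" for s
    proof -
      have s': "s \<in> {0<..<t0}" using s t by simp
      have "D s \<subseteq> D t" using assms(3)[OF s' t] s by simp
      then have "indicator (D t) z * (q z - (\<rho> t)\<^sup>2 / 4) \<le> indicator (D s) z * (q z - (\<rho> t)\<^sup>2 / 4)" for z
        using subsetD[OF in_ball[OF t], of z]
        by (auto simp: indicator_def q_def dist_norm norm_minus_commute intro: power_mono)
      then show ?thesis unfolding h_eq[OF t] h_eq[OF s'] using h_int[OF t] h_int[OF s'] by (rule integral_mono[rotated 2])
    qed
    assume "\<not> ?thesis"
    moreover have "(h has_real_derivative
        - (LBINT z. indicator (D t) z * (g t z * (1 - u z * q z))) - (\<rho> t)\<^sup>2 / 4 * rate t) (at t)"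
      unfolding h_def by (intro DERIV_diff DERIV_cmult m_deriv area_deriv t)
    ultimately have "\<exists>d>0. \<forall>e>0. e < d \<longrightarrow> h (t - e) < h t" by (elim DERIV_pos_inc_left) simp
    then obtain d where d: "0 < d" "\<And>e. 0 < e \<Longrightarrow> e < d \<Longrightarrow> h (t - e) < h t" by blast
    define e where "e = min d t / 2"
    have "0 < e" "e < d" "e < t" using d(1) t by (auto simp: e_def)
    then show False using d(2)[of e] h_mono[of "t - e"] by simp
  qed
  \<comment> \<open>Any time serves to see that \<open>w\<close> lies in \<open>U\<close>. The bound
    of \<open>u\<close> is then taken on a fixed disc about \<open>w\<close>, which contains all
    slices for small t.\<close>
  have "t0 / 2 \<in> {0<..<t0}" using assms(1) by simp
  then have "w \<in> U" using eg(2) U(2) closure_subset by blast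
  then obtain r where r: "0 < r" "cball w r \<subseteq> U" using U(1) open_contains_cball by blast
  have "compact (u ` cball w r)"
    using smooth_continuous_on[OF U(3)] r(2) by (intro compact_continuous_image) (auto intro: continuous_on_subset)
  then obtain M where M: "0 < M" "\<And>z. z \<in> cball w r \<Longrightarrow> \<bar>u z\<bar> \<le> M"
    using compact_imp_bounded bounded_pos[of "u ` cball w r"] by auto
  have \<rho>_lim: "(\<rho> \<longlongrightarrow> 0) (at_right 0)" using assms(5) by (simp add: \<rho>_def)
  then have lim: "((\<lambda>t. M * (\<rho> t)\<^sup>2 / 2) \<longlongrightarrow> 0) (at_right 0)"
    by (auto intro!: tendsto_eq_intros)
  \<comment> \<open>Eventually \<rho> t < r places the slice where u \<le> M, and M \<rho>^2 / 2 < 1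
    supplies the smallness condition of \<open>rate_bound\<close>.\<close>
  have "eventually (\<lambda>t. norm (deriv area t - 1) \<le> M * (\<rho> t)\<^sup>2 / 2) (at_right 0)"
    using order_tendstoD(2)[OF \<rho>_lim r(1)] order_tendstoD(2)[OF lim zero_less_one]
      eventually_at_right_real[OF assms(1)]
  proof eventually_elim
    case (elim t)
    then have t: "t \<in> {0<..<t0}" by simp
    have "D t \<subseteq> cball w r" using in_ball[OF t] elim by force
    then have "u z \<le> M" if "z \<in> D t" for z using M(2)[of z] that by force
    then have "\<bar>rate t - 1\<bar> \<le> M * (\<rho> t)\<^sup>2 / 2"
      using green_domain.rate_bound[OF gd[OF t] in_ball[OF t], of M] m_rate[OF t] elim M(1)
      by (simp add: rate_def q_def)
    then show ?case using DERIV_imp_deriv[OF area_deriv[OF t]] by simp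
  qed
  then have "((\<lambda>t. deriv area t - 1) \<longlongrightarrow> 0) (at_right 0)" using lim by (rule Lim_null_comparison)
  then have "(deriv area \<longlongrightarrow> 1) (at_right 0)" by (rule LIM_zero_cancel)
  moreover have "area differentiable (at t)" if "t \<in> {0<..<t0}" for t
    using area_deriv[OF that] real_differentiable_def by blast
  ultimately show ?thesis unfolding area_def by blast
qed

end
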